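(* Let $\psi$ be a variational solution (in the sense defined in the context) of the free boundary problem $\operatorname{div}(\frac1x\nabla\psi)=-xf(\psi)$ in $\Omega\cap\{\psi>0\}$, $\frac1{x^2}|\nabla\psi|^2=y$ on $\Omega\cap\partial\{\psi>0\}$, let $X_0=(x_0,0)\in S^s_\psi$, and assume the growth assumption: there is a constant $C$ such that for every $X_1=(x_1,y_1)\in\Omega\cap\partial\{\psi>0\}$, $\frac{|\nabla\psi|^2}{x^2}\le C(|y|+|x-x_1|)$ in $B_r(X_1)$ (for some $r>0$). Then the frequency $H(r)=D(r)-V(r)$ satisfies, for a.e. $r\in(0,\delta)$, writing $N(r)=\int_{\partial B_r(X_0)}\frac1x\psi^2d\mathcal H^1$, $$H'(r)=\frac2r\int_{\partial B_r(X_0)}\frac1x\Big[\frac{r\,\nabla\psi\cdot\nu}{N(r)^{1/2}}-D(r)\frac{\psi}{N(r)^{1/2}}\Big]^2d\mathcal H^1+\frac2rV^2(r)+\frac2rV(r)\Big(H(r)-\frac32\Big)+\frac1rZ(r)\Big(H(r)-\frac32\Big)+\frac{K(r)}{N(r)}$$ $$=\frac2r\int_{\partial B_r(X_0)}\frac1x\Big[\frac{r\,\nabla\psi\cdot\nu}{N(r)^{1/2}}-H(r)\frac{\psi}{N(r)^{1/2}}\Big]^2d\mathcal H^1+\frac2rV(r)\Big(H(r)-\frac32\Big)+\frac1rZ(r)\Big(H(r)-\frac32\Big)+\frac{K(r)}{N(r)}.$$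
   Context: Points of $\mathbb{R}^2$ are written $X=(x,y)$; $\mathbb{R}^2_+=\{(x,y):x\ge0\}$, and $\Omega$ is a connected set that is open relative to $\mathbb{R}^2_+$. $B_r(X_0)$ is the open disc of radius $r$ centred at $X_0$, $\nu$ the outward unit normal to $\partial B_r(X_0)$, $\mathcal H^1$ the one-dimensional Hausdorff measure, $\chi_A$ the characteristic function of $A$, $y^+=\max\{y,0\}$, $dX=dx\,dy$. The function $f:\mathbb{R}\to\mathbb{R}$ is continuous and $F(z)=\int_0^z f(s)\,ds$. For open $E$, $L^2_{w}(E)$ is the set of measurable $\psi$ on $E$ with $\int_E\frac1x|\psi|^2dX<\infty$, and $W^{1,2}_{w}(E)$ the set of $\psi\in L^2_w(E)$ with $\partial_x\psi,\partial_y\psi\in L^2_w(E)$; $W^{1,2}_{w,\mathrm{loc}}$ is the local version. Variational solution: $\psi\in W^{1,2}_{w,\mathrm{loc}}(\Omega)$ with $\psi\ge0$ in $\Omega$, $\psi=0$ on $\Omega\cap\{x=0\}$, $\psi\in C^0(\Omega)\cap C^2(\Omega\cap\{\psi>0\})$, $\psi\equiv0$ in $\{y\le 0\}$, such that for every $X_0\in\Omega\cap\{x=0\}$, $\lim_{X\to X_0,\,X\in\Omega\cap\{\psi>0\}}\frac1x\partial_y\psi=0$ and $\lim_{X\to X_0,\,X\in\Omega\cap\{\psi>0\}}\frac1x\partial_x\psi$ exists, and $$\int_\Omega\Big(\tfrac1x|\nabla\psi|^2-2xF(\psi)+xy\chi_{\{\psi>0\}}\Big)\operatorname{div}\phi-\tfrac2x\nabla\psi\,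 D\phi\,\nabla\psi\,dX+\int_\Omega\Big(-\tfrac1{x^2}|\nabla\psi|^2-2F(\psi)+y\chi_{\{\psi>0\}}\Big)\phi_1\,dX+\int_\Omega x\chi_{\{\psi>0\}}\phi_2\,dX=0$$ for all $\phi=(\phi_1,\phi_2)\in C^\infty_0(\Omega;\mathbb{R}^2)$ with $\phi_1=0$ on $\{x=0\}$. $S^s_\psi=\{X_0=(x_0,0)\in\Omega\cap\partial\{\psi>0\}: x_0>0\}$; for $X_0\in S^s_\psi$, $\delta=\frac12\min\{x_0,\operatorname{dist}(X_0,\partial\Omega)\}$. For $r\in(0,\delta)$ (all integrals over $B_r(X_0)$ w.r.t. $dX$, over $\partial B_r(X_0)$ w.r.t. $d\mathcal H^1$): $I_1(r)=\int_{B_r(X_0)}-\frac{x-x_0}{x^2}|\nabla\psi|^2$, $I_2(r)=\int_{B_r(X_0)}(x-x_0)y\chi_{\{\psi>0\}}$, $J_1(r)=\int_{\partial B_r(X_0)}\frac{x-x_0}{x^2}\psi^2$, $K(r)=r\int_{\partial B_r(X_0)}(2xF(\psi)-x\psi f(\psi))+\int_{B_r(X_0)}(2x_0F(\psi)-6xF(\psi))$, $D(r)=\dfrac{r\int_{B_r(X_0)}(\frac1x|\nabla\psi|^2-x\psi f(\psi))}{\int_{\partial B_r(X_0)}\frac1x\psi^2}$, $V(r)=\dfrac{r\int_{B_r(X_0)}y^+(x_0-x\chi_{\{\psi>0\}})+\sum_{i=1}^2r^4\int_0^rt^{-4}I_i(t)dt+\frac32r^4\int_0^rt^{-5}J_1(t)dt}{\int_{\partial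 B_r(X_0)}\frac1x\psi^2}$, $Z(r)=\dfrac{\int_{\partial B_r(X_0)}\frac{x-x_0}{x^2}\psi^2}{\int_{\partial B_r(X_0)}\frac1x\psi^2}$, and $H(r)=D(r)-V(r)$. *)

theory Defs
  imports "HOL-Analysis.Analysis"
begin

type_synonym point = "real \<times> real"

definition halfplane :: "point set" where
  "halfplane = {p. fst p \<ge> 0}"

definition px :: "(point \<Rightarrow> real) \<Rightarrow> point \<Rightarrow> real" where
  "px h p = deriv (\<lambda>t. h (t, snd p)) (fst p)"
definition py :: "(point \<Rightarrow> real) \<Rightarrow> point \<Rightarrow> real" where
  "py h p = deriv (\<lambda>t. h (fst p, t)) (snd p)"

fun Ck_on :: "nat \<Rightarrow> point set \<Rightarrow> (point \<Rightarrow> real) \<Rightarrow> bool" where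
  "Ck_on 0 U h = continuous_on U h"
| "Ck_on (Suc n) U h = ((\<forall>p\<in>U. h differentiable (at p)) \<and> Ck_on n U (px h) \<and> Ck_on n U (py h))"

definition smooth :: "(point \<Rightarrow> real) \<Rightarrow> bool" where
  "smooth h = (\<forall>n. Ck_on n UNIV h)"

definition gsq :: "(point \<Rightarrow> point) \<Rightarrow> point \<Rightarrow> real" where
  "gsq g p = (fst (g p))\<^sup>2 + (snd (g p))\<^sup>2"

definition chi :: "(point \<Rightarrow> real) \<Rightarrow> point \<Rightarrow> real" where
  "chi \<psi> p = indicator {q. \<psi> q > 0} p"

definition Fprim :: "(real \<Rightarrow> real) \<Rightarrow> real \<Rightarrow> real" where
  "Fprim f z = (LBINT s=0..z. f s)"

definition weak_gradient :: "point set \<Rightarrow> (point \<Rightarrow> real) \<Rightarrow> (point \<Rightarrow> point) \<Rightarrow> bool" where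
  "weak_gradient U \<psi> g =
    ((\<forall>K. compact K \<and> K \<subseteq> U \<longrightarrow>
        set_integrable lborel K \<psi> \<and> set_integrable lborel K (\<lambda>p. fst (g p))
        \<and> set_integrable lborel K (\<lambda>p. snd (g p))) \<and>
     (\<forall>\<phi>. smooth \<phi> \<and> compact (closure {p. \<phi> p \<noteq> 0}) \<and> closure {p. \<phi> p \<noteq> 0} \<subseteq> U \<longrightarrow>
        (LINT p:U|lborel. \<psi> p * px \<phi> p) = - (LINT p:U|lborel. fst (g p) * \<phi> p) \<and>
        (LINT p:U|lborel. \<psi> p * py \<phi> p) = - (LINT p:U|lborel. snd (g p) * \<phi> p)))"

definition W12w_loc :: "point set \<Rightarrow> (point \<Rightarrow> real) \<Rightarrow> (point \<Rightarrow> point) \<Rightarrow> bool" where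
  "W12w_loc \<Omega> \<psi> g =
    (weak_gradient (interior \<Omega>) \<psi> g \<and>
     (\<forall>K. compact K \<and> K \<subseteq> \<Omega> \<longrightarrow>
        set_integrable lborel K (\<lambda>p. (\<psi> p)\<^sup>2 / fst p) \<and>
        set_integrable lborel K (\<lambda>p. (fst (g p))\<^sup>2 / fst p) \<and>
        set_integrable lborel K (\<lambda>p. (snd (g p))\<^sup>2 / fst p)))"

definition positivity_set :: "point set \<Rightarrow> (point \<Rightarrow> real) \<Rightarrow> point set" where
  "positivity_set \<Omega> \<psi> = {p \<in> \<Omega>. \<psi> p > 0}"

definition variational_solution ::
  "point set \<Rightarrow> (real \<Rightarrow> real) \<Rightarrow> (point \<Rightarrow> real) \<Rightarrow> (point \<Rightarrow> point) \<Rightarrow> bool" where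
  "variational_solution \<Omega> f \<psi> g =
    (W12w_loc \<Omega> \<psi> g \<and>
     (\<forall>p\<in>\<Omega>. \<psi> p \<ge> 0) \<and>
     (\<forall>p\<in>\<Omega>. fst p = 0 \<longrightarrow> \<psi> p = 0) \<and>
     continuous_on \<Omega> \<psi> \<and>
     Ck_on 2 (positivity_set \<Omega> \<psi>) \<psi> \<and>
     (\<forall>p\<in>\<Omega>. snd p \<le> 0 \<longrightarrow> \<psi> p = 0) \<and>
     (\<forall>X0\<in>\<Omega>. fst X0 = 0 \<longrightarrow>
        ((\<lambda>p. py \<psi> p / fst p) \<longlongrightarrow> 0) (at X0 within positivity_set \<Omega> \<psi>) \<and>
        (\<exists>L. ((\<lambda>p. px \<psi> p / fst p) \<longlongrightarrow> L) (at X0 within positivity_set \<Omega> \<psi>))) \<and>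
     (\<forall>\<phi>1 \<phi>2. smooth \<phi>1 \<and> smooth \<phi>2 \<and>
        compact (closure {p\<in>\<Omega>. \<phi>1 p \<noteq> 0 \<or> \<phi>2 p \<noteq> 0}) \<and>
        closure {p\<in>\<Omega>. \<phi>1 p \<noteq> 0 \<or> \<phi>2 p \<noteq> 0} \<subseteq> \<Omega> \<and>
        (\<forall>p\<in>\<Omega>. fst p = 0 \<longrightarrow> \<phi>1 p = 0) \<longrightarrow>
        (LINT p:\<Omega>|lborel.
            (gsq g p / fst p - 2 * fst p * Fprim f (\<psi> p) + fst p * snd p * chi \<psi> p)
              * (px \<phi>1 p + py \<phi>2 p)
            - 2 / fst p *
              (fst (g p) * px \<phi>1 p * fst (g p) + fst (g p) * py \<phi>1 p * snd (g p)
               + snd (g p) * px \<phi>2 p * fst (g p) + snd (g p) * py \<phi>2 p * snd (g p)))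
        + (LINT p:\<Omega>|lborel.
            (- gsq g p / (fst p)\<^sup>2 - 2 * Fprim f (\<psi> p) + snd p * chi \<psi> p) * \<phi>1 p)
        + (LINT p:\<Omega>|lborel. fst p * chi \<psi> p * \<phi>2 p) = 0))"

definition S_s :: "point set \<Rightarrow> (point \<Rightarrow> real) \<Rightarrow> point set" where
  "S_s \<Omega> \<psi> = {X0 \<in> \<Omega> \<inter> frontier (positivity_set \<Omega> \<psi>). snd X0 = 0 \<and> fst X0 > 0}"

definition delta :: "point set \<Rightarrow> point \<Rightarrow> real" where
  "delta \<Omega> X0 = min (fst X0) (infdist X0 (frontier \<Omega>)) / 2"

definition disc_int :: "point \<Rightarrow> real \<Rightarrow> (point \<Rightarrow> real) \<Rightarrow> real" where
  "disc_int X0 r h = (LINT p:ball X0 r|lborel. h p)"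

definition circ_int :: "point \<Rightarrow> real \<Rightarrow> (point \<Rightarrow> real) \<Rightarrow> real" where
  "circ_int X0 r h = (LBINT t=0..2*pi. r * h (X0 + (r * cos t, r * sin t)))"

definition nu :: "point \<Rightarrow> real \<Rightarrow> point \<Rightarrow> point" where
  "nu X0 r p = (1 / r) *\<^sub>R (p - X0)"

definition I1 :: "(point \<Rightarrow> point) \<Rightarrow> point \<Rightarrow> real \<Rightarrow> real" where
  "I1 g X0 t = disc_int X0 t (\<lambda>p. - (fst p - fst X0) / (fst p)\<^sup>2 * gsq g p)"

definition I2 :: "(point \<Rightarrow> real) \<Rightarrow> point \<Rightarrow> real \<Rightarrow> real" where
  "I2 \<psi> X0 t = disc_int X0 t (\<lambda>p. (fst p - fst X0) * snd p * chi \<psi> p)"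

definition J1 :: "(point \<Rightarrow> real) \<Rightarrow> point \<Rightarrow> real \<Rightarrow> real" where
  "J1 \<psi> X0 t = circ_int X0 t (\<lambda>p. (fst p - fst X0) / (fst p)\<^sup>2 * (\<psi> p)\<^sup>2)"

definition Kfun :: "(real \<Rightarrow> real) \<Rightarrow> (point \<Rightarrow> real) \<Rightarrow> point \<Rightarrow> real \<Rightarrow> real" where
  "Kfun f \<psi> X0 r =
     r * circ_int X0 r (\<lambda>p. 2 * fst p * Fprim f (\<psi> p) - fst p * \<psi> p * f (\<psi> p))
     + disc_int X0 r (\<lambda>p. 2 * fst X0 * Fprim f (\<psi> p) - 6 * fst p * Fprim f (\<psi> p))"

definition Nfun :: "(point \<Rightarrow> real) \<Rightarrow> point \<Rightarrow> real \<Rightarrow> real" where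
  "Nfun \<psi> X0 r = circ_int X0 r (\<lambda>p. (\<psi> p)\<^sup>2 / fst p)"

definition Dfun :: "(real \<Rightarrow> real) \<Rightarrow> (point \<Rightarrow> real) \<Rightarrow> (point \<Rightarrow> point) \<Rightarrow> point \<Rightarrow> real \<Rightarrow> real" where
  "Dfun f \<psi> g X0 r =
     r * disc_int X0 r (\<lambda>p. gsq g p / fst p - fst p * \<psi> p * f (\<psi> p)) / Nfun \<psi> X0 r"

definition Vfun :: "(point \<Rightarrow> real) \<Rightarrow> (point \<Rightarrow> point) \<Rightarrow> point \<Rightarrow> real \<Rightarrow> real" where
  "Vfun \<psi> g X0 r =
     (r * disc_int X0 r (\<lambda>p. max (snd p) 0 * (fst X0 - fst p * chi \<psi> p))
      + r ^ 4 * (LBINT t=0..r. I1 g X0 t / t ^ 4)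
      + r ^ 4 * (LBINT t=0..r. I2 \<psi> X0 t / t ^ 4)
      + 3 / 2 * r ^ 4 * (LBINT t=0..r. J1 \<psi> X0 t / t ^ 5)) / Nfun \<psi> X0 r"

definition Zfun :: "(point \<Rightarrow> real) \<Rightarrow> point \<Rightarrow> real \<Rightarrow> real" where
  "Zfun \<psi> X0 r = circ_int X0 r (\<lambda>p. (fst p - fst X0) / (fst p)\<^sup>2 * (\<psi> p)\<^sup>2) / Nfun \<psi> X0 r"

definition Hfun :: "(real \<Rightarrow> real) \<Rightarrow> (point \<Rightarrow> real) \<Rightarrow> (point \<Rightarrow> point) \<Rightarrow> point \<Rightarrow> real \<Rightarrow> real" where
  "Hfun f \<psi> g X0 r = Dfun f \<psi> g X0 r - Vfun \<psi> g X0 r"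

end

theory Submission imports Defs "HOL-Analysis.Analysis" begin

text \<open>Test the domain variation identity with \<open>h(|X - X\<^sub>0|\<^sup>2)\<close> times the field \<open>X - X\<^sub>0\<close>, for arbitrary smooth
  \<open>h\<close>. In polar coordinates this is the weak form of an ordinary differential equation in the radius, so that
  for almost every \<open>r\<close> it yields a Pohozaev identity between integrals over the disc and over the circle. The
  equation in \<open>{\<psi> > 0}\<close> is not assumed, but it follows from the variation identity; tested with
  \<open>h \<psi>\<close> it gives the energy identity \<open>\<integral>\<^sub>B (|\<nabla>\<psi>|\<^sup>2/x - x \<psi> f(\<psi>)) = \<integral>\<^sub>\<partial>\<^sub>B \<psi> \<nabla>\<psi> \<cdot> \<nu> / x\<close>.
  By Lebesgue differentiation every disc integral is differentiable for almost every \<open>r\<close>, with the circle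
  integral as its derivative. The denominator \<open>N\<close> is positive for almost every \<open>r\<close> by the vertical
  translation variation, and the growth assumption makes the integrals of \<open>t\<^sup>-\<^sup>4 I\<^sub>i\<close> and
  \<open>t\<^sup>-\<^sup>5 J\<^sub>1\<close> converge at \<open>0\<close>. What remains is algebra.\<close>

section \<open>Lebesgue differentiation on the line\<close>

text \<open>Nothing is known about the free boundary as a set, and \<open>\<psi>\<close> is C^2 only
  where it is positive, so no divergence theorem holds up to the edge of \<open>P\<close>.
  Integrations by parts across it carry a factor that vanishes near the edge and is then removed by
  dominated convergence. The gradient \<open>g\<close> is fixed only up to null sets, while a circle
  is itself null: \<open>g\<close> is replaced by a Borel field, and Fubini in polar coordinates
  shows that circle integrals keep their values for almost every radius. The denominator
  \<open>N\<close> has to be differentiated, so knowing it for almost every radius is not enough; it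
  is continuous in \<open>r\<close> and hence equals, for every \<open>r\<close>, a disc integral
  divided by \<open>r\<close>. The form of \<open>V\<close> follows from scaling: for
  \<open>\<psi>\<close> of order r^(3/2), \<open>N\<close> is of order r^4, and r^4 times the
  primitive of t^-4 I solves W' = 4 W / r + I. With this choice the \<open>I1\<close>,
  \<open>I2\<close> and \<open>y\<close> terms of the Pohozaev identity are exactly those removed by
  the derivative of the numerator of \<open>V\<close>.\<close>

lemma null_set_by_vitali:
  fixes v :: "real \<Rightarrow> real"
  assumes v: "integrable lborel v" and c: "c > 0"
    and E: "E \<in> sets borel" "emeasure lborel E < \<infinity>"
    and le: "\<And>x. x \<in> E \<Longrightarrow> v x \<le> - c"
    and cover: "\<And>x d. x \<in> E \<Longrightarrow> d > 0 \<Longrightarrow>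
      \<exists>z \<rho>. 0 < \<rho> \<and> \<rho> < d \<and> x \<in> ball z \<rho> \<and> 0 \<le> (LINT y:ball z \<rho>|lborel. v y)"
  shows "emeasure lborel E = 0"
proof -
  \<comment> \<open>Vitali's theorem picks countably many disjoint balls inside \<open>G\<close>
    that cover almost all of \<open>E\<close>, each with nonnegative integral of \<open>v\<close>.
    On \<open>E\<close> the integral is at most \<open>-c\<close> times the measure, so the part of
    \<open>G\<close> outside \<open>E\<close> must compensate.\<close>
  have key: "c * measure lborel E \<le> (LINT x:G - E|lborel. \<bar>v x\<bar>)" if G: "open G" "E \<subseteq> G" for G
  proof -
    define K where "K = {i::real\<times>real. 0 < snd i \<and> ball (fst i) (snd i) \<subseteq> G \<and>
        0 \<le> (LINT y:ball (fst i) (snd i)|lborel. v y)}"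
    have cov: "\<exists>i. i \<in> K \<and> x \<in> ball (fst i) (snd i) \<and> snd i < d" if "x \<in> E" "d > 0" for x d
    proof -
      obtain e where e: "e > 0" "ball x e \<subseteq> G"
        using G \<open>x \<in> E\<close> by (meson open_contains_ball subsetD)
      \<comment> \<open>The ball contains \<open>x\<close> but is not centred there; a radius below
        \<open>e/2\<close> keeps it inside \<open>ball x e\<close>.\<close>
      obtain z \<rho> where z: "0 < \<rho>" "\<rho> < min d (e/2)" "x \<in> ball z \<rho>" "0 \<le> (LINT y:ball z \<rho>|lborel. v y)"
        using cover[OF \<open>x \<in> E\<close>, of "min d (e/2)"] \<open>d > 0\<close> e by auto
      have "ball z \<rho> \<subseteq> ball x e"
      proof
        fix y assume "y \<in> ball z \<rho>"
        then show "y \<in> ball x e"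
          using z dist_triangle[of x y z] by (auto simp: dist_commute)
      qed
      then have "(z,\<rho>) \<in> K" using z e by (auto simp: K_def)
      with z show ?thesis by (intro exI[of _ "(z,\<rho>)"]) auto
    qed
    obtain C where C: "countable C" "C \<subseteq> K"
      and disj: "pairwise (\<lambda>i j. disjnt (ball (fst i) (snd i)) (ball (fst j) (snd j))) C"
      and neg: "negligible (E - (\<Union>i\<in>C. ball (fst i) (snd i)))"
      by (rule Vitali_covering_theorem_balls[of E K fst snd]) (use cov in auto)
    define W where "W = (\<Union>i\<in>C. ball (fst i) (snd i))"
    have Wopen: "open W" by (auto simp: W_def)
    have WG: "W \<subseteq> G" using C by (auto simp: W_def K_def)
    have Wb[measurable]: "W \<in> sets borel" using Wopen by auto
    have Gb[measurable]: "G \<in> sets borel" using G by auto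
    note E(1)[measurable]
    have [measurable]: "v \<in> borel_measurable borel" using v by auto
    have intv: "set_integrable lborel S v" if "S \<in> sets borel" for S
      using v that unfolding set_integrable_def by (intro integrable_mult_indicator) auto
    have nonneg: "0 \<le> (LINT y:W|lborel. v y)"
    proof -
      \<comment> \<open>Numbering the countable family makes each \<open>B n\<close> a finite
        disjoint union, to which additivity applies; \<open>W\<close> is their increasing
        limit.\<close>
      define B where "B n = (\<Union>i\<in>{i\<in>C. to_nat_on C i \<le> n}. ball (fst i) (snd i))" for n
      have fin: "finite {i\<in>C. to_nat_on C i \<le> n}" for n
        by (rule inj_on_finite[of "to_nat_on C" _ "{..n}"]) (use C inj_on_to_nat_on[of C] in \<open>auto simp: inj_on_def\<close>)
      have WB: "W = (\<Union>n. B n)" by (auto simp: W_def B_def)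
      have "(\<lambda>n. LINT y:B n|lborel. v y) \<longlonglongrightarrow> (LINT y:W|lborel. v y)"
        unfolding WB
        by (rule set_integral_cont_up) (auto simp: incseq_def B_def intro!: intv borel_open)
      moreover have "0 \<le> (LINT y:B n|lborel. v y)" for n
      proof -
        have "(LINT y:B n|lborel. v y) = (\<Sum>i\<in>{i\<in>C. to_nat_on C i \<le> n}. LINT y:ball (fst i) (snd i)|lborel. v y)"
          unfolding B_def
          by (rule set_integral_finite_Union)
             (use disj fin in \<open>auto simp: disjoint_family_on_def pairwise_def disjnt_def intro!: intv\<close>)
        also have "\<dots> \<ge> 0" using C by (intro sum_nonneg) (auto simp: K_def)
        finally show ?thesis .
      qed
      ultimately show ?thesis by (intro LIMSEQ_le_const) auto
    qed
    have "(LINT y:W|lborel. v y) = (LINT y:W\<inter>E|lborel. v y) + (LINT y:W-E|lborel. v y)"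
    proof -
      have *: "W = (W\<inter>E) \<union> (W-E)" by auto
      show ?thesis by (subst *, rule set_integral_Un) (auto intro!: intv)
    qed
    also have "(LINT y:W\<inter>E|lborel. v y) \<le> (LINT y:W\<inter>E|lborel. - c)"
    proof (rule set_integral_mono)
      show "set_integrable lborel (W \<inter> E) (\<lambda>y. - c)"
        using E by (auto simp: set_integrable_def intro!: integrable_mult_left integrable_real_indicator
            le_less_trans[OF emeasure_mono[of "W\<inter>E" E]])
    qed (use le intv in auto)
    also have "(LINT y:W\<inter>E|lborel. - c) = - c * measure lborel (W\<inter>E)"
      by (simp add: set_lebesgue_integral_def mult.commute)
    also have "measure lborel (W\<inter>E) = measure lborel E"
    proof -
      have "emeasure lborel (E - W) = 0"
      proof -
        have "E - W \<in> null_sets lebesgue" using neg by (simp add: W_def negligible_iff_null_sets)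
        then show ?thesis by (auto simp: null_sets_def)
      qed
      then have "emeasure lborel E = emeasure lborel (W\<inter>E)"
        by (intro emeasure_eq_AE AE_I[of _ _ "E - W"]) auto
      then show ?thesis by (simp add: measure_def)
    qed
    also have "(LINT y:W-E|lborel. v y) \<le> (LINT y:G-E|lborel. \<bar>v y\<bar>)"
      unfolding set_lebesgue_integral_def
      using WG v by (intro integral_mono integrable_mult_indicator integrable_abs)
         (auto simp: indicator_def)
    finally show ?thesis using nonneg by simp
  qed
  note E(1)[measurable]
  have "\<forall>n::nat. \<exists>G. open G \<and> E \<subseteq> G \<and> emeasure lborel (G - E) < ennreal (1 / Suc n)"
    by (meson outer_regular_lborel[OF E(1)] zero_less_divide_1_iff of_nat_0_less_iff zero_less_Suc)
  then obtain G where G: "\<And>n. open (G n)" "\<And>n. E \<subseteq> G n" "\<And>n. emeasure lborel (G n - E) < ennreal (1 / Suc n)"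
    by metis
  \<comment> \<open>The sets \<open>G n\<close> need not decrease, but these intersections do. Their
    excess over \<open>E\<close> shrinks to a null set, so the right side of \<open>key\<close>
    tends to zero.\<close>
  define H where "H n = (\<Inter>i\<le>n::nat. G i)" for n
  have H: "open (H n)" "E \<subseteq> H n" for n using G by (auto simp: H_def)
  have [measurable]: "H n \<in> sets borel" "G n \<in> sets borel" for n using H G by auto
  have [measurable]: "v \<in> borel_measurable borel" using v by auto
  have "(\<lambda>n. (LINT x:H n - E|lborel. \<bar>v x\<bar>)) \<longlonglongrightarrow> (LINT (x::real)|lborel. (0::real))"
    unfolding set_lebesgue_integral_def
  proof (rule integral_dominated_convergence[where w="\<lambda>x. \<bar>v x\<bar>" and f="\<lambda>x. 0"
        and s="\<lambda>n x. indicat_real (H n - E) x *\<^sub>R \<bar>v x\<bar>"])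
    have "emeasure lborel ((\<Inter>n. G n) - E) = 0"
    proof -
      have "emeasure lborel ((\<Inter>n. G n) - E) \<le> ennreal (1 / Suc n)" for n
        by (rule order_trans[OF emeasure_mono less_imp_le[OF G(3)]]) auto
      moreover have "(\<lambda>n. ennreal (1 / Suc n)) \<longlonglongrightarrow> ennreal 0"
        by (intro tendsto_ennrealI LIMSEQ_Suc[OF lim_1_over_n])
      ultimately have "emeasure lborel ((\<Inter>n. G n) - E) \<le> ennreal 0"
        by (intro LIMSEQ_le_const) auto
      then show ?thesis by simp
    qed
    then show "AE x in lborel. (\<lambda>n. indicat_real (H n - E) x *\<^sub>R \<bar>v x\<bar>) \<longlonglongrightarrow> 0"
    proof (intro AE_I[of _ _ "(\<Inter>n. G n) - E"] subsetI, goal_cases)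
      case (1 x)
      show ?case
      proof (rule ccontr)
        assume "x \<notin> (\<Inter>n. G n) - E"
        then have "eventually (\<lambda>n. x \<notin> H n - E) sequentially"
          by (auto simp: H_def eventually_sequentially)
        then have "(\<lambda>n. indicat_real (H n - E) x *\<^sub>R \<bar>v x\<bar>) \<longlonglongrightarrow> 0"
          by (intro tendsto_eventually) (elim eventually_mono, simp)
        with 1 show False by simp
      qed
    qed auto
  qed (use v in \<open>auto simp: indicator_def\<close>)
  then have "c * measure lborel E \<le> 0"
    using key[OF H] by (intro LIMSEQ_le_const[where X="\<lambda>n. (LINT x:H n - E|lborel. \<bar>v x\<bar>)"]) auto
  then have "measure lborel E = 0" using c
    by (simp add: mult_le_0_iff measure_le_0_iff)
  with E show ?thesis by (auto simp: measure_def enn2real_eq_0_iff)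
qed

lemma isCont_integral_atMost:
  fixes u :: "real \<Rightarrow> real"
  assumes u: "integrable lborel u"
  shows "isCont (\<lambda>r. LINT y:{..r}|lborel. u y) x"
proof (rule continuous_at_sequentiallyI)
  fix X :: "nat \<Rightarrow> real" assume X: "X \<longlonglongrightarrow> x"
  show "(\<lambda>n. LINT y:{..X n}|lborel. u y) \<longlonglongrightarrow> (LINT y:{..x}|lborel. u y)"
    unfolding set_lebesgue_integral_def
  proof (rule integral_dominated_convergence[where w="\<lambda>y. \<bar>u y\<bar>"])
    show "AE y in lborel. (\<lambda>n. indicat_real {..X n} y *\<^sub>R u y) \<longlonglongrightarrow> indicat_real {..x} y *\<^sub>R u y"
    proof (rule AE_I'[of "{x}"])
      show "{y \<in> space lborel. \<not> (\<lambda>n. indicat_real {..X n} y *\<^sub>R u y) \<longlonglongrightarrow> indicat_real {..x} y *\<^sub>R u y} \<subseteq> {x}"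
      proof clarify
        fix y assume y: "y \<notin> {}" "\<not> (\<lambda>n. indicat_real {..X n} y *\<^sub>R u y) \<longlonglongrightarrow> indicat_real {..x} y *\<^sub>R u y"
        show "y = x"
        proof (rule ccontr)
          assume "y \<noteq> x"
          then consider "y < x" | "x < y" by linarith
          then have "eventually (\<lambda>n. indicat_real {..X n} y *\<^sub>R u y = indicat_real {..x} y *\<^sub>R u y) sequentially"
          proof cases
            case 1
            show ?thesis using order_tendstoD(1)[OF X, OF 1] by eventually_elim (use 1 in auto)
          next
            case 2
            show ?thesis using order_tendstoD(2)[OF X, OF 2] by eventually_elim (use 2 in auto)
          qed
          from tendsto_eventually[OF this] y(2) show False by contradiction
        qed
      qed
    qed auto
  qed (use u in \<open>auto simp: indicator_def\<close>)
qed

lemma set_integral_atMost_diff: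
  fixes u :: "real \<Rightarrow> real"
  assumes u: "integrable lborel u" and "a \<le> b"
  shows "(LINT y:{..b}|lborel. u y) - (LINT y:{..a}|lborel. u y) = (LINT y:{a<..<b}|lborel. u y)"
proof -
  have intv: "set_integrable lborel S u" if "S \<in> sets borel" for S
    using u that unfolding set_integrable_def by (intro integrable_mult_indicator) auto
  have "(LINT y:{..b}|lborel. u y) = (LINT y:{..a} \<union> {a<..b}|lborel. u y)"
    using assms by (simp add: ivl_disj_un)
  also have "\<dots> = (LINT y:{..a}|lborel. u y) + (LINT y:{a<..b}|lborel. u y)"
    by (rule set_integral_Un) (auto intro!: intv)
  also have "(LINT y:{a<..b}|lborel. u y) = (LINT y:{a<..<b}|lborel. u y)"
  proof (rule set_integral_null_delta)
    have "sym_diff {a<..b} {a<..<b} \<subseteq> {b}" by auto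
    then show "sym_diff {a<..b} {a<..<b} \<in> null_sets lborel"
      by (rule null_sets_subset[rotated 2]) (auto simp: finite_imp_null_set_lborel)
  qed (use u in auto)
  finally show ?thesis by simp
qed

text \<open>If the bound fails at \<open>x\<close>, arbitrarily short intervals around
  \<open>x\<close> have mean value above \<open>q\<close> although \<open>u x < p\<close>. This is
  the situation treated by \<open>null_set_by_vitali\<close>, for \<open>u - q\<close> with gap
  \<open>c = q - p\<close>. Since the intervals only have to contain \<open>x\<close> in their
  interior, the points of failure form an intersection of open sets with a Borel set.\<close>

lemma AE_upper_derivative_bound:
  fixes u :: "real \<Rightarrow> real"
  assumes u: "integrable lborel u" and pq: "p < q"
  shows "AE x in lborel. u x < p \<longrightarrow>
    (\<exists>d>0. \<forall>a b. a < x \<and> x < b \<and> b - a < d \<longrightarrow> (LINT y:{a<..<b}|lborel. u y) \<le> q * (b - a))"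
proof -
  have [measurable]: "u \<in> borel_measurable borel" using u by auto
  define Ok where "Ok k = \<Union>{{a<..<b} | a b. b - a < 1 / Suc k \<and> (LINT y:{a<..<b}|lborel. u y) > q * (b - a)}" for k
  have Ok: "open (Ok k)" for k by (auto simp: Ok_def)
  then have [measurable]: "Ok k \<in> sets borel" for k by auto
  define E where "E n = {x\<in>{- real n..real n}. u x < p} \<inter> (\<Inter>k. Ok k)" for n
  have [measurable]: "E n \<in> sets borel" for n unfolding E_def by measurable
  have "emeasure lborel (E n) = 0" for n
  proof (rule null_set_by_vitali)
    \<comment> \<open>The window exceeds that of \<open>E n\<close> by one on each side, so
      intervals of length below one through a point of \<open>E n\<close> stay inside it; on the
      window the constant \<open>q\<close> is integrable.\<close>
    let ?I = "{- real n - 1..real n + 1}"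
    have ii: "integrable lborel (\<lambda>x. indicator ?I x * u x)"
      using u integrable_mult_indicator[of ?I lborel u] by auto
    then show "integrable lborel (\<lambda>x. indicator ?I x * u x - q * indicator ?I x)"
      by (intro Bochner_Integration.integrable_diff) (auto intro!: integrable_mult_right)
    show "emeasure lborel (E n) < \<infinity>"
    proof -
      have "emeasure lborel (E n) \<le> emeasure lborel {-real n..real n}"
        by (intro emeasure_mono) (auto simp: E_def)
      also have "\<dots> < \<infinity>" by simp
      finally show ?thesis .
    qed
    fix x assume x: "x \<in> E n"
    then show "indicator ?I x * u x - q * indicator ?I x \<le> - (q - p)"
      by (auto simp: E_def)
    fix d :: real assume d: "d > 0"
    obtain k where k: "1 / Suc k < min d 1"
      using d nat_approx_posE[of "min d 1"] by (auto simp: inverse_eq_divide)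
    have "x \<in> Ok k" using x by (auto simp: E_def)
    then obtain a b where ab: "a < x" "x < b" "b - a < 1 / Suc k" "(LINT y:{a<..<b}|lborel. u y) > q * (b - a)"
      by (auto simp: Ok_def)
    define z \<rho> where "z = (a + b) / 2" and "\<rho> = (b - a) / 2"
    have ball: "ball z \<rho> = {a<..<b}" by (auto simp: z_def \<rho>_def ball_eq_greaterThanLessThan field_simps)
    have "b - a < 1" using ab(3) k by linarith
    then have sub: "{a<..<b} \<subseteq> ?I" using x ab(1,2) by (auto simp: E_def)
    have "(LINT y:{a<..<b}|lborel. indicator ?I y * u y - q * indicator ?I y)
        = (LINT y:{a<..<b}|lborel. u y - q)"
      using sub by (intro set_lebesgue_integral_cong) auto
    also have "\<dots> = (LINT y:{a<..<b}|lborel. u y) - (LINT y:{a<..<b}|lborel. q)"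
    proof (intro set_integral_diff)
      show "set_integrable lborel {a<..<b} u"
        using u unfolding set_integrable_def by (intro integrable_mult_indicator) auto
      show "set_integrable lborel {a<..<b} (\<lambda>y. q)"
        using ab unfolding set_integrable_def by (intro integrable_scaleR_left integrable_real_indicator) auto
    qed
    also have "(LINT y:{a<..<b}|lborel. q) = q * (b - a)"
      using ab by (simp add: set_lebesgue_integral_def mult.commute)
    finally have "0 \<le> (LINT y:{a<..<b}|lborel. indicator ?I y * u y - q * indicator ?I y)" using ab by simp
    then show "\<exists>z \<rho>. 0 < \<rho> \<and> \<rho> < d \<and> x \<in> ball z \<rho> \<and>
       0 \<le> (LINT y:ball z \<rho>|lborel. indicator ?I y * u y - q * indicator ?I y)"
      using ab k d ball by (intro exI[of _ z] exI[of _ \<rho>]) (auto simp: \<rho>_def)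
  qed (use pq in auto)
  then have "(\<Union>n. E n) \<in> null_sets lborel" by (intro null_sets_UN) auto
  then show ?thesis
  proof (rule AE_I', intro subsetI)
    fix x assume "x \<in> {x \<in> space lborel. \<not> (u x < p \<longrightarrow>
      (\<exists>d>0. \<forall>a b. a < x \<and> x < b \<and> b - a < d \<longrightarrow> (LINT y:{a<..<b}|lborel. u y) \<le> q * (b - a)))}"
    then have x: "u x < p" "\<not> (\<exists>d>0. \<forall>a b. a < x \<and> x < b \<and> b - a < d \<longrightarrow> (LINT y:{a<..<b}|lborel. u y) \<le> q * (b - a))"
      by blast+
    have "x \<in> Ok k" for k
    proof -
      have "\<not> (\<forall>a b. a < x \<and> x < b \<and> b - a < 1 / Suc k \<longrightarrow> (LINT y:{a<..<b}|lborel. u y) \<le> q * (b - a))"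
        using x(2) by (metis zero_less_divide_1_iff of_nat_0_less_iff zero_less_Suc)
      then obtain a b where "a < x" "x < b" "b - a < 1 / Suc k" "(LINT y:{a<..<b}|lborel. u y) > q * (b - a)"
        by (auto simp: not_le)
      then show ?thesis unfolding Ok_def by (intro UnionI[of "{a<..<b}"]) auto
    qed
    moreover obtain n :: nat where "\<bar>x\<bar> \<le> real n" using real_arch_simple by blast
    ultimately show "x \<in> (\<Union>n. E n)" using x(1) by (auto simp: E_def intro!: exI[of _ n])
  qed
qed

text \<open>The one-sided estimate for all rational \<open>p < q\<close>, applied to
  \<open>u\<close> and to \<open>-u\<close>, traps the difference quotients near \<open>u x\<close>;
  countability of the rationals keeps the exceptional set null.\<close>

lemma lebesgue_differentiation:
  fixes u :: "real \<Rightarrow> real"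
  assumes u: "integrable lborel u"
  shows "AE x in lborel. ((\<lambda>r. LINT y:{..r}|lborel. u y) has_real_derivative u x) (at x)"
proof -
  let ?U = "\<lambda>r. LINT y:{..r}|lborel. u y"
  let ?P = "\<lambda>u x p q. u x < p \<longrightarrow>
    (\<exists>d>0. \<forall>a b. a < x \<and> x < b \<and> b - a < d \<longrightarrow> (LINT y:{a<..<b}|lborel. u y) \<le> q * (b - a))"
  have "AE x in lborel. \<forall>p\<in>\<rat>. \<forall>q\<in>\<rat>. p < q \<longrightarrow> ?P u x p q \<and> ?P (\<lambda>x. - u x) x p q"
  proof (intro AE_ball_countable' countable_rat)
    fix p q :: real
    show "AE x in lborel. p < q \<longrightarrow> ?P u x p q \<and> ?P (\<lambda>x. - u x) x p q"
    proof (cases "p < q")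
      case True
      have u': "integrable lborel (\<lambda>x. - u x)" using u by simp
      show ?thesis
        using AE_upper_derivative_bound[OF u True] AE_upper_derivative_bound[OF u' True]
        by eventually_elim (rule impI, rule conjI)
    qed simp
  qed
  then show ?thesis
  proof eventually_elim
    case (elim x)
    have up: "\<exists>d>0. \<forall>y. y \<noteq> x \<and> \<bar>y - x\<bar> < d \<longrightarrow> (LINT z:{min x y<..<max x y}|lborel. w z) \<le> (w x + e) * \<bar>y - x\<bar>"
      if w: "integrable lborel w" "\<And>p q. p \<in> \<rat> \<Longrightarrow> q \<in> \<rat> \<Longrightarrow> p < q \<Longrightarrow> ?P w x p q" and e: "e > 0" for w e
    proof -
      obtain p where p: "p \<in> \<rat>" "w x < p" "p < w x + e" using Rats_dense_in_real[of "w x" "w x + e"] e by auto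
      obtain q where q: "q \<in> \<rat>" "p < q" "q < w x + e" using Rats_dense_in_real[of p "w x + e"] p by auto
      obtain d where d: "d > 0" "\<And>a b. a < x \<Longrightarrow> x < b \<Longrightarrow> b - a < d \<Longrightarrow> (LINT y:{a<..<b}|lborel. w y) \<le> q * (b - a)"
        using w(2)[of p q] p q by blast
      let ?W = "\<lambda>r. LINT y:{..r}|lborel. w y"
      have d': "?W b - ?W a \<le> q * (b - a)" if "a < x" "x < b" "b - a < d" for a b
        using d(2)[OF that] set_integral_atMost_diff[OF w(1), of a b] that by simp
      have Wx: "(?W \<longlongrightarrow> ?W x) (at x within S)" for S
        using isCont_integral_atMost[OF w(1), of x] by (simp add: isCont_def tendsto_within_subset[of _ _ x UNIV])
      \<comment> \<open>The estimates hold for intervals with \<open>x\<close> in the interior;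
        continuity of the primitive allows one endpoint to tend to \<open>x\<close>.\<close>
      have 1: "?W y - ?W x \<le> q * (y - x)" if y: "x < y" "y - x < d" for y
      proof (rule tendsto_le[of "at_left x" "\<lambda>a. q * (y - a)" _ "\<lambda>a. ?W y - ?W a"])
        show "\<forall>\<^sub>F a in at_left x. ?W y - ?W a \<le> q * (y - a)"
          using eventually_at_left_real[of "y - d" x] y by (auto elim!: eventually_mono intro!: d')
      qed (auto intro!: tendsto_intros Wx)
      have 2: "?W x - ?W y \<le> q * (x - y)" if y: "y < x" "x - y < d" for y
      proof (rule tendsto_le[of "at_right x" "\<lambda>a. q * (a - y)" _ "\<lambda>a. ?W a - ?W y"])
        show "\<forall>\<^sub>F a in at_right x. ?W a - ?W y \<le> q * (a - y)"
          using eventually_at_right_real[of x "y + d"] y by (auto elim!: eventually_mono intro!: d')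
      qed (auto intro!: tendsto_intros Wx)
      have "(LINT z:{min x y<..<max x y}|lborel. w z) \<le> q * \<bar>y - x\<bar>" if "y \<noteq> x" "\<bar>y - x\<bar> < d" for y
        using 1[of y] 2[of y] that set_integral_atMost_diff[OF w(1), of "min x y" "max x y"]
        by (auto simp: min_def max_def abs_if split: if_splits)
      moreover have "q * \<bar>y - x\<bar> \<le> (w x + e) * \<bar>y - x\<bar>" for y using q by (intro mult_right_mono) auto
      ultimately show ?thesis using d(1) by (meson order_trans)
    qed
    show ?case
      unfolding has_field_derivative_iff tendsto_iff
    proof safe
      fix e :: real assume "e > 0"
      then have e2: "e/2 > 0" by simp
      obtain d1 where d1: "d1 > 0" "\<And>y. y \<noteq> x \<Longrightarrow> \<bar>y - x\<bar> < d1 \<Longrightarrow> (LINT z:{min x y<..<max x y}|lborel. u z) \<le> (u x + e/2) * \<bar>y - x\<bar>"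
        using up[OF u _ e2] elim by blast
      have u': "integrable lborel (\<lambda>x. - u x)" using u by simp
      obtain d2 where d2: "d2 > 0" "\<And>y. y \<noteq> x \<Longrightarrow> \<bar>y - x\<bar> < d2 \<Longrightarrow> (LINT z:{min x y<..<max x y}|lborel. - u z) \<le> (- u x + e/2) * \<bar>y - x\<bar>"
        using up[OF u' _ e2] elim by blast
      show "\<forall>\<^sub>F y in at x. dist ((?U y - ?U x) / (y - x)) (u x) < e"
        unfolding eventually_at
      proof (intro exI[of _ "min d1 d2"] conjI ballI impI)
        fix y assume y: "y \<noteq> x \<and> dist y x < min d1 d2"
        let ?I = "LINT z:{min x y<..<max x y}|lborel. u z"
        have "?I \<le> (u x + e/2) * \<bar>y - x\<bar>" using d1(2)[of y] y by (auto simp: dist_real_def)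
        moreover have "- ?I \<le> (- u x + e/2) * \<bar>y - x\<bar>" using d2(2)[of y] y
          by (auto simp: dist_real_def set_lebesgue_integral_def)
        ultimately have "\<bar>?I - u x * \<bar>y - x\<bar>\<bar> \<le> e/2 * \<bar>y - x\<bar>"
          unfolding distrib_right mult_minus_left by linarith
        moreover have "?I / \<bar>y - x\<bar> - u x = (?I - u x * \<bar>y - x\<bar>) / \<bar>y - x\<bar>"
          using y by (simp add: diff_divide_distrib)
        ultimately have "\<bar>?I / \<bar>y - x\<bar> - u x\<bar> \<le> e/2"
          using y by (simp add: abs_divide pos_divide_le_eq)
        moreover have "(?U y - ?U x) / (y - x) = ?I / \<bar>y - x\<bar>"
          using set_integral_atMost_diff[OF u, of "min x y" "max x y"] y
          by (auto simp: min_def max_def abs_if field_simps split: if_splits)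
        ultimately show "dist ((?U y - ?U x) / (y - x)) (u x) < e"
          using \<open>e > 0\<close> by (simp add: dist_real_def)
      qed (use d1 d2 in auto)
    qed
  qed
qed

section \<open>Polar coordinates in the plane\<close>

text \<open>For fixed height \<open>y > 0\<close> the angle parametrises the horizontal line by
  \<open>x = y * cot \<theta>\<close>. With this substitution polar coordinates reduce to
  one-dimensional changes of variables and Fubini.\<close>

lemma lborel_eq_distr_cot:
  "lborel = distr (density lborel (\<lambda>\<theta>. indicator {0<..<pi} \<theta> * ennreal (inverse ((sin \<theta>)\<^sup>2)))) borel (cot :: real \<Rightarrow> real)"
proof (rule lborel_eqI)
  have [measurable]: "(cot :: real \<Rightarrow> real) \<in> borel_measurable borel"
    unfolding cot_def[abs_def] by measurable
  fix l u :: real assume lu: "\<And>b. b \<in> Basis \<Longrightarrow> l \<bullet> b \<le> u \<bullet> b"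
  then have lu: "l \<le> u" by simp
  \<comment> \<open>\<open>cot\<close> decreases on (0, pi), so the preimage of (l, u) is (a, b),
    with the roles of the endpoints exchanged.\<close>
  define a b where "a = pi/2 - arctan u" and "b = pi/2 - arctan l"
  have ab: "0 < a" "a \<le> b" "b < pi"
    using arctan_bounded[of u] arctan_bounded[of l] arctan_monotone'[OF lu] by (auto simp: a_def b_def)
  have cot_tan: "cot \<theta> = tan (pi/2 - \<theta>)" for \<theta> :: real
    by (simp add: cot_def tan_def cos_diff sin_diff)
  have iff: "l < cot \<theta> \<and> cot \<theta> < u \<longleftrightarrow> a < \<theta> \<and> \<theta> < b" if "0 < \<theta>" "\<theta> < pi" for \<theta>
  proof -
    have "arctan (tan (pi/2 - \<theta>)) = pi/2 - \<theta>" using that by (intro arctan_tan) auto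
    then have "pi/2 - \<theta> = arctan (cot \<theta>)" by (simp add: cot_tan)
    then have "\<theta> = pi/2 - arctan (cot \<theta>)" by simp
    then show ?thesis unfolding a_def b_def by (smt (verit) arctan_less_iff)
  qed
  have "emeasure (distr (density lborel (\<lambda>\<theta>. indicator {0<..<pi} \<theta> * ennreal (inverse ((sin \<theta>)\<^sup>2)))) borel cot) (box l u)
    = (\<integral>\<^sup>+\<theta>. indicator {0<..<pi} \<theta> * ennreal (inverse ((sin \<theta>)\<^sup>2)) * indicator (cot -` box l u) \<theta> \<partial>lborel)"
    by (simp add: emeasure_distr emeasure_density measurable_sets_borel[OF _ borel_open])
  also have "\<dots> = (\<integral>\<^sup>+\<theta>. ennreal (inverse ((sin \<theta>)\<^sup>2)) * indicator {a..b} \<theta> \<partial>lborel)"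
  proof (rule nn_integral_cong_AE)
    have "AE \<theta> in lborel. \<theta> \<notin> {a,b}" by (intro AE_not_in finite_imp_null_set_lborel) auto
    then show "AE \<theta> in lborel. indicator {0<..<pi} \<theta> * ennreal (inverse ((sin \<theta>)\<^sup>2)) * indicator (cot -` box l u) \<theta>
      = ennreal (inverse ((sin \<theta>)\<^sup>2)) * indicator {a..b} \<theta>"
    proof eventually_elim
      case (elim \<theta>)
      then show ?case using iff[of \<theta>] ab by (auto simp: indicator_def)
    qed
  qed
  also have "\<dots> = ennreal ((- cot b) - (- cot a))"
  proof (rule nn_integral_FTC_Icc)
    fix \<theta> assume "\<theta> \<in> {a..b}"
    then have "sin \<theta> \<noteq> 0" using ab sin_gt_zero[of \<theta>] by auto
    from DERIV_minus[OF DERIV_cot[OF this]]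
    show "((\<lambda>x. - cot x) has_real_derivative inverse ((sin \<theta>)\<^sup>2)) (at \<theta>)"
      by simp
  qed (use ab in auto)
  also have "\<dots> = ennreal (u - l)" by (simp add: cot_tan a_def b_def tan_arctan)
  finally show "emeasure (distr (density lborel (\<lambda>\<theta>. indicator {0<..<pi} \<theta> * ennreal (inverse ((sin \<theta>)\<^sup>2)))) borel cot) (box l u)
     = (\<Prod>b\<in>Basis. (u - l) \<bullet> b)" by simp
qed simp

lemma nn_integral_cot:
  fixes h :: "real \<Rightarrow> ennreal"
  assumes [measurable]: "h \<in> borel_measurable borel"
  shows "(\<integral>\<^sup>+x. h x \<partial>lborel) = (\<integral>\<^sup>+\<theta>. indicator {0<..<pi} \<theta> * ennreal (inverse ((sin \<theta>)\<^sup>2)) * h (cot \<theta>) \<partial>lborel)"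
proof -
  have [measurable]: "(cot :: real \<Rightarrow> real) \<in> borel_measurable borel"
    unfolding cot_def[abs_def] by measurable
  show ?thesis by (subst lborel_eq_distr_cot) (simp add: nn_integral_distr nn_integral_density)
qed

text \<open>Slice by height, substitute \<open>x = y * cot \<theta>\<close> with Jacobian
  \<open>y / (sin \<theta>)^2\<close>, exchange the integrals, then substitute
  \<open>y = t * sin \<theta>\<close>; the factors multiply to \<open>t\<close>.\<close>

lemma nn_integral_polar_upper:
  fixes h :: "real \<times> real \<Rightarrow> ennreal"
  assumes [measurable]: "h \<in> borel_measurable borel"
  shows "(\<integral>\<^sup>+p. indicator {p. snd p > 0} p * h p \<partial>lborel)
    = (\<integral>\<^sup>+\<theta>. indicator {0<..<pi} \<theta> * (\<integral>\<^sup>+t. indicator {0<..} t * ennreal t * h (t * cos \<theta>, t * sin \<theta>) \<partial>lborel) \<partial>lborel)"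
proof -
  have [measurable]: "(cot :: real \<Rightarrow> real) \<in> borel_measurable borel"
    unfolding cot_def[abs_def] by measurable
  have [measurable]: "{p::real\<times>real. snd p > 0} \<in> sets borel"
    by (intro borel_open open_Collect_less continuous_intros)
  have [measurable]: "h \<in> borel_measurable (borel \<Otimes>\<^sub>M borel)" by (simp add: borel_prod)
  have "(\<integral>\<^sup>+p. indicator {p. snd p > 0} p * h p \<partial>lborel)
     = (\<integral>\<^sup>+y. (\<integral>\<^sup>+x. indicator {0<..} y * h (x, y) \<partial>lborel) \<partial>lborel)"
    unfolding lborel_prod[symmetric]
    by (subst lborel_pair.nn_integral_snd[symmetric])
       (auto simp: borel_prod indicator_def intro!: nn_integral_cong)
  also have "\<dots> = (\<integral>\<^sup>+y. (\<integral>\<^sup>+\<theta>. indicator {0<..<pi} \<theta> * ennreal (inverse ((sin \<theta>)\<^sup>2)) *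
       (indicator {0<..} y * ennreal y * h (y * cot \<theta>, y)) \<partial>lborel) \<partial>lborel)"
  proof (rule nn_integral_cong)
    fix y :: real
    show "(\<integral>\<^sup>+x. indicator {0<..} y * h (x, y) \<partial>lborel) = (\<integral>\<^sup>+\<theta>. indicator {0<..<pi} \<theta> * ennreal (inverse ((sin \<theta>)\<^sup>2)) *
       (indicator {0<..} y * ennreal y * h (y * cot \<theta>, y)) \<partial>lborel)"
    proof (cases "y > 0")
      case True
      have "(\<integral>\<^sup>+x. h (x, y) \<partial>lborel) = (\<integral>\<^sup>+u. ennreal y * h (y * u, y) \<partial>lborel)"
        using True by (subst nn_integral_real_affine[where c=y and t=0]) (auto simp: nn_integral_cmult)
      also have "\<dots> = (\<integral>\<^sup>+\<theta>. indicator {0<..<pi} \<theta> * ennreal (inverse ((sin \<theta>)\<^sup>2)) * (ennreal y * h (y * cot \<theta>, y)) \<partial>lborel)"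
        by (rule nn_integral_cot) measurable
      finally show ?thesis using True by simp
    qed simp
  qed
  also have "\<dots> = (\<integral>\<^sup>+\<theta>. (\<integral>\<^sup>+y. indicator {0<..<pi} \<theta> * ennreal (inverse ((sin \<theta>)\<^sup>2)) *
       (indicator {0<..} y * ennreal y * h (y * cot \<theta>, y)) \<partial>lborel) \<partial>lborel)"
    by (rule lborel_pair.Fubini') measurable
  also have "\<dots> = (\<integral>\<^sup>+\<theta>. indicator {0<..<pi} \<theta> * (\<integral>\<^sup>+t. indicator {0<..} t * ennreal t * h (t * cos \<theta>, t * sin \<theta>) \<partial>lborel) \<partial>lborel)"
  proof (rule nn_integral_cong)
    fix \<theta> :: real
    show "(\<integral>\<^sup>+y. indicator {0<..<pi} \<theta> * ennreal (inverse ((sin \<theta>)\<^sup>2)) *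
       (indicator {0<..} y * ennreal y * h (y * cot \<theta>, y)) \<partial>lborel)
      = indicator {0<..<pi} \<theta> * (\<integral>\<^sup>+t. indicator {0<..} t * ennreal t * h (t * cos \<theta>, t * sin \<theta>) \<partial>lborel)"
    proof (cases "\<theta> \<in> {0<..<pi}")
      case True
      then have s: "sin \<theta> > 0" by (simp add: sin_gt_zero)
      have "(\<integral>\<^sup>+y. ennreal (inverse ((sin \<theta>)\<^sup>2)) * (indicator {0<..} y * ennreal y * h (y * cot \<theta>, y)) \<partial>lborel)
        = (\<integral>\<^sup>+t. ennreal (sin \<theta>) * (ennreal (inverse ((sin \<theta>)\<^sup>2)) * (indicator {0<..} (sin \<theta> * t) * ennreal (sin \<theta> * t) * h (sin \<theta> * t * cot \<theta>, sin \<theta> * t))) \<partial>lborel)"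
        using s by (subst nn_integral_real_affine[where c="sin \<theta>" and t=0]) (auto simp: nn_integral_cmult)
      also have "\<dots> = (\<integral>\<^sup>+t. indicator {0<..} t * ennreal t * h (t * cos \<theta>, t * sin \<theta>) \<partial>lborel)"
      proof (rule nn_integral_cong)
        fix t :: real
        show "ennreal (sin \<theta>) * (ennreal (inverse ((sin \<theta>)\<^sup>2)) * (indicator {0<..} (sin \<theta> * t) * ennreal (sin \<theta> * t) * h (sin \<theta> * t * cot \<theta>, sin \<theta> * t)))
          = indicator {0<..} t * ennreal t * h (t * cos \<theta>, t * sin \<theta>)"
        proof (cases "t > 0")
          case t: True
          have "ennreal (sin \<theta>) * (ennreal (inverse ((sin \<theta>)\<^sup>2)) * ennreal (sin \<theta> * t)) = ennreal t"
            using s t by (simp add: ennreal_mult[symmetric] power2_eq_square field_simps)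
          moreover have "t * sin \<theta> * cot \<theta> = t * cos \<theta>" using s by (simp add: cot_def)
          ultimately show ?thesis using s t
            by (simp only: mult.assoc[symmetric] mult.commute[of "sin \<theta>" t] zero_less_mult_iff
                 indicator_def greaterThan_iff simp_thms of_bool_eq mult_1_left mult_1_right)
        qed (use s in \<open>auto simp: zero_less_mult_iff\<close>)
      qed
      finally show ?thesis using True by simp
    qed simp
  qed
  finally show ?thesis .
qed

text \<open>The lower half plane is the reflection of the upper one, with angle
  \<open>2*pi - \<theta>\<close>; the horizontal axis and the direction \<open>pi\<close> are
  null.\<close>

lemma nn_integral_polar:
  fixes h :: "real \<times> real \<Rightarrow> ennreal"
  assumes [measurable]: "h \<in> borel_measurable borel"
  shows "(\<integral>\<^sup>+p. h p \<partial>lborel)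
    = (\<integral>\<^sup>+\<theta>. indicator {0<..<2*pi} \<theta> * (\<integral>\<^sup>+t. indicator {0<..} t * ennreal t * h (t * cos \<theta>, t * sin \<theta>) \<partial>lborel) \<partial>lborel)"
proof -
  let ?g = "\<lambda>\<theta>. (\<integral>\<^sup>+t. indicator {0<..} t * ennreal t * h (t * cos \<theta>, t * sin \<theta>) \<partial>lborel)"
  have [measurable]: "h \<in> borel_measurable (borel \<Otimes>\<^sub>M borel)" by (simp add: borel_prod)
  have [measurable]: "?g \<in> borel_measurable borel" by measurable
  have refl: "(\<lambda>p::real\<times>real. (fst p, - snd p)) \<in> borel \<rightarrow>\<^sub>M borel"
    by (intro borel_measurable_continuous_onI continuous_intros)
  have h': "(\<lambda>p. h (fst p, - snd p)) \<in> borel_measurable borel"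
    using measurable_compose[OF refl assms] by simp
  have hs[measurable]: "{p::real\<times>real. snd p > 0} \<in> sets borel" "{p::real\<times>real. snd p < 0} \<in> sets borel"
    by (intro borel_open open_Collect_less continuous_intros)+
  have low: "(\<integral>\<^sup>+p. indicator {p. snd p < 0} p * h p \<partial>lborel) = (\<integral>\<^sup>+p. indicator {p. snd p > 0} p * h (fst p, - snd p) \<partial>lborel)"
  proof -
    have "(\<integral>\<^sup>+p. indicator {p. snd p < 0} p * h p \<partial>lborel)
       = (\<integral>\<^sup>+x. (\<integral>\<^sup>+y. indicator {..<0} y * h (x, y) \<partial>lborel) \<partial>lborel)"
      unfolding lborel_prod[symmetric]
      by (subst lborel.nn_integral_fst[symmetric]) (auto simp: borel_prod indicator_def intro!: nn_integral_cong)
    also have "\<dots> = (\<integral>\<^sup>+x. (\<integral>\<^sup>+y. indicator {0<..} y * h (x, - y) \<partial>lborel) \<partial>lborel)"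
    proof (rule nn_integral_cong)
      fix x :: real
      show "(\<integral>\<^sup>+y. indicator {..<0} y * h (x, y) \<partial>lborel) = (\<integral>\<^sup>+y. indicator {0<..} y * h (x, - y) \<partial>lborel)"
        by (subst nn_integral_real_affine[where c="-1" and t=0])
           (auto simp: indicator_def intro!: nn_integral_cong)
    qed
    also have "\<dots> = (\<integral>\<^sup>+p. indicator {p. snd p > 0} p * h (fst p, - snd p) \<partial>lborel)"
      unfolding lborel_prod[symmetric] using h'
      by (subst lborel.nn_integral_fst[symmetric]) (auto simp: borel_prod indicator_def intro!: nn_integral_cong)
    finally show ?thesis .
  qed
  have null: "AE p in lborel. snd (p::real\<times>real) \<noteq> 0"
  proof -
    have "emeasure lborel {p::real\<times>real. snd p = 0} = (\<integral>\<^sup>+x. (\<integral>\<^sup>+y. indicator {0::real} y \<partial>lborel) \<partial>(lborel::real measure))"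
    proof -
      have [measurable]: "{p::real\<times>real. snd p = 0} \<in> sets borel" by (intro borel_closed closed_Collect_eq continuous_intros)
      have z: "(\<integral>\<^sup>+y. of_bool (y = 0) \<partial>(lborel::real measure)) = (0::ennreal)"
      proof -
        have "(\<integral>\<^sup>+y. of_bool (y = 0) \<partial>(lborel::real measure)) = (\<integral>\<^sup>+y. indicator {0} y \<partial>(lborel::real measure) :: ennreal)"
          by (intro nn_integral_cong) (simp add: indicator_def)
        also have "\<dots> = 0" by (subst nn_integral_indicator) simp_all
        finally show ?thesis .
      qed
      have "emeasure lborel {p::real\<times>real. snd p = 0} = (\<integral>\<^sup>+p. indicator {p::real\<times>real. snd p = 0} p \<partial>lborel)" by simp
      also have "\<dots> = (\<integral>\<^sup>+x. (\<integral>\<^sup>+y. indicator {0} y \<partial>lborel) \<partial>(lborel::real measure))"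
        unfolding lborel_prod[symmetric]
        by (subst lborel.nn_integral_fst[symmetric])
           (auto simp: borel_prod indicator_def z intro!: nn_integral_cong)
      finally show ?thesis .
    qed
    also have "(\<integral>\<^sup>+y. indicator {0::real} y \<partial>lborel) = 0"
      by (subst nn_integral_indicator) simp_all
    finally have "emeasure lborel {p::real\<times>real. snd p = 0} = 0" by simp
    then show ?thesis
      by (intro AE_I[of _ _ "{p. snd p = 0}"]) (auto intro!: borel_closed closed_Collect_eq continuous_intros)
  qed
  have "(\<integral>\<^sup>+p. h p \<partial>lborel) = (\<integral>\<^sup>+p. indicator {p. snd p > 0} p * h p + indicator {p. snd p < 0} p * h p \<partial>lborel)"
    using null by (intro nn_integral_cong_AE) (auto elim!: eventually_mono simp: indicator_def)
  also have "\<dots> = (\<integral>\<^sup>+p. indicator {p. snd p > 0} p * h p \<partial>lborel) + (\<integral>\<^sup>+p. indicator {p. snd p < 0} p * h p \<partial>lborel)"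
    by (intro nn_integral_add) auto
  also have "(\<integral>\<^sup>+p. indicator {p. snd p > 0} p * h p \<partial>lborel) = (\<integral>\<^sup>+\<theta>. indicator {0<..<pi} \<theta> * ?g \<theta> \<partial>lborel)"
    by (rule nn_integral_polar_upper) fact
  also have "(\<integral>\<^sup>+p. indicator {p. snd p < 0} p * h p \<partial>lborel) = (\<integral>\<^sup>+\<theta>. indicator {pi<..<2*pi} \<theta> * ?g \<theta> \<partial>lborel)"
  proof -
    have "(\<integral>\<^sup>+\<theta>. indicator {pi<..<2*pi} \<theta> * ?g \<theta> \<partial>lborel)
        = (\<integral>\<^sup>+\<theta>. indicator {pi<..<2*pi} (2*pi - \<theta>) * ?g (2*pi - \<theta>) \<partial>lborel)"
      by (subst nn_integral_real_affine[where c="-1" and t="2*pi"]) auto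
    also have "\<dots> = (\<integral>\<^sup>+\<theta>. indicator {0<..<pi} \<theta> * (\<integral>\<^sup>+t. indicator {0<..} t * ennreal t * h (t * cos \<theta>, - (t * sin \<theta>)) \<partial>lborel) \<partial>lborel)"
      by (intro nn_integral_cong) (auto simp: indicator_def cos_diff sin_diff)
    also have "\<dots> = (\<integral>\<^sup>+p. indicator {p. snd p > 0} p * h (fst p, - snd p) \<partial>lborel)"
      by (subst nn_integral_polar_upper[OF h']) simp
    finally show ?thesis using low by simp
  qed
  also have "(\<integral>\<^sup>+\<theta>. indicator {0<..<pi} \<theta> * ?g \<theta> \<partial>lborel) + (\<integral>\<^sup>+\<theta>. indicator {pi<..<2*pi} \<theta> * ?g \<theta> \<partial>lborel)
     = (\<integral>\<^sup>+\<theta>. indicator {0<..<pi} \<theta> * ?g \<theta> + indicator {pi<..<2*pi} \<theta> * ?g \<theta> \<partial>lborel)"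
    by (intro nn_integral_add[symmetric]) auto
  also have "\<dots> = (\<integral>\<^sup>+\<theta>. indicator {0<..<2*pi} \<theta> * ?g \<theta> \<partial>lborel)"
  proof (rule nn_integral_cong_AE)
    have "AE \<theta> in lborel. \<theta> \<notin> {pi}" by (intro AE_not_in finite_imp_null_set_lborel) auto
    then show "AE \<theta> in lborel. indicator {0<..<pi} \<theta> * ?g \<theta> + indicator {pi<..<2*pi} \<theta> * ?g \<theta> = indicator {0<..<2*pi} \<theta> * ?g \<theta>"
      by eventually_elim (auto simp: indicator_def)
  qed
  finally show ?thesis .
qed

text \<open>The Jacobian, cut off to the open strip on which polar coordinates are injective; the
  first coordinate is the radius.\<close>

definition polar_weight :: "real \<times> real \<Rightarrow> ennreal" where
  "polar_weight q = indicator {0<..} (fst q) * indicator {0<..<2*pi} (snd q) * ennreal (fst q)"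

definition polar_map :: "point \<Rightarrow> real \<times> real \<Rightarrow> point" where
  "polar_map X q = X + (fst q * cos (snd q), fst q * sin (snd q))"

lemma measurable_polar[measurable]:
  "polar_weight \<in> borel_measurable (borel \<Otimes>\<^sub>M borel)" "polar_map X \<in> borel \<Otimes>\<^sub>M borel \<rightarrow>\<^sub>M borel"
proof -
  show "polar_weight \<in> borel_measurable (borel \<Otimes>\<^sub>M borel)" unfolding polar_weight_def[abs_def] by measurable
  show "polar_map X \<in> borel \<Otimes>\<^sub>M borel \<rightarrow>\<^sub>M borel"
    unfolding borel_prod polar_map_def[abs_def]
    by (intro borel_measurable_continuous_onI continuous_intros)
qed

text \<open>As an identity of measures it transfers integrability, values of integrals and null sets
  to polar coordinates all at once.\<close>

lemma lborel_eq_distr_polar: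
  "lborel = distr (density (lborel \<Otimes>\<^sub>M lborel) polar_weight) borel (polar_map X)"
proof (rule measure_eqI)
  fix A assume "A \<in> sets (lborel :: point measure)"
  then have [measurable]: "A \<in> sets borel" by simp
  have tr: "(+) X \<in> borel \<rightarrow>\<^sub>M borel" by simp
  have m0: "(\<lambda>p. indicator A (X + p) :: ennreal) \<in> borel_measurable borel"
    using measurable_compose[OF tr, of "indicator A" borel] by simp
  have "emeasure lborel A = emeasure (distr lborel borel ((+) X)) A"
    by (simp add: lborel_distr_plus)
  also have "\<dots> = (\<integral>\<^sup>+p. indicator A (X + p) \<partial>lborel)"
    by (simp add: nn_integral_indicator[symmetric] nn_integral_distr del: nn_integral_indicator)
  also have "\<dots> = (\<integral>\<^sup>+\<theta>. indicator {0<..<2*pi} \<theta> * (\<integral>\<^sup>+t. indicator {0<..} t * ennreal t * indicator A (X + (t * cos \<theta>, t * sin \<theta>)) \<partial>lborel) \<partial>lborel)"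
    by (rule nn_integral_polar[OF m0])
  also have "\<dots> = (\<integral>\<^sup>+\<theta>. (\<integral>\<^sup>+t. polar_weight (t,\<theta>) * indicator A (polar_map X (t,\<theta>)) \<partial>lborel) \<partial>lborel)"
    by (intro nn_integral_cong) (auto simp: polar_weight_def polar_map_def indicator_def intro!: nn_integral_cong)
  also have "\<dots> = (\<integral>\<^sup>+q. polar_weight q * indicator A (polar_map X q) \<partial>(lborel \<Otimes>\<^sub>M lborel))"
    by (subst lborel_pair.nn_integral_snd[symmetric]) auto
  also have "\<dots> = emeasure (distr (density (lborel \<Otimes>\<^sub>M lborel) polar_weight) borel (polar_map X)) A"
    by (simp add: nn_integral_indicator[symmetric] nn_integral_distr nn_integral_density del: nn_integral_indicator)
  finally show "emeasure lborel A = emeasure (distr (density (lborel \<Otimes>\<^sub>M lborel) polar_weight) borel (polar_map X)) A" .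
qed simp

lemma circ_int_alt:
  "circ_int X r h = (LINT \<theta>:{0<..<2*pi}|lborel. r * h (polar_map X (r, \<theta>)))"
  by (simp add: circ_int_def polar_map_def interval_lebesgue_integral_def zero_ereal_def)

text \<open>Fubini in the coordinates (radius, angle). Integrability along a single circle is
  obtained for almost every radius only; this is one source of the exceptional radii in the final
  formula.\<close>

lemma polar_integral:
  fixes u :: "point \<Rightarrow> real"
  assumes u: "integrable lborel u"
  shows "AE t in lborel. 0 < t \<longrightarrow> set_integrable lborel {0<..<2*pi} (\<lambda>\<theta>. t * u (polar_map X (t,\<theta>)))"
    and "set_integrable lborel {0<..} (\<lambda>t. circ_int X t u)"
    and "(LINT p|lborel. u p) = (LINT t:{0<..}|lborel. circ_int X t u)"
proof -
  let ?w = "\<lambda>q::real\<times>real. indicator {0<..} (fst q) * indicator {0<..<2*pi} (snd q) * (fst q)"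
  have [measurable]: "u \<in> borel_measurable borel" using u by simp
  have w: "polar_weight = (\<lambda>q. ennreal (?w q))"
    by (auto simp: polar_weight_def indicator_def)
  have "integrable (distr (density (lborel \<Otimes>\<^sub>M lborel) polar_weight) borel (polar_map X)) u"
    using u lborel_eq_distr_polar[of X] by simp
  then have i1: "integrable (lborel \<Otimes>\<^sub>M lborel) (\<lambda>q. ?w q * u (polar_map X q))"
    unfolding w by (subst (asm) integrable_distr_eq, simp, simp, subst (asm) integrable_density)
       (auto simp: indicator_def)
  have fst_eq: "(\<integral>\<theta>. ?w (t,\<theta>) * u (polar_map X (t,\<theta>)) \<partial>lborel) = indicator {0<..} t *\<^sub>R circ_int X t u" for t
    by (simp add: circ_int_alt set_lebesgue_integral_def mult.assoc mult.left_commute[of _ t])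
  have "AE t in lborel. integrable lborel (\<lambda>\<theta>. ?w (t,\<theta>) * u (polar_map X (t,\<theta>)))"
    using lborel_pair.AE_integrable_fst'[OF i1] by simp
  then show "AE t in lborel. 0 < t \<longrightarrow> set_integrable lborel {0<..<2*pi} (\<lambda>\<theta>. t * u (polar_map X (t,\<theta>)))"
    by eventually_elim (auto simp: set_integrable_def mult.assoc)
  show "set_integrable lborel {0<..} (\<lambda>t. circ_int X t u)"
    using lborel_pair.integrable_fst'[OF i1] unfolding set_integrable_def fst_eq[symmetric] by simp
  have "(LINT p|lborel. u p) = integral\<^sup>L (distr (density (lborel \<Otimes>\<^sub>M lborel) polar_weight) borel (polar_map X)) u"
    using lborel_eq_distr_polar[of X] by simp
  also have "\<dots> = (\<integral>q. ?w q * u (polar_map X q) \<partial>(lborel \<Otimes>\<^sub>M lborel))"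
    unfolding w by (subst integral_distr, simp, simp, subst integral_density) (auto simp: indicator_def)
  also have "\<dots> = (LINT t:{0<..}|lborel. circ_int X t u)"
    using lborel_pair.integral_fst'[OF i1] unfolding set_lebesgue_integral_def fst_eq[symmetric] by simp
  finally show "(LINT p|lborel. u p) = (LINT t:{0<..}|lborel. circ_int X t u)" .
qed

text \<open>A circle is null in the plane, so a property valid almost everywhere may fail on all of
  it; on almost every circle, however, it fails for a null set of angles only.\<close>

lemma AE_polar:
  fixes P :: "point \<Rightarrow> bool"
  assumes "AE p in lborel. P p"
  shows "AE t in lborel. 0 < t \<longrightarrow> (AE \<theta> in lborel. \<theta> \<in> {0<..<2*pi} \<longrightarrow> P (polar_map X (t,\<theta>)))"
proof -
  obtain A where A: "{p. \<not> P p} \<subseteq> A" "A \<in> sets borel" "emeasure lborel A = 0"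
    using assms by (auto elim!: AE_E)
  note [measurable] = A(2)
  have "AE p in lborel. p \<notin> A" using A by (intro AE_not_in) (auto simp: null_sets_def)
  then have "AE p in distr (density (lborel \<Otimes>\<^sub>M lborel) polar_weight) borel (polar_map X). p \<notin> A"
    by (subst lborel_eq_distr_polar[of X, symmetric])
  then have "AE q in lborel \<Otimes>\<^sub>M lborel. 0 < polar_weight q \<longrightarrow> polar_map X q \<notin> A"
    by (subst (asm) AE_distr_iff, simp, measurable, subst (asm) AE_density) auto
  then have "AE t in lborel. AE \<theta> in lborel. 0 < polar_weight (t,\<theta>) \<longrightarrow> polar_map X (t,\<theta>) \<notin> A"
    by (rule lborel_pair.AE_pair)
  then show ?thesis
  proof eventually_elim
    case (elim t)
    show ?case
    proof
      assume "0 < t"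
      from elim show "AE \<theta> in lborel. \<theta> \<in> {0<..<2*pi} \<longrightarrow> P (polar_map X (t,\<theta>))"
        by eventually_elim (use \<open>0 < t\<close> A(1) in \<open>auto simp: polar_weight_def\<close>)
    qed
  qed
qed

lemma polar_map_in_ball: "0 < t \<Longrightarrow> polar_map X (t,\<theta>) \<in> ball X r \<longleftrightarrow> t < r"
proof -
  assume "0 < t"
  have "dist X (polar_map X (t,\<theta>)) = norm (t * cos \<theta>, t * sin \<theta>)"
    by (simp add: polar_map_def dist_norm norm_prod_def)
  also have "\<dots> = sqrt (t\<^sup>2 * ((cos \<theta>)\<^sup>2 + (sin \<theta>)\<^sup>2))"
    by (simp add: norm_prod_def power_mult_distrib distrib_left del: sin_cos_squared_add sin_cos_squared_add2)
  also have "\<dots> = t" using \<open>0 < t\<close> by simp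
  finally show ?thesis by simp
qed

lemma disc_int_polar:
  fixes u :: "point \<Rightarrow> real"
  assumes u: "integrable lborel u"
  shows "disc_int X r u = (LINT t:{..r}|lborel. indicator {0<..} t * circ_int X t u)"
proof -
  have [measurable]: "u \<in> borel_measurable borel" using u by simp
  have "disc_int X r u = (LINT p|lborel. indicator (ball X r) p *\<^sub>R u p)"
    by (simp add: disc_int_def set_lebesgue_integral_def)
  also have "\<dots> = (LINT t:{0<..}|lborel. circ_int X t (\<lambda>p. indicator (ball X r) p *\<^sub>R u p))"
    using u by (intro polar_integral(3) integrable_mult_indicator) auto
  also have "\<dots> = (LINT t:{..r}|lborel. indicator {0<..} t * circ_int X t u)"
    unfolding set_lebesgue_integral_def
  proof (rule integral_cong_AE)
    \<comment> \<open>The open ball excludes the radius \<open>r\<close> while \<open>{..r}\<close>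
      contains it; the form with \<open>{..r}\<close> is the one to which
      \<open>lebesgue_differentiation\<close> applies.\<close>
    have "AE t in lborel. t \<notin> {r}" by (intro AE_not_in finite_imp_null_set_lborel) auto
    then show "AE t in lborel. indicator {0<..} t *\<^sub>R circ_int X t (\<lambda>p. indicator (ball X r) p *\<^sub>R u p)
        = indicator {..r} t *\<^sub>R (indicator {0<..} t * circ_int X t u)"
    proof eventually_elim
      case (elim t)
      show ?case
      proof (cases "0 < t")
        case True
        have "circ_int X t (\<lambda>p. indicator (ball X r) p *\<^sub>R u p) = indicator {..r} t * circ_int X t u"
          using True elim polar_map_in_ball[OF True, of X _ r]
          by (auto simp: circ_int_alt indicator_def set_lebesgue_integral_def intro!: Bochner_Integration.integral_cong)
        then show ?thesis by simp
      qed simp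
    qed
  next
    have "integrable lborel (\<lambda>p. indicator (ball X r) p *\<^sub>R u p)" using u by (intro integrable_mult_indicator) auto
    from polar_integral(2)[OF this, of X]
    show "(\<lambda>t. indicator {0<..} t *\<^sub>R circ_int X t (\<lambda>p. indicator (ball X r) p *\<^sub>R u p)) \<in> borel_measurable lborel"
      unfolding set_integrable_def by (rule borel_measurable_integrable)
    have "(\<lambda>t. indicator {0<..} t *\<^sub>R circ_int X t u) \<in> borel_measurable lborel"
      using polar_integral(2)[OF u, of X]
      unfolding set_integrable_def by (rule borel_measurable_integrable)
    then show "(\<lambda>t. indicator {..r} t *\<^sub>R (indicator {0<..} t * circ_int X t u)) \<in> borel_measurable lborel" by simp
  qed
  finally show ?thesis .
qed

lemma disc_int_has_derivative:
  fixes u :: "point \<Rightarrow> real"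
  assumes u: "integrable lborel u"
  shows "AE r in lborel. 0 < r \<longrightarrow> ((\<lambda>r. disc_int X r u) has_real_derivative circ_int X r u) (at r)"
proof -
  have "integrable lborel (\<lambda>t. indicator {0<..} t * circ_int X t u)"
    using polar_integral(2)[OF u, of X] by (simp add: set_integrable_def)
  from lebesgue_differentiation[OF this] show ?thesis
    by eventually_elim (auto simp: disc_int_polar[OF u])
qed

lemma continuous_on_disc_int:
  fixes u :: "point \<Rightarrow> real"
  assumes u: "integrable lborel u"
  shows "continuous_on S (\<lambda>r. disc_int X r u)"
proof -
  have "integrable lborel (\<lambda>t. indicator {0<..} t * circ_int X t u)"
    using polar_integral(2)[OF u, of X] by (simp add: set_integrable_def)
  from isCont_integral_atMost[OF this] show ?thesis
    by (auto simp: disc_int_polar[OF u] intro!: continuous_at_imp_continuous_on)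
qed

section \<open>Smooth test functions\<close>

text \<open>Differentiability is recorded by a witness \<open>h'\<close>, so closure under sums,
  products and affine substitution is proved by exhibiting the derivative.\<close>

fun Cn :: "nat \<Rightarrow> (real \<Rightarrow> real) \<Rightarrow> bool" where
  "Cn 0 h = continuous_on UNIV h"
| "Cn (Suc n) h = (\<exists>h'. (\<forall>x. (h has_real_derivative h' x) (at x)) \<and> Cn n h')"

lemma Cn_Suc_D: "Cn (Suc n) h \<Longrightarrow> Cn n h"
proof (induction n arbitrary: h)
  case 0
  then obtain h' where h': "\<And>x. (h has_real_derivative h' x) (at x)" unfolding Cn.simps by blast
  show ?case unfolding Cn.simps
    by (rule DERIV_continuous_on) (rule has_field_derivative_at_within[OF h'])
next
  case (Suc n)
  from Suc.prems obtain h' where h': "\<forall>x. (h has_real_derivative h' x) (at x)" "Cn (Suc n) h'"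
    unfolding Cn.simps(2)[of "Suc n"] by blast
  show ?case unfolding Cn.simps(2)[of n] using h'(1) Suc.IH[OF h'(2)] by blast
qed

lemma Cn_const: "Cn n (\<lambda>x. c)"
proof (induction n arbitrary: c)
  case (Suc n)
  then show ?case unfolding Cn.simps by (intro exI[of _ "\<lambda>x. 0"] conjI allI DERIV_const)
qed simp

lemma Cn_add: "Cn n u \<Longrightarrow> Cn n v \<Longrightarrow> Cn n (\<lambda>x. u x + v x)"
proof (induction n arbitrary: u v)
  case (Suc n)
  from Suc.prems obtain u' v' where *: "\<forall>x. (u has_real_derivative u' x) (at x)" "Cn n u'"
    "\<forall>x. (v has_real_derivative v' x) (at x)" "Cn n v'" by auto
  then show ?case unfolding Cn.simps
    by (intro exI[of _ "\<lambda>x. u' x + v' x"] conjI allI DERIV_add Suc.IH) simp_all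
qed (auto intro!: continuous_intros)

lemma Cn_mult: "Cn n u \<Longrightarrow> Cn n v \<Longrightarrow> Cn n (\<lambda>x. u x * v x)"
proof (induction n arbitrary: u v)
  case (Suc n)
  from Suc.prems obtain u' v' where *: "\<forall>x. (u has_real_derivative u' x) (at x)" "Cn n u'"
    "\<forall>x. (v has_real_derivative v' x) (at x)" "Cn n v'" by auto
  moreover have "Cn n u" "Cn n v" using Suc.prems Cn_Suc_D by blast+
  ultimately have "Cn n (\<lambda>x. u' x * v x + u x * v' x)"
    by (intro Cn_add Suc.IH)
  with * show ?case unfolding Cn.simps
    by (intro exI[of _ "\<lambda>x. u' x * v x + u x * v' x"] conjI allI) (auto intro!: derivative_eq_intros)
qed (auto intro!: continuous_intros)

lemma Cn_affine: "Cn n u \<Longrightarrow> Cn n (\<lambda>x. u (c * x + d))"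
proof (induction n arbitrary: u)
  case 0
  then have "continuous_on UNIV (u \<circ> (\<lambda>x. c * x + d))"
    by (intro continuous_on_compose) (auto intro!: continuous_intros intro: continuous_on_subset)
  then show ?case by (simp add: comp_def)
next
  case (Suc n)
  from Suc.prems obtain u' where *: "\<forall>x. (u has_real_derivative u' x) (at x)" "Cn n u'" by auto
  have "((\<lambda>x. u (c * x + d)) has_real_derivative (u' (c * x + d) * c)) (at x)" for x
    by (rule DERIV_chain2[where f=u and g="\<lambda>x. c * x + d"]) (use * in \<open>auto intro!: derivative_eq_intros\<close>)
  moreover have "Cn n (\<lambda>x. u' (c * x + d) * c)" using * by (intro Cn_mult Cn_const Suc.IH)
  ultimately show ?case unfolding Cn.simps
    by (intro exI[of _ "\<lambda>x. u' (c * x + d) * c"] conjI allI)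
qed

text \<open>The classical smooth function \<open>exp (-1/t)\<close> together with the powers
  \<open>1 / t^k\<close> that its derivatives produce. The family is closed under differentiation up
  to linear combinations, so one induction covers every order.\<close>

definition flat :: "nat \<Rightarrow> real \<Rightarrow> real" where
  "flat k t = (if t > 0 then exp (- 1 / t) / t ^ k else 0)"

text \<open>From the right, \<open>s = 1/t\<close> reduces this to the decay of
  \<open>s^k / exp s\<close>.\<close>

lemma flat_tendsto_0: "(flat k \<longlongrightarrow> 0) (at 0)"
proof -
  have "((\<lambda>s::real. s ^ k / exp s) \<longlongrightarrow> 0) at_top" by (rule tendsto_power_div_exp_0)
  then have "((\<lambda>t. (inverse t) ^ k / exp (inverse t)) \<longlongrightarrow> 0) (at_right (0::real))"
    by (rule filterlim_compose[OF _ filterlim_inverse_at_top_right])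
  moreover have "eventually (\<lambda>t. (inverse t) ^ k / exp (inverse t) = flat k t) (at_right (0::real))"
    using eventually_at_right_less by (rule eventually_mono) (simp add: flat_def exp_minus field_simps)
  ultimately have "(flat k \<longlongrightarrow> 0) (at_right 0)" by (rule Lim_transform_eventually)
  moreover have "(flat k \<longlongrightarrow> 0) (at_left 0)"
    by (rule tendsto_eventually) (auto simp: flat_def eventually_at intro!: exI[of _ 1])
  ultimately show ?thesis by (simp add: filterlim_at_split)
qed

lemma flat_deriv: "(flat k has_real_derivative (flat (k + 2) x + - real k * flat (k + 1) x)) (at x)"
proof -
  consider "x > 0" | "x < 0" | "x = 0" by linarith
  then show ?thesis
  proof cases
    case 1
    have "((\<lambda>t. exp (- 1 / t) / t ^ k) has_real_derivative (flat (k + 2) x + - real k * flat (k + 1) x)) (at x)"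
    proof (cases k)
      case 0
      then show ?thesis using 1 by (auto intro!: derivative_eq_intros simp: flat_def field_simps power2_eq_square)
    next
      case (Suc m)
      have "((\<lambda>t. exp (- 1 / t) / t ^ Suc m) has_real_derivative
          (exp (- 1 / x) * (1 / x\<^sup>2) * x ^ Suc m - exp (- 1 / x) * (real (Suc m) * x ^ m)) / (x ^ Suc m * x ^ Suc m)) (at x)"
        using 1 by (auto intro!: derivative_eq_intros simp: power2_eq_square) (cases m; simp add: algebra_simps)
      also have "(exp (- 1 / x) * (1 / x\<^sup>2) * x ^ Suc m - exp (- 1 / x) * (real (Suc m) * x ^ m)) / (x ^ Suc m * x ^ Suc m)
        = flat (k + 2) x + - real k * flat (k + 1) x"
        using 1 by (simp add: flat_def Suc divide_simps power2_eq_square) (simp add: algebra_simps)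
      finally show ?thesis unfolding Suc .
    qed
    then show ?thesis
      by (rule has_field_derivative_transform_within_open[where S="{0<..}"]) (use 1 in \<open>auto simp: flat_def\<close>)
  next
    case 2
    have "((\<lambda>t. 0) has_real_derivative (flat (k + 2) x + - real k * flat (k + 1) x)) (at x)"
      using 2 by (auto simp: flat_def)
    then show ?thesis
      by (rule has_field_derivative_transform_within_open[where S="{..<0}"]) (use 2 in \<open>auto simp: flat_def\<close>)
  next
    case 3
    \<comment> \<open>At the origin the difference quotient of \<open>flat k\<close> is
      \<open>flat (k + 1)\<close> itself, whose limit is zero.\<close>
    have "eventually (\<lambda>t. flat (k + 1) t = (flat k t - flat k 0) / (t - 0)) (at 0)"
      by (auto simp: flat_def eventually_at intro!: exI[of _ 1])
    with flat_tendsto_0[of "k+1"] have "((\<lambda>t. (flat k t - flat k 0) / (t - 0)) \<longlongrightarrow> 0) (at 0)"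
      by (rule Lim_transform_eventually)
    then show ?thesis unfolding 3 has_field_derivative_iff by (simp add: flat_def)
  qed
qed

lemma Cn_flat: "Cn n (flat k)"
proof (induction n arbitrary: k)
  case 0
  show ?case unfolding Cn.simps
    by (rule DERIV_continuous_on) (rule has_field_derivative_at_within[OF flat_deriv])
next
  case (Suc n)
  have "Cn n (\<lambda>x. flat (k + 2) x + - real k * flat (k + 1) x)"
    by (intro Cn_add Cn_mult Cn_const Suc.IH)
  then show ?case unfolding Cn.simps
    by (intro exI[of _ "\<lambda>x. flat (k + 2) x + - real k * flat (k + 1) x"] conjI allI flat_deriv)
qed

text \<open>A smooth function that is nonzero exactly on (a, b). The factor \<open>Suc k\<close>,
  positive already for \<open>k = 0\<close>, steepens both flanks; as \<open>k\<close> grows the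
  functions tend to the indicator and stay below 1.\<close>

definition bump :: "real \<Rightarrow> real \<Rightarrow> nat \<Rightarrow> real \<Rightarrow> real" where
  "bump a b k t = flat 0 (real (Suc k) * (t - a)) * flat 0 (real (Suc k) * (b - t))"

lemma Cn_bump: "Cn n (bump a b k)"
proof -
  have "Cn n (\<lambda>t. flat 0 (real (Suc k) * t + - (real (Suc k) * a)) * flat 0 (- real (Suc k) * t + (real (Suc k) * b)))"
    by (intro Cn_mult Cn_affine Cn_flat)
  then show ?thesis by (simp add: bump_def[abs_def] algebra_simps)
qed

lemma bump_bounds: "0 \<le> bump a b k t" "bump a b k t \<le> 1"
  by (auto simp: bump_def flat_def intro!: mult_le_one)

lemma bump_nonzero: "bump a b k t \<noteq> 0 \<longleftrightarrow> a < t \<and> t < b"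
  by (auto simp: bump_def flat_def zero_less_mult_iff)

lemma bump_tendsto: "(\<lambda>k. bump a b k t) \<longlonglongrightarrow> indicator {a<..<b} t"
proof (cases "a < t \<and> t < b")
  case True
  have *: "(\<lambda>k. flat 0 (real (Suc k) * c)) \<longlonglongrightarrow> 1" if "c > 0" for c
  proof -
    have "(\<lambda>k. exp (- (1 / c) * (1 / real (Suc k)))) \<longlonglongrightarrow> exp (- (1 / c) * 0)"
      by (intro tendsto_intros LIMSEQ_Suc[OF lim_1_over_n])
    then show ?thesis using that by (simp add: flat_def mult.commute)
  qed
  have "(\<lambda>k. bump a b k t) \<longlonglongrightarrow> 1 * 1"
    unfolding bump_def by (intro tendsto_mult *) (use True in auto)
  with True show ?thesis by simp
next
  case False
  then have "bump a b k t = 0" for k using bump_nonzero[of a b k t] by blast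
  then show ?thesis using False by (auto simp: indicator_def)
qed

section \<open>Partial derivatives and functions of class C^n in the plane\<close>

lemma px_eqI: "((\<lambda>t. h (t, snd p)) has_real_derivative d) (at (fst p)) \<Longrightarrow> px h p = d"
  unfolding px_def by (rule DERIV_imp_deriv)

lemma py_eqI: "((\<lambda>t. h (fst p, t)) has_real_derivative d) (at (snd p)) \<Longrightarrow> py h p = d"
  unfolding py_def by (rule DERIV_imp_deriv)

lemma differentiable_px:
  fixes h :: "point \<Rightarrow> real"
  assumes "h differentiable (at p)"
  shows "((\<lambda>t. h (t, snd p)) has_real_derivative px h p) (at (fst p))"
proof -
  obtain D where D: "(h has_derivative D) (at p)" using assms by (auto simp: differentiable_def)
  have "((\<lambda>t. (t, snd p)) has_derivative (\<lambda>t. (t, 0))) (at (fst p))"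
    by (auto intro!: derivative_eq_intros)
  then have "((\<lambda>t. h (t, snd p)) has_derivative (\<lambda>t. D (t, 0))) (at (fst p))"
    by (rule has_derivative_compose) (use D in simp)
  then have "(\<lambda>t. h (t, snd p)) differentiable (at (fst p))" by (auto simp: differentiable_def)
  then show ?thesis unfolding px_def by (simp add: DERIV_deriv_iff_real_differentiable)
qed

lemma differentiable_py:
  fixes h :: "point \<Rightarrow> real"
  assumes "h differentiable (at p)"
  shows "((\<lambda>t. h (fst p, t)) has_real_derivative py h p) (at (snd p))"
proof -
  obtain D where D: "(h has_derivative D) (at p)" using assms by (auto simp: differentiable_def)
  have "((\<lambda>t. (fst p, t)) has_derivative (\<lambda>t. (0, t))) (at (snd p))"
    by (auto intro!: derivative_eq_intros)
  then have "((\<lambda>t. h (fst p, t)) has_derivative (\<lambda>t. D (0, t))) (at (snd p))"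
    by (rule has_derivative_compose) (use D in simp)
  then have "(\<lambda>t. h (fst p, t)) differentiable (at (snd p))" by (auto simp: differentiable_def)
  then show ?thesis unfolding py_def by (simp add: DERIV_deriv_iff_real_differentiable)
qed

lemma Ck_on_Suc_D: "Ck_on (Suc n) UNIV h \<Longrightarrow> Ck_on n UNIV h"
proof (induction n arbitrary: h)
  case 0
  then show ?case
    by (auto intro!: continuous_at_imp_continuous_on differentiable_imp_continuous_within)
next
  case (Suc n)
  from Suc.prems have d: "\<forall>p\<in>UNIV. h differentiable (at p)"
    and c: "Ck_on (Suc n) UNIV (px h)" "Ck_on (Suc n) UNIV (py h)" by (simp_all del: split_paired_All)
  show ?case unfolding Ck_on.simps(2)[of n] using d Suc.IH[OF c(1)] Suc.IH[OF c(2)] by (intro conjI)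
qed

lemma Ck_on_const: "Ck_on n UNIV (\<lambda>p. c)"
proof (induction n arbitrary: c)
  case (Suc n)
  have "px (\<lambda>p. c) = (\<lambda>p. 0)" "py (\<lambda>p. c) = (\<lambda>p. 0)"
    by (auto simp: px_def py_def fun_eq_iff)
  with Suc show ?case by simp
qed simp

lemma Ck_on_fst: "Ck_on n UNIV fst" and Ck_on_snd: "Ck_on n UNIV snd"
proof -
  have *: "px fst = (\<lambda>p. 1)" "py fst = (\<lambda>p. 0)" "px snd = (\<lambda>p. 0)" "py snd = (\<lambda>p. 1)"
    by (auto simp: px_def py_def fun_eq_iff)
  have "(fst :: point \<Rightarrow> real) differentiable at p" "(snd :: point \<Rightarrow> real) differentiable at p" for p
    by (simp_all add: bounded_linear_imp_differentiable bounded_linear_fst bounded_linear_snd)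
  then show "Ck_on n UNIV fst" "Ck_on n UNIV snd"
    by (cases n; simp add: * Ck_on_const continuous_on_fst continuous_on_snd continuous_on_id)+
qed

lemma
  fixes u v :: "point \<Rightarrow> real"
  assumes u: "u differentiable (at p)" and v: "v differentiable (at p)"
  shows px_add: "px (\<lambda>p. u p + v p) p = px u p + px v p"
    and py_add: "py (\<lambda>p. u p + v p) p = py u p + py v p"
    and px_mult: "px (\<lambda>p. u p * v p) p = px u p * v p + u p * px v p"
    and py_mult: "py (\<lambda>p. u p * v p) p = py u p * v p + u p * py v p"
  using DERIV_add[OF differentiable_px[OF u] differentiable_px[OF v]] DERIV_add[OF differentiable_py[OF u] differentiable_py[OF v]]
    DERIV_mult[OF differentiable_px[OF u] differentiable_px[OF v]] DERIV_mult[OF differentiable_py[OF u] differentiable_py[OF v]]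
  by (auto intro!: px_eqI py_eqI simp: mult.commute add.commute)

lemma px_compose: "(h has_real_derivative d) (at (q p)) \<Longrightarrow> q differentiable (at p) \<Longrightarrow> px (\<lambda>p. h (q p)) p = d * px q p"
  and py_compose: "(h has_real_derivative d) (at (q p)) \<Longrightarrow> q differentiable (at p) \<Longrightarrow> py (\<lambda>p. h (q p)) p = d * py q p"
  for q :: "point \<Rightarrow> real"
  using DERIV_chain2[OF _ differentiable_px, of h d q p] DERIV_chain2[OF _ differentiable_py, of h d q p]
  by (auto intro!: px_eqI py_eqI)

lemma Ck_on_add: "Ck_on n UNIV u \<Longrightarrow> Ck_on n UNIV v \<Longrightarrow> Ck_on n UNIV (\<lambda>p. u p + v p)"
proof (induction n arbitrary: u v)
  case (Suc n)
  have d: "u differentiable (at p)" "v differentiable (at p)" for p using Suc.prems by (simp_all del: split_paired_All)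
  have e: "px (\<lambda>p. u p + v p) = (\<lambda>p. px u p + px v p)" "py (\<lambda>p. u p + v p) = (\<lambda>p. py u p + py v p)"
    by (rule ext, rule px_add[OF d], rule ext, rule py_add[OF d])
  have c: "Ck_on n UNIV (px u)" "Ck_on n UNIV (py u)" "Ck_on n UNIV (px v)" "Ck_on n UNIV (py v)"
    using Suc.prems by simp_all
  show ?case unfolding Ck_on.simps e
    by (intro conjI ballI differentiable_add d Suc.IH c)
qed (auto intro!: continuous_intros)

lemma Ck_on_mult: "Ck_on n UNIV u \<Longrightarrow> Ck_on n UNIV v \<Longrightarrow> Ck_on n UNIV (\<lambda>p. u p * v p)"
proof (induction n arbitrary: u v)
  case (Suc n)
  have d: "u differentiable (at p)" "v differentiable (at p)" for p using Suc.prems by (simp_all del: split_paired_All)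
  have e: "px (\<lambda>p. u p * v p) = (\<lambda>p. px u p * v p + u p * px v p)" "py (\<lambda>p. u p * v p) = (\<lambda>p. py u p * v p + u p * py v p)"
    by (rule ext, rule px_mult[OF d], rule ext, rule py_mult[OF d])
  note c0 = Ck_on_Suc_D[OF Suc.prems(1)] Ck_on_Suc_D[OF Suc.prems(2)]
  have c: "Ck_on n UNIV (px u)" "Ck_on n UNIV (py u)" "Ck_on n UNIV (px v)" "Ck_on n UNIV (py v)"
    using Suc.prems by simp_all
  show ?case unfolding Ck_on.simps e
    by (intro conjI ballI differentiable_mult d Ck_on_add Suc.IH c0 c)
qed (auto intro!: continuous_intros)

lemma Ck_on_compose: "Cn n h \<Longrightarrow> Ck_on n UNIV q \<Longrightarrow> Ck_on n UNIV (\<lambda>p. h (q p))"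
proof (induction n arbitrary: h q)
  case 0
  then show ?case using continuous_on_compose2[of UNIV h UNIV q] by simp
next
  case (Suc n)
  have d: "q differentiable (at p)" for p using Suc.prems by (simp del: split_paired_All)
  obtain h' where h': "\<And>x. (h has_real_derivative h' x) (at x)" "Cn n h'"
    using Suc.prems(1) unfolding Cn.simps by blast
  have e: "px (\<lambda>p. h (q p)) = (\<lambda>p. h' (q p) * px q p)" "py (\<lambda>p. h (q p)) = (\<lambda>p. h' (q p) * py q p)"
    by (rule ext, rule px_compose[OF h'(1) d], rule ext, rule py_compose[OF h'(1) d])
  have diff: "(\<lambda>p. h (q p)) differentiable (at p)" for p
  proof -
    have "h differentiable (at (q p))"
      using h'(1)[of "q p"] unfolding has_field_derivative_def differentiable_def by blast
    from differentiable_chain_at[OF d this] show ?thesis by (simp add: comp_def)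
  qed
  note c0 = Ck_on_Suc_D[OF Suc.prems(2)]
  have c: "Ck_on n UNIV (px q)" "Ck_on n UNIV (py q)" using Suc.prems(2) by simp_all
  show ?case unfolding Ck_on.simps e
    using Ck_on_mult[OF Suc.IH[OF h'(2) c0] c(1)] Ck_on_mult[OF Suc.IH[OF h'(2) c0] c(2)] diff
    by (intro conjI ballI)
qed

definition bump2 :: "point \<Rightarrow> point \<Rightarrow> nat \<Rightarrow> point \<Rightarrow> real" where
  "bump2 a b k p = bump (fst a) (fst b) k (fst p) * bump (snd a) (snd b) k (snd p)"

lemma smooth_bump2: "smooth (bump2 a b k)"
  unfolding smooth_def bump2_def[abs_def]
  by (intro allI Ck_on_mult Ck_on_compose[OF Cn_bump Ck_on_fst] Ck_on_compose[OF Cn_bump Ck_on_snd])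

lemma mem_box_prod: "p \<in> box a b \<longleftrightarrow> fst a < fst p \<and> fst p < fst b \<and> snd a < snd p \<and> snd p < snd (b::point)"
  by (auto simp: box_def Basis_prod_def ball_Un inner_prod_def)

lemma bump2_nonzero: "bump2 a b k p \<noteq> 0 \<longleftrightarrow> p \<in> box a b"
  by (auto simp: bump2_def bump_nonzero mem_box_prod)

lemma bump2_tendsto: "(\<lambda>k. bump2 a b k p) \<longlonglongrightarrow> indicator (box a b) p"
proof -
  have "(\<lambda>k. bump2 a b k p) \<longlonglongrightarrow> indicator {fst a<..<fst b} (fst p) * indicator {snd a<..<snd b} (snd p)"
    unfolding bump2_def by (intro tendsto_mult bump_tendsto)
  also have "indicator {fst a<..<fst b} (fst p) * indicator {snd a<..<snd b} (snd p) = (indicator (box a b) p :: real)"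
    by (auto simp: indicator_def mem_box_prod)
  finally show ?thesis .
qed

lemma bump2_bounds: "0 \<le> bump2 a b k p" "bump2 a b k p \<le> 1"
  by (auto simp: bump2_def bump_bounds intro!: mult_le_one)

section \<open>The fundamental lemma of the calculus of variations\<close>

lemma enn2real_cong:
  assumes "enn2real a = enn2real b" "a \<noteq> \<infinity>" "b \<noteq> \<infinity>"
  shows "a = b"
proof -
  have *: "ennreal (enn2real a) = a" "ennreal (enn2real b) = b" using assms(2,3) by (auto simp: ennreal_enn2real_if)
  show ?thesis by (rule *(1)[unfolded assms(1) *(2), symmetric])
qed

text \<open>The measures whose densities are the positive and the negative part of \<open>w\<close>
  agree on boxes, which are stable under intersection and generate the Borel sets. Hence the two
  parts agree almost everywhere, and a number with equal positive and negative part is zero.\<close>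

lemma AE_zero_if_box_integrals_zero:
  fixes w :: "'a::euclidean_space \<Rightarrow> real"
  assumes w: "integrable lborel w" and zero: "\<And>a b. (LINT x:box a b|lborel. w x) = 0"
  shows "AE x in lborel. w x = 0"
proof -
  have [measurable]: "w \<in> borel_measurable borel" using w by auto
  define B where "B n = box (- real n *\<^sub>R One) (real n *\<^sub>R One :: 'a)" for n
  have eq: "emeasure (density lborel (\<lambda>x. ennreal (w x))) (box a b) = emeasure (density lborel (\<lambda>x. ennreal (- w x))) (box a b)"
     and fin: "emeasure (density lborel (\<lambda>x. ennreal (w x))) (box a b) \<noteq> \<infinity>" for a b
  proof -
    let ?v = "\<lambda>x. indicator (box a b) x *\<^sub>R w x"
    have v: "integrable lborel ?v" using w by (intro integrable_mult_indicator) auto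
    have e: "emeasure (density lborel (\<lambda>x. ennreal (w x))) (box a b) = (\<integral>\<^sup>+x. ennreal (?v x) \<partial>lborel)"
      "emeasure (density lborel (\<lambda>x. ennreal (- w x))) (box a b) = (\<integral>\<^sup>+x. ennreal (- ?v x) \<partial>lborel)"
      by (auto simp: emeasure_density intro!: nn_integral_cong split: split_indicator)
    have f: "(\<integral>\<^sup>+x. ennreal (?v x) \<partial>lborel) \<noteq> \<infinity>" "(\<integral>\<^sup>+x. ennreal (- ?v x) \<partial>lborel) \<noteq> \<infinity>"
      using v unfolding real_integrable_def by blast+
    have "enn2real (\<integral>\<^sup>+x. ennreal (?v x) \<partial>lborel) = enn2real (\<integral>\<^sup>+x. ennreal (- ?v x) \<partial>lborel)"
      using zero[of a b] unfolding set_lebesgue_integral_def real_lebesgue_integral_def[OF v] by linarith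
    then show "emeasure (density lborel (\<lambda>x. ennreal (w x))) (box a b) = emeasure (density lborel (\<lambda>x. ennreal (- w x))) (box a b)"
      unfolding e by (rule enn2real_cong[OF _ f])
    show "emeasure (density lborel (\<lambda>x. ennreal (w x))) (box a b) \<noteq> \<infinity>" unfolding e by fact
  qed
  have "density lborel (\<lambda>x. ennreal (w x)) = density lborel (\<lambda>x. ennreal (- w x))"
  proof (rule measure_eqI_generator_eq[where E="range (\<lambda>(a, b). box a b)" and \<Omega>=UNIV and A=B])
    show "Int_stable (range (\<lambda>(a::'a, b). box a b))"
    proof (rule Int_stableI)
      fix X Y assume "X \<in> range (\<lambda>(a::'a, b). box a b)" "Y \<in> range (\<lambda>(a::'a, b). box a b)"
      then obtain a b c d :: 'a where "X = box a b" "Y = box c d" by auto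
      then obtain e f where "X \<inter> Y = box e f" using box_Int_box[of a b c d] by blast
      then show "X \<inter> Y \<in> range (\<lambda>(a::'a, b). box a b)" by (auto intro: range_eqI[of _ _ "(e, f)"])
    qed
    show "(\<Union>i. B i) = UNIV" using UN_box_eq_UNIV[where 'a='a] by (simp add: B_def)
    show "range B \<subseteq> range (\<lambda>(a, b). box a b)" by (auto simp: B_def)
    have "sets (borel :: 'a measure) = sigma_sets UNIV (range (\<lambda>(a, b). box a b))"
      by (subst borel_eq_box, subst sets_measure_of) simp_all
    then show "sets (density lborel (\<lambda>x. ennreal (w x))) = sigma_sets UNIV (range (\<lambda>(a, b). box a b))"
      "sets (density lborel (\<lambda>x. ennreal (- w x))) = sigma_sets UNIV (range (\<lambda>(a, b). box a b))"
      by simp_all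
    fix X assume "X \<in> range (\<lambda>(a::'a, b). box a b)"
    then obtain a b :: 'a where "X = box a b" by auto
    then show "emeasure (density lborel (\<lambda>x. ennreal (w x))) X = emeasure (density lborel (\<lambda>x. ennreal (- w x))) X"
      using eq by simp
  next
    fix i show "emeasure (density lborel (\<lambda>x. ennreal (w x))) (B i) \<noteq> \<infinity>"
      unfolding B_def by (rule fin)
  qed simp
  then have "AE x in lborel. ennreal (w x) = ennreal (- w x)"
    by (subst (asm) sigma_finite_measure.density_unique_iff[OF sigma_finite_lborel]) auto
  then show ?thesis
  proof eventually_elim
    case (elim x)
    show ?case
    proof (cases "w x \<ge> 0")
      case True
      with elim have "ennreal (w x) = 0" by (simp add: ennreal_neg)
      with True show ?thesis by (simp add: ennreal_eq_0_iff)
    next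
      case False
      with elim have "ennreal (- w x) = 0" by (simp add: ennreal_neg)
      with False show ?thesis by (simp add: ennreal_eq_0_iff)
    qed
  qed
qed

text \<open>Cut \<open>u\<close> off to a box with closure in \<open>U\<close>; its intersections
  with other boxes are boxes of the same kind. Closed boxes differ from open ones by null sets, and
  countably many of them exhaust \<open>U\<close>.\<close>

lemma AE_zero_if_local_box_integrals_zero:
  fixes u :: "'a::euclidean_space \<Rightarrow> real"
  assumes "open U" and int: "\<And>K. compact K \<Longrightarrow> K \<subseteq> U \<Longrightarrow> set_integrable lborel K u"
    and zero: "\<And>a b. cbox a b \<subseteq> U \<Longrightarrow> (LINT x:box a b|lborel. u x) = 0"
  shows "AE x in lborel. x \<in> U \<longrightarrow> u x = 0"
proof -
  have box: "AE x in lborel. x \<in> cbox c d \<longrightarrow> u x = 0" if cd: "cbox c d \<subseteq> U" for c d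
  proof -
    let ?w = "\<lambda>x. indicator (box c d) x *\<^sub>R u x"
    have w: "integrable lborel ?w"
      using set_integrable_subset[OF int[OF compact_cbox cd], of "box c d"] box_subset_cbox[of c d]
      by (simp add: set_integrable_def)
    have "AE x in lborel. ?w x = 0"
    proof (rule AE_zero_if_box_integrals_zero[OF w])
      fix a b :: 'a
      obtain a' b' where ab: "box a b \<inter> box c d = box a' b'" using box_Int_box[of a b c d] by blast
      have "(LINT x:box a b|lborel. ?w x) = (LINT x:box a' b'|lborel. u x)"
        unfolding set_lebesgue_integral_def ab[symmetric]
        by (intro Bochner_Integration.integral_cong) (auto simp: indicator_def)
      also have "\<dots> = 0"
      proof (cases "box a' b' = {}")
        case False
        have "box a' b' \<subseteq> box c d" using ab by auto
        then have "cbox a' b' \<subseteq> cbox c d"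
          using closure_mono[of "box a' b'" "cbox c d"] box_subset_cbox[of c d] closure_box[OF False] by auto
        then show ?thesis using zero cd by auto
      qed (simp add: set_lebesgue_integral_def)
      finally show "(LINT x:box a b|lborel. ?w x) = 0" .
    qed
    moreover have "AE x in lborel. x \<notin> cbox c d - box c d"
    proof (rule AE_not_in)
      have "emeasure lborel (cbox c d - box c d) = 0"
        by (subst emeasure_Diff) (auto simp: box_subset_cbox emeasure_lborel_box_eq emeasure_lborel_cbox_eq)
      then show "cbox c d - box c d \<in> null_sets lborel" by auto
    qed
    ultimately show ?thesis by eventually_elim auto
  qed
  obtain \<D> where D: "countable \<D>" "\<D> \<subseteq> Pow U" "\<And>X. X \<in> \<D> \<Longrightarrow> \<exists>a b. X = cbox a b" "\<Union>\<D> = U"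
    by (rule open_countable_Union_open_cbox[OF \<open>open U\<close>]) (use that in auto)
  have "AE x in lborel. \<forall>X\<in>\<D>. x \<in> X \<longrightarrow> u x = 0"
  proof (rule AE_ball_countable'[OF _ D(1)])
    fix X assume "X \<in> \<D>"
    then show "AE x in lborel. x \<in> X \<longrightarrow> u x = 0" using D(2) D(3)[of X] box by auto
  qed
  then show ?thesis by eventually_elim (use D(4) in auto)
qed

text \<open>Products of bumps tend boundedly to the indicator of a box, so testing with them makes
  all box integrals vanish.\<close>

lemma fundamental_lemma:
  fixes u :: "point \<Rightarrow> real"
  assumes U: "open U" and int: "\<And>K. compact K \<Longrightarrow> K \<subseteq> U \<Longrightarrow> set_integrable lborel K u"
    and zero: "\<And>\<phi>. smooth \<phi> \<Longrightarrow> compact (closure {p. \<phi> p \<noteq> 0}) \<Longrightarrow> closure {p. \<phi> p \<noteq> 0} \<subseteq> U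
       \<Longrightarrow> (LINT p:U|lborel. u p * \<phi> p) = 0"
  shows "AE p in lborel. p \<in> U \<longrightarrow> u p = 0"
proof (rule AE_zero_if_local_box_integrals_zero[OF U int])
  fix a b :: point assume ab: "cbox a b \<subseteq> U"
  have sup: "{p. bump2 a b k p \<noteq> 0} = box a b" for k using bump2_nonzero by auto
  have cl: "closure (box a b) \<subseteq> cbox a b" by (rule closure_minimal[OF box_subset_cbox closed_cbox])
  have 0: "(LINT p:U|lborel. u p * bump2 a b k p) = 0" for k
    by (rule zero[OF smooth_bump2]) (use cl ab in \<open>auto simp: sup compact_closure intro: bounded_subset bounded_box\<close>)
  have i: "set_integrable lborel (box a b) u"
    using int[OF compact_cbox ab] by (rule set_integrable_subset) (auto simp: box_subset_cbox)
  have [measurable]: "(\<lambda>p. bump2 a b k p) \<in> borel_measurable borel" for k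
    using smooth_bump2[of a b k] by (intro borel_measurable_continuous_onI) (metis Ck_on.simps(1) smooth_def)
  have [measurable]: "(\<lambda>x. indicator (box a b) x *\<^sub>R u x) \<in> borel_measurable borel"
    using i by (auto simp: set_integrable_def)
  have eq: "indicator U p *\<^sub>R (u p * bump2 a b k p) = (indicator (box a b) p *\<^sub>R u p) * bump2 a b k p" for p k
    using bump2_nonzero[of a b k p] ab box_subset_cbox[of a b] by (auto simp: indicator_def)
  have "(\<lambda>k. \<integral>p. (indicator (box a b) p *\<^sub>R u p) * bump2 a b k p \<partial>lborel)
     \<longlonglongrightarrow> (\<integral>p. (indicator (box a b) p *\<^sub>R u p) * indicator (box a b) p \<partial>lborel)"
  proof (rule integral_dominated_convergence[where w="\<lambda>p. \<bar>indicator (box a b) p *\<^sub>R u p\<bar>"])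
    show "AE p in lborel. (\<lambda>k. indicat_real (box a b) p *\<^sub>R u p * bump2 a b k p) \<longlonglongrightarrow> indicat_real (box a b) p *\<^sub>R u p * indicat_real (box a b) p"
      by (intro AE_I2 tendsto_mult tendsto_const bump2_tendsto)
    show "AE p in lborel. norm (indicat_real (box a b) p *\<^sub>R u p * bump2 a b k p) \<le> \<bar>indicat_real (box a b) p *\<^sub>R u p\<bar>" for k
      using bump2_bounds[of a b k] by (auto simp: abs_mult mult_left_le intro!: AE_I2)
    show "integrable lborel (\<lambda>p. \<bar>indicat_real (box a b) p *\<^sub>R u p\<bar>)"
      using i unfolding set_integrable_def by (rule integrable_abs)
  qed measurable
  moreover have "(\<integral>p. (indicator (box a b) p *\<^sub>R u p) * bump2 a b k p \<partial>lborel) = 0" for k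
    using 0[of k] unfolding set_lebesgue_integral_def eq .
  moreover have "(\<integral>p. (indicator (box a b) p *\<^sub>R u p) * indicator (box a b) p \<partial>lborel) = (LINT x:box a b|lborel. u x)"
    unfolding set_lebesgue_integral_def by (intro Bochner_Integration.integral_cong) (auto simp: indicator_def)
  ultimately show "(LINT x:box a b|lborel. u x) = 0"
    by (simp add: LIMSEQ_const_iff)
qed

section \<open>Integration by parts and radial test functions\<close>

lemma integral_derivative_compact_support:
  fixes V w :: "real \<Rightarrow> real"
  assumes V: "\<And>t. (V has_real_derivative w t) (at t)" and w: "continuous_on UNIV w"
    and supp: "\<And>t. \<bar>t\<bar> \<ge> M \<Longrightarrow> V t = 0" "\<And>t. \<bar>t\<bar> > M \<Longrightarrow> w t = 0" and M: "M \<ge> 0"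
  shows "(LINT t|lborel. w t) = 0"
proof -
  have "(LINT t|lborel. w t) = (LINT t|lborel. indicator {-M..M} t *\<^sub>R w t)"
    using supp(2) by (intro Bochner_Integration.integral_cong) (force simp: indicator_def)+
  also have "\<dots> = V M - V (- M)"
  proof (rule integral_FTC_Icc)
    show "continuous_on {-M..M} w" using w continuous_on_subset by blast
    fix x show "(V has_vector_derivative w x) (at x within {-M..M})"
      using V[of x] by (auto simp: has_real_derivative_iff_has_vector_derivative intro: has_vector_derivative_at_within)
  qed (use M in auto)
  also have "\<dots> = 0" using supp(1)[of M] supp(1)[of "-M"] M by simp
  finally show ?thesis .
qed

text \<open>\<open>P\<close> and the complement of \<open>C\<close> are open and cover the plane;
  the extension is \<open>w\<close> on the first and 0 on the second, and on the overlap both are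
  zero.\<close>

lemma zero_extension_continuous:
  fixes w :: "point \<Rightarrow> real"
  assumes P: "open P" and C: "compact C" "C \<subseteq> P" and w: "continuous_on P w" and z: "\<And>p. p \<in> P - C \<Longrightarrow> w p = 0"
  shows "continuous_on UNIV (\<lambda>p. if p \<in> C then w p else 0)"
proof -
  have "continuous_on (P \<union> - C) (\<lambda>p. if p \<in> C then w p else 0)"
  proof (rule continuous_on_open_Un)
    show "continuous_on P (\<lambda>p. if p \<in> C then w p else 0)"
      using w by (rule continuous_on_cong[THEN iffD1, OF refl, rotated -1]) (use z in auto)
    show "continuous_on (- C) (\<lambda>p. if p \<in> C then w p else 0)"
      by (rule continuous_on_cong[THEN iffD1, OF refl _ continuous_on_const[of _ 0]]) auto
  qed (use P C in \<open>auto intro: compact_imp_closed\<close>)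
  moreover have "P \<union> - C = UNIV" using C by auto
  ultimately show ?thesis by simp
qed

lemma zero_extension_integrable:
  fixes w :: "point \<Rightarrow> real"
  assumes C: "compact C" and w: "continuous_on UNIV (\<lambda>p. if p \<in> C then w p else 0)"
  shows "integrable lborel (\<lambda>p. if p \<in> C then w p else 0)"
proof -
  have "set_integrable lborel C (\<lambda>p. if p \<in> C then w p else 0)"
    unfolding set_integrable_def
    by (rule borel_integrable_compact[OF C continuous_on_subset[OF w subset_UNIV]])
  then show ?thesis unfolding set_integrable_def
    by (rule Bochner_Integration.integrable_cong[THEN iffD1, rotated 2]) auto
qed

text \<open>The divergence theorem for one component at a time: on each line the derivative of a
  compactly supported function integrates to zero, and Fubini adds up the lines. The support is
  compact in \<open>P\<close>, so the shape of the boundary of \<open>P\<close> never enters;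
  \<open>S\<close> admits integrals over any set between \<open>C\<close> and
  \<open>P\<close>.\<close>

lemma
  fixes v :: "point \<Rightarrow> real"
  assumes P: "open P" and C: "compact C" "C \<subseteq> P" and v0: "\<And>p. p \<notin> C \<Longrightarrow> v p = 0"
    and S: "C \<subseteq> S" "S \<subseteq> P"
  shows integral_px_zero: "\<lbrakk>\<And>p. p \<in> P \<Longrightarrow> ((\<lambda>t. v (t, snd p)) has_real_derivative vx p) (at (fst p)); continuous_on P vx\<rbrakk>
      \<Longrightarrow> set_integrable lborel S vx \<and> (LINT p:S|lborel. vx p) = 0"
    and integral_py_zero: "\<lbrakk>\<And>p. p \<in> P \<Longrightarrow> ((\<lambda>t. v (fst p, t)) has_real_derivative vx p) (at (snd p)); continuous_on P vx\<rbrakk>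
      \<Longrightarrow> set_integrable lborel S vx \<and> (LINT p:S|lborel. vx p) = 0"
proof -
  define w where "w p = (if p \<in> C then vx p else 0)" for p
  obtain M where M: "M > 0" "\<And>p. p \<in> C \<Longrightarrow> norm p < M"
    using compact_imp_bounded[OF C(1)] by (metis bounded_pos_less)
  have small: "\<bar>fst p\<bar> < M" "\<bar>snd p\<bar> < M" if "p \<in> C" for p
    using M(2)[OF that] norm_fst_le[of "fst p" "snd p"] norm_snd_le[of "snd p" "fst p"] by auto
  have oC: "open (- C)" using C(1) by (simp add: compact_imp_closed open_Compl)
  have concl: "set_integrable lborel S vx \<and> (LINT p:S|lborel. vx p) = 0"
    if z: "\<And>p. p \<in> P - C \<Longrightarrow> vx p = 0" and i: "integrable lborel w" and 0: "(LINT p|lborel. w p) = 0"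
  proof -
    have "indicator S p *\<^sub>R vx p = w p" for p
      using z[of p] S by (auto simp: w_def indicator_def)
    then show ?thesis using i 0 by (simp add: set_integrable_def set_lebesgue_integral_def)
  qed
  {
    assume D: "\<And>p. p \<in> P \<Longrightarrow> ((\<lambda>t. v (t, snd p)) has_real_derivative vx p) (at (fst p))" and c: "continuous_on P vx"
    have D0: "((\<lambda>t. v (t, snd p)) has_real_derivative 0) (at (fst p))" if "p \<notin> C" for p
    proof -
      have "open ((\<lambda>t. (t, snd p)) -` (- C))"
        by (intro open_vimage[OF oC] continuous_intros)
      then have "((\<lambda>t. v (t, snd p)) has_real_derivative 0) (at (fst p)) \<longleftrightarrow> ((\<lambda>t. 0) has_real_derivative 0) (at (fst p))"
        using that v0 by (intro DERIV_cong_ev refl) (auto simp: eventually_nhds)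
      then show ?thesis by simp
    qed
    have z: "vx p = 0" if "p \<in> P - C" for p
      using D[of p] D0[of p] that DERIV_unique by blast
    have D': "((\<lambda>t. v (t, snd p)) has_real_derivative w p) (at (fst p))" for p
      using D[of p] D0[of p] C by (auto simp: w_def)
    have cw: "continuous_on UNIV w" unfolding w_def by (rule zero_extension_continuous[OF P C c z])
    have iw: "integrable lborel w" unfolding w_def using cw unfolding w_def by (rule zero_extension_integrable[OF C(1)])
    have "(LINT x|lborel. w (x, y)) = 0" for y
    proof (rule integral_derivative_compact_support)
      show "((\<lambda>x. v (x, y)) has_real_derivative w (t, y)) (at t)" for t using D'[of "(t, y)"] by simp
      show "continuous_on UNIV (\<lambda>x. w (x, y))"
        by (rule continuous_on_compose2[OF cw]) (auto intro!: continuous_intros)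
      show "v (t, y) = 0" if "M \<le> \<bar>t\<bar>" for t using small(1)[of "(t, y)"] v0[of "(t,y)"] that by fastforce
      show "w (t, y) = 0" if "M < \<bar>t\<bar>" for t using small(1)[of "(t, y)"] that by (auto simp: w_def)
    qed (use M in auto)
    moreover have "(LINT p|lborel. w p) = (LINT y|lborel. (LINT x|lborel. w (x, y)))"
      using lborel_pair.integral_snd[of "\<lambda>x y. w (x, y)"] iw by (simp add: lborel_prod)
    ultimately have "(LINT p|lborel. w p) = 0" by simp
    with concl[OF z iw] show "set_integrable lborel S vx \<and> (LINT p:S|lborel. vx p) = 0" by blast
  }
  {
    assume D: "\<And>p. p \<in> P \<Longrightarrow> ((\<lambda>t. v (fst p, t)) has_real_derivative vx p) (at (snd p))" and c: "continuous_on P vx"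
    have D0: "((\<lambda>t. v (fst p, t)) has_real_derivative 0) (at (snd p))" if "p \<notin> C" for p
    proof -
      have "open ((\<lambda>t. (fst p, t)) -` (- C))"
        by (intro open_vimage[OF oC] continuous_intros)
      then have "((\<lambda>t. v (fst p, t)) has_real_derivative 0) (at (snd p)) \<longleftrightarrow> ((\<lambda>t. 0) has_real_derivative 0) (at (snd p))"
        using that v0 by (intro DERIV_cong_ev refl) (auto simp: eventually_nhds)
      then show ?thesis by simp
    qed
    have z: "vx p = 0" if "p \<in> P - C" for p
      using D[of p] D0[of p] that DERIV_unique by blast
    have D': "((\<lambda>t. v (fst p, t)) has_real_derivative w p) (at (snd p))" for p
      using D[of p] D0[of p] C by (auto simp: w_def)
    have cw: "continuous_on UNIV w" unfolding w_def by (rule zero_extension_continuous[OF P C c z])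
    have iw: "integrable lborel w" unfolding w_def using cw unfolding w_def by (rule zero_extension_integrable[OF C(1)])
    have "(LINT y|lborel. w (x, y)) = 0" for x
    proof (rule integral_derivative_compact_support)
      show "((\<lambda>y. v (x, y)) has_real_derivative w (x, t)) (at t)" for t using D'[of "(x, t)"] by simp
      show "continuous_on UNIV (\<lambda>y. w (x, y))"
        by (rule continuous_on_compose2[OF cw]) (auto intro!: continuous_intros)
      show "v (x, t) = 0" if "M \<le> \<bar>t\<bar>" for t using small(2)[of "(x, t)"] v0[of "(x,t)"] that by fastforce
      show "w (x, t) = 0" if "M < \<bar>t\<bar>" for t using small(2)[of "(x, t)"] that by (auto simp: w_def)
    qed (use M in auto)
    moreover have "(LINT p|lborel. w p) = (LINT x|lborel. (LINT y|lborel. w (x, y)))"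
      using lborel_pair.integral_fst[of "\<lambda>x y. w (x, y)"] iw by (simp add: lborel_prod)
    ultimately have "(LINT p|lborel. w p) = 0" by simp
    with concl[OF z iw] show "set_integrable lborel S vx \<and> (LINT p:S|lborel. vx p) = 0" by blast
  }
qed

lemma Fprim_has_derivative:
  assumes "continuous_on UNIV f"
  shows "(Fprim f has_real_derivative f z) (at z)"
proof -
  have "((\<lambda>u. LBINT s=ereal 0..u. f s) has_vector_derivative f z) (at z within {min 0 z - 1..max 0 z + 1})"
    by (rule interval_integral_FTC2) (auto intro: continuous_on_subset[OF assms])
  moreover have "at z within {min 0 z - 1..max 0 z + 1} = at z" by (rule at_within_interior) auto
  ultimately show ?thesis
    by (simp add: Fprim_def[abs_def] has_real_derivative_iff_has_vector_derivative zero_ereal_def)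
qed

lemma Fprim_0 [simp]: "Fprim f 0 = 0"
  by (simp add: Fprim_def zero_ereal_def[symmetric])

text \<open>The square of the distance is smooth at the centre as well, so
  \<open>h (rsq X p)\<close> is a smooth test function for every smooth \<open>h\<close>.\<close>

definition rsq :: "point \<Rightarrow> point \<Rightarrow> real" where
  "rsq X p = (fst p - fst X)\<^sup>2 + (snd p - snd X)\<^sup>2"

lemma rsq_polar_map [simp]: "rsq X (polar_map X (t, \<theta>)) = t\<^sup>2"
  by (simp add: rsq_def polar_map_def power_mult_distrib distrib_left[symmetric])

lemma rsq_dist: "rsq X p = (dist X p)\<^sup>2"
  by (simp add: rsq_def dist_prod_def dist_real_def power2_commute)

lemma Ck_on_rsq: "Ck_on n UNIV (rsq X)"
proof -
  have "Ck_on n UNIV (\<lambda>p. (fst p + - fst X) * (fst p + - fst X) + (snd p + - snd X) * (snd p + - snd X))"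
    by (intro Ck_on_add Ck_on_mult Ck_on_const Ck_on_fst Ck_on_snd)
  then show ?thesis by (simp add: rsq_def[abs_def] power2_eq_square)
qed

lemma integrable_bounded_mult:
  fixes u v :: "'a::euclidean_space \<Rightarrow> real"
  assumes "integrable lborel u" "v \<in> borel_measurable borel" "\<And>x. \<bar>v x\<bar> \<le> C"
  shows "integrable lborel (\<lambda>x. u x * v x)"
proof (rule Bochner_Integration.integrable_bound[where f="\<lambda>x. C * u x"])
  show "AE x in lborel. norm (u x * v x) \<le> norm (C * u x)"
  proof (rule AE_I2)
    fix x
    have "\<bar>u x\<bar> * \<bar>v x\<bar> \<le> \<bar>u x\<bar> * \<bar>C\<bar>" using assms(3)[of x] by (intro mult_left_mono) auto
    then show "norm (u x * v x) \<le> norm (C * u x)" by (simp add: abs_mult mult.commute)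
  qed
qed (use assms in auto)

lemma set_integrable_of_integrable:
  fixes u :: "'a \<Rightarrow> real"
  shows "integrable M u \<Longrightarrow> S \<in> sets M \<Longrightarrow> set_integrable M S u"
  unfolding set_integrable_def by (rule integrable_mult_indicator)

text \<open>Layer cake: since \<open>h (R\<^sup>2) = 0\<close>, the weight at distance
  \<open>d\<close> is minus the integral of \<open>2 * s * \<eta> (s\<^sup>2)\<close> over
  \<open>s\<close> from \<open>d\<close> to \<open>R\<close>. Fubini turns the weighted integral
  into a superposition of disc integrals.\<close>

lemma integral_radial_weight:
  fixes a :: "point \<Rightarrow> real" and \<eta> :: "real \<Rightarrow> real"
  assumes a: "integrable lborel a" and R: "R > 0" and \<eta>: "continuous_on UNIV \<eta>" "\<And>s. \<bar>\<eta> s\<bar> \<le> 1"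
    and h: "\<And>s. (h has_real_derivative \<eta> s) (at s)" "h (R\<^sup>2) = 0"
  shows "(LINT p:ball X R|lborel. h (rsq X p) * a p) = - (LINT s:{0<..<R}|lborel. 2 * s * \<eta> (s\<^sup>2) * disc_int X s a)"
proof -
  have [measurable]: "a \<in> borel_measurable borel" "\<eta> \<in> borel_measurable borel"
    using a \<eta> by (auto intro: borel_measurable_continuous_onI)
  have A[measurable]: "Measurable.pred (borel \<Otimes>\<^sub>M borel) (\<lambda>q::point\<times>real. dist X (fst q) < snd q)"
  proof -
    have "{q::point\<times>real. dist X (fst q) < snd q} \<in> sets borel"
      by (intro borel_open open_Collect_less continuous_intros)
    then show ?thesis by (simp add: pred_def borel_prod space_pair_measure)
  qed
  let ?G = "\<lambda>p s. (indicator {0<..<R} s * (2 * s * \<eta> (s\<^sup>2)) * of_bool (dist X p < s)) * a p"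
  have bd: "\<bar>indicator {0<..<R} s * (2 * s * \<eta> (s\<^sup>2)) * of_bool (dist X p < s)\<bar> \<le> 2 * R * indicator {0<..<R} s" for p s
    using \<eta>(2)[of "s\<^sup>2"] R by (auto simp: indicator_def abs_mult intro: mult_mono[of s R "\<bar>\<eta> (s\<^sup>2)\<bar>" 1, simplified])
  have i1: "integrable lborel (\<lambda>s::real. 2 * R * indicator {0<..<R} s)"
    using R by (intro integrable_mult_right integrable_real_indicator) auto
  have int_s: "integrable lborel (\<lambda>s. ?G p s)" for p
    by (intro integrable_mult_left Bochner_Integration.integrable_bound[OF i1]) (use bd R in auto)
  have intG: "integrable (lborel \<Otimes>\<^sub>M lborel) (\<lambda>(p, s). ?G p s)"
  proof (rule lborel_pair.Fubini_integrable)
    show "(\<lambda>(p, s). ?G p s) \<in> borel_measurable (lborel \<Otimes>\<^sub>M lborel)" by measurable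
    show "integrable lborel (\<lambda>p. \<integral>s. norm (case (p, s) of (p, s) \<Rightarrow> ?G p s) \<partial>lborel)"
    proof (rule Bochner_Integration.integrable_bound[where f="\<lambda>p. (2 * R * R) * a p"])
      show "AE p in lborel. norm (\<integral>s. norm (case (p, s) of (p, s) \<Rightarrow> ?G p s) \<partial>lborel) \<le> norm ((2 * R * R) * a p)"
      proof (rule AE_I2)
        fix p
        have "norm (\<integral>s. norm (?G p s) \<partial>lborel) = (\<integral>s. norm (?G p s) \<partial>lborel)" by simp
        also have "\<dots> \<le> (\<integral>s. 2 * R * indicator {0<..<R} s * \<bar>a p\<bar> \<partial>lborel)"
        proof (rule integral_mono)
          show "integrable lborel (\<lambda>s. norm (?G p s))" by (rule integrable_norm[OF int_s])
          show "integrable lborel (\<lambda>s. 2 * R * indicator {0<..<R} s * \<bar>a p\<bar>)" by (rule integrable_mult_left[OF i1])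
          show "norm (?G p s) \<le> 2 * R * indicator {0<..<R} s * \<bar>a p\<bar>" for s
            unfolding real_norm_def abs_mult[of _ "a p"] by (rule mult_right_mono[OF bd]) simp
        qed
        also have "\<dots> = norm ((2 * R * R) * a p)" using R by (simp add: abs_mult)
        finally show "norm (\<integral>s. norm (case (p, s) of (p, s) \<Rightarrow> ?G p s) \<partial>lborel) \<le> norm ((2 * R * R) * a p)" by simp
      qed
    qed (use a in \<open>auto intro!: integrable_mult_right lborel.borel_measurable_lebesgue_integral\<close>)
    show "AE p in lborel. integrable lborel (\<lambda>s. case (p, s) of (p, s) \<Rightarrow> ?G p s)" using int_s by simp
  qed
  have inner: "(\<integral>s. ?G p s \<partial>lborel) = - (indicator (ball X R) p *\<^sub>R (h (rsq X p) * a p))" for p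
  proof (cases "p \<in> ball X R")
    case True
    define d where "d = dist X p"
    have d: "0 \<le> d" "d < R" using True by (auto simp: d_def)
    have "(\<integral>s. indicator {0<..<R} s * (2 * s * \<eta> (s\<^sup>2)) * of_bool (dist X p < s) \<partial>lborel)
      = (\<integral>s. indicator {d..R} s *\<^sub>R (2 * s * \<eta> (s\<^sup>2)) \<partial>lborel)"
    proof (rule integral_cong_AE)
      have "AE s in lborel. s \<notin> {d, R}" by (intro AE_not_in finite_imp_null_set_lborel) auto
      then show "AE s in lborel. indicator {0<..<R} s * (2 * s * \<eta> (s\<^sup>2)) * of_bool (dist X p < s) = indicator {d..R} s *\<^sub>R (2 * s * \<eta> (s\<^sup>2))"
        by eventually_elim (use d in \<open>auto simp: d_def[symmetric] indicator_def\<close>)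
    qed measurable
    also have "\<dots> = h (R\<^sup>2) - h (d\<^sup>2)"
    proof (rule integral_FTC_Icc)
      fix s
      have "((\<lambda>s. h (s\<^sup>2)) has_real_derivative \<eta> (s\<^sup>2) * (2 * s)) (at s)"
        by (rule DERIV_chain2[OF h(1)]) (auto intro!: derivative_eq_intros)
      then show "((\<lambda>s. h (s\<^sup>2)) has_vector_derivative 2 * s * \<eta> (s\<^sup>2)) (at s within {d..R})"
        by (auto simp: has_real_derivative_iff_has_vector_derivative mult.commute intro: has_vector_derivative_at_within)
      show "continuous_on {d..R} (\<lambda>s. 2 * s * \<eta> (s\<^sup>2))"
        by (intro continuous_intros continuous_on_compose2[OF \<eta>(1)]) auto
    qed (use d in auto)
    finally show ?thesis using True h(2) by (simp add: rsq_dist d_def)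
  next
    case False
    then have "?G p s = 0" for s by (auto simp: indicator_def)
    then have "(\<integral>s. ?G p s \<partial>lborel) = (\<integral>s. 0 \<partial>(lborel::real measure))"
      by (intro Bochner_Integration.integral_cong refl)
    with False show ?thesis by (simp add: indicator_def)
  qed
  have "(LINT p:ball X R|lborel. h (rsq X p) * a p) = - (\<integral>p. (\<integral>s. ?G p s \<partial>lborel) \<partial>lborel)"
    unfolding inner by (simp add: set_lebesgue_integral_def)
  also have "(\<integral>p. (\<integral>s. ?G p s \<partial>lborel) \<partial>lborel) = (\<integral>s. (\<integral>p. ?G p s \<partial>lborel) \<partial>lborel)"
    using lborel_pair.Fubini_integral[OF intG] by simp
  also have "\<dots> = (LINT s:{0<..<R}|lborel. 2 * s * \<eta> (s\<^sup>2) * disc_int X s a)"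
    unfolding set_lebesgue_integral_def disc_int_def
  proof (rule Bochner_Integration.integral_cong[OF refl])
    fix s :: real
    have "(\<integral>p. ?G p s \<partial>lborel) = (\<integral>p. (indicator {0<..<R} s * (2 * s * \<eta> (s\<^sup>2))) * (indicator (ball X s) p *\<^sub>R a p) \<partial>lborel)"
      by (intro Bochner_Integration.integral_cong) (auto simp: indicator_def)
    then show "(\<integral>p. ?G p s \<partial>lborel) = indicat_real {0<..<R} s *\<^sub>R (2 * s * \<eta> (s\<^sup>2) * (\<integral>p. indicator (ball X s) p *\<^sub>R a p \<partial>lborel))"
      by simp
  qed
  finally show ?thesis .
qed

text \<open>Formally \<open>h\<close> is the indicator function of \<open>[0, t\<^sup>2]\<close>.\<close>

lemma radial_flux:
  fixes a b :: "point \<Rightarrow> real"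
  assumes a: "integrable lborel a" and b: "integrable lborel b" and R: "R > 0"
    and test: "\<And>h h' \<rho>. \<lbrakk>\<And>n. Cn n h; \<And>n. Cn n h'; \<And>s. (h has_real_derivative h' s) (at s); 0 < \<rho>; \<rho> < R; \<And>s. s \<ge> \<rho>\<^sup>2 \<Longrightarrow> h s = 0\<rbrakk>
       \<Longrightarrow> (LINT p:ball X R|lborel. h (rsq X p) * a p + 2 * h' (rsq X p) * b p) = 0"
  shows "AE t in lborel. 0 < t \<and> t < R \<longrightarrow> t * disc_int X t a = circ_int X t b"
proof -
  let ?u = "\<lambda>t. circ_int X t b - t * disc_int X t a"
  have intb: "set_integrable lborel {0<..<R} (\<lambda>t. circ_int X t b)"
    by (rule set_integrable_subset[OF polar_integral(2)[OF b, of X]]) auto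
  have contA: "continuous_on S (\<lambda>t. t * disc_int X t a)" for S
    by (intro continuous_intros continuous_on_disc_int[OF a])
  have intA: "set_integrable lborel {0<..<R} (\<lambda>t. t * disc_int X t a)"
  proof (rule set_integrable_subset)
    show "set_integrable lborel {0..R} (\<lambda>t. t * disc_int X t a)"
      unfolding set_integrable_def by (rule borel_integrable_compact[OF _ contA]) auto
  qed auto
  have intu: "set_integrable lborel {0<..<R} ?u" using intb intA by (rule set_integral_diff)
  have "AE t in lborel. t \<in> {0<..<R} \<longrightarrow> ?u t = 0"
  proof (rule AE_zero_if_local_box_integrals_zero)
    fix K :: "real set" assume K: "compact K" "K \<subseteq> {0<..<R}"
    show "set_integrable lborel K ?u"
      by (rule set_integrable_subset[OF intu _ K(2)]) (use K(1) in \<open>auto intro: borel_compact\<close>)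
  next
    fix \<alpha> \<beta> :: real assume sub: "cbox \<alpha> \<beta> \<subseteq> {0<..<R}"
    show "(LINT t:box \<alpha> \<beta>|lborel. ?u t) = 0"
    proof (cases "\<alpha> < \<beta>")
      case True
      then have "\<alpha> \<in> {0<..<R}" "\<beta> \<in> {0<..<R}" by (intro subsetD[OF sub], simp)+
      then have ab: "0 < \<alpha>" "\<beta> < R" by auto
      \<comment> \<open>The test prescribes the derivative of \<open>h\<close> rather than
        \<open>h\<close>: a bump in the variable \<open>t\<^sup>2\<close> concentrates the boundary
        term on the radii between \<open>\<alpha>\<close> and \<open>\<beta>\<close>.\<close>
      let ?\<eta> = "bump (\<alpha>\<^sup>2) (\<beta>\<^sup>2)"
      have c\<eta>: "continuous_on UNIV (?\<eta> k)" for k using Cn_bump[of 0] by simp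
      have [measurable]: "?\<eta> k \<in> borel_measurable borel" for k using c\<eta> by (rule borel_measurable_continuous_onI)
      have zero: "(LINT t:{0<..<R}|lborel. ?\<eta> k (t\<^sup>2) * ?u t) = 0" for k
      proof -
        \<comment> \<open>The primitive is normalised to vanish from \<open>\<beta>\<^sup>2\<close>
          on, so the weight is supported in the disc of radius \<open>\<beta> < R\<close>.\<close>
        define h where "h s = Fprim (?\<eta> k) s + - Fprim (?\<eta> k) (\<beta>\<^sup>2)" for s
        have h: "(h has_real_derivative ?\<eta> k s) (at s)" for s
          unfolding h_def using Fprim_has_derivative[OF c\<eta>, of k s] by (auto intro!: derivative_eq_intros)
        have conth: "continuous_on S h" for S
          by (rule DERIV_continuous_on[OF has_field_derivative_at_within[OF h]])
        have h0: "h s = 0" if "s \<ge> \<beta>\<^sup>2" for s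
        proof (cases "s = \<beta>\<^sup>2")
          case False
          have "h s = h (\<beta>\<^sup>2)"
          proof (rule DERIV_isconst2[of "\<beta>\<^sup>2" s h s])
            show "\<beta>\<^sup>2 < s" "\<beta>\<^sup>2 \<le> s" "s \<le> s" using False that by auto
            show "continuous_on {\<beta>\<^sup>2..s} h" by (rule conth)
            show "(h has_real_derivative 0) (at x)" if "\<beta>\<^sup>2 < x" "x < s" for x
              using h[of x] bump_nonzero[of "\<alpha>\<^sup>2" "\<beta>\<^sup>2" k x] that by (cases "?\<eta> k x = 0") auto
          qed
          then show ?thesis by (simp add: h_def)
        qed (simp add: h_def)
        have Cnh: "Cn n h" for n
        proof (cases n)
          case 0
          then show ?thesis using conth by simp
        next
          case (Suc m)
          show ?thesis unfolding Suc Cn.simps by (intro exI[of _ "?\<eta> k"] conjI allI h Cn_bump)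
        qed
        have meas_h: "(\<lambda>p. h (rsq X p)) \<in> borel_measurable borel" "(\<lambda>p. ?\<eta> k (rsq X p)) \<in> borel_measurable borel"
          using Ck_on_compose[OF Cnh[of 0] Ck_on_rsq, of X] Ck_on_compose[OF Cn_bump[of 0] Ck_on_rsq, of "\<alpha>\<^sup>2" "\<beta>\<^sup>2" k X]
          by (auto intro: borel_measurable_continuous_onI)
        have b1: "\<bar>?\<eta> k s\<bar> \<le> 1" for s using bump_bounds[of "\<alpha>\<^sup>2" "\<beta>\<^sup>2" k s] by simp
        have R0: "h (R\<^sup>2) = 0" using ab True by (intro h0 power_mono) auto
        have "compact (h ` {0..R\<^sup>2})"
          by (intro compact_continuous_image conth) auto
        then obtain C where C: "\<And>s. s \<in> {0..R\<^sup>2} \<Longrightarrow> \<bar>h s\<bar> \<le> C"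
          using compact_imp_bounded[of "h ` {0..R\<^sup>2}"] unfolding bounded_real by blast
        have hb: "\<bar>h s\<bar> \<le> \<bar>C\<bar>" if "s \<ge> 0" for s
        proof (cases "s \<le> R\<^sup>2")
          case True
          then show ?thesis using C[of s] that by auto
        next
          case False
          moreover have "\<beta>\<^sup>2 \<le> R\<^sup>2" using ab \<open>\<alpha> < \<beta>\<close> by (intro power_mono) auto
          ultimately have "\<beta>\<^sup>2 \<le> s" by simp
          then show ?thesis using h0 by simp
        qed
        have ih: "integrable lborel (\<lambda>p. a p * h (rsq X p))"
          by (rule integrable_bounded_mult[OF a meas_h(1), where C="\<bar>C\<bar>"]) (simp add: hb rsq_def)
        have i\<eta>: "integrable lborel (\<lambda>p. b p * ?\<eta> k (rsq X p))"
          by (rule integrable_bounded_mult[OF b meas_h(2)]) (rule b1)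
        have "0 = (LINT p:ball X R|lborel. h (rsq X p) * a p + 2 * ?\<eta> k (rsq X p) * b p)"
          by (rule test[OF Cnh Cn_bump h _ _ h0, symmetric]) (use ab True in auto)
        also have "\<dots> = (LINT p:ball X R|lborel. h (rsq X p) * a p) + (LINT p:ball X R|lborel. 2 * ?\<eta> k (rsq X p) * b p)"
        proof (intro set_integral_add set_integrable_of_integrable)
          show "integrable lborel (\<lambda>p. h (rsq X p) * a p)" using ih by (simp add: mult.commute)
          show "integrable lborel (\<lambda>p. 2 * ?\<eta> k (rsq X p) * b p)"
            using integrable_mult_right[OF i\<eta>, of 2] by (simp add: mult_ac)
        qed auto
        also have "(LINT p:ball X R|lborel. h (rsq X p) * a p) = - (LINT s:{0<..<R}|lborel. 2 * s * ?\<eta> k (s\<^sup>2) * disc_int X s a)"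
          by (rule integral_radial_weight[OF a R c\<eta> b1 h R0])
        also have "(LINT p:ball X R|lborel. 2 * ?\<eta> k (rsq X p) * b p) = 2 * disc_int X R (\<lambda>p. b p * ?\<eta> k (rsq X p))"
          unfolding disc_int_def set_integral_mult_right[symmetric]
          by (intro set_lebesgue_integral_cong) (auto simp: mult_ac)
        also have "disc_int X R (\<lambda>p. b p * ?\<eta> k (rsq X p)) = (LINT t:{..R}|lborel. indicator {0<..} t * (?\<eta> k (t\<^sup>2) * circ_int X t b))"
          unfolding disc_int_polar[OF i\<eta>] by (simp add: circ_int_alt mult_ac)
        also have "\<dots> = (LINT t:{0<..<R}|lborel. ?\<eta> k (t\<^sup>2) * circ_int X t b)"
        proof -
          \<comment> \<open>Passing from \<open>{..R}\<close> to the open interval loses only the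
            endpoint \<open>R\<close>, where the bump vanishes.\<close>
          have "?\<eta> k (R\<^sup>2) = 0" using bump_nonzero[of "\<alpha>\<^sup>2" "\<beta>\<^sup>2" k "R\<^sup>2"] ab True power_mono[of \<beta> R 2] by fastforce
          then show ?thesis unfolding set_lebesgue_integral_def
            by (intro Bochner_Integration.integral_cong) (auto simp: indicator_def less_le)
        qed
        also have "(LINT s:{0<..<R}|lborel. 2 * s * ?\<eta> k (s\<^sup>2) * disc_int X s a) = 2 * (LINT t:{0<..<R}|lborel. ?\<eta> k (t\<^sup>2) * (t * disc_int X t a))"
          unfolding set_integral_mult_right[symmetric]
          by (intro set_lebesgue_integral_cong) (auto simp: mult_ac)
        finally have e: "(LINT t:{0<..<R}|lborel. ?\<eta> k (t\<^sup>2) * circ_int X t b) - (LINT t:{0<..<R}|lborel. ?\<eta> k (t\<^sup>2) * (t * disc_int X t a)) = 0"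
          by simp
        have m2: "(\<lambda>t. ?\<eta> k (t\<^sup>2)) \<in> borel_measurable borel" by measurable
        have "set_integrable lborel {0<..<R} (\<lambda>t. ?\<eta> k (t\<^sup>2) * circ_int X t b)"
          "set_integrable lborel {0<..<R} (\<lambda>t. ?\<eta> k (t\<^sup>2) * (t * disc_int X t a))"
          using integrable_bounded_mult[OF intb[unfolded set_integrable_def] m2 b1]
            integrable_bounded_mult[OF intA[unfolded set_integrable_def] m2 b1]
          by (simp_all add: set_integrable_def mult_ac)
        from set_integral_diff(2)[OF this] e show ?thesis by (simp add: right_diff_distrib)
      qed
      \<comment> \<open>Steepening the bump leaves the integral of \<open>?u\<close> over the
        arbitrary interval from \<open>\<alpha>\<close> to \<open>\<beta>\<close>; as all of these
        vanish, \<open>?u\<close> is zero almost everywhere.\<close>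
      have "(\<lambda>k. LINT t:{0<..<R}|lborel. ?\<eta> k (t\<^sup>2) * ?u t) \<longlonglongrightarrow> (LINT t:box \<alpha> \<beta>|lborel. ?u t)"
        unfolding set_lebesgue_integral_def
      proof (rule integral_dominated_convergence[where w="\<lambda>t. \<bar>indicator {0<..<R} t *\<^sub>R ?u t\<bar>"])
        have mu[measurable]: "(\<lambda>t. indicator {0<..<R} t *\<^sub>R ?u t) \<in> borel_measurable borel"
          using intu unfolding set_integrable_def by (simp add: borel_measurable_integrable)
        have eqb: "indicator (box \<alpha> \<beta>) t *\<^sub>R ?u t = indicator {\<alpha><..<\<beta>} t * (indicator {0<..<R} t *\<^sub>R ?u t)" for t
          using ab by (auto simp: indicator_def)
        show "(\<lambda>t. indicator (box \<alpha> \<beta>) t *\<^sub>R ?u t) \<in> borel_measurable lborel"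
          unfolding eqb measurable_lborel2 by (intro borel_measurable_times mu) measurable
        have eqk: "indicator {0<..<R} t *\<^sub>R (?\<eta> k (t\<^sup>2) * ?u t) = ?\<eta> k (t\<^sup>2) * (indicator {0<..<R} t *\<^sub>R ?u t)" for t k
          by simp
        show "(\<lambda>t. indicator {0<..<R} t *\<^sub>R (?\<eta> k (t\<^sup>2) * ?u t)) \<in> borel_measurable lborel" for k
          unfolding eqk measurable_lborel2 by (intro borel_measurable_times mu) measurable
        show "integrable lborel (\<lambda>t. \<bar>indicator {0<..<R} t *\<^sub>R ?u t\<bar>)"
          using intu unfolding set_integrable_def by (rule integrable_abs)
        show "AE t in lborel. (\<lambda>k. indicator {0<..<R} t *\<^sub>R (?\<eta> k (t\<^sup>2) * ?u t)) \<longlonglongrightarrow> indicator (box \<alpha> \<beta>) t *\<^sub>R ?u t"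
        proof (rule AE_I2)
          fix t
          have "(\<lambda>k. indicator {0<..<R} t *\<^sub>R (?\<eta> k (t\<^sup>2) * ?u t)) \<longlonglongrightarrow> indicator {0<..<R} t *\<^sub>R (indicator {\<alpha>\<^sup>2<..<\<beta>\<^sup>2} (t\<^sup>2) * ?u t)"
            by (intro tendsto_intros bump_tendsto)
          also have "indicator {0<..<R} t *\<^sub>R (indicator {\<alpha>\<^sup>2<..<\<beta>\<^sup>2} (t\<^sup>2) * ?u t) = indicator (box \<alpha> \<beta>) t *\<^sub>R ?u t"
          proof (cases "0 < t \<and> t < R")
            case t: True
            then have "\<alpha>\<^sup>2 < t\<^sup>2 \<longleftrightarrow> \<alpha> < t" "t\<^sup>2 < \<beta>\<^sup>2 \<longleftrightarrow> t < \<beta>"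
              using ab \<open>\<alpha> < \<beta>\<close> by (simp_all add: power_mono_iff not_le[symmetric])
            then show ?thesis using t by (simp add: indicator_def)
          qed (use ab in \<open>auto simp: indicator_def\<close>)
          finally show "(\<lambda>k. indicator {0<..<R} t *\<^sub>R (?\<eta> k (t\<^sup>2) * ?u t)) \<longlonglongrightarrow> indicator (box \<alpha> \<beta>) t *\<^sub>R ?u t" .
        qed
        show "AE t in lborel. norm (indicator {0<..<R} t *\<^sub>R (?\<eta> k (t\<^sup>2) * ?u t)) \<le> \<bar>indicator {0<..<R} t *\<^sub>R ?u t\<bar>" for k
          using bump_bounds[of "\<alpha>\<^sup>2" "\<beta>\<^sup>2" k] by (auto simp: abs_mult indicator_def intro!: AE_I2 mult_left_le_one_le)
      qed
      then show ?thesis unfolding zero by (simp add: LIMSEQ_const_iff)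
    qed (simp add: set_lebesgue_integral_def)
  qed auto
  then show ?thesis by eventually_elim auto
qed

section \<open>Truncation near the free boundary\<close>

lemma compact_support_set_integrable:
  fixes w :: "point \<Rightarrow> real"
  assumes P: "open P" and C: "compact C" "C \<subseteq> P" and w: "continuous_on P w" and z: "\<And>p. p \<in> P - C \<Longrightarrow> w p = 0"
    and S: "C \<subseteq> S" "S \<subseteq> P"
  shows "set_integrable lborel S w"
proof -
  have "integrable lborel (\<lambda>p. if p \<in> C then w p else 0)"
    by (rule zero_extension_integrable[OF C(1) zero_extension_continuous[OF P C w z]])
  moreover have "indicator S p *\<^sub>R w p = (if p \<in> C then w p else 0)" for p
    using z[of p] S by (auto simp: indicator_def)
  ultimately show ?thesis by (simp add: set_integrable_def)
qed

text \<open>Squaring removes the corner of the positive part; this is why the truncation below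
  contains a square.\<close>

lemma max_square_has_derivative: "((\<lambda>z::real. (max z 0)\<^sup>2) has_real_derivative 2 * max z 0) (at z)"
proof -
  consider "z > 0" | "z < 0" | "z = 0" by linarith
  then show ?thesis
  proof cases
    case 1
    have "((\<lambda>z::real. z\<^sup>2) has_real_derivative 2 * max z 0) (at z)" using 1 by (auto intro!: derivative_eq_intros)
    then show ?thesis by (rule has_field_derivative_transform_within_open[where S="{0<..}"]) (use 1 in auto)
  next
    case 2
    have "((\<lambda>z::real. 0) has_real_derivative 2 * max z 0) (at z)" using 2 by auto
    then show ?thesis by (rule has_field_derivative_transform_within_open[where S="{..<0}"]) (use 2 in auto)
  next
    case 3
    have "((\<lambda>h::real. \<bar>h\<bar>) \<longlongrightarrow> 0) (at 0)" by (auto intro!: tendsto_eq_intros)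
    moreover have "eventually (\<lambda>h::real. norm (((max h 0)\<^sup>2 - (max 0 0)\<^sup>2) / (h - 0)) \<le> \<bar>h\<bar>) (at 0)"
      by (rule always_eventually) (auto simp: max_def power2_eq_square)
    ultimately have "((\<lambda>h::real. ((max h 0)\<^sup>2 - (max 0 0)\<^sup>2) / (h - 0)) \<longlongrightarrow> 0) (at 0)"
      by (rule Lim_null_comparison[rotated])
    then show ?thesis unfolding 3 has_field_derivative_iff by simp
  qed
qed

text \<open>The truncation of a value \<open>z > 0\<close> is
  \<open>z * (ratio_cut n z)\<^sup>2\<close>, that is, the squared positive part of
  \<open>z - 1 / Suc n\<close> divided by \<open>z\<close>. It is C^1, vanishes for \<open>z\<close>
  at most \<open>1 / Suc n\<close>, and tends to \<open>z\<close>.\<close>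

definition ratio_cut :: "nat \<Rightarrow> real \<Rightarrow> real" where
  "ratio_cut n z = max (z - 1 / Suc n) 0 / z"

lemma ratio_cut_bounds: "z > 0 \<Longrightarrow> 0 \<le> ratio_cut n z" "z > 0 \<Longrightarrow> ratio_cut n z \<le> 1"
  by (auto simp: ratio_cut_def field_simps max_def)

lemma ratio_cut_tendsto: "z > 0 \<Longrightarrow> (\<lambda>n. ratio_cut n z) \<longlonglongrightarrow> 1"
proof -
  assume z: "z > 0"
  have "(\<lambda>n. max (z - 1 / Suc n) 0 / z) \<longlonglongrightarrow> max (z - 0) 0 / z"
    by (intro tendsto_intros LIMSEQ_Suc[OF lim_1_over_n]) (use z in auto)
  then show ?thesis using z by (simp add: ratio_cut_def)
qed

text \<open>Both this derivative and the factor \<open>(ratio_cut n z)\<^sup>2\<close> lie between 0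
  and 1 and tend to 1. Truncating therefore costs no bound on the gradient: integrability of the
  limit integrands suffices for dominated convergence.\<close>

lemma truncated_has_derivative:
  assumes z: "z > 0"
  shows "((\<lambda>z. z * (ratio_cut n z)\<^sup>2) has_real_derivative 2 * ratio_cut n z - (ratio_cut n z)\<^sup>2) (at z)"
proof -
  let ?m = "max (z - 1 / Suc n) 0"
  have "((\<lambda>z. (max (z - 1 / Suc n) 0)\<^sup>2) has_real_derivative (2 * ?m) * 1) (at z)"
    by (rule DERIV_chain2[where f="\<lambda>z. (max z 0)\<^sup>2"]) (auto intro!: max_square_has_derivative derivative_eq_intros)
  from DERIV_divide[OF this DERIV_ident] z
  have "((\<lambda>z. (max (z - 1 / Suc n) 0)\<^sup>2 / z) has_real_derivative ((2 * ?m) * z - ?m\<^sup>2) / (z * z)) (at z)"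
    by simp
  also have "((2 * ?m) * z - ?m\<^sup>2) / (z * z) = 2 * ratio_cut n z - (ratio_cut n z)\<^sup>2"
    using z by (simp add: ratio_cut_def field_simps power2_eq_square)
  finally show ?thesis
    by (rule has_field_derivative_transform_within_open[where S="{0<..}"])
       (use z in \<open>auto simp: ratio_cut_def power2_eq_square\<close>)
qed

lemma ratio_cut_continuous: "continuous_on {0<..} (ratio_cut n)"
  unfolding ratio_cut_def[abs_def] by (intro continuous_intros) auto

section \<open>The ball around a point of \<open>S_s\<close> and its elementary geometry\<close>

locale degenerate_point =
  fixes \<Omega> :: "point set" and f :: "real \<Rightarrow> real" and \<psi> :: "point \<Rightarrow> real" and g :: "point \<Rightarrow> point" and x0 :: real
  assumes \<Omega>_sub: "\<Omega> \<subseteq> halfplane"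
    and \<Omega>_open: "openin (top_of_set halfplane) \<Omega>"
    and f_cont: "continuous_on UNIV f"
    and var: "variational_solution \<Omega> f \<psi> g"
    and growth: "\<exists>C. \<forall>X1 \<in> \<Omega> \<inter> frontier (positivity_set \<Omega> \<psi>). \<exists>r>0.
                   AE X in lborel. X \<in> ball X1 r \<inter> \<Omega> \<longrightarrow>
                     gsq g X / (fst X)\<^sup>2 \<le> C * (\<bar>snd X\<bar> + \<bar>fst X - fst X1\<bar>)"
    and Xc_in: "(x0, 0) \<in> S_s \<Omega> \<psi>"
begin

definition Xc :: point where "Xc = (x0, 0)"
text \<open>Because \<open>delta\<close> is half a minimum, even the ball of radius
  \<open>2 * R\<close> lies in \<open>\<Omega>\<close> and off the line \<open>x = 0\<close>, so the
  closed ball of radius \<open>R\<close> is a compact set with room around it.\<close>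

definition R :: real where "R = delta \<Omega> Xc"
definition U :: "point set" where "U = ball Xc R"
definition P :: "point set" where "P = {p \<in> U. \<psi> p > 0}"
text \<open>\<open>G1\<close> and \<open>G2\<close> extend the classical gradient by zero. Unlike
  \<open>g\<close> they are Borel on the whole plane and vanish at every point outside
  \<open>P\<close>, so they can be restricted to circles.\<close>

definition G1 :: "point \<Rightarrow> real" where "G1 p = indicator P p * px \<psi> p"
definition G2 :: "point \<Rightarrow> real" where "G2 p = indicator P p * py \<psi> p"

lemma x0_pos: "x0 > 0" and Xc_Omega: "Xc \<in> \<Omega>" and Xc_frontier: "Xc \<in> frontier (positivity_set \<Omega> \<psi>)"
  using Xc_in by (auto simp: S_s_def Xc_def)

lemma Xc_interior: "Xc \<in> interior \<Omega>"
proof -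
  obtain T where T: "open T" "\<Omega> = halfplane \<inter> T" using \<Omega>_open by (auto simp: openin_open)
  have "open (T \<inter> {p. fst p > 0})" using T by (intro open_Int open_Collect_less continuous_intros)
  moreover have "T \<inter> {p. fst p > 0} \<subseteq> \<Omega>" using T by (auto simp: halfplane_def)
  moreover have "Xc \<in> T \<inter> {p. fst p > 0}" using T Xc_Omega x0_pos by (auto simp: Xc_def)
  ultimately show ?thesis by (meson interiorI)
qed

lemma R_pos: "R > 0" and ball_2R: "ball Xc (2 * R) \<subseteq> \<Omega>" and R_le: "2 * R \<le> x0"
proof -
  have nf: "Xc \<notin> frontier \<Omega>" using Xc_interior by (auto simp: frontier_def)
  \<comment> \<open>\<open>infdist\<close> to the empty set is 0, so a positive radius requires a
    nonempty frontier.\<close>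
  have ne: "frontier \<Omega> \<noteq> {}"
  proof -
    have "(-1, 0) \<notin> \<Omega>" using \<Omega>_sub by (auto simp: halfplane_def)
    then have "\<Omega> \<noteq> UNIV" by auto
    moreover have "\<Omega> \<noteq> {}" using Xc_Omega by auto
    ultimately show ?thesis by (simp add: frontier_eq_empty)
  qed
  have pos: "infdist Xc (frontier \<Omega>) > 0"
    using infdist_pos_not_in_closed[OF frontier_closed ne nf] .
  then show "R > 0" using x0_pos by (simp add: R_def delta_def Xc_def)
  show "2 * R \<le> x0" by (simp add: R_def delta_def Xc_def)
  have le: "2 * R \<le> infdist Xc (frontier \<Omega>)" by (simp add: R_def delta_def)
  have "ball Xc (2 * R) \<inter> frontier \<Omega> = {}"
  proof (rule ccontr)
    assume "ball Xc (2 * R) \<inter> frontier \<Omega> \<noteq> {}"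
    then obtain p where p: "p \<in> ball Xc (2 * R)" "p \<in> frontier \<Omega>" by auto
    from infdist_le[OF p(2), of Xc] le p(1) show False by simp
  qed
  moreover have "Xc \<in> ball Xc (2 * R)" using \<open>R > 0\<close> by simp
  then have "ball Xc (2 * R) \<inter> \<Omega> \<noteq> {}" using Xc_Omega by blast
  ultimately show "ball Xc (2 * R) \<subseteq> \<Omega>"
    using connected_Int_frontier[of "ball Xc (2 * R)" \<Omega>] by blast
qed

lemma ball_interior: "ball Xc (2 * R) \<subseteq> interior \<Omega>" and cball_ball: "cball Xc R \<subseteq> ball Xc (2 * R)"
  and cball_interior: "cball Xc R \<subseteq> interior \<Omega>" and cball_Omega: "cball Xc R \<subseteq> \<Omega>"
proof -
  show 1: "ball Xc (2 * R) \<subseteq> interior \<Omega>" using ball_2R by (simp add: interior_maximal)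
  show 2: "cball Xc R \<subseteq> ball Xc (2 * R)" using R_pos by auto
  show "cball Xc R \<subseteq> interior \<Omega>" "cball Xc R \<subseteq> \<Omega>" using 1 2 ball_2R by auto
qed

lemma U_sub: "U \<subseteq> cball Xc R" "U \<subseteq> interior \<Omega>" "U \<subseteq> \<Omega>" and open_U: "open U"
  using cball_interior cball_Omega ball_subset_cball[of Xc R] by (auto simp: U_def)

text \<open>Two-sided bounds for \<open>x\<close> make the weight \<open>1/x\<close> harmless on the
  ball; the degeneracy at the line \<open>x = 0\<close> is never met.\<close>

lemma fst_lower: "p \<in> cball Xc R \<Longrightarrow> x0 / 2 \<le> fst p" and fst_pos: "p \<in> U \<Longrightarrow> 0 < fst p"
  and fst_upper: "p \<in> cball Xc R \<Longrightarrow> fst p \<le> 2 * x0"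
proof -
  have *: "x0 / 2 \<le> fst p \<and> fst p \<le> 2 * x0" if "p \<in> cball Xc R" for p
  proof -
    have "\<bar>fst Xc - fst p\<bar> \<le> dist Xc p" using dist_fst_le[of Xc p] by (simp add: dist_real_def)
    then show ?thesis using that R_le R_pos x0_pos by (auto simp: Xc_def)
  qed
  show "p \<in> cball Xc R \<Longrightarrow> x0 / 2 \<le> fst p" "p \<in> cball Xc R \<Longrightarrow> fst p \<le> 2 * x0" using * by auto
  show "p \<in> U \<Longrightarrow> 0 < fst p" using * U_sub x0_pos by fastforce
qed

lemma psi_cont: "continuous_on \<Omega> \<psi>" and psi_nonneg: "p \<in> \<Omega> \<Longrightarrow> \<psi> p \<ge> 0"
  and psi_lower: "p \<in> \<Omega> \<Longrightarrow> snd p \<le> 0 \<Longrightarrow> \<psi> p = 0"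
  and psi_Ck: "Ck_on 2 (positivity_set \<Omega> \<psi>) \<psi>"
  and weak: "weak_gradient (interior \<Omega>) \<psi> g"
  using var by (auto simp: variational_solution_def W12w_loc_def)

lemma psi_Xc: "\<psi> Xc = 0" using psi_lower[OF Xc_Omega] by (simp add: Xc_def)

lemma psi_cont_U: "continuous_on U \<psi>" using psi_cont U_sub(3) by (rule continuous_on_subset)

lemma open_P: "open P" and P_sub: "P \<subseteq> U" "P \<subseteq> positivity_set \<Omega> \<psi>"
proof -
  have "open (\<psi> -` {0<..} \<inter> U)"
    by (rule iffD1[OF continuous_on_open_vimage[OF open_U] psi_cont_U, rule_format]) simp
  moreover have "\<psi> -` {0<..} \<inter> U = P" by (auto simp: P_def)
  ultimately show "open P" by simp
  show "P \<subseteq> U" "P \<subseteq> positivity_set \<Omega> \<psi>" using U_sub by (auto simp: P_def positivity_set_def)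
qed

lemma psi_diff:
  assumes "p \<in> P"
  shows "\<psi> differentiable (at p)" "px \<psi> differentiable (at p)" "py \<psi> differentiable (at p)"
  using psi_Ck P_sub(2) assms by (auto simp: numeral_2_eq_2 simp del: split_paired_All)

lemma psi_cont2:
  "continuous_on P \<psi>" "continuous_on P (px \<psi>)" "continuous_on P (py \<psi>)"
  "continuous_on P (px (px \<psi>))" "continuous_on P (py (px \<psi>))" "continuous_on P (px (py \<psi>))" "continuous_on P (py (py \<psi>))"
proof -
  show "continuous_on P \<psi>" using psi_cont_U P_sub(1) by (rule continuous_on_subset)
  show "continuous_on P (px \<psi>)" "continuous_on P (py \<psi>)"
    using psi_diff by (auto intro!: continuous_at_imp_continuous_on differentiable_imp_continuous_within)
  show "continuous_on P (px (px \<psi>))" "continuous_on P (py (px \<psi>))" "continuous_on P (px (py \<psi>))" "continuous_on P (py (py \<psi>))"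
    using psi_Ck P_sub(2) by (auto simp: numeral_2_eq_2 intro: continuous_on_subset)
qed

text \<open>The abstract cut-off \<open>c n\<close> serves both for the factor on
  \<open>\<psi>\<close> and for the factor on its gradient.\<close>

lemma integral_ratio_cut_tendsto:
  assumes w: "set_integrable lborel P w"
    and cn: "\<And>n. continuous_on {0<..} (c n)" "\<And>n z. z > 0 \<Longrightarrow> \<bar>c n z\<bar> \<le> 1" "\<And>z. z > 0 \<Longrightarrow> (\<lambda>n. c n z) \<longlonglongrightarrow> (1::real)"
  shows "(\<lambda>n. LINT p:P|lborel. c n (\<psi> p) * w p) \<longlonglongrightarrow> (LINT p:P|lborel. w p)"
    and "set_integrable lborel P (\<lambda>p. c n (\<psi> p) * w p)"
proof -
  have [measurable]: "(\<lambda>p. indicator P p *\<^sub>R w p) \<in> borel_measurable borel"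
    using w unfolding set_integrable_def by (simp add: borel_measurable_integrable)
  have mc[measurable]: "(\<lambda>p. indicator P p *\<^sub>R c n (\<psi> p)) \<in> borel_measurable borel" for n
    using open_P by (intro borel_measurable_continuous_on_indicator continuous_on_compose2[OF cn(1) psi_cont2(1)]) (auto simp: P_def)
  have eq: "indicator P p *\<^sub>R (c n (\<psi> p) * w p) = (indicator P p *\<^sub>R c n (\<psi> p)) * (indicator P p *\<^sub>R w p)" for n p
    by (simp add: indicator_def)
  have bd: "norm (indicator P p *\<^sub>R (c n (\<psi> p) * w p)) \<le> \<bar>indicator P p *\<^sub>R w p\<bar>" for n p
    using cn(2)[of "\<psi> p" n] by (auto simp: indicator_def P_def abs_mult intro: mult_left_le_one_le)
  have meas: "(\<lambda>p. indicator P p *\<^sub>R (c n (\<psi> p) * w p)) \<in> borel_measurable lborel" for n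
    unfolding eq measurable_lborel2 by measurable
  have absw: "integrable lborel (\<lambda>p. \<bar>indicator P p *\<^sub>R w p\<bar>)"
    using w unfolding set_integrable_def by (rule integrable_abs)
  show "(\<lambda>n. LINT p:P|lborel. c n (\<psi> p) * w p) \<longlonglongrightarrow> (LINT p:P|lborel. w p)"
    unfolding set_lebesgue_integral_def
  proof (rule integral_dominated_convergence[OF _ meas absw])
    show "AE p in lborel. (\<lambda>n. indicator P p *\<^sub>R (c n (\<psi> p) * w p)) \<longlonglongrightarrow> indicator P p *\<^sub>R w p"
    proof (rule AE_I2)
      fix p
      show "(\<lambda>n. indicator P p *\<^sub>R (c n (\<psi> p) * w p)) \<longlonglongrightarrow> indicator P p *\<^sub>R w p"
      proof (cases "p \<in> P")
        case True
        then have "(\<lambda>n. indicator P p *\<^sub>R (c n (\<psi> p) * w p)) \<longlonglongrightarrow> indicator P p *\<^sub>R (1 * w p)"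
          by (intro tendsto_intros cn(3)) (auto simp: P_def)
        then show ?thesis by simp
      qed simp
    qed
    show "AE p in lborel. norm (indicator P p *\<^sub>R (c n (\<psi> p) * w p)) \<le> \<bar>indicator P p *\<^sub>R w p\<bar>" for n
      using bd by (intro AE_I2)
  qed measurable
  show "set_integrable lborel P (\<lambda>p. c n (\<psi> p) * w p)"
    unfolding set_integrable_def
    by (rule Bochner_Integration.integrable_bound[OF absw meas]) (use bd in auto)
qed

text \<open>The field (A, B) need not vanish near the free boundary, so the divergence theorem is
  applied to its product with a truncation of \<open>\<psi>\<close> that does.\<close>

lemma truncated_divergence:
  fixes A B :: "point \<Rightarrow> real"
  assumes K: "compact K" "K \<subseteq> U"
    and supp: "\<And>p. p \<in> P - K \<Longrightarrow> A p = 0 \<and> B p = 0 \<and> Ax p = 0 \<and> By p = 0"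
    and cont: "continuous_on P A" "continuous_on P B" "continuous_on P Ax" "continuous_on P By"
    and DA: "\<And>p. p \<in> P \<Longrightarrow> ((\<lambda>t. A (t, snd p)) has_real_derivative Ax p) (at (fst p))"
    and DB: "\<And>p. p \<in> P \<Longrightarrow> ((\<lambda>t. B (fst p, t)) has_real_derivative By p) (at (snd p))"
    and int: "set_integrable lborel P (\<lambda>p. px \<psi> p * A p + py \<psi> p * B p)"
      "set_integrable lborel P (\<lambda>p. \<psi> p * (Ax p + By p))"
  shows "(LINT p:P|lborel. px \<psi> p * A p + py \<psi> p * B p) + (LINT p:P|lborel. \<psi> p * (Ax p + By p)) = 0"
proof -
  let ?r = ratio_cut
  let ?c1 = "\<lambda>n z. 2 * ?r n z - (?r n z)\<^sup>2" and ?c2 = "\<lambda>n z. (?r n z)\<^sup>2"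
  have cc: "continuous_on {0<..} (?c1 n)" "continuous_on {0<..} (?c2 n)" for n
    by (intro continuous_intros ratio_cut_continuous)+
  have b1: "\<bar>?c1 n z\<bar> \<le> 1" if "z > 0" for n z
  proof -
    have "?c1 n z = 1 - (1 - ?r n z)\<^sup>2" by (simp add: power2_eq_square algebra_simps)
    moreover have "(1 - ?r n z)\<^sup>2 \<le> 1" using ratio_cut_bounds[OF that, of n] by (intro power_le_one) auto
    ultimately show ?thesis by (simp add: abs_le_iff)
  qed
  have b2: "\<bar>?c2 n z\<bar> \<le> 1" if "z > 0" for n z
    using ratio_cut_bounds[OF that, of n] by (simp add: power_le_one)
  have l1: "(\<lambda>n. ?c1 n z) \<longlonglongrightarrow> 1" and l2: "(\<lambda>n. ?c2 n z) \<longlonglongrightarrow> 1" if "z > 0" for z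
    using tendsto_intros ratio_cut_tendsto[OF that] by (auto intro!: tendsto_eq_intros)
  have comp: "continuous_on P (\<lambda>p. c (\<psi> p))" if "continuous_on {0<..} c" for c :: "real \<Rightarrow> real"
    by (rule continuous_on_compose2[OF that psi_cont2(1)]) (auto simp: P_def)
  have zero: "(LINT p:P|lborel. ?c1 n (\<psi> p) * (px \<psi> p * A p + py \<psi> p * B p))
      + (LINT p:P|lborel. ?c2 n (\<psi> p) * (\<psi> p * (Ax p + By p))) = 0" for n
  proof -
    \<comment> \<open>In \<open>P\<close> the truncated field vanishes off \<open>C\<close>: on
      \<open>K\<close> because the truncation does, outside \<open>K\<close> because the field does.
      \<open>C\<close> is compact inside \<open>P\<close>, since \<open>\<psi>\<close> is continuous
      on the closed ball and at least \<open>1 / Suc n\<close> on \<open>C\<close>.\<close>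
    define C where "C = K \<inter> {p \<in> cball Xc R. 1 / Suc n \<le> \<psi> p}"
    have "closed {p \<in> cball Xc R. 1 / Suc n \<le> \<psi> p}"
      using continuous_on_closed_Collect_le[OF continuous_on_const continuous_on_subset[OF psi_cont cball_Omega]] by simp
    then have C: "compact C" using K(1) by (simp add: C_def compact_Int_closed)
    have CP: "C \<subseteq> P"
    proof
      fix p assume "p \<in> C"
      then have "p \<in> K" "1 / Suc n \<le> \<psi> p" by (auto simp: C_def)
      moreover from this(2) have "0 < \<psi> p" by (rule less_le_trans[rotated]) simp
      ultimately show "p \<in> P" using K(2) by (auto simp: P_def)
    qed
    have r0: "?r n (\<psi> p) = 0" if "p \<in> P" "p \<notin> C" "p \<in> K" for p
      using that K(2) U_sub(1) by (auto simp: C_def ratio_cut_def P_def)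
    define \<theta> where "\<theta> p = (if p \<in> P then \<psi> p * ?c2 n (\<psi> p) else 0)" for p
    have v0: "\<theta> p * A p = 0" "\<theta> p * B p = 0" if "p \<notin> C" for p
      using r0[of p] supp[of p] that by (auto simp: \<theta>_def)
    have near: "eventually (\<lambda>t. (t, snd p) \<in> P) (nhds (fst p))" "eventually (\<lambda>t. (fst p, t) \<in> P) (nhds (snd p))" if "p \<in> P" for p
    proof -
      have o: "open ((\<lambda>t. (t, snd p)) -` P)" "open ((\<lambda>t. (fst p, t)) -` P)"
        by (intro open_vimage[OF open_P] continuous_intros)+
      show "eventually (\<lambda>t. (t, snd p) \<in> P) (nhds (fst p))"
        using eventually_nhds_in_open[OF o(1), of "fst p"] that by (simp add: vimage_def)
      show "eventually (\<lambda>t. (fst p, t) \<in> P) (nhds (snd p))"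
        using eventually_nhds_in_open[OF o(2), of "snd p"] that by (simp add: vimage_def)
    qed
    have pos: "\<psi> p > 0" if "p \<in> P" for p using that by (simp add: P_def)
    have dx: "((\<lambda>t. \<theta> (t, snd p)) has_real_derivative ?c1 n (\<psi> p) * px \<psi> p) (at (fst p))" if p: "p \<in> P" for p
    proof -
      have "((\<lambda>t. \<psi> (t, snd p) * ?c2 n (\<psi> (t, snd p))) has_real_derivative ?c1 n (\<psi> p) * px \<psi> p) (at (fst p))"
        by (rule DERIV_chain2[where f="\<lambda>z. z * ?c2 n z"]) (use truncated_has_derivative[OF pos[OF p], of n] differentiable_px[OF psi_diff(1)[OF p]] in auto)
      moreover have "eventually (\<lambda>t. \<theta> (t, snd p) = \<psi> (t, snd p) * ?c2 n (\<psi> (t, snd p))) (nhds (fst p))"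
        using near(1)[OF p] by eventually_elim (simp add: \<theta>_def)
      ultimately show ?thesis by (subst DERIV_cong_ev[OF refl _ refl])
    qed
    have dy: "((\<lambda>t. \<theta> (fst p, t)) has_real_derivative ?c1 n (\<psi> p) * py \<psi> p) (at (snd p))" if p: "p \<in> P" for p
    proof -
      have "((\<lambda>t. \<psi> (fst p, t) * ?c2 n (\<psi> (fst p, t))) has_real_derivative ?c1 n (\<psi> p) * py \<psi> p) (at (snd p))"
        by (rule DERIV_chain2[where f="\<lambda>z. z * ?c2 n z"]) (use truncated_has_derivative[OF pos[OF p], of n] differentiable_py[OF psi_diff(1)[OF p]] in auto)
      moreover have "eventually (\<lambda>t. \<theta> (fst p, t) = \<psi> (fst p, t) * ?c2 n (\<psi> (fst p, t))) (nhds (snd p))"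
        using near(2)[OF p] by eventually_elim (simp add: \<theta>_def)
      ultimately show ?thesis by (subst DERIV_cong_ev[OF refl _ refl])
    qed
    have c\<theta>: "continuous_on P \<theta>"
      by (rule continuous_on_cong[THEN iffD1, OF refl _ continuous_on_mult[OF psi_cont2(1) comp[OF cc(2)[of n]]]]) (simp add: \<theta>_def)
    let ?vx = "\<lambda>p. ?c1 n (\<psi> p) * px \<psi> p * A p + \<theta> p * Ax p" and ?vy = "\<lambda>p. ?c1 n (\<psi> p) * py \<psi> p * B p + \<theta> p * By p"
    have ix: "set_integrable lborel P ?vx \<and> (LINT p:P|lborel. ?vx p) = 0"
    proof (rule integral_px_zero[OF open_P C CP v0(1) CP order_refl])
      show "((\<lambda>t. \<theta> (t, snd p) * A (t, snd p)) has_real_derivative ?vx p) (at (fst p))" if "p \<in> P" for p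
        using DERIV_mult[OF dx[OF that] DA[OF that]] by (simp add: mult.commute add.commute)
      show "continuous_on P ?vx" by (intro continuous_intros comp[OF cc(1)] psi_cont2 cont c\<theta>)
    qed
    have iy: "set_integrable lborel P ?vy \<and> (LINT p:P|lborel. ?vy p) = 0"
    proof (rule integral_py_zero[OF open_P C CP v0(2) CP order_refl])
      show "((\<lambda>t. \<theta> (fst p, t) * B (fst p, t)) has_real_derivative ?vy p) (at (snd p))" if "p \<in> P" for p
        using DERIV_mult[OF dy[OF that] DB[OF that]] by (simp add: mult.commute add.commute)
      show "continuous_on P ?vy" by (intro continuous_intros comp[OF cc(1)] psi_cont2 cont c\<theta>)
    qed
    \<comment> \<open>Adding the components gives the divergence of the truncated field, split into
      the two terms whose limits are wanted.\<close>
    have "0 = (LINT p:P|lborel. ?vx p + ?vy p)"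
      using ix iy by (subst set_integral_add) auto
    also have "\<dots> = (LINT p:P|lborel. ?c1 n (\<psi> p) * (px \<psi> p * A p + py \<psi> p * B p) + ?c2 n (\<psi> p) * (\<psi> p * (Ax p + By p)))"
      using open_P by (intro set_lebesgue_integral_cong) (auto simp: \<theta>_def algebra_simps)
    also have "\<dots> = (LINT p:P|lborel. ?c1 n (\<psi> p) * (px \<psi> p * A p + py \<psi> p * B p))
      + (LINT p:P|lborel. ?c2 n (\<psi> p) * (\<psi> p * (Ax p + By p)))"
      by (intro set_integral_add integral_ratio_cut_tendsto(2) int cc b1 b2 l1 l2)
    finally show ?thesis by simp
  qed
  have "(\<lambda>n. (LINT p:P|lborel. ?c1 n (\<psi> p) * (px \<psi> p * A p + py \<psi> p * B p))
      + (LINT p:P|lborel. ?c2 n (\<psi> p) * (\<psi> p * (Ax p + By p))))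
    \<longlonglongrightarrow> (LINT p:P|lborel. px \<psi> p * A p + py \<psi> p * B p) + (LINT p:P|lborel. \<psi> p * (Ax p + By p))"
    by (intro tendsto_add integral_ratio_cut_tendsto(1) int cc b1 b2 l1 l2)
  then show ?thesis unfolding zero by (simp add: LIMSEQ_const_iff)
qed

end

section \<open>The weak gradient\<close>

context degenerate_point begin

lemma px_py_zero_off_support:
  assumes "p \<notin> closure {p. \<phi> p \<noteq> 0}"
  shows "px \<phi> p = 0" "py \<phi> p = 0"
proof -
  have o: "open (- closure {p. \<phi> p \<noteq> 0})" by (rule open_Compl[OF closed_closure])
  have z: "\<phi> q = 0" if "q \<in> - closure {p. \<phi> p \<noteq> 0}" for q
    using that closure_subset[of "{p. \<phi> p \<noteq> 0}"] by auto
  have o2: "open ((\<lambda>t. (t, snd p)) -` (- closure {p. \<phi> p \<noteq> 0}))" "open ((\<lambda>t. (fst p, t)) -` (- closure {p. \<phi> p \<noteq> 0}))"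
    by (intro open_vimage[OF o] continuous_intros)+
  have ev: "eventually (\<lambda>t. \<phi> (t, snd p) = 0) (nhds (fst p))"
    by (rule eventually_mono[OF eventually_nhds_in_open[OF o2(1), of "fst p"]])
       (simp only: vimage_eq prod.collapse Compl_iff assms simp_thms, rule z, erule vimageD)
  have ev2: "eventually (\<lambda>t. \<phi> (fst p, t) = 0) (nhds (snd p))"
    by (rule eventually_mono[OF eventually_nhds_in_open[OF o2(2), of "snd p"]])
       (simp only: vimage_eq prod.collapse Compl_iff assms simp_thms, rule z, erule vimageD)
  have "((\<lambda>t. \<phi> (t, snd p)) has_real_derivative 0) (at (fst p))"
    by (rule DERIV_cong_ev[OF refl ev refl, THEN iffD2]) simp
  then show "px \<phi> p = 0" by (rule px_eqI)
  have "((\<lambda>t. \<phi> (fst p, t)) has_real_derivative 0) (at (snd p))"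
    by (rule DERIV_cong_ev[OF refl ev2 refl, THEN iffD2]) simp
  then show "py \<phi> p = 0" by (rule py_eqI)
qed

lemma set_integrable_times_test:
  fixes h \<phi> :: "point \<Rightarrow> real"
  assumes h: "set_integrable lborel C h" and C: "compact C" "C \<subseteq> W" and \<phi>: "continuous_on UNIV \<phi>" "\<And>p. p \<notin> C \<Longrightarrow> \<phi> p = 0"
  shows "set_integrable lborel W (\<lambda>p. h p * \<phi> p)"
proof -
  have "compact (\<phi> ` C)" using C(1) \<phi>(1) by (intro compact_continuous_image continuous_on_subset[OF \<phi>(1)]) auto
  then obtain M where M: "\<And>p. p \<in> C \<Longrightarrow> \<bar>\<phi> p\<bar> \<le> M"
    using compact_imp_bounded[of "\<phi> ` C"] unfolding bounded_real by blast
  have "integrable lborel (\<lambda>p. (indicator C p *\<^sub>R h p) * \<phi> p)"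
  proof (rule integrable_bounded_mult[where C="\<bar>M\<bar>"])
    show "\<bar>\<phi> p\<bar> \<le> \<bar>M\<bar>" for p using M[of p] \<phi>(2)[of p] by (cases "p \<in> C") auto
  qed (use h \<phi>(1) in \<open>auto simp: set_integrable_def intro: borel_measurable_continuous_onI\<close>)
  moreover have eq: "(indicator C p *\<^sub>R h p) * \<phi> p = indicator W p *\<^sub>R (h p * \<phi> p)" for p
    using \<phi>(2)[of p] C(2) by (auto simp: indicator_def)
  ultimately show ?thesis unfolding set_integrable_def eq by simp
qed

lemma smooth_D:
  assumes "smooth \<phi>"
  shows "\<phi> differentiable (at p)" "continuous_on S \<phi>" "continuous_on S (px \<phi>)" "continuous_on S (py \<phi>)"
proof -
  have 1: "Ck_on (Suc 0) UNIV \<phi>" and 0: "Ck_on 0 UNIV \<phi>" using assms by (simp_all only: smooth_def)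
  then show "\<phi> differentiable (at p)" by (simp del: split_paired_All)
  show "continuous_on S \<phi>" "continuous_on S (px \<phi>)" "continuous_on S (py \<phi>)"
    using 0 1 continuous_on_subset[of UNIV _ S] by (auto simp del: split_paired_All)
qed

text \<open>Subtracting the two defining identities leaves a function orthogonal to all tests. It is
  applied to \<open>P\<close> with the classical gradient and then to the ball with the extension by
  zero.\<close>

lemma weak_gradient_unique:
  assumes W: "open W" "W \<subseteq> interior \<Omega>"
    and H: "\<And>K. compact K \<Longrightarrow> K \<subseteq> W \<Longrightarrow> set_integrable lborel K H1" "\<And>K. compact K \<Longrightarrow> K \<subseteq> W \<Longrightarrow> set_integrable lborel K H2"
    and test: "\<And>\<phi>. smooth \<phi> \<Longrightarrow> compact (closure {p. \<phi> p \<noteq> 0}) \<Longrightarrow> closure {p. \<phi> p \<noteq> 0} \<subseteq> W \<Longrightarrow>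
       (LINT p:W|lborel. \<psi> p * px \<phi> p) = - (LINT p:W|lborel. H1 p * \<phi> p) \<and>
       (LINT p:W|lborel. \<psi> p * py \<phi> p) = - (LINT p:W|lborel. H2 p * \<phi> p)"
  shows "AE p in lborel. p \<in> W \<longrightarrow> g p = (H1 p, H2 p)"
proof -
  have gi: "set_integrable lborel K (\<lambda>p. fst (g p))" "set_integrable lborel K (\<lambda>p. snd (g p))" if "compact K" "K \<subseteq> W" for K
    using weak W(2) that by (auto simp: weak_gradient_def)
  have *: "(LINT p:W|lborel. (fst (g p) - H1 p) * \<phi> p) = 0 \<and> (LINT p:W|lborel. (snd (g p) - H2 p) * \<phi> p) = 0"
    if \<phi>: "smooth \<phi>" "compact (closure {p. \<phi> p \<noteq> 0})" "closure {p. \<phi> p \<noteq> 0} \<subseteq> W" for \<phi>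
  proof -
    let ?C = "closure {p. \<phi> p \<noteq> 0}"
    have z: "\<phi> p = 0" "px \<phi> p = 0" "py \<phi> p = 0" if "p \<notin> ?C" for p
      using that px_py_zero_off_support[OF that] closure_subset[of "{p. \<phi> p \<noteq> 0}"] by auto
    have sub: "?C \<subseteq> interior \<Omega>" using \<phi>(3) W(2) by auto
    have restr: "(LINT p:interior \<Omega>|lborel. u p * v p) = (LINT p:W|lborel. u p * v p)" if "\<And>p. p \<notin> ?C \<Longrightarrow> v p = 0" for u v :: "point \<Rightarrow> real"
      unfolding set_lebesgue_integral_def
    proof (rule Bochner_Integration.integral_cong[OF refl])
      fix p show "indicator (interior \<Omega>) p *\<^sub>R (u p * v p) = indicator W p *\<^sub>R (u p * v p)"
        using that[of p] \<phi>(3) sub by (cases "p \<in> ?C") (auto simp: indicator_def)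
    qed
    have "(LINT p:W|lborel. \<psi> p * px \<phi> p) = - (LINT p:W|lborel. fst (g p) * \<phi> p)"
         "(LINT p:W|lborel. \<psi> p * py \<phi> p) = - (LINT p:W|lborel. snd (g p) * \<phi> p)"
    proof -
      have "smooth \<phi> \<and> compact ?C \<and> ?C \<subseteq> interior \<Omega>" using \<phi> sub by blast
      then have "(LINT p:interior \<Omega>|lborel. \<psi> p * px \<phi> p) = - (LINT p:interior \<Omega>|lborel. fst (g p) * \<phi> p) \<and>
        (LINT p:interior \<Omega>|lborel. \<psi> p * py \<phi> p) = - (LINT p:interior \<Omega>|lborel. snd (g p) * \<phi> p)"
        using weak unfolding weak_gradient_def by blast
      moreover have "(LINT p:interior \<Omega>|lborel. \<psi> p * px \<phi> p) = (LINT p:W|lborel. \<psi> p * px \<phi> p)"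
        by (rule restr) (rule z)
      moreover have "(LINT p:interior \<Omega>|lborel. \<psi> p * py \<phi> p) = (LINT p:W|lborel. \<psi> p * py \<phi> p)"
        by (rule restr) (rule z)
      moreover have "(LINT p:interior \<Omega>|lborel. fst (g p) * \<phi> p) = (LINT p:W|lborel. fst (g p) * \<phi> p)"
        by (rule restr) (rule z)
      moreover have "(LINT p:interior \<Omega>|lborel. snd (g p) * \<phi> p) = (LINT p:W|lborel. snd (g p) * \<phi> p)"
        by (rule restr) (rule z)
      ultimately show "(LINT p:W|lborel. \<psi> p * px \<phi> p) = - (LINT p:W|lborel. fst (g p) * \<phi> p)"
         "(LINT p:W|lborel. \<psi> p * py \<phi> p) = - (LINT p:W|lborel. snd (g p) * \<phi> p)"
        by linarith+
    qed
    with test[OF \<phi>] have e: "(LINT p:W|lborel. fst (g p) * \<phi> p) = (LINT p:W|lborel. H1 p * \<phi> p)"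
      "(LINT p:W|lborel. snd (g p) * \<phi> p) = (LINT p:W|lborel. H2 p * \<phi> p)" by auto
    note i = set_integrable_times_test[OF _ \<phi>(2,3) smooth_D(2)[OF \<phi>(1)] z(1)]
    show ?thesis unfolding left_diff_distrib
      using e by (subst (1 2) set_integral_diff(2)) (auto intro!: i gi H \<phi>)
  qed
  have "AE p in lborel. p \<in> W \<longrightarrow> fst (g p) - H1 p = 0"
    by (rule fundamental_lemma[OF W(1)]) (use * gi H in \<open>auto intro!: set_integral_diff(1)\<close>)
  moreover have "AE p in lborel. p \<in> W \<longrightarrow> snd (g p) - H2 p = 0"
    by (rule fundamental_lemma[OF W(1)]) (use * gi H in \<open>auto intro!: set_integral_diff(1)\<close>)
  ultimately show ?thesis by eventually_elim (auto simp: prod_eq_iff)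
qed

text \<open>The test function may cross the free boundary. No boundary term arises because
  \<open>\<psi>\<close> vanishes there; truncation makes this precise once the gradient terms are
  integrable.\<close>

lemma psi_test_divergence:
  assumes \<phi>: "smooth \<phi>" "compact (closure {p. \<phi> p \<noteq> 0})" "closure {p. \<phi> p \<noteq> 0} \<subseteq> U"
    and int: "set_integrable lborel P (\<lambda>p. px \<psi> p * \<phi> p)" "set_integrable lborel P (\<lambda>p. py \<psi> p * \<phi> p)"
  shows "(LINT p:P|lborel. \<psi> p * px \<phi> p) = - (LINT p:P|lborel. px \<psi> p * \<phi> p)"
    "(LINT p:P|lborel. \<psi> p * py \<phi> p) = - (LINT p:P|lborel. py \<psi> p * \<phi> p)"
proof -
  let ?C = "closure {p. \<phi> p \<noteq> 0}"
  have z: "\<phi> p = 0" "px \<phi> p = 0" "py \<phi> p = 0" if "p \<notin> ?C" for p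
    using that px_py_zero_off_support[OF that] closure_subset[of "{p. \<phi> p \<noteq> 0}"] by auto
  note c = smooth_D[OF \<phi>(1)]
  have "set_integrable lborel U (\<lambda>p. \<psi> p * px \<phi> p)"
    by (rule compact_support_set_integrable[OF open_U \<phi>(2,3) continuous_on_mult[OF psi_cont_U c(3)] _ \<phi>(3) order_refl])
       (elim DiffE, simp only: z mult_zero_right simp_thms)
  moreover have "set_integrable lborel U (\<lambda>p. \<psi> p * py \<phi> p)"
    by (rule compact_support_set_integrable[OF open_U \<phi>(2,3) continuous_on_mult[OF psi_cont_U c(4)] _ \<phi>(3) order_refl])
       (elim DiffE, simp only: z mult_zero_right simp_thms)
  ultimately have i: "set_integrable lborel P (\<lambda>p. \<psi> p * px \<phi> p)" "set_integrable lborel P (\<lambda>p. \<psi> p * py \<phi> p)"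
    using open_P P_sub(1) by (auto intro: set_integrable_subset)
  have "(LINT p:P|lborel. px \<psi> p * \<phi> p + py \<psi> p * 0) + (LINT p:P|lborel. \<psi> p * (px \<phi> p + 0)) = 0"
  proof (rule truncated_divergence[OF \<phi>(2,3)])
    show "\<phi> p = 0 \<and> 0 = 0 \<and> px \<phi> p = 0 \<and> 0 = 0" if "p \<in> P - ?C" for p
      using that by (simp only: z Diff_iff simp_thms)
    show "((\<lambda>t. \<phi> (t, snd p)) has_real_derivative px \<phi> p) (at (fst p))" for p by (rule differentiable_px[OF c(1)])
  qed (use int i in \<open>simp_all add: c\<close>)
  then show "(LINT p:P|lborel. \<psi> p * px \<phi> p) = - (LINT p:P|lborel. px \<psi> p * \<phi> p)" by simp
  have "(LINT p:P|lborel. px \<psi> p * 0 + py \<psi> p * \<phi> p) + (LINT p:P|lborel. \<psi> p * (0 + py \<phi> p)) = 0"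
  proof (rule truncated_divergence[OF \<phi>(2,3)])
    show "0 = 0 \<and> \<phi> p = 0 \<and> 0 = 0 \<and> py \<phi> p = 0" if "p \<in> P - ?C" for p
      using that by (simp only: z Diff_iff simp_thms)
    show "((\<lambda>t. \<phi> (fst p, t)) has_real_derivative py \<phi> p) (at (snd p))" for p by (rule differentiable_py[OF c(1)])
  qed (use int i in \<open>simp_all add: c\<close>)
  then show "(LINT p:P|lborel. \<psi> p * py \<phi> p) = - (LINT p:P|lborel. py \<psi> p * \<phi> p)" by simp
qed

lemma weak_gradient_on_P: "AE p in lborel. p \<in> P \<longrightarrow> g p = (px \<psi> p, py \<psi> p)"
proof (rule weak_gradient_unique[OF open_P])
  show "P \<subseteq> interior \<Omega>" using P_sub(1) U_sub(2) by auto
  show "set_integrable lborel K (px \<psi>)" "set_integrable lborel K (py \<psi>)" if "compact K" "K \<subseteq> P" for K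
    unfolding set_integrable_def
    using borel_integrable_compact[OF that(1) continuous_on_subset[OF psi_cont2(2) that(2)]]
      borel_integrable_compact[OF that(1) continuous_on_subset[OF psi_cont2(3) that(2)]] by simp_all
  fix \<phi> assume \<phi>: "smooth \<phi>" "compact (closure {p. \<phi> p \<noteq> 0})" "closure {p. \<phi> p \<noteq> 0} \<subseteq> P"
  have z: "\<phi> p = 0" if "p \<notin> closure {p. \<phi> p \<noteq> 0}" for p
    using that closure_subset[of "{p. \<phi> p \<noteq> 0}"] by auto
  have 1: "set_integrable lborel P (\<lambda>p. px \<psi> p * \<phi> p)"
    by (rule compact_support_set_integrable[OF open_P \<phi>(2,3) continuous_on_mult[OF psi_cont2(2) smooth_D(2)[OF \<phi>(1)]] _ \<phi>(3) order_refl])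
       (elim DiffE, simp only: z mult_zero_right simp_thms)
  have 2: "set_integrable lborel P (\<lambda>p. py \<psi> p * \<phi> p)"
    by (rule compact_support_set_integrable[OF open_P \<phi>(2,3) continuous_on_mult[OF psi_cont2(3) smooth_D(2)[OF \<phi>(1)]] _ \<phi>(3) order_refl])
       (elim DiffE, simp only: z mult_zero_right simp_thms)
  from psi_test_divergence[OF \<phi>(1,2) order_trans[OF \<phi>(3) P_sub(1)] 1 2]
  show "(LINT p:P|lborel. \<psi> p * px \<phi> p) = - (LINT p:P|lborel. px \<psi> p * \<phi> p) \<and>
       (LINT p:P|lborel. \<psi> p * py \<phi> p) = - (LINT p:P|lborel. py \<psi> p * \<phi> p)" by auto
qed

lemma G_meas [measurable]: "G1 \<in> borel_measurable borel" "G2 \<in> borel_measurable borel"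
proof -
  have "(\<lambda>p. indicator P p *\<^sub>R px \<psi> p) \<in> borel_measurable borel" "(\<lambda>p. indicator P p *\<^sub>R py \<psi> p) \<in> borel_measurable borel"
    by (intro borel_measurable_continuous_on_indicator psi_cont2 borel_open open_P)+
  then show "G1 \<in> borel_measurable borel" "G2 \<in> borel_measurable borel" by (simp_all add: G1_def[abs_def] G2_def[abs_def])
qed

text \<open>C^2 regularity inside \<open>P\<close> gives no integrability up to the free boundary;
  that is inherited from \<open>g\<close>, with which the classical gradient agrees almost
  everywhere on \<open>P\<close>.\<close>

lemma G_integrable_on: 
  assumes K: "compact K" "K \<subseteq> cball Xc R"
  shows "set_integrable lborel K G1" "set_integrable lborel K G2"
proof -
  have gi: "set_integrable lborel K (\<lambda>p. fst (g p))" "set_integrable lborel K (\<lambda>p. snd (g p))"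
    using weak K cball_interior by (auto simp: weak_gradient_def)
  have [measurable]: "K \<in> sets borel" "P \<in> sets borel" using K(1) open_P by (auto intro: borel_compact)
  have "integrable lborel (\<lambda>p. indicator P p *\<^sub>R (indicator K p *\<^sub>R fst (g p)))" "integrable lborel (\<lambda>p. indicator P p *\<^sub>R (indicator K p *\<^sub>R snd (g p)))"
    by (intro integrable_mult_indicator gi[unfolded set_integrable_def]; simp)+
  note * = this
  have "AE p in lborel. indicator P p *\<^sub>R (indicator K p *\<^sub>R fst (g p)) = indicator K p *\<^sub>R G1 p"
    using weak_gradient_on_P by eventually_elim (auto simp: indicator_def G1_def)
  with *(1) show "set_integrable lborel K G1" unfolding set_integrable_def
    by (subst integrable_cong_AE[where g="\<lambda>p. indicator P p *\<^sub>R (indicator K p *\<^sub>R fst (g p))"])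
       (auto elim!: eventually_mono dest: borel_measurable_integrable)
  have "AE p in lborel. indicator P p *\<^sub>R (indicator K p *\<^sub>R snd (g p)) = indicator K p *\<^sub>R G2 p"
    using weak_gradient_on_P by eventually_elim (auto simp: indicator_def G2_def)
  with *(2) show "set_integrable lborel K G2" unfolding set_integrable_def
    by (subst integrable_cong_AE[where g="\<lambda>p. indicator P p *\<^sub>R (indicator K p *\<^sub>R snd (g p))"])
       (auto elim!: eventually_mono dest: borel_measurable_integrable)
qed

text \<open>Since \<open>\<psi>\<close> is zero on the ball outside \<open>P\<close>, its integrals
  over \<open>P\<close> and over the ball coincide, and the zero extension is a weak gradient on the
  ball. In particular \<open>g\<close> vanishes almost everywhere on the zero set of
  \<open>\<psi>\<close> in the ball.\<close>

lemma g_eq_G: "AE p in lborel. p \<in> U \<longrightarrow> g p = (G1 p, G2 p)"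
proof (rule weak_gradient_unique[OF open_U U_sub(2)])
  show "set_integrable lborel K G1" "set_integrable lborel K G2" if "compact K" "K \<subseteq> U" for K
    using G_integrable_on that U_sub(1) by auto
  fix \<phi> assume \<phi>: "smooth \<phi>" "compact (closure {p. \<phi> p \<noteq> 0})" "closure {p. \<phi> p \<noteq> 0} \<subseteq> U"
  have z: "\<phi> p = 0" if "p \<notin> closure {p. \<phi> p \<noteq> 0}" for p
    using that closure_subset[of "{p. \<phi> p \<noteq> 0}"] by auto
  have "closure {p. \<phi> p \<noteq> 0} \<subseteq> cball Xc R" using \<phi>(3) U_sub(1) by auto
  note Gi = G_integrable_on[OF \<phi>(2) this]
  have 1: "set_integrable lborel U (\<lambda>p. G1 p * \<phi> p)"
    by (rule set_integrable_times_test[OF Gi(1) \<phi>(2,3) smooth_D(2)[OF \<phi>(1)]]) (rule z)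
  have 2: "set_integrable lborel U (\<lambda>p. G2 p * \<phi> p)"
    by (rule set_integrable_times_test[OF Gi(2) \<phi>(2,3) smooth_D(2)[OF \<phi>(1)]]) (rule z)
  have GU: "set_integrable lborel P (\<lambda>p. px \<psi> p * \<phi> p)" "set_integrable lborel P (\<lambda>p. py \<psi> p * \<phi> p)"
  proof -
    have e: "indicator U p *\<^sub>R (G1 p * \<phi> p) = indicator P p *\<^sub>R (px \<psi> p * \<phi> p)" "indicator U p *\<^sub>R (G2 p * \<phi> p) = indicator P p *\<^sub>R (py \<psi> p * \<phi> p)" for p
      using P_sub(1) by (auto simp: G1_def G2_def indicator_def)
    show "set_integrable lborel P (\<lambda>p. px \<psi> p * \<phi> p)" "set_integrable lborel P (\<lambda>p. py \<psi> p * \<phi> p)"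
      using 1 2 unfolding set_integrable_def e by simp_all
  qed
  have e1: "(LINT p:P|lborel. px \<psi> p * \<phi> p) = (LINT p:U|lborel. G1 p * \<phi> p)" "(LINT p:P|lborel. py \<psi> p * \<phi> p) = (LINT p:U|lborel. G2 p * \<phi> p)"
    using P_sub(1) unfolding set_lebesgue_integral_def
    by (auto simp: G1_def G2_def indicator_def intro!: Bochner_Integration.integral_cong)
  have "\<psi> p = 0" if "p \<in> U" "p \<notin> P" for p
    using that psi_nonneg[of p] U_sub(3) by (auto simp: P_def)
  then have e2: "(LINT p:P|lborel. \<psi> p * v p) = (LINT p:U|lborel. \<psi> p * v p)" for v
    using P_sub(1) unfolding set_lebesgue_integral_def
    by (intro Bochner_Integration.integral_cong) (auto simp: indicator_def)
  show "(LINT p:U|lborel. \<psi> p * px \<phi> p) = - (LINT p:U|lborel. G1 p * \<phi> p) \<and>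
       (LINT p:U|lborel. \<psi> p * py \<phi> p) = - (LINT p:U|lborel. G2 p * \<phi> p)"
    using psi_test_divergence[OF \<phi> GU] unfolding e1 e2 by simp
qed

lemma G_square_integrable: "integrable lborel (\<lambda>p. (G1 p)\<^sup>2 / fst p)" "integrable lborel (\<lambda>p. (G2 p)\<^sup>2 / fst p)"
  and G_prod_integrable: "integrable lborel (\<lambda>p. G1 p * G2 p / fst p)"
  and G_integrable: "integrable lborel G1" "integrable lborel G2"
proof -
  have [measurable]: "(\<lambda>p::point. fst p) \<in> borel_measurable borel" by (intro borel_measurable_continuous_onI continuous_intros)
  have [measurable]: "U \<in> sets borel" using open_U by auto
  have si: "set_integrable lborel U (\<lambda>p. (fst (g p))\<^sup>2 / fst p)" "set_integrable lborel U (\<lambda>p. (snd (g p))\<^sup>2 / fst p)"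
  proof -
    have "\<forall>K. compact K \<and> K \<subseteq> \<Omega> \<longrightarrow> set_integrable lborel K (\<lambda>p. (\<psi> p)\<^sup>2 / fst p) \<and>
        set_integrable lborel K (\<lambda>p. (fst (g p))\<^sup>2 / fst p) \<and> set_integrable lborel K (\<lambda>p. (snd (g p))\<^sup>2 / fst p)"
      using var unfolding variational_solution_def W12w_loc_def by (elim conjE)
    then have "set_integrable lborel (cball Xc R) (\<lambda>p. (fst (g p))\<^sup>2 / fst p)" "set_integrable lborel (cball Xc R) (\<lambda>p. (snd (g p))\<^sup>2 / fst p)"
      using cball_Omega compact_cball by blast+
    note * = this
    show "set_integrable lborel U (\<lambda>p. (fst (g p))\<^sup>2 / fst p)"
      by (rule set_integrable_subset[OF *(1)]; use open_U U_sub(1) in auto)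
    show "set_integrable lborel U (\<lambda>p. (snd (g p))\<^sup>2 / fst p)"
      by (rule set_integrable_subset[OF *(2)]; use open_U U_sub(1) in auto)
  qed
  have G0: "G1 p = 0" "G2 p = 0" if "p \<notin> U" for p using subsetD[OF P_sub(1), of p] that by (auto simp: G1_def G2_def split: split_indicator)
  have "AE p in lborel. indicator U p *\<^sub>R ((fst (g p))\<^sup>2 / fst p) = (G1 p)\<^sup>2 / fst p"
    using g_eq_G by eventually_elim (auto simp: indicator_def G0)
  with si(1) show 1: "integrable lborel (\<lambda>p. (G1 p)\<^sup>2 / fst p)" unfolding set_integrable_def
    by (subst integrable_cong_AE[where g="\<lambda>p. indicator U p *\<^sub>R ((fst (g p))\<^sup>2 / fst p)"])
       (auto elim!: eventually_mono dest: borel_measurable_integrable)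
  have "AE p in lborel. indicator U p *\<^sub>R ((snd (g p))\<^sup>2 / fst p) = (G2 p)\<^sup>2 / fst p"
    using g_eq_G by eventually_elim (auto simp: indicator_def G0)
  with si(2) show 2: "integrable lborel (\<lambda>p. (G2 p)\<^sup>2 / fst p)" unfolding set_integrable_def
    by (subst integrable_cong_AE[where g="\<lambda>p. indicator U p *\<^sub>R ((snd (g p))\<^sup>2 / fst p)"])
       (auto elim!: eventually_mono dest: borel_measurable_integrable)
  show "integrable lborel (\<lambda>p. G1 p * G2 p / fst p)"
  proof (rule Bochner_Integration.integrable_bound[OF Bochner_Integration.integrable_add[OF 1 2]])
    show "AE p in lborel. norm (G1 p * G2 p / fst p) \<le> norm ((G1 p)\<^sup>2 / fst p + (G2 p)\<^sup>2 / fst p)"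
    proof (rule AE_I2)
      fix p
      have "\<bar>G1 p * G2 p\<bar> \<le> (G1 p)\<^sup>2 + (G2 p)\<^sup>2"
      proof -
        have "2 * (\<bar>G1 p\<bar> * \<bar>G2 p\<bar>) \<le> (G1 p)\<^sup>2 + (G2 p)\<^sup>2"
          using sum_squares_bound[of "\<bar>G1 p\<bar>" "\<bar>G2 p\<bar>"] by (simp add: mult.assoc)
        moreover have "0 \<le> \<bar>G1 p\<bar> * \<bar>G2 p\<bar>" by simp
        ultimately show ?thesis unfolding abs_mult by linarith
      qed
      then show "norm (G1 p * G2 p / fst p) \<le> norm ((G1 p)\<^sup>2 / fst p + (G2 p)\<^sup>2 / fst p)"
        by (simp add: add_divide_distrib[symmetric] abs_divide divide_right_mono)
    qed
  qed measurable
  have ind: "indicator (cball Xc R) p *\<^sub>R G1 p = G1 p" "indicator (cball Xc R) p *\<^sub>R G2 p = G2 p" for p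
    using G0[of p] subsetD[OF U_sub(1), of p] by (auto split: split_indicator)
  show "integrable lborel G1" "integrable lborel G2"
    using G_integrable_on[OF compact_cball order_refl] unfolding set_integrable_def ind by simp_all
qed

text \<open>Measurability of \<open>g\<close> comes from local integrability, hence after
  multiplication by the indicator of a compact set.\<close>

lemma g_meas:
  "(\<lambda>p. indicator (cball Xc R) p * fst (g p)) \<in> borel_measurable borel"
  "(\<lambda>p. indicator (cball Xc R) p * snd (g p)) \<in> borel_measurable borel"
proof -
  have "set_integrable lborel (cball Xc R) (\<lambda>p. fst (g p))" "set_integrable lborel (cball Xc R) (\<lambda>p. snd (g p))"
    using weak compact_cball cball_interior unfolding weak_gradient_def by blast+
  then show "(\<lambda>p. indicator (cball Xc R) p * fst (g p)) \<in> borel_measurable borel"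
    "(\<lambda>p. indicator (cball Xc R) p * snd (g p)) \<in> borel_measurable borel"
    unfolding set_integrable_def by (auto dest: borel_measurable_integrable)
qed

end

section \<open>The equation on the positivity set\<close>

text \<open>The second difference over a small square of side \<open>k\<close> equals
  \<open>k * k\<close> times a mixed derivative at an intermediate point, for either order of
  differentiation. Continuity at \<open>p\<close> forces equality.\<close>

lemma mixed_partials_eq:
  fixes h :: "point \<Rightarrow> real"
  assumes P: "open P" "p \<in> P"
    and d: "\<And>q. q \<in> P \<Longrightarrow> h differentiable (at q)" "\<And>q. q \<in> P \<Longrightarrow> px h differentiable (at q)" "\<And>q. q \<in> P \<Longrightarrow> py h differentiable (at q)"
    and c: "continuous_on P (px (py h))" "continuous_on P (py (px h))"
  shows "px (py h) p = py (px h) p"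
proof -
  obtain x y where p: "p = (x, y)" by (cases p)
  have close: "\<bar>px (py h) p - py (px h) p\<bar> \<le> e" if "e > 0" for e
  proof -
    have "isCont (px (py h)) p" "isCont (py (px h)) p" using c P by (auto simp: continuous_on_eq_continuous_at)
    then obtain d1 d2 where d1: "d1 > 0" "\<And>q. dist q p < d1 \<Longrightarrow> dist (px (py h) q) (px (py h) p) < e/2"
      and d2: "d2 > 0" "\<And>q. dist q p < d2 \<Longrightarrow> dist (py (px h) q) (py (px h) p) < e/2"
      unfolding continuous_at_eps_delta using \<open>e > 0\<close> by (metis half_gt_zero)
    obtain d3 where d3: "d3 > 0" "ball p d3 \<subseteq> P" using P open_contains_ball by blast
    define k where "k = min d1 (min d2 d3) / 3"
    have k: "k > 0" "3 * k \<le> d1" "3 * k \<le> d2" "3 * k \<le> d3" using d1 d2 d3 by (auto simp: k_def)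
    have near: "dist (s, t) p < 3 * k" if "x \<le> s" "s \<le> x + k" "y \<le> t" "t \<le> y + k" for s t
    proof -
      have "dist (s, t) p \<le> dist s x + dist t y"
        using norm_Pair_le[of "s - x" "t - y"] by (simp add: p dist_norm)
      then show ?thesis using that k by (simp add: dist_real_def)
    qed
    have inP: "(s, t) \<in> P" if "x \<le> s" "s \<le> x + k" "y \<le> t" "t \<le> y + k" for s t
      using near[OF that] d3 k by (auto simp: dist_commute)
    have D: "((\<lambda>s. h (s, t)) has_real_derivative px h (s, t)) (at s)" "((\<lambda>t. h (s, t)) has_real_derivative py h (s, t)) (at t)"
      "((\<lambda>t. px h (s, t)) has_real_derivative py (px h) (s, t)) (at t)" "((\<lambda>s. py h (s, t)) has_real_derivative px (py h) (s, t)) (at s)"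
      if "x \<le> s" "s \<le> x + k" "y \<le> t" "t \<le> y + k" for s t
      using differentiable_px[OF d(1)[OF inP[OF that]]] differentiable_py[OF d(1)[OF inP[OF that]]]
        differentiable_py[OF d(2)[OF inP[OF that]]] differentiable_px[OF d(3)[OF inP[OF that]]] by simp_all
    let ?\<Delta> = "h (x + k, y + k) - h (x + k, y) - (h (x, y + k) - h (x, y))"
    have "\<exists>s>x. s < x + k \<and> ?\<Delta> = (x + k - x) * (px h (s, y + k) - px h (s, y))"
      using k by (intro MVT2) (auto intro!: DERIV_diff D)
    then obtain s where s: "x < s" "s < x + k" "?\<Delta> = k * (px h (s, y + k) - px h (s, y))" by auto
    have "\<exists>t>y. t < y + k \<and> px h (s, y + k) - px h (s, y) = (y + k - y) * py (px h) (s, t)"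
      using k s by (intro MVT2) (auto intro!: D)
    then obtain t where t: "y < t" "t < y + k" "?\<Delta> = k * (k * py (px h) (s, t))" using s by auto
    have "\<exists>t>y. t < y + k \<and> (h (x + k, y + k) - h (x, y + k)) - (h (x + k, y) - h (x, y)) = (y + k - y) * (py h (x + k, t) - py h (x, t))"
      using k by (intro MVT2) (auto intro!: DERIV_diff D)
    then obtain t' where t': "y < t'" "t' < y + k" "?\<Delta> = k * (py h (x + k, t') - py h (x, t'))" by (auto simp: algebra_simps)
    have "\<exists>s>x. s < x + k \<and> py h (x + k, t') - py h (x, t') = (x + k - x) * px (py h) (s, t')"
      using k t' by (intro MVT2) (auto intro!: D)
    then obtain s' where s': "x < s'" "s' < x + k" "?\<Delta> = k * (k * px (py h) (s', t'))" using t' by auto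
    have eq: "py (px h) (s, t) = px (py h) (s', t')" using t(3) s'(3) k by simp
    have "dist (py (px h) (s, t)) (py (px h) p) < e/2"
      using near[of s t] s t k by (intro d2(2)) auto
    moreover have "dist (px (py h) (s', t')) (px (py h) p) < e/2"
      using near[of s' t'] s' t' k by (intro d1(2)) auto
    ultimately show ?thesis unfolding eq dist_real_def by linarith
  qed
  show ?thesis
  proof (rule ccontr)
    assume "px (py h) p \<noteq> py (px h) p"
    with close[of "\<bar>px (py h) p - py (px h) p\<bar> / 2"] show False by simp
  qed
qed

lemma continuous_AE_zero:
  fixes u :: "point \<Rightarrow> real"
  assumes P: "open P" and u: "continuous_on P u" and ae: "AE p in lborel. p \<in> P \<longrightarrow> u p = 0" and p: "p \<in> P"
  shows "u p = 0"
proof (rule ccontr)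
  assume "u p \<noteq> 0"
  define V where "V = P \<inter> u -` (- {0})"
  have "open V" unfolding V_def using u P by (metis continuous_on_open_vimage open_Compl closed_singleton Int_commute)
  moreover have "p \<in> V" using p \<open>u p \<noteq> 0\<close> by (auto simp: V_def)
  moreover have "V \<in> null_sets lborel"
  proof -
    have "AE p in lborel. p \<notin> V" using ae by eventually_elim (auto simp: V_def)
    then show ?thesis using \<open>open V\<close> by (subst (asm) AE_iff_null_sets[symmetric]) auto
  qed
  then have "negligible V" by (simp add: negligible_iff_null_sets null_sets_completionI)
  ultimately show False using open_not_negligible by blast
qed

section \<open>The first variation localised to the ball\<close>

context degenerate_point begin

lemma F_deriv: "(Fprim f has_real_derivative f z) (at z)" by (rule Fprim_has_derivative[OF f_cont])

lemma F_cont: "continuous_on S (Fprim f)"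
  by (rule DERIV_continuous_on[OF has_field_derivative_at_within[OF F_deriv]])

lemma F_psi_cont: "continuous_on (cball Xc R) (\<lambda>p. Fprim f (\<psi> p))"
  by (rule continuous_on_compose2[OF F_cont[of UNIV] continuous_on_subset[OF psi_cont cball_Omega]]) simp

lemma f_psi_cont: "continuous_on (cball Xc R) (\<lambda>p. f (\<psi> p))"
  by (rule continuous_on_compose2[OF f_cont continuous_on_subset[OF psi_cont cball_Omega]]) simp

lemma fst_nz: "p \<in> cball Xc R \<Longrightarrow> fst p \<noteq> 0"
  using fst_lower x0_pos by fastforce

lemma cball_integrable:
  assumes w: "continuous_on (cball Xc R) w" and S: "S \<in> sets borel" "S \<subseteq> cball Xc R"
  shows "integrable lborel (\<lambda>p. indicator S p * (w p :: real))"
proof -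
  have "set_integrable lborel (cball Xc R) w"
    unfolding set_integrable_def by (rule borel_integrable_compact[OF compact_cball w])
  then have "set_integrable lborel S w" by (rule set_integrable_subset) (use S in auto)
  then show ?thesis by (simp add: set_integrable_def)
qed

lemma sets_UP [measurable]: "U \<in> sets borel" "P \<in> sets borel" using open_U open_P by auto

lemma P_sub_cball: "P \<subseteq> cball Xc R" using P_sub(1) U_sub(1) by auto

lemma chi_eq: "p \<in> U \<Longrightarrow> chi \<psi> p = indicator P p"
  by (auto simp: chi_def P_def indicator_def)

lemma G_zero: "p \<notin> P \<Longrightarrow> G1 p = 0" "p \<notin> P \<Longrightarrow> G2 p = 0"
  by (auto simp: G1_def G2_def)

lemma integrable_over_fst:
  assumes "integrable lborel w" "\<And>p. p \<notin> U \<Longrightarrow> w p = 0"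
  shows "integrable lborel (\<lambda>p. w p / fst p :: real)"
proof -
  have c: "continuous_on (cball Xc R) (\<lambda>p. 1 / fst p)"
    by (intro continuous_intros) (use fst_nz in auto)
  have m: "(\<lambda>p. indicator U p *\<^sub>R (1 / fst p)) \<in> borel_measurable borel"
    by (rule borel_measurable_continuous_on_indicator[OF sets_UP(1) continuous_on_subset[OF c U_sub(1)]])
  have "integrable lborel (\<lambda>p. w p * (indicator U p *\<^sub>R (1 / fst p)))"
  proof (rule integrable_bounded_mult[OF assms(1) m])
    fix p show "\<bar>indicator U p *\<^sub>R (1 / fst p)\<bar> \<le> 2 / x0"
    proof (cases "p \<in> U")
      case True
      then have "x0 / 2 \<le> fst p" by (rule fst_lower[OF subsetD[OF U_sub(1)]])
      then show ?thesis using True x0_pos by (simp add: field_simps)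
    qed (use x0_pos in simp)
  qed
  moreover have eq: "w p * (indicator U p *\<^sub>R (1 / fst p)) = w p / fst p" for p
    using assms(2)[of p] by (cases "p \<in> U") auto
  ultimately show ?thesis unfolding eq by simp
qed

text \<open>\<open>e1\<close>, \<open>e12\<close>, \<open>e2\<close> are the entries of the matrix
  of products of first derivatives divided by \<open>x\<close>, formed with \<open>G1\<close> and
  \<open>G2\<close> so that they are integrable over the whole plane.\<close>

definition e1 :: "point \<Rightarrow> real" where "e1 p = (G1 p)\<^sup>2 / fst p"
definition e2 :: "point \<Rightarrow> real" where "e2 p = (G2 p)\<^sup>2 / fst p"
definition e12 :: "point \<Rightarrow> real" where "e12 p = G1 p * G2 p / fst p"

lemma e_integrable: "integrable lborel e1" "integrable lborel e2" "integrable lborel e12"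
  using G_square_integrable G_prod_integrable by (simp_all add: e1_def[abs_def] e2_def[abs_def] e12_def[abs_def])

lemma e_zero: "p \<notin> P \<Longrightarrow> e1 p = 0" "p \<notin> P \<Longrightarrow> e2 p = 0" "p \<notin> P \<Longrightarrow> e12 p = 0"
  by (auto simp: e1_def e2_def e12_def G_zero)

text \<open>Fields supported in the ball stay away from \<open>x = 0\<close> and so meet the
  condition on that line. On the ball \<open>g\<close> may be replaced by \<open>G1\<close>,
  \<open>G2\<close> and \<open>chi\<close> by the indicator of \<open>P\<close>; all terms are then
  globally integrable and merge into one integral.\<close>

lemma variation:
  assumes \<phi>: "smooth \<phi>1" "smooth \<phi>2" and C: "compact C" "C \<subseteq> U"
    and z: "\<And>p. p \<notin> C \<Longrightarrow> \<phi>1 p = 0 \<and> \<phi>2 p = 0"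
  shows "(LINT p|lborel. (e1 p + e2 p - 2 * (indicator U p * (fst p * Fprim f (\<psi> p))) + indicator P p * (fst p * snd p)) * (px \<phi>1 p + py \<phi>2 p)
     - 2 * (e1 p * px \<phi>1 p + e12 p * py \<phi>1 p + e12 p * px \<phi>2 p + e2 p * py \<phi>2 p)
     + (- ((e1 p + e2 p) / fst p) - 2 * (indicator U p * Fprim f (\<psi> p)) + indicator P p * snd p) * \<phi>1 p
     + (indicator P p * fst p) * \<phi>2 p) = 0"
proof -
  have cl: "closure {p. \<phi>1 p \<noteq> 0} \<subseteq> C" "closure {p. \<phi>2 p \<noteq> 0} \<subseteq> C"
    by (rule closure_minimal[OF _ compact_imp_closed[OF C(1)]]; use z in blast)+
  have zd: "px \<phi>1 p = 0" "py \<phi>1 p = 0" "px \<phi>2 p = 0" "py \<phi>2 p = 0" if "p \<notin> C" for p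
    using px_py_zero_off_support(1)[of p \<phi>1] px_py_zero_off_support(2)[of p \<phi>1]
      px_py_zero_off_support(1)[of p \<phi>2] px_py_zero_off_support(2)[of p \<phi>2] cl that
    by (meson subsetD)+
  have z1: "\<phi>1 p = 0" "\<phi>2 p = 0" if "p \<notin> C" for p using z[OF that] by auto
  have D: "closure {p \<in> \<Omega>. \<phi>1 p \<noteq> 0 \<or> \<phi>2 p \<noteq> 0} \<subseteq> C"
    by (rule closure_minimal[OF _ compact_imp_closed[OF C(1)]]) (use z in blast)
  have cD: "compact (closure {p \<in> \<Omega>. \<phi>1 p \<noteq> 0 \<or> \<phi>2 p \<noteq> 0})"
    using compact_Int_closed[OF C(1) closed_closure, of "{p \<in> \<Omega>. \<phi>1 p \<noteq> 0 \<or> \<phi>2 p \<noteq> 0}"] D by (simp add: Int_absorb1)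
  have DO: "closure {p \<in> \<Omega>. \<phi>1 p \<noteq> 0 \<or> \<phi>2 p \<noteq> 0} \<subseteq> \<Omega>" using D C(2) U_sub(3) by (meson order_trans)
  have f0: "\<forall>p\<in>\<Omega>. fst p = 0 \<longrightarrow> \<phi>1 p = 0"
  proof (intro ballI impI)
    fix p :: point assume "fst p = 0"
    then have "p \<notin> U" using fst_pos[of p] by auto
    then show "\<phi>1 p = 0" using z1(1) C(2) by blast
  qed
  let ?EA = "\<lambda>p. (gsq g p / fst p - 2 * fst p * Fprim f (\<psi> p) + fst p * snd p * chi \<psi> p) * (px \<phi>1 p + py \<phi>2 p)
            - 2 / fst p * (fst (g p) * px \<phi>1 p * fst (g p) + fst (g p) * py \<phi>1 p * snd (g p)
               + snd (g p) * px \<phi>2 p * fst (g p) + snd (g p) * py \<phi>2 p * snd (g p))"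
  let ?EB = "\<lambda>p. (- gsq g p / (fst p)\<^sup>2 - 2 * Fprim f (\<psi> p) + snd p * chi \<psi> p) * \<phi>1 p"
  let ?EC = "\<lambda>p. fst p * chi \<psi> p * \<phi>2 p"
  have id: "(LINT p:\<Omega>|lborel. ?EA p) + (LINT p:\<Omega>|lborel. ?EB p) + (LINT p:\<Omega>|lborel. ?EC p) = 0"
  proof -
    have "\<forall>\<phi>1 \<phi>2. smooth \<phi>1 \<and> smooth \<phi>2 \<and>
        compact (closure {p\<in>\<Omega>. \<phi>1 p \<noteq> 0 \<or> \<phi>2 p \<noteq> 0}) \<and>
        closure {p\<in>\<Omega>. \<phi>1 p \<noteq> 0 \<or> \<phi>2 p \<noteq> 0} \<subseteq> \<Omega> \<and>
        (\<forall>p\<in>\<Omega>. fst p = 0 \<longrightarrow> \<phi>1 p = 0) \<longrightarrow>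
        (LINT p:\<Omega>|lborel.
            (gsq g p / fst p - 2 * fst p * Fprim f (\<psi> p) + fst p * snd p * chi \<psi> p)
              * (px \<phi>1 p + py \<phi>2 p)
            - 2 / fst p *
              (fst (g p) * px \<phi>1 p * fst (g p) + fst (g p) * py \<phi>1 p * snd (g p)
               + snd (g p) * px \<phi>2 p * fst (g p) + snd (g p) * py \<phi>2 p * snd (g p)))
        + (LINT p:\<Omega>|lborel.
            (- gsq g p / (fst p)\<^sup>2 - 2 * Fprim f (\<psi> p) + snd p * chi \<psi> p) * \<phi>1 p)
        + (LINT p:\<Omega>|lborel. fst p * chi \<psi> p * \<phi>2 p) = 0"
      using var unfolding variational_solution_def by (elim conjE)
    then show ?thesis using \<phi> cD DO f0 by blast
  qed
  let ?A = "\<lambda>p. (e1 p + e2 p - 2 * (indicator U p * (fst p * Fprim f (\<psi> p))) + indicator P p * (fst p * snd p)) * (px \<phi>1 p + py \<phi>2 p)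
     - 2 * (e1 p * px \<phi>1 p + e12 p * py \<phi>1 p + e12 p * px \<phi>2 p + e2 p * py \<phi>2 p)"
  let ?B = "\<lambda>p. (- ((e1 p + e2 p) / fst p) - 2 * (indicator U p * Fprim f (\<psi> p)) + indicator P p * snd p) * \<phi>1 p"
  let ?C = "\<lambda>p. (indicator P p * fst p) * \<phi>2 p"
  note ci = continuous_on_mult continuous_on_fst continuous_on_snd continuous_on_id F_psi_cont
  have i: "integrable lborel (\<lambda>p. indicator U p * (fst p * Fprim f (\<psi> p)))" "integrable lborel (\<lambda>p. indicator U p * Fprim f (\<psi> p))"
    "integrable lborel (\<lambda>p. indicator P p * (fst p * snd p :: real))" "integrable lborel (\<lambda>p. indicator P p * (snd p :: real))"
    "integrable lborel (\<lambda>p. indicator P p * (fst p :: real))"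
    by (intro cball_integrable ci sets_UP U_sub(1) P_sub_cball)+
  have ie: "integrable lborel (\<lambda>p. (e1 p + e2 p) / fst p)"
  proof (intro integrable_over_fst Bochner_Integration.integrable_add e_integrable)
    fix p assume "p \<notin> U"
    then have "p \<notin> P" using P_sub(1) by blast
    then show "e1 p + e2 p = 0" by (simp add: e_zero)
  qed
  have tm: "integrable lborel (\<lambda>p. w p * v p)" if w: "integrable lborel w" and v: "continuous_on UNIV v" "\<And>p. p \<notin> C \<Longrightarrow> v p = 0" for w v :: "point \<Rightarrow> real"
  proof -
    have "set_integrable lborel C w" by (rule set_integrable_of_integrable[OF w]) (use C(1) in \<open>auto intro: borel_compact\<close>)
    from set_integrable_times_test[OF this C(1) subset_UNIV v] show ?thesis by (simp add: set_integrable_def)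
  qed
  note cs = smooth_D(2-4)[OF \<phi>(1)] smooth_D(2-4)[OF \<phi>(2)]
  have t: "integrable lborel (\<lambda>p. w p * px \<phi>1 p)" "integrable lborel (\<lambda>p. w p * py \<phi>1 p)" "integrable lborel (\<lambda>p. w p * px \<phi>2 p)"
    "integrable lborel (\<lambda>p. w p * py \<phi>2 p)" "integrable lborel (\<lambda>p. w p * \<phi>1 p)" "integrable lborel (\<lambda>p. w p * \<phi>2 p)"
    if "integrable lborel w" for w :: "point \<Rightarrow> real"
    by (rule tm[OF that]; (rule cs)?; rule zd z1; assumption)+
  have iA: "integrable lborel ?A"
    unfolding distrib_left
    by (intro Bochner_Integration.integrable_add Bochner_Integration.integrable_diff integrable_mult_right t i e_integrable)
  have iB: "integrable lborel ?B"
    by (intro Bochner_Integration.integrable_add Bochner_Integration.integrable_diff Bochner_Integration.integrable_minus integrable_mult_right t i ie)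
  have iC: "integrable lborel ?C" by (intro t i)
  have aeU: "AE p in lborel. p \<in> C \<longrightarrow> g p = (G1 p, G2 p)" using g_eq_G by eventually_elim (use C(2) in auto)
  have nzC: "fst p \<noteq> 0" if "p \<in> C" for p using fst_pos[of p] that C(2) by auto
  let ?gm1 = "\<lambda>p. indicator (cball Xc R) p * fst (g p)" and ?gm2 = "\<lambda>p. indicator (cball Xc R) p * snd (g p)"
  note [measurable] = g_meas
  have [measurable]: "(\<lambda>p::point. fst p) \<in> borel_measurable borel" "(\<lambda>p::point. snd p) \<in> borel_measurable borel"
    by (intro borel_measurable_continuous_onI continuous_intros)+
  have [measurable]: "px \<phi>1 \<in> borel_measurable borel" "py \<phi>1 \<in> borel_measurable borel" "px \<phi>2 \<in> borel_measurable borel"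
    "py \<phi>2 \<in> borel_measurable borel" "\<phi>1 \<in> borel_measurable borel" "\<phi>2 \<in> borel_measurable borel"
    by (intro borel_measurable_continuous_onI cs)+
  have [measurable]: "C \<in> sets borel" using C(1) by (rule borel_compact)
  have [measurable]: "(\<lambda>p. indicator U p * Fprim f (\<psi> p)) \<in> borel_measurable borel"
    using i(2) by (simp add: borel_measurable_integrable)
  have CU: "p \<in> C \<Longrightarrow> p \<in> U" "p \<in> C \<Longrightarrow> p \<in> cball Xc R" for p using C(2) U_sub(1) by auto
  have CI: "indicat_real U p = 1" "indicat_real (cball Xc R) p = 1" "chi \<psi> p = indicator P p" if "p \<in> C" for p
    using CU[OF that] chi_eq[of p] by (simp_all del: mem_cball)
  \<comment> \<open>The original integrand \<open>E\<close> contains \<open>g\<close> and is not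
    known to be measurable. A measurable \<open>M\<close> equal to it on \<open>C\<close> is
    interposed; only then are values changed on a null set to reach \<open>W\<close>.\<close>
  have conv: "(LINT p:\<Omega>|lborel. E p) = (LINT p|lborel. W p)" if W: "integrable lborel W" and EW: "\<And>p. p \<in> C \<Longrightarrow> g p = (G1 p, G2 p) \<Longrightarrow> E p = W p"
    and E0: "\<And>p. p \<notin> C \<Longrightarrow> E p = 0 \<and> W p = 0" and M: "M \<in> borel_measurable borel" "\<And>p. p \<in> C \<Longrightarrow> E p = M p" for E W M :: "point \<Rightarrow> real"
  proof -
    have "(LINT p:\<Omega>|lborel. E p) = (LINT p|lborel. indicator C p * M p)"
      unfolding set_lebesgue_integral_def
    proof (rule Bochner_Integration.integral_cong[OF refl])
      fix p show "indicator \<Omega> p *\<^sub>R E p = indicator C p * M p"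
        using E0[of p] M(2)[of p] C(2) U_sub(3) by (cases "p \<in> C") auto
    qed
    also have "\<dots> = (LINT p|lborel. W p)"
    proof (rule integral_cong_AE)
      show "AE p in lborel. indicator C p * M p = W p"
        using aeU
      proof eventually_elim
        case (elim p)
        then show ?case using EW[of p] E0[of p] M(2)[of p] by (cases "p \<in> C") auto
      qed
    qed (use W M in auto)
    finally show ?thesis .
  qed
  have z': "\<phi>1 p = 0" "\<phi>2 p = 0" "px \<phi>1 p = 0" "py \<phi>1 p = 0" "px \<phi>2 p = 0" "py \<phi>2 p = 0" if "p \<notin> C" for p
    using zd[OF that] z1[OF that] by auto
  have A: "(LINT p:\<Omega>|lborel. ?EA p) = (LINT p|lborel. ?A p)"
  proof (rule conv[OF iA])
    show "?EA p = ?A p" if "p \<in> C" "g p = (G1 p, G2 p)" for p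
      using CI[OF that(1)] nzC[OF that(1)] that(2)
      by (simp add: gsq_def e1_def e2_def e12_def field_simps power2_eq_square)
    show "?EA p = 0 \<and> ?A p = 0" if "p \<notin> C" for p by (simp add: z'[OF that])
    show "(\<lambda>p. (((?gm1 p)\<^sup>2 + (?gm2 p)\<^sup>2) / fst p - 2 * fst p * (indicator U p * Fprim f (\<psi> p)) + fst p * snd p * indicator P p) * (px \<phi>1 p + py \<phi>2 p)
            - 2 / fst p * (?gm1 p * px \<phi>1 p * ?gm1 p + ?gm1 p * py \<phi>1 p * ?gm2 p
               + ?gm2 p * px \<phi>2 p * ?gm1 p + ?gm2 p * py \<phi>2 p * ?gm2 p)) \<in> borel_measurable borel"
      by measurable
  qed (simp add: CI gsq_def)
  have B: "(LINT p:\<Omega>|lborel. ?EB p) = (LINT p|lborel. ?B p)"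
  proof (rule conv[OF iB])
    show "?EB p = ?B p" if "p \<in> C" "g p = (G1 p, G2 p)" for p
      using CI[OF that(1)] nzC[OF that(1)] that(2)
      by (simp add: gsq_def e1_def e2_def field_simps power2_eq_square)
    show "?EB p = 0 \<and> ?B p = 0" if "p \<notin> C" for p by (simp add: z'[OF that])
    show "(\<lambda>p. (- (((?gm1 p)\<^sup>2 + (?gm2 p)\<^sup>2)) / (fst p)\<^sup>2 - 2 * (indicator U p * Fprim f (\<psi> p)) + snd p * indicator P p) * \<phi>1 p) \<in> borel_measurable borel"
      by measurable
  qed (simp add: CI gsq_def)
  have C': "(LINT p:\<Omega>|lborel. ?EC p) = (LINT p|lborel. ?C p)"
  proof (rule conv[OF iC])
    show "?EC p = ?C p" if "p \<in> C" "g p = (G1 p, G2 p)" for p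
      using CU[OF that(1)] chi_eq[of p] by simp
    show "?EC p = 0 \<and> ?C p = 0" if "p \<notin> C" for p by (simp add: z'[OF that])
    show "(\<lambda>p. fst p * indicator P p * \<phi>2 p) \<in> borel_measurable borel" by measurable
  qed (simp add: CI)
  show ?thesis using id unfolding A B C'
    by (subst Bochner_Integration.integral_add[OF Bochner_Integration.integrable_add[OF iA iB] iC],
        subst Bochner_Integration.integral_add[OF iA iB])
qed

end

text \<open>With \<open>u\<close>, \<open>v\<close> the first derivatives of the solution, these
  differentiate the entries of the stress tensor: \<open>(v\<^sup>2 - u\<^sup>2) / x + L\<close> and
  \<open>- (v\<^sup>2 - u\<^sup>2) / x + L\<close> on the diagonal, \<open>- 2 * u * v / x\<close>
  off it, where \<open>L = - 2 * x * F + x * y\<close>.\<close>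

lemma
  fixes u v F :: "real \<Rightarrow> real"
  assumes u: "(u has_real_derivative u') (at x)" and v: "(v has_real_derivative v') (at x)" and F: "(F has_real_derivative F') (at x)"
  shows stress_deriv_x1: "x \<noteq> 0 \<Longrightarrow> ((\<lambda>t. ((v t)\<^sup>2 - (u t)\<^sup>2) / t + (- 2 * (t * F t) + t * y)) has_real_derivative
      2 * (v x * v' - u x * u') / x - ((v x)\<^sup>2 - (u x)\<^sup>2) / x\<^sup>2 - 2 * F x - 2 * x * F' + y) (at x)"
    and stress_deriv_x2: "x \<noteq> 0 \<Longrightarrow> ((\<lambda>t. - 2 * (u t * v t) / t) has_real_derivative
      - 2 * (u' * v x + u x * v') / x + 2 * (u x * v x) / x\<^sup>2) (at x)"
    and stress_deriv_y1: "((\<lambda>t. - 2 * (u t * v t) / c) has_real_derivative - 2 * (u' * v x + u x * v') / c) (at x)"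
    and stress_deriv_y2: "((\<lambda>t. - ((v t)\<^sup>2 - (u t)\<^sup>2) / c + (- 2 * (c * F t) + c * t)) has_real_derivative
      - 2 * (v x * v' - u x * u') / c - 2 * c * F' + c) (at x)"
proof -
  {
    assume x: "x \<noteq> 0"
    show "((\<lambda>t. ((v t)\<^sup>2 - (u t)\<^sup>2) / t + (- 2 * (t * F t) + t * y)) has_real_derivative
      2 * (v x * v' - u x * u') / x - ((v x)\<^sup>2 - (u x)\<^sup>2) / x\<^sup>2 - 2 * F x - 2 * x * F' + y) (at x)"
      using x by (auto intro!: derivative_eq_intros u v F) (simp add: field_simps power2_eq_square)
    show "((\<lambda>t. - 2 * (u t * v t) / t) has_real_derivative
      - 2 * (u' * v x + u x * v') / x + 2 * (u x * v x) / x\<^sup>2) (at x)"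
      using x by (auto intro!: derivative_eq_intros u v F) (simp add: field_simps power2_eq_square)
  }
  show "((\<lambda>t. - 2 * (u t * v t) / c) has_real_derivative - 2 * (u' * v x + u x * v') / c) (at x)"
  proof -
    have "((\<lambda>t. (- 2 / c) * (u t * v t)) has_real_derivative (- 2 / c) * (u' * v x + v' * u x)) (at x)"
      by (intro DERIV_cmult DERIV_mult u v)
    then show ?thesis by (simp add: add_divide_distrib diff_divide_distrib algebra_simps)
  qed
  show "((\<lambda>t. - ((v t)\<^sup>2 - (u t)\<^sup>2) / c + (- 2 * (c * F t) + c * t)) has_real_derivative
      - 2 * (v x * v' - u x * u') / c - 2 * c * F' + c) (at x)"
  proof -
    have d: "((\<lambda>t. (- 1 / c) * (v t * v t - u t * u t) + ((- 2 * c) * F t + c * t)) has_real_derivative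
      (- 1 / c) * ((v' * v x + v' * v x) - (u' * u x + u' * u x)) + ((- 2 * c) * F' + c * 1)) (at x)"
      by (intro DERIV_add DERIV_diff DERIV_cmult DERIV_mult DERIV_ident u v F)
    have e1: "(- 1 / c) * ((v' * v x + v' * v x) - (u' * u x + u' * u x)) + ((- 2 * c) * F' + c * 1)
      = - 2 * (v x * v' - u x * u') / c - 2 * c * F' + c"
      by (simp add: diff_divide_distrib add_divide_distrib algebra_simps)
    have e2: "(\<lambda>t. (- 1 / c) * (v t * v t - u t * u t) + ((- 2 * c) * F t + c * t)) = (\<lambda>t. - ((v t)\<^sup>2 - (u t)\<^sup>2) / c + (- 2 * (c * F t) + c * t))"
      by (simp add: fun_eq_iff power2_eq_square diff_divide_distrib algebra_simps)
    show ?thesis using d unfolding e1 e2 .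
  qed
qed

lemma stress_expand1:
  fixes a b x :: real
  shows "(a\<^sup>2 / x + b\<^sup>2 / x - 2 * (x * F) + x * y) * u - 2 * (a\<^sup>2 / x * u + a * b / x * v) + (- ((a\<^sup>2 / x + b\<^sup>2 / x) / x) - 2 * F + y) * w
    = ((b\<^sup>2 - a\<^sup>2) / x + (- 2 * (x * F) + x * y)) * u + - 2 * (a * b) / x * v + (- (a\<^sup>2 + b\<^sup>2) / x\<^sup>2 - 2 * F + y) * w"
  by (simp add: add_divide_distrib diff_divide_distrib power2_eq_square algebra_simps)

lemma stress_expand2:
  fixes a b x :: real
  shows "(a\<^sup>2 / x + b\<^sup>2 / x - 2 * (x * F) + x * y) * v - 2 * (a * b / x * u + b\<^sup>2 / x * v) + x * w
    = - 2 * (a * b) / x * u + (- (b\<^sup>2 - a\<^sup>2) / x + (- 2 * (x * F) + x * y)) * v + x * w"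
  by (simp add: add_divide_distrib diff_divide_distrib power2_eq_square algebra_simps)

text \<open>A Noether identity: the source of the first variation minus the divergence of a row of
  the stress tensor is twice a component of the gradient times the residual of the equation. Here
  \<open>s\<close>, \<open>t\<close>, \<open>m\<close> stand for the second derivatives in xx, yy,
  xy, and \<open>f'\<close> for \<open>f (\<psi> p)\<close>.\<close>

lemma pde_expand1:
  fixes a b x :: real
  shows "2 * a * (x * f' + (s + t) / x - a / x\<^sup>2) = - (a\<^sup>2 + b\<^sup>2) / x\<^sup>2 - 2 * F + y
    - ((2 * (b * m - a * s) / x - (b\<^sup>2 - a\<^sup>2) / x\<^sup>2 - 2 * F - 2 * x * (f' * a) + y) + - 2 * (m * b + a * t) / x)"
  by (simp add: add_divide_distrib diff_divide_distrib power2_eq_square algebra_simps)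

lemma pde_expand2:
  fixes a b x :: real
  shows "2 * b * (x * f' + (s + t) / x - a / x\<^sup>2) = x
    - ((- 2 * (s * b + a * m) / x + 2 * (a * b) / x\<^sup>2) + (- 2 * (b * t - a * m) / x - 2 * x * (f' * b) + x))"
  by (simp add: add_divide_distrib diff_divide_distrib power2_eq_square algebra_simps)

section \<open>The Euler-Lagrange equation where the solution is positive\<close>

context degenerate_point begin

text \<open>The residual of div((1/x) grad \<psi>) = - x f(\<psi>) with the divergence expanded; the
  last term comes from differentiating 1/x.\<close>

definition pde :: "point \<Rightarrow> real" where
  "pde p = fst p * f (\<psi> p) + (px (px \<psi>) p + py (py \<psi>) p) / fst p - px \<psi> p / (fst p)\<^sup>2"

lemma P_fst_pos: "p \<in> P \<Longrightarrow> fst p > 0" by (rule fst_pos[OF subsetD[OF P_sub(1)]])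

lemma P_deriv:
  assumes p: "p \<in> P"
  shows "((\<lambda>t. \<psi> (t, snd p)) has_real_derivative px \<psi> p) (at (fst p))"
    "((\<lambda>t. \<psi> (fst p, t)) has_real_derivative py \<psi> p) (at (snd p))"
    "((\<lambda>t. px \<psi> (t, snd p)) has_real_derivative px (px \<psi>) p) (at (fst p))"
    "((\<lambda>t. px \<psi> (fst p, t)) has_real_derivative py (px \<psi>) p) (at (snd p))"
    "((\<lambda>t. py \<psi> (t, snd p)) has_real_derivative py (px \<psi>) p) (at (fst p))"
    "((\<lambda>t. py \<psi> (fst p, t)) has_real_derivative py (py \<psi>) p) (at (snd p))"
    "((\<lambda>t. Fprim f (\<psi> (t, snd p))) has_real_derivative f (\<psi> p) * px \<psi> p) (at (fst p))"
    "((\<lambda>t. Fprim f (\<psi> (fst p, t))) has_real_derivative f (\<psi> p) * py \<psi> p) (at (snd p))"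
proof -
  note d = psi_diff[OF p]
  have mixed: "px (py \<psi>) p = py (px \<psi>) p"
    by (rule mixed_partials_eq[OF open_P p psi_diff psi_cont2(6,5)])
  show "((\<lambda>t. \<psi> (t, snd p)) has_real_derivative px \<psi> p) (at (fst p))"
    "((\<lambda>t. \<psi> (fst p, t)) has_real_derivative py \<psi> p) (at (snd p))"
    "((\<lambda>t. px \<psi> (t, snd p)) has_real_derivative px (px \<psi>) p) (at (fst p))"
    "((\<lambda>t. px \<psi> (fst p, t)) has_real_derivative py (px \<psi>) p) (at (snd p))"
    "((\<lambda>t. py \<psi> (t, snd p)) has_real_derivative py (px \<psi>) p) (at (fst p))"
    "((\<lambda>t. py \<psi> (fst p, t)) has_real_derivative py (py \<psi>) p) (at (snd p))"
    using differentiable_px[OF d(1)] differentiable_py[OF d(1)] differentiable_px[OF d(2)] differentiable_py[OF d(2)]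
      differentiable_px[OF d(3)] differentiable_py[OF d(3)] by (simp_all only: mixed)
  show "((\<lambda>t. Fprim f (\<psi> (t, snd p))) has_real_derivative f (\<psi> p) * px \<psi> p) (at (fst p))"
    using DERIV_chain2[OF F_deriv differentiable_px[OF d(1)]] by simp
  show "((\<lambda>t. Fprim f (\<psi> (fst p, t))) has_real_derivative f (\<psi> p) * py \<psi> p) (at (snd p))"
    using DERIV_chain2[OF F_deriv differentiable_py[OF d(1)]] by simp
qed

lemma P_cont: "continuous_on P (\<lambda>p. f (\<psi> p))" "continuous_on P (\<lambda>p. Fprim f (\<psi> p))"
  using continuous_on_subset[OF f_psi_cont P_sub_cball] continuous_on_subset[OF F_psi_cont P_sub_cball] by auto

lemma pde_cont: "continuous_on P pde"
  unfolding pde_def[abs_def]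
  by (intro continuous_intros psi_cont2 P_cont) (use P_fst_pos in force)+

text \<open>Here the test function keeps away from the free boundary, so the product of
  \<open>\<phi>\<close> and the field is compactly supported in \<open>P\<close> and no truncation
  occurs.\<close>

lemma localized_divergence:
  assumes \<phi>: "smooth \<phi>" "compact (closure {p. \<phi> p \<noteq> 0})" "closure {p. \<phi> p \<noteq> 0} \<subseteq> P"
    and c: "continuous_on P A" "continuous_on P B" "continuous_on P Ax" "continuous_on P By"
    and DA: "\<And>p. p \<in> P \<Longrightarrow> ((\<lambda>t. A (t, snd p)) has_real_derivative Ax p) (at (fst p))"
    and DB: "\<And>p. p \<in> P \<Longrightarrow> ((\<lambda>t. B (fst p, t)) has_real_derivative By p) (at (snd p))"
  shows "set_integrable lborel P (\<lambda>p. (A p * px \<phi> p + B p * py \<phi> p) + (Ax p + By p) * \<phi> p)"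
    "(LINT p:P|lborel. (A p * px \<phi> p + B p * py \<phi> p) + (Ax p + By p) * \<phi> p) = 0"
proof -
  let ?C = "closure {p. \<phi> p \<noteq> 0}"
  have z: "A p * \<phi> p = 0" "B p * \<phi> p = 0" if "p \<notin> ?C" for p using that closure_subset[of "{p. \<phi> p \<noteq> 0}"] by auto
  note cs = smooth_D[OF \<phi>(1)]
  let ?vx = "\<lambda>p. A p * px \<phi> p + Ax p * \<phi> p" and ?vy = "\<lambda>p. B p * py \<phi> p + By p * \<phi> p"
  have x: "set_integrable lborel P ?vx \<and> (LINT p:P|lborel. ?vx p) = 0"
  proof (rule integral_px_zero[OF open_P \<phi>(2,3) z(1) \<phi>(3) order_refl])
    show "((\<lambda>t. A (t, snd p) * \<phi> (t, snd p)) has_real_derivative ?vx p) (at (fst p))" if "p \<in> P" for p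
      using DERIV_mult[OF DA[OF that] differentiable_px[OF cs(1)]] by (simp add: mult.commute add.commute)
    show "continuous_on P ?vx" by (intro continuous_intros c cs)
  qed assumption
  have y: "set_integrable lborel P ?vy \<and> (LINT p:P|lborel. ?vy p) = 0"
  proof (rule integral_py_zero[OF open_P \<phi>(2,3) z(2) \<phi>(3) order_refl])
    show "((\<lambda>t. B (fst p, t) * \<phi> (fst p, t)) has_real_derivative ?vy p) (at (snd p))" if "p \<in> P" for p
      using DERIV_mult[OF DB[OF that] differentiable_py[OF cs(1)]] by (simp add: mult.commute add.commute)
    show "continuous_on P ?vy" by (intro continuous_intros c cs)
  qed assumption
  have e: "(A p * px \<phi> p + B p * py \<phi> p) + (Ax p + By p) * \<phi> p = ?vx p + ?vy p" for p by (simp add: algebra_simps)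
  show "set_integrable lborel P (\<lambda>p. (A p * px \<phi> p + B p * py \<phi> p) + (Ax p + By p) * \<phi> p)"
    unfolding e by (rule set_integral_add(1)[OF conjunct1[OF x] conjunct1[OF y]])
  show "(LINT p:P|lborel. (A p * px \<phi> p + B p * py \<phi> p) + (Ax p + By p) * \<phi> p) = 0"
    unfolding e using x y by (subst set_integral_add(2)[OF conjunct1[OF x] conjunct1[OF y]]) simp
qed

lemma
  assumes p: "p \<in> P"
  shows variation_integrand1: "((\<lambda>p. (e1 p + e2 p - 2 * (indicator U p * (fst p * Fprim f (\<psi> p))) + indicator P p * (fst p * snd p)) * (px \<phi> p + py (\<lambda>p. 0) p) - 2 * (e1 p * px \<phi> p + e12 p * py \<phi> p + e12 p * px (\<lambda>p. 0) p + e2 p * py (\<lambda>p. 0) p) + (- ((e1 p + e2 p) / fst p) - 2 * (indicator U p * Fprim f (\<psi> p)) + indicator P p * snd p) * \<phi> p + (indicator P p * fst p) * 0)) p = (\<lambda>p. (((py \<psi> p)\<^sup>2 - (px \<psi> p)\<^sup>2) / fst p + (- 2 * (fst p * Fprim f (\<psi> p)) + fst p * snd p)) * px \<phi> p + (- 2 * (px \<psi> p * py \<psi> p) / fst p) * py \<phi> p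
       + (- ((px \<psi> p)\<^sup>2 + (py \<psi> p)\<^sup>2) / (fst p)\<^sup>2 - 2 * Fprim f (\<psi> p) + snd p) * \<phi> p) p" (is "?A1 = ?B1")
    and variation_integrand2: "((\<lambda>p. (e1 p + e2 p - 2 * (indicator U p * (fst p * Fprim f (\<psi> p))) + indicator P p * (fst p * snd p)) * (px (\<lambda>p. 0) p + py \<phi> p) - 2 * (e1 p * px (\<lambda>p. 0) p + e12 p * py (\<lambda>p. 0) p + e12 p * px \<phi> p + e2 p * py \<phi> p) + (- ((e1 p + e2 p) / fst p) - 2 * (indicator U p * Fprim f (\<psi> p)) + indicator P p * snd p) * 0 + (indicator P p * fst p) * \<phi> p)) p = (\<lambda>p. (- 2 * (px \<psi> p * py \<psi> p) / fst p) * px \<phi> p + (- ((py \<psi> p)\<^sup>2 - (px \<psi> p)\<^sup>2) / fst p + (- 2 * (fst p * Fprim f (\<psi> p)) + fst p * snd p)) * py \<phi> p + fst p * \<phi> p) p" (is "?A2 = ?B2")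
proof -
  have PU: "p \<in> U" using p P_sub(1) by auto
  have GP: "G1 p = px \<psi> p" "G2 p = py \<psi> p" using p by (simp_all add: G1_def G2_def)
  have p0: "px (\<lambda>p. 0) p = 0" "py (\<lambda>p. 0) p = 0" by (simp_all add: px_def py_def)
  show "?A1 = ?B1"
    unfolding e1_def e2_def e12_def
    apply (simp only: indicator_simps(1)[OF p] indicator_simps(1)[OF PU])
    apply (simp only: GP p0)
    apply (simp only: mult_1_left mult_zero_left mult_zero_right add_0_right add_0_left)
    apply (rule stress_expand1)
    done
  show "?A2 = ?B2"
    unfolding e1_def e2_def e12_def
    apply (simp only: indicator_simps(1)[OF p] indicator_simps(1)[OF PU])
    apply (simp only: GP p0)
    apply (simp only: mult_1_left mult_zero_left mult_zero_right add_0_right add_0_left)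
    apply (rule stress_expand2)
    done
qed

text \<open>The variation fields are \<open>(\<phi>, 0)\<close> and \<open>(0, \<phi>)\<close>,
  supported in \<open>P\<close>. There the stress tensor is C^1, so integration by parts moves all
  derivatives off \<open>\<phi>\<close>.\<close>

lemma localized_pde_test:
  assumes \<phi>: "smooth \<phi>" "compact (closure {p. \<phi> p \<noteq> 0})" "closure {p. \<phi> p \<noteq> 0} \<subseteq> P"
  shows "(LINT p:P|lborel. (2 * px \<psi> p * pde p) * \<phi> p) = 0" "(LINT p:P|lborel. (2 * py \<psi> p * pde p) * \<phi> p) = 0"
proof -
  let ?C = "closure {p. \<phi> p \<noteq> 0}"
  have zero: "(\<lambda>p::point. 0::real) = (\<lambda>p. 0)" by simp
  have sm0: "smooth (\<lambda>p. 0)" by (simp add: smooth_def Ck_on_const)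
  have z: "\<phi> p = 0" "px \<phi> p = 0" "py \<phi> p = 0" if "p \<notin> ?C" for p
    using that px_py_zero_off_support[OF that] closure_subset[of "{p. \<phi> p \<noteq> 0}"] by auto
  have p0: "px (\<lambda>p. 0) = (\<lambda>p. 0)" "py (\<lambda>p. 0) = (\<lambda>p. 0)" by (auto simp: px_def py_def fun_eq_iff)
  have CU: "?C \<subseteq> U" using \<phi>(3) P_sub(1) by auto
  let ?S = "\<lambda>p. (py \<psi> p)\<^sup>2 - (px \<psi> p)\<^sup>2"
  let ?Q = "\<lambda>p. - 2 * (px \<psi> p * py \<psi> p) / fst p"
  let ?L = "\<lambda>p. - 2 * (fst p * Fprim f (\<psi> p)) + fst p * snd p"
  have conv: "(LINT p|lborel. W p) = (LINT p:P|lborel. W' p)" if "\<And>p. p \<in> P \<Longrightarrow> W p = W' p" "\<And>p. p \<notin> ?C \<Longrightarrow> W p = 0" for W W' :: "point \<Rightarrow> real"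
    unfolding set_lebesgue_integral_def
  proof (rule Bochner_Integration.integral_cong[OF refl])
    fix p show "W p = indicator P p *\<^sub>R W' p"
      using that[of p] \<phi>(3) by (cases "p \<in> P") auto
  qed
  note ci = psi_cont2 P_cont continuous_on_fst continuous_on_snd continuous_on_id
  have nz: "\<forall>p\<in>P. fst p \<noteq> 0" "\<forall>p\<in>P. (fst p)\<^sup>2 \<noteq> 0" using P_fst_pos by force+
  have PU: "p \<in> P \<Longrightarrow> p \<in> U" for p using P_sub(1) by auto
  have GP: "p \<in> P \<Longrightarrow> G1 p = px \<psi> p" "p \<in> P \<Longrightarrow> G2 p = py \<psi> p" for p by (simp_all add: G1_def G2_def)
  {
    let ?E = "\<lambda>p. (?S p / fst p + ?L p) * px \<phi> p + ?Q p * py \<phi> p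
       + (- ((px \<psi> p)\<^sup>2 + (py \<psi> p)\<^sup>2) / (fst p)\<^sup>2 - 2 * Fprim f (\<psi> p) + snd p) * \<phi> p"
    have v: "(LINT p:P|lborel. ?E p) = 0"
    proof -
      let ?W = "(\<lambda>p. (e1 p + e2 p - 2 * (indicator U p * (fst p * Fprim f (\<psi> p))) + indicator P p * (fst p * snd p)) * (px \<phi> p + py (\<lambda>p. 0) p) - 2 * (e1 p * px \<phi> p + e12 p * py \<phi> p + e12 p * px (\<lambda>p. 0) p + e2 p * py (\<lambda>p. 0) p) + (- ((e1 p + e2 p) / fst p) - 2 * (indicator U p * Fprim f (\<psi> p)) + indicator P p * snd p) * \<phi> p + (indicator P p * fst p) * 0)"
      have va: "(LINT p|lborel. ?W p) = 0"
        by (rule variation[OF \<phi>(1) sm0 \<phi>(2) CU]) (rule conjI, erule z(1), rule refl)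
      have "(LINT p|lborel. ?W p) = (LINT p:P|lborel. ?E p)"
      proof (rule conv)
        show "?W p = ?E p" if "p \<in> P" for p using that by (rule variation_integrand1)
        show "?W p = 0" if "p \<notin> ?C" for p by (simp only: p0 z[OF that] mult_zero_right add_0_right diff_zero)
      qed
      then show ?thesis using va by linarith
    qed
    let ?Ax = "\<lambda>p. 2 * (py \<psi> p * py (px \<psi>) p - px \<psi> p * px (px \<psi>) p) / fst p - ?S p / (fst p)\<^sup>2
        - 2 * Fprim f (\<psi> p) - 2 * fst p * (f (\<psi> p) * px \<psi> p) + snd p"
    let ?By = "\<lambda>p. - 2 * (py (px \<psi>) p * py \<psi> p + px \<psi> p * py (py \<psi>) p) / fst p"
    have cont: "continuous_on P (\<lambda>p. ?S p / fst p + ?L p)" "continuous_on P ?Q" "continuous_on P ?Ax" "continuous_on P ?By"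
      by (intro continuous_intros ci nz)+
    have DA: "((\<lambda>t. ?S (t, snd p) / fst (t, snd p) + ?L (t, snd p)) has_real_derivative ?Ax p) (at (fst p))" if "p \<in> P" for p
      using P_fst_pos[OF that] stress_deriv_x1[OF P_deriv(3)[OF that] P_deriv(5)[OF that] P_deriv(7)[OF that]] by simp
    have DB: "((\<lambda>t. ?Q (fst p, t)) has_real_derivative ?By p) (at (snd p))" if "p \<in> P" for p
      using P_fst_pos[OF that] stress_deriv_y1[OF P_deriv(4)[OF that] P_deriv(6)[OF that] P_deriv(8)[OF that]] by simp
    note ld = localized_divergence[OF \<phi> cont DA DB]
    have iE: "set_integrable lborel P ?E"
    proof (rule compact_support_set_integrable[OF open_P \<phi>(2,3) _ _ \<phi>(3) order_refl])
      show "continuous_on P ?E" by (intro continuous_intros ci nz smooth_D[OF \<phi>(1)])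
      fix p assume "p \<in> P - ?C"
      then have "p \<notin> ?C" by blast
      then show "?E p = 0" by (simp only: z[OF \<open>p \<notin> ?C\<close>] mult_zero_right add_0_right)
    qed
    have "(LINT p:P|lborel. (2 * px \<psi> p * pde p) * \<phi> p)
      = (LINT p:P|lborel. ?E p - (((?S p / fst p + ?L p) * px \<phi> p + ?Q p * py \<phi> p) + (?Ax p + ?By p) * \<phi> p))"
    proof (rule set_lebesgue_integral_cong)
      show "\<forall>p. p \<in> P \<longrightarrow> (2 * px \<psi> p * pde p) * \<phi> p
        = ?E p - (((?S p / fst p + ?L p) * px \<phi> p + ?Q p * py \<phi> p) + (?Ax p + ?By p) * \<phi> p)"
      proof (intro allI impI)
        fix p assume "p \<in> P"
        then have "2 * px \<psi> p * pde p = - ((px \<psi> p)\<^sup>2 + (py \<psi> p)\<^sup>2) / (fst p)\<^sup>2 - 2 * Fprim f (\<psi> p) + snd p - (?Ax p + ?By p)"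
          unfolding pde_def by (intro pde_expand1)
        then show "(2 * px \<psi> p * pde p) * \<phi> p
          = ?E p - (((?S p / fst p + ?L p) * px \<phi> p + ?Q p * py \<phi> p) + (?Ax p + ?By p) * \<phi> p)"
          by (simp only:) (simp add: algebra_simps)
      qed
    qed auto
    also have "\<dots> = (LINT p:P|lborel. ?E p) - (LINT p:P|lborel. ((?S p / fst p + ?L p) * px \<phi> p + ?Q p * py \<phi> p) + (?Ax p + ?By p) * \<phi> p)"
      by (rule set_integral_diff(2)[OF iE ld(1)])
    also have "\<dots> = 0" using v ld(2) by linarith
    finally show "(LINT p:P|lborel. (2 * px \<psi> p * pde p) * \<phi> p) = 0" .
  }
  {
    let ?E = "\<lambda>p. ?Q p * px \<phi> p + (- ?S p / fst p + ?L p) * py \<phi> p + fst p * \<phi> p"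
    have v: "(LINT p:P|lborel. ?E p) = 0"
    proof -
      let ?W = "(\<lambda>p. (e1 p + e2 p - 2 * (indicator U p * (fst p * Fprim f (\<psi> p))) + indicator P p * (fst p * snd p)) * (px (\<lambda>p. 0) p + py \<phi> p) - 2 * (e1 p * px (\<lambda>p. 0) p + e12 p * py (\<lambda>p. 0) p + e12 p * px \<phi> p + e2 p * py \<phi> p) + (- ((e1 p + e2 p) / fst p) - 2 * (indicator U p * Fprim f (\<psi> p)) + indicator P p * snd p) * 0 + (indicator P p * fst p) * \<phi> p)"
      have va: "(LINT p|lborel. ?W p) = 0"
        by (rule variation[OF sm0 \<phi>(1) \<phi>(2) CU]) (rule conjI, rule refl, erule z(1))
      have "(LINT p|lborel. ?W p) = (LINT p:P|lborel. ?E p)"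
      proof (rule conv)
        show "?W p = ?E p" if "p \<in> P" for p using that by (rule variation_integrand2)
        show "?W p = 0" if "p \<notin> ?C" for p by (simp only: p0 z[OF that] mult_zero_right add_0_right diff_zero)
      qed
      then show ?thesis using va by linarith
    qed
    let ?Ax = "\<lambda>p. - 2 * (px (px \<psi>) p * py \<psi> p + px \<psi> p * py (px \<psi>) p) / fst p + 2 * (px \<psi> p * py \<psi> p) / (fst p)\<^sup>2"
    let ?By = "\<lambda>p. - 2 * (py \<psi> p * py (py \<psi>) p - px \<psi> p * py (px \<psi>) p) / fst p - 2 * fst p * (f (\<psi> p) * py \<psi> p) + fst p"
    have cont: "continuous_on P ?Q" "continuous_on P (\<lambda>p. - ?S p / fst p + ?L p)" "continuous_on P ?Ax" "continuous_on P ?By"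
      by (intro continuous_intros ci nz)+
    have DA: "((\<lambda>t. ?Q (t, snd p)) has_real_derivative ?Ax p) (at (fst p))" if "p \<in> P" for p
      using P_fst_pos[OF that] stress_deriv_x2[OF P_deriv(3)[OF that] P_deriv(5)[OF that] P_deriv(7)[OF that]] by simp
    have DB: "((\<lambda>t. - ?S (fst p, t) / fst (fst p, t) + ?L (fst p, t)) has_real_derivative ?By p) (at (snd p))" if "p \<in> P" for p
      using P_fst_pos[OF that] stress_deriv_y2[OF P_deriv(4)[OF that] P_deriv(6)[OF that] P_deriv(8)[OF that]] by simp
    note ld = localized_divergence[OF \<phi> cont DA DB]
    have iE: "set_integrable lborel P ?E"
    proof (rule compact_support_set_integrable[OF open_P \<phi>(2,3) _ _ \<phi>(3) order_refl])
      show "continuous_on P ?E" by (intro continuous_intros ci nz smooth_D[OF \<phi>(1)])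
      fix p assume "p \<in> P - ?C"
      then have "p \<notin> ?C" by blast
      then show "?E p = 0" by (simp only: z[OF \<open>p \<notin> ?C\<close>] mult_zero_right add_0_right)
    qed
    have "(LINT p:P|lborel. (2 * py \<psi> p * pde p) * \<phi> p)
      = (LINT p:P|lborel. ?E p - ((?Q p * px \<phi> p + (- ?S p / fst p + ?L p) * py \<phi> p) + (?Ax p + ?By p) * \<phi> p))"
    proof (rule set_lebesgue_integral_cong)
      show "\<forall>p. p \<in> P \<longrightarrow> (2 * py \<psi> p * pde p) * \<phi> p
        = ?E p - ((?Q p * px \<phi> p + (- ?S p / fst p + ?L p) * py \<phi> p) + (?Ax p + ?By p) * \<phi> p)"
      proof (intro allI impI)
        fix p assume "p \<in> P"
        then have "2 * py \<psi> p * pde p = fst p - (?Ax p + ?By p)"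
          unfolding pde_def by (intro pde_expand2)
        then show "(2 * py \<psi> p * pde p) * \<phi> p
          = ?E p - ((?Q p * px \<phi> p + (- ?S p / fst p + ?L p) * py \<phi> p) + (?Ax p + ?By p) * \<phi> p)"
          by (simp only:) (simp add: algebra_simps)
      qed
    qed auto
    also have "\<dots> = (LINT p:P|lborel. ?E p) - (LINT p:P|lborel. (?Q p * px \<phi> p + (- ?S p / fst p + ?L p) * py \<phi> p) + (?Ax p + ?By p) * \<phi> p)"
      by (rule set_integral_diff(2)[OF iE ld(1)])
    also have "\<dots> = 0" using v ld(2) by linarith
    finally show "(LINT p:P|lborel. (2 * py \<psi> p * pde p) * \<phi> p) = 0" .
  }
qed

text \<open>The tests give zero almost everywhere, and both products are continuous on
  \<open>P\<close>.\<close>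

lemma pde_times_gradient:
  assumes p: "p \<in> P"
  shows "px \<psi> p * pde p = 0" "py \<psi> p * pde p = 0"
proof -
  have ci: "continuous_on P (\<lambda>p. 2 * px \<psi> p * pde p)" "continuous_on P (\<lambda>p. 2 * py \<psi> p * pde p)"
    by (intro continuous_intros psi_cont2 pde_cont)+
  have I: "set_integrable lborel K u" if "compact K" "K \<subseteq> P" "continuous_on P u" for K and u :: "point \<Rightarrow> real"
    unfolding set_integrable_def by (rule borel_integrable_compact[OF that(1) continuous_on_subset[OF that(3,2)]])
  have "2 * px \<psi> p * pde p = 0"
    by (rule continuous_AE_zero[OF open_P ci(1) fundamental_lemma[OF open_P I localized_pde_test(1)] p]) (use ci in auto)
  moreover have "2 * py \<psi> p * pde p = 0"
    by (rule continuous_AE_zero[OF open_P ci(2) fundamental_lemma[OF open_P I localized_pde_test(2)] p]) (use ci in auto)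
  ultimately show "px \<psi> p * pde p = 0" "py \<psi> p * pde p = 0" by auto
qed

text \<open>Where the gradient vanishes the variational identity says nothing about \<open>f\<close>. If the equation
  failed at a point with value \<open>c\<close>, then the set of points with value \<open>c\<close> at which it fails would be
  open and closed in the ball, which is impossible because \<open>\<psi>\<close> vanishes at the centre.\<close>

lemma pde_zero:
  assumes p0: "p0 \<in> P"
  shows "pde p0 = 0"
proof (rule ccontr)
  assume nz: "pde p0 \<noteq> 0"
  define c where "c = \<psi> p0"
  have c: "c > 0" using p0 by (simp add: c_def P_def)
  \<comment> \<open>On the open set where the equation fails both first derivatives vanish
    identically, hence also the pure second ones, and the residual is just
    \<open>x * f(\<psi>)\<close>.\<close>
  define V where "V = {p \<in> P. pde p \<noteq> 0}"
  have oV: "open V"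
  proof -
    have "V = pde -` (- {0}) \<inter> P" by (auto simp: V_def)
    then show ?thesis using pde_cont open_P by (simp add: continuous_on_open_vimage open_Compl)
  qed
  have grad: "px \<psi> p = 0" "py \<psi> p = 0" if "p \<in> V" for p
    using pde_times_gradient[of p] that by (auto simp: V_def)
  have VP: "V \<subseteq> P" by (auto simp: V_def)
  have second: "px (px \<psi>) p = 0" "py (py \<psi>) p = 0" if p: "p \<in> V" for p
  proof -
    have "open ((\<lambda>t. (t, snd p)) -` V)" "open ((\<lambda>t. (fst p, t)) -` V)"
      by (intro open_vimage[OF oV] continuous_intros)+
    note o = this
    have "eventually (\<lambda>t. px \<psi> (t, snd p) = 0) (nhds (fst p))"
      by (rule eventually_mono[OF eventually_nhds_in_open[OF o(1), of "fst p"]]) (use p grad in auto)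
    from DERIV_cong_ev[OF refl this refl, THEN iffD2] have "((\<lambda>t. px \<psi> (t, snd p)) has_real_derivative 0) (at (fst p))" by simp
    then show "px (px \<psi>) p = 0" by (rule px_eqI)
    have "eventually (\<lambda>t. py \<psi> (fst p, t) = 0) (nhds (snd p))"
      by (rule eventually_mono[OF eventually_nhds_in_open[OF o(2), of "snd p"]]) (use p grad in auto)
    from DERIV_cong_ev[OF refl this refl, THEN iffD2] have "((\<lambda>t. py \<psi> (fst p, t)) has_real_derivative 0) (at (snd p))" by simp
    then show "py (py \<psi>) p = 0" by (rule py_eqI)
  qed
  have pdeV: "pde p = fst p * f (\<psi> p)" if "p \<in> V" for p
    using grad[OF that] second[OF that] by (simp add: pde_def)
  have p0V: "p0 \<in> V" using nz p0 by (simp add: V_def)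
  have fc: "f c \<noteq> 0" using pdeV[OF p0V] nz by (auto simp: c_def)
  define A where "A = {p \<in> V. \<psi> p = c}"
  \<comment> \<open>Inside \<open>V\<close> the gradient is zero, so \<open>\<psi>\<close> is
    constant on small balls.\<close>
  have oA: "open A"
    unfolding open_contains_ball
  proof
    fix p assume p: "p \<in> A"
    then obtain e where e: "e > 0" "ball p e \<subseteq> V" using oV by (auto simp: A_def open_contains_ball)
    have const: "\<psi> q = \<psi> p" if q: "q \<in> ball p e" for q
    proof -
      have "(\<psi> has_derivative (\<lambda>v. 0)) (at z within ball p e)" if z: "z \<in> ball p e" for z
      proof -
        have zV: "z \<in> V" using z e by auto
        then have "\<psi> differentiable (at z)" by (intro psi_diff(1) subsetD[OF VP])
        then obtain D where D: "(\<psi> has_derivative D) (at z)" by (auto simp: differentiable_def)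
        have "((\<lambda>t. \<psi> (t, snd z)) has_derivative (\<lambda>t. D (t, 0))) (at (fst z))"
          by (rule has_derivative_compose[of "\<lambda>t. (t, snd z)" "\<lambda>t. (t, 0)"]) (use D in \<open>auto intro!: derivative_eq_intros\<close>)
        moreover have "((\<lambda>t. \<psi> (t, snd z)) has_derivative (*) 0) (at (fst z))"
          using P_deriv(1)[OF subsetD[OF VP zV]] grad(1)[OF zV] by (simp add: has_field_derivative_def)
        ultimately have "(\<lambda>t. D (t, 0)) = (*) 0" by (rule has_derivative_unique)
        then have D1: "D (t, 0) = 0" for t by (simp add: fun_eq_iff)
        have "((\<lambda>t. \<psi> (fst z, t)) has_derivative (\<lambda>t. D (0, t))) (at (snd z))"
          by (rule has_derivative_compose[of "\<lambda>t. (fst z, t)" "\<lambda>t. (0, t)"]) (use D in \<open>auto intro!: derivative_eq_intros\<close>)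
        moreover have "((\<lambda>t. \<psi> (fst z, t)) has_derivative (*) 0) (at (snd z))"
          using P_deriv(2)[OF subsetD[OF VP zV]] grad(2)[OF zV] by (simp add: has_field_derivative_def)
        ultimately have "(\<lambda>t. D (0, t)) = (*) 0" by (rule has_derivative_unique)
        then have D2: "D (0, t) = 0" for t by (simp add: fun_eq_iff)
        have "D v = 0" for v
          using linear_add[OF has_derivative_linear[OF D], of "(fst v, 0)" "(0, snd v)"] D1 D2 by simp
        then have "D = (\<lambda>v. 0)" by (simp add: fun_eq_iff del: split_paired_All)
        then show ?thesis using D by (simp add: has_derivative_at_withinI)
      qed
      then show ?thesis
        using has_derivative_zero_unique[OF convex_ball, of p e \<psi> p q] q e by auto
    qed
    have "ball p e \<subseteq> A"
    proof
      fix q assume q: "q \<in> ball p e"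
      show "q \<in> A" using const[OF q] subsetD[OF e(2) q] p by (simp add: A_def)
    qed
    then show "\<exists>e>0. ball p e \<subseteq> A" using e(1) by blast
  qed
  have "A = U"
  proof -
    have "closedin (top_of_set U) A"
      unfolding closedin_limpt
    proof (intro conjI allI impI)
      show "A \<subseteq> U" using VP P_sub(1) by (auto simp: A_def)
      fix p assume p: "p islimpt A \<and> p \<in> U"
      then obtain s where s: "\<And>n. s n \<in> A" "s \<longlonglongrightarrow> p" by (auto simp: islimpt_sequential)
      have psi: "\<psi> p = c"
      proof (rule LIMSEQ_unique)
        show "(\<lambda>n. \<psi> (s n)) \<longlonglongrightarrow> \<psi> p"
        proof (rule continuous_on_tendsto_compose[OF psi_cont_U s(2)])
          show "p \<in> U" using p by simp
          have "s n \<in> U" for n using s(1)[of n] VP P_sub(1) by (auto simp: A_def)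
          then show "eventually (\<lambda>n. s n \<in> U) sequentially" by (rule always_eventually[OF allI])
        qed
        show "(\<lambda>n. \<psi> (s n)) \<longlonglongrightarrow> c" using s(1) by (simp add: A_def)
      qed
      then have pP: "p \<in> P" using p c by (simp add: P_def)
      \<comment> \<open>The failure survives the limit: along the sequence the residual is
        \<open>x\<close> times the same nonzero \<open>f c\<close>, and the limit point has value
        \<open>c > 0\<close>, so it lies in \<open>P\<close>, where the residual is
        continuous.\<close>
      have "pde p = fst p * f c"
      proof (rule LIMSEQ_unique)
        show "(\<lambda>n. pde (s n)) \<longlonglongrightarrow> pde p"
        proof (rule continuous_on_tendsto_compose[OF pde_cont s(2) pP])
          have "s n \<in> P" for n using s(1)[of n] VP by (auto simp: A_def)
          then show "eventually (\<lambda>n. s n \<in> P) sequentially" by (rule always_eventually[OF allI])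
        qed
        have "pde (s n) = fst (s n) * f c" for n using s(1)[of n] pdeV by (auto simp: A_def)
        then show "(\<lambda>n. pde (s n)) \<longlonglongrightarrow> fst p * f c" using s(2) by (auto intro!: tendsto_intros)
      qed
      then have "pde p \<noteq> 0" using fc P_fst_pos[OF pP] by simp
      then show "p \<in> A" using pP psi by (simp add: A_def V_def)
    qed
    moreover have "openin (top_of_set U) A" using oA VP P_sub(1) by (intro open_subset) (auto simp: A_def)
    moreover have "connected U" by (simp add: U_def)
    ultimately show ?thesis using p0V unfolding connected_clopen by (auto simp: A_def c_def)
  qed
  moreover have "Xc \<in> U" using R_pos by (simp add: U_def)
  ultimately have "Xc \<in> A" by simp
  then have "\<psi> Xc = c" by (simp add: A_def)
  then show False using psi_Xc c by simp
qed

end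

section \<open>Flux identities on circles\<close>

lemma rsq_derivs:
  shows "((\<lambda>t. rsq X (t, snd p)) has_real_derivative 2 * (fst p - fst X)) (at (fst p))"
    "((\<lambda>t. rsq X (fst p, t)) has_real_derivative 2 * (snd p - snd X)) (at (snd p))"
    "px (rsq X) p = 2 * (fst p - fst X)" "py (rsq X) p = 2 * (snd p - snd X)"
proof -
  show 1: "((\<lambda>t. rsq X (t, snd p)) has_real_derivative 2 * (fst p - fst X)) (at (fst p))"
    unfolding rsq_def by (auto intro!: derivative_eq_intros)
  show 2: "((\<lambda>t. rsq X (fst p, t)) has_real_derivative 2 * (snd p - snd X)) (at (snd p))"
    unfolding rsq_def by (auto intro!: derivative_eq_intros)
  show "px (rsq X) p = 2 * (fst p - fst X)" "py (rsq X) p = 2 * (snd p - snd X)"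
    using px_eqI[OF 1] py_eqI[OF 2] by auto
qed

lemma rsq_cont: "continuous_on S (rsq X)"
  using Ck_on_rsq[of 0 X] by (simp add: continuous_on_subset[of UNIV])

text \<open>These are the hypotheses on the weight in \<open>radial_flux\<close>; each flux identity
  interprets the locale for its test functions.\<close>

locale radial_test = degenerate_point +
  fixes h h' :: "real \<Rightarrow> real" and \<rho> :: real
  assumes Cnh: "\<And>n. Cn n h" and Cnh': "\<And>n. Cn n h'" and dh: "\<And>s. (h has_real_derivative h' s) (at s)"
    and \<rho>: "0 < \<rho>" "\<rho> < R" and h0: "\<And>s. s \<ge> \<rho>\<^sup>2 \<Longrightarrow> h s = 0"
begin

abbreviation hr :: "point \<Rightarrow> real" where "hr p \<equiv> h (rsq Xc p)"
abbreviation hr' :: "point \<Rightarrow> real" where "hr' p \<equiv> h' (rsq Xc p)"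
abbreviation dx :: "point \<Rightarrow> real" where "dx p \<equiv> fst p - fst Xc"
abbreviation dy :: "point \<Rightarrow> real" where "dy p \<equiv> snd p - snd Xc"

lemma Ck_hr: "Ck_on n UNIV hr" and Ck_hr': "Ck_on n UNIV hr'"
  by (rule Ck_on_compose[OF Cnh Ck_on_rsq], rule Ck_on_compose[OF Cnh' Ck_on_rsq])

lemma Ck_dx: "Ck_on n UNIV dx" and Ck_dy: "Ck_on n UNIV dy"
  using Ck_on_add[OF Ck_on_fst Ck_on_const, of n "- fst Xc"] Ck_on_add[OF Ck_on_snd Ck_on_const, of n "- snd Xc"] by simp_all

lemma smooth_hr: "smooth hr" and smooth_hrdx: "smooth (\<lambda>p. hr p * dx p)" and smooth_hrdy: "smooth (\<lambda>p. hr p * dy p)"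
  unfolding smooth_def by (intro allI Ck_on_mult Ck_hr Ck_dx Ck_dy)+

lemma hr_cont: "continuous_on S hr" "continuous_on S hr'"
  using Ck_hr[of 0] Ck_hr'[of 0] by (auto intro: continuous_on_subset[of UNIV])

lemma hr_deriv:
  "((\<lambda>t. hr (t, snd p)) has_real_derivative hr' p * (2 * dx p)) (at (fst p))"
  "((\<lambda>t. hr (fst p, t)) has_real_derivative hr' p * (2 * dy p)) (at (snd p))"
  using DERIV_chain2[OF dh rsq_derivs(1)] DERIV_chain2[OF dh rsq_derivs(2)] by simp_all

lemma px_hr: "px hr p = hr' p * (2 * dx p)" "py hr p = hr' p * (2 * dy p)"
  using px_eqI[of hr, OF hr_deriv(1)] py_eqI[of hr, OF hr_deriv(2)] by auto

lemma px_hrdx: "px (\<lambda>p. hr p * dx p) p = hr' p * (2 * dx p) * dx p + hr p"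
   "py (\<lambda>p. hr p * dx p) p = hr' p * (2 * dy p) * dx p"
   "px (\<lambda>p. hr p * dy p) p = hr' p * (2 * dx p) * dy p"
   "py (\<lambda>p. hr p * dy p) p = hr' p * (2 * dy p) * dy p + hr p"
proof -
  have d: "hr differentiable (at p)" "dx differentiable (at p)" "dy differentiable (at p)"
    using Ck_hr[of "Suc 0"] Ck_dx[of "Suc 0"] Ck_dy[of "Suc 0"] by (simp_all del: split_paired_All)
  have "px dx p = 1" "py dx p = 0" "px dy p = 0" "py dy p = 1"
    by (auto intro!: px_eqI py_eqI derivative_eq_intros)
  then show "px (\<lambda>p. hr p * dx p) p = hr' p * (2 * dx p) * dx p + hr p"
   "py (\<lambda>p. hr p * dx p) p = hr' p * (2 * dy p) * dx p"
   "px (\<lambda>p. hr p * dy p) p = hr' p * (2 * dx p) * dy p"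
   "py (\<lambda>p. hr p * dy p) p = hr' p * (2 * dy p) * dy p + hr p"
    by (simp_all add: px_mult[OF d(1,2)] py_mult[OF d(1,2)] px_mult[OF d(1,3)] py_mult[OF d(1,3)] px_hr)
qed

text \<open>Outside the closed disc \<open>rsq\<close> strictly exceeds
  \<open>\<rho>\<^sup>2\<close>, so \<open>h\<close> is zero near that value and its derivative
  vanishes too.\<close>

lemma hr_zero: "p \<notin> cball Xc \<rho> \<Longrightarrow> hr p = 0" "p \<notin> cball Xc \<rho> \<Longrightarrow> hr' p = 0"
proof -
  assume p: "p \<notin> cball Xc \<rho>"
  then have gt: "\<rho>\<^sup>2 < rsq Xc p" unfolding rsq_dist using \<rho> by (intro power_strict_mono) auto
  then show "hr p = 0" using h0 by simp
  have "eventually (\<lambda>s. h s = 0) (nhds (rsq Xc p))"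
    by (rule eventually_mono[OF eventually_nhds_in_open[of "{\<rho>\<^sup>2<..}"]]) (use gt h0 in auto)
  from DERIV_cong_ev[OF refl this refl, THEN iffD2] have "(h has_real_derivative 0) (at (rsq Xc p))" by simp
  then show "hr' p = 0" using dh DERIV_unique by blast
qed

lemma cball_\<rho>: "compact (cball Xc \<rho>)" "cball Xc \<rho> \<subseteq> U"
  using \<rho> by (auto simp: U_def)

end

section \<open>Bulk and boundary densities of the flux identities\<close>

context degenerate_point begin

lemma integrable_times_cont:
  assumes w: "integrable lborel w" "\<And>p. p \<notin> U \<Longrightarrow> w p = 0" and v: "continuous_on (cball Xc R) v"
  shows "integrable lborel (\<lambda>p. w p * v p :: real)"
proof -
  have m: "(\<lambda>p. indicator U p *\<^sub>R v p) \<in> borel_measurable borel"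
    by (rule borel_measurable_continuous_on_indicator[OF sets_UP(1) continuous_on_subset[OF v U_sub(1)]])
  have "compact (v ` cball Xc R)" by (rule compact_continuous_image[OF v compact_cball])
  then obtain M where M: "\<And>p. p \<in> cball Xc R \<Longrightarrow> \<bar>v p\<bar> \<le> M"
    using compact_imp_bounded[of "v ` cball Xc R"] unfolding bounded_real by blast
  have "integrable lborel (\<lambda>p. w p * (indicator U p *\<^sub>R v p))"
  proof (rule integrable_bounded_mult[OF w(1) m])
    fix p show "\<bar>indicator U p *\<^sub>R v p\<bar> \<le> \<bar>M\<bar>"
    proof (cases "p \<in> U")
      case True
      then have "\<bar>v p\<bar> \<le> M" by (rule M[OF subsetD[OF U_sub(1)]])
      then show ?thesis using True by simp
    qed simp
  qed
  moreover have eq: "w p * (indicator U p *\<^sub>R v p) = w p * v p" for p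
    using w(2)[of p] by (cases "p \<in> U") auto
  ultimately show ?thesis unfolding eq by simp
qed

lemma off_U: assumes "p \<notin> U" shows "p \<notin> P" "indicat_real P p = 0" "indicat_real U p = 0" "e1 p = 0" "e2 p = 0" "e12 p = 0" "G1 p = 0" "G2 p = 0"
proof -
  show 1: "p \<notin> P" using assms P_sub(1) by blast
  show "indicat_real P p = 0" "indicat_real U p = 0" "e1 p = 0" "e2 p = 0" "e12 p = 0" "G1 p = 0" "G2 p = 0"
    using 1 assms by (simp_all add: e_zero G_zero)
qed

lemma psi_cont_cball: "continuous_on (cball Xc R) \<psi>"
  by (rule continuous_on_subset[OF psi_cont cball_Omega])

lemma radial_integral_restrict:
  assumes "\<And>p. p \<notin> U \<Longrightarrow> a p = 0" "\<And>p. p \<notin> U \<Longrightarrow> b p = 0"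
  shows "(LINT p:ball Xc R|lborel. h p * a p + 2 * h' p * b p) = (LINT p|lborel. h p * a p + 2 * h' p * (b p :: real))"
  unfolding set_lebesgue_integral_def
proof (rule Bochner_Integration.integral_cong[OF refl])
  fix p show "indicator (ball Xc R) p *\<^sub>R (h p * a p + 2 * h' p * b p) = h p * a p + 2 * h' p * b p"
    using assms[of p] by (cases "p \<in> U") (auto simp: U_def)
qed

text \<open>The scalar that multiplies the divergence of the test field in
  \<open>variation\<close>.\<close>

definition TF :: "point \<Rightarrow> real" where
  "TF p = e1 p + e2 p - 2 * (indicator U p * (fst p * Fprim f (\<psi> p))) + indicator P p * (fst p * snd p)"

lemma TF_integrable: "integrable lborel TF"
proof -
  note ci = continuous_on_mult continuous_on_fst continuous_on_snd continuous_on_id F_psi_cont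
  show ?thesis unfolding TF_def[abs_def]
    by (intro Bochner_Integration.integrable_add Bochner_Integration.integrable_diff integrable_mult_right e_integrable
        cball_integrable ci sets_UP U_sub(1) P_sub_cball)
qed

lemma TF_off_U: "p \<notin> U \<Longrightarrow> TF p = 0"
  by (simp add: TF_def off_U)

text \<open>The coefficients of \<open>h\<close> and \<open>2 h'\<close> when the variation is tested with
  \<open>h(|p - X\<^sub>0|\<^sup>2) (p - X\<^sub>0)\<close>.\<close>

definition a_pohozaev :: "point \<Rightarrow> real" where
  "a_pohozaev p = - 6 * (indicator U p * (fst p * Fprim f (\<psi> p))) + 2 * x0 * (indicator U p * Fprim f (\<psi> p))
     + 3 * (indicator P p * (fst p * snd p)) + indicator P p * ((fst p - x0) * snd p) - (e1 p + e2 p) * ((fst p - x0) / fst p)"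

definition b_pohozaev :: "point \<Rightarrow> real" where
  "b_pohozaev p = TF p * rsq Xc p - 2 * (e1 p * (fst p - x0)\<^sup>2 + 2 * (e12 p * ((fst p - x0) * snd p)) + e2 p * (snd p)\<^sup>2)"

lemma cball_cont_over_fst: "continuous_on (cball Xc R) v \<Longrightarrow> continuous_on (cball Xc R) (\<lambda>p. v p / fst p :: real)"
  by (intro continuous_on_divide continuous_on_fst continuous_on_id) (use fst_nz in blast)+

lemma e12_sum_off_U: "p \<notin> U \<Longrightarrow> e1 p + e2 p = 0" by (simp add: off_U)

lemma a_pohozaev_integrable: "integrable lborel a_pohozaev" and b_pohozaev_integrable: "integrable lborel b_pohozaev"
proof -
  have c: "continuous_on (cball Xc R) (\<lambda>p. fst p * Fprim f (\<psi> p))" "continuous_on (cball Xc R) (\<lambda>p. (fst p - x0) * snd p)"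
    "continuous_on (cball Xc R) (\<lambda>p. fst p * snd p)" "continuous_on (cball Xc R) (\<lambda>p. fst p - x0)"
    "continuous_on (cball Xc R) (\<lambda>p. (fst p - x0)\<^sup>2)" "continuous_on (cball Xc R) (\<lambda>p. (snd p)\<^sup>2)"
    by (intro continuous_intros F_psi_cont)+
  show "integrable lborel a_pohozaev"
    unfolding a_pohozaev_def[abs_def]
    by (intro Bochner_Integration.integrable_add Bochner_Integration.integrable_diff integrable_mult_right e_integrable
        cball_integrable c F_psi_cont sets_UP U_sub(1) P_sub_cball integrable_times_cont cball_cont_over_fst e12_sum_off_U)
  show "integrable lborel b_pohozaev"
    unfolding b_pohozaev_def[abs_def]
    by (intro Bochner_Integration.integrable_add Bochner_Integration.integrable_diff integrable_mult_right e_integrable TF_integrable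
        integrable_times_cont c rsq_cont TF_off_U off_U)
qed

text \<open>The divergence of \<open>p - Xc\<close> is 2, which in the plane cancels the Dirichlet
  energy against the term with the Jacobian of the field. In the bulk there remain the potential
  terms and what comes from the explicit dependence of the functional on \<open>x\<close> and
  \<open>y\<close>.\<close>

lemma pohozaev_flux: "AE t in lborel. 0 < t \<and> t < R \<longrightarrow> t * disc_int Xc t a_pohozaev = circ_int Xc t b_pohozaev"
proof (rule radial_flux[OF a_pohozaev_integrable b_pohozaev_integrable R_pos])
  fix h h' :: "real \<Rightarrow> real" and \<rho> :: real
  assume "\<And>n. Cn n h" "\<And>n. Cn n h'" "\<And>s. (h has_real_derivative h' s) (at s)" "0 < \<rho>" "\<rho> < R" "\<And>s. s \<ge> \<rho>\<^sup>2 \<Longrightarrow> h s = 0"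
  then interpret radial_test \<Omega> f \<psi> g x0 h h' \<rho> by unfold_locales auto
  have v: "(LINT p|lborel. TF p * (px (\<lambda>p. hr p * dx p) p + py (\<lambda>p. hr p * dy p) p)
     - 2 * (e1 p * px (\<lambda>p. hr p * dx p) p + e12 p * py (\<lambda>p. hr p * dx p) p + e12 p * px (\<lambda>p. hr p * dy p) p + e2 p * py (\<lambda>p. hr p * dy p) p)
     + (- ((e1 p + e2 p) / fst p) - 2 * (indicator U p * Fprim f (\<psi> p)) + indicator P p * snd p) * (hr p * dx p)
     + (indicator P p * fst p) * (hr p * dy p)) = 0"
    unfolding TF_def
    by (rule variation[OF smooth_hrdx smooth_hrdy cball_\<rho>]) (simp add: hr_zero del: mem_cball)
  have "(LINT p:ball Xc R|lborel. hr p * a_pohozaev p + 2 * hr' p * b_pohozaev p) = (LINT p|lborel. hr p * a_pohozaev p + 2 * hr' p * b_pohozaev p)"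
    by (rule radial_integral_restrict) (simp_all add: a_pohozaev_def b_pohozaev_def off_U TF_off_U)
  also have "\<dots> = 0"
  proof (rule trans[OF Bochner_Integration.integral_cong[OF refl] v])
    fix p
    \<comment> \<open>The energy in \<open>2 * TF\<close> cancels against the next summand; its term
      -4 x F combines with -2 (x - x0) F to -6 x F + 2 x0 F.\<close>
    have eq: "hr p * a_pohozaev p = 2 * TF p * hr p - 2 * (e1 p + e2 p) * hr p
      + (- ((e1 p + e2 p) / fst p) - 2 * (indicator U p * Fprim f (\<psi> p)) + indicator P p * snd p) * (hr p * dx p)
     + (indicator P p * fst p) * (hr p * dy p)"
      by (simp add: a_pohozaev_def TF_def Xc_def add_divide_distrib diff_divide_distrib algebra_simps)
    have eb: "b_pohozaev p = TF p * (dx p * dx p + dy p * dy p) - 2 * (e1 p * (dx p * dx p) + 2 * (e12 p * (dx p * dy p)) + e2 p * (dy p * dy p))"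
      by (simp add: b_pohozaev_def rsq_def Xc_def power2_eq_square)
    show "hr p * a_pohozaev p + 2 * hr' p * b_pohozaev p = TF p * (px (\<lambda>p. hr p * dx p) p + py (\<lambda>p. hr p * dy p) p)
     - 2 * (e1 p * px (\<lambda>p. hr p * dx p) p + e12 p * py (\<lambda>p. hr p * dx p) p + e12 p * px (\<lambda>p. hr p * dy p) p + e2 p * py (\<lambda>p. hr p * dy p) p)
     + (- ((e1 p + e2 p) / fst p) - 2 * (indicator U p * Fprim f (\<psi> p)) + indicator P p * snd p) * (hr p * dx p)
     + (indicator P p * fst p) * (hr p * dy p)"
      unfolding eq eb px_hrdx by (simp add: algebra_simps)
  qed
  finally show "(LINT p:ball Xc R|lborel. hr p * a_pohozaev p + 2 * hr' p * b_pohozaev p) = 0" .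
qed

text \<open>The coefficient of \<open>2 * h'\<close> when the test field is
  \<open>(0, h)\<close>.\<close>

definition b_vertical :: "point \<Rightarrow> real" where
  "b_vertical p = TF p * snd p - 2 * (e12 p * (fst p - x0) + e2 p * snd p)"

text \<open>The functional depends explicitly on \<open>y\<close> only through \<open>x * y\<close>
  on the positivity set, so vertical translation leaves the positive density \<open>x\<close> in the
  bulk.\<close>

lemma vertical_flux: "AE t in lborel. 0 < t \<and> t < R \<longrightarrow> t * disc_int Xc t (\<lambda>p. indicator P p * fst p) = circ_int Xc t b_vertical"
proof (rule radial_flux[OF _ _ R_pos])
  show "integrable lborel (\<lambda>p. indicator P p * (fst p :: real))"
    by (intro cball_integrable continuous_on_fst continuous_on_id sets_UP P_sub_cball)
  have c: "continuous_on (cball Xc R) (\<lambda>p. fst p - x0)" "continuous_on (cball Xc R) (\<lambda>p. snd p :: real)"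
    by (intro continuous_intros)+
  show "integrable lborel b_vertical" unfolding b_vertical_def[abs_def]
    by (intro Bochner_Integration.integrable_add Bochner_Integration.integrable_diff integrable_mult_right e_integrable TF_integrable
        integrable_times_cont c TF_off_U off_U)
  fix h h' :: "real \<Rightarrow> real" and \<rho> :: real
  assume "\<And>n. Cn n h" "\<And>n. Cn n h'" "\<And>s. (h has_real_derivative h' s) (at s)" "0 < \<rho>" "\<rho> < R" "\<And>s. s \<ge> \<rho>\<^sup>2 \<Longrightarrow> h s = 0"
  then interpret radial_test \<Omega> f \<psi> g x0 h h' \<rho> by unfold_locales auto
  have sm0: "smooth (\<lambda>p. 0)" by (simp add: smooth_def Ck_on_const)
  have p0: "px (\<lambda>p. 0) p = 0" "py (\<lambda>p. 0) p = 0" for p by (auto simp: px_def py_def)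
  have v: "(LINT p|lborel. TF p * (px (\<lambda>p. 0) p + py hr p)
     - 2 * (e1 p * px (\<lambda>p. 0) p + e12 p * py (\<lambda>p. 0) p + e12 p * px hr p + e2 p * py hr p)
     + (- ((e1 p + e2 p) / fst p) - 2 * (indicator U p * Fprim f (\<psi> p)) + indicator P p * snd p) * 0
     + (indicator P p * fst p) * hr p) = 0"
    unfolding TF_def
    by (rule variation[OF sm0 smooth_hr cball_\<rho>]) (simp add: hr_zero del: mem_cball)
  have "(LINT p:ball Xc R|lborel. hr p * (indicator P p * fst p) + 2 * hr' p * b_vertical p) = (LINT p|lborel. hr p * (indicator P p * fst p) + 2 * hr' p * b_vertical p)"
    by (rule radial_integral_restrict) (simp_all add: b_vertical_def off_U TF_off_U)
  also have "\<dots> = 0"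
    by (rule trans[OF Bochner_Integration.integral_cong[OF refl] v])
       (simp only: p0 px_hr b_vertical_def, simp add: Xc_def algebra_simps)
  finally show "(LINT p:ball Xc R|lborel. hr p * (indicator P p * fst p) + 2 * hr' p * b_vertical p) = 0" .
qed

text \<open>On the circle of radius \<open>t\<close>, \<open>mm\<close> is \<open>t\<close> times
  \<open>\<psi>\<close> times the normal derivative over \<open>x\<close>. \<open>nn\<close> and
  \<open>jj\<close> are the densities of \<open>N\<close> and \<open>J1\<close>, and
  \<open>ff\<close> that of the term with \<open>f\<close>; all vanish outside the ball.\<close>

definition mm :: "point \<Rightarrow> real" where "mm p = (G1 p * (fst p - x0) + G2 p * snd p) * (\<psi> p / fst p)"
definition ff :: "point \<Rightarrow> real" where "ff p = indicator P p * (fst p * \<psi> p * f (\<psi> p))"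
definition nn :: "point \<Rightarrow> real" where "nn p = indicator U p * ((\<psi> p)\<^sup>2 / fst p)"
definition jj :: "point \<Rightarrow> real" where "jj p = indicator U p * ((fst p - x0) / (fst p)\<^sup>2 * (\<psi> p)\<^sup>2)"

lemma nn_cont: "continuous_on (cball Xc R) (\<lambda>p. (\<psi> p)\<^sup>2 / fst p)" and jj_cont: "continuous_on (cball Xc R) (\<lambda>p. (fst p - x0) / (fst p)\<^sup>2 * (\<psi> p)\<^sup>2)"
proof -
  have nz: "\<forall>p\<in>cball Xc R. fst p \<noteq> 0" "\<forall>p\<in>cball Xc R. (fst p)\<^sup>2 \<noteq> 0" using fst_nz by auto
  show "continuous_on (cball Xc R) (\<lambda>p. (\<psi> p)\<^sup>2 / fst p)" "continuous_on (cball Xc R) (\<lambda>p. (fst p - x0) / (fst p)\<^sup>2 * (\<psi> p)\<^sup>2)"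
    by (intro continuous_intros psi_cont_cball nz)+
qed

lemma mfnj_integrable: "integrable lborel mm" "integrable lborel ff" "integrable lborel nn" "integrable lborel jj"
proof -
  have c: "continuous_on (cball Xc R) (\<lambda>p. fst p - x0)" "continuous_on (cball Xc R) (\<lambda>p. snd p :: real)" "continuous_on (cball Xc R) (\<lambda>p. fst p * \<psi> p * f (\<psi> p))"
    by (intro continuous_intros psi_cont_cball f_psi_cont)+
  have z: "p \<notin> U \<Longrightarrow> G1 p * (fst p - x0) + G2 p * snd p = 0" for p by (simp add: off_U)
  show "integrable lborel mm" unfolding mm_def[abs_def]
    by (intro integrable_times_cont Bochner_Integration.integrable_add G_integrable off_U c z cball_cont_over_fst psi_cont_cball)
  show "integrable lborel ff" unfolding ff_def[abs_def] by (intro cball_integrable c sets_UP P_sub_cball)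
  show "integrable lborel nn" unfolding nn_def[abs_def] by (intro cball_integrable nn_cont sets_UP U_sub(1))
  show "integrable lborel jj" unfolding jj_def[abs_def] by (intro cball_integrable jj_cont sets_UP U_sub(1))
qed

lemma psi_off_P: "p \<in> U \<Longrightarrow> p \<notin> P \<Longrightarrow> \<psi> p = 0"
  using psi_nonneg[of p] U_sub(3) by (force simp: P_def)

lemma nn_jj_P: "nn p = indicator P p * ((\<psi> p)\<^sup>2 / fst p)" "jj p = indicator P p * ((fst p - x0) / (fst p)\<^sup>2 * (\<psi> p)\<^sup>2)"
  using psi_off_P[of p] off_U[of p] P_sub(1) by (auto simp: nn_def jj_def indicator_def)

lemma set_P_of_global:
  assumes i: "integrable lborel w" and e: "\<And>p. p \<in> P \<Longrightarrow> w' p = w p" and z: "\<And>p. p \<notin> P \<Longrightarrow> w p = (0::real)"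
  shows "set_integrable lborel P w'" "(LINT p:P|lborel. w' p) = (LINT p|lborel. w p)"
proof -
  have "indicator P p *\<^sub>R w' p = w p" for p using e[of p] z[of p] by (cases "p \<in> P") auto
  then show "set_integrable lborel P w'" "(LINT p:P|lborel. w' p) = (LINT p|lborel. w p)"
    using i by (simp_all add: set_integrable_def set_lebesgue_integral_def)
qed

lemma mm_P: "p \<notin> P \<Longrightarrow> mm p = 0" "p \<notin> P \<Longrightarrow> ff p = 0" "p \<notin> P \<Longrightarrow> nn p = 0" "p \<notin> P \<Longrightarrow> jj p = 0"
  by (simp_all add: mm_def ff_def G_zero nn_jj_P)

text \<open>Integrate the divergence of \<open>h * \<psi> / x\<close> times the gradient over
  \<open>P\<close>: differentiating \<open>h\<close> produces the circle term, and
  \<open>pde_zero\<close> eliminates the second derivatives.\<close>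

lemma energy_flux: "AE t in lborel. 0 < t \<and> t < R \<longrightarrow> t * disc_int Xc t (\<lambda>p. e1 p + e2 p - ff p) = circ_int Xc t mm"
proof (rule radial_flux[OF _ mfnj_integrable(1) R_pos])
  show ia: "integrable lborel (\<lambda>p. e1 p + e2 p - ff p)"
    by (intro Bochner_Integration.integrable_add Bochner_Integration.integrable_diff e_integrable mfnj_integrable)
  fix h h' :: "real \<Rightarrow> real" and \<rho> :: real
  assume "\<And>n. Cn n h" "\<And>n. Cn n h'" "\<And>s. (h has_real_derivative h' s) (at s)" "0 < \<rho>" "\<rho> < R" "\<And>s. s \<ge> \<rho>\<^sup>2 \<Longrightarrow> h s = 0"
  then interpret radial_test \<Omega> f \<psi> g x0 h h' \<rho> by unfold_locales auto
  have offU: "e1 p + e2 p - ff p = 0" "mm p = 0" if "p \<notin> U" for p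
    using off_U[OF that] by (simp_all add: mm_P)
  have offP: "e1 p + e2 p = 0" "ff p = 0" "mm p = 0" if "p \<notin> P" for p
    using that by (simp_all add: mm_P e_zero)
  have nz: "\<forall>p\<in>P. fst p \<noteq> 0" "\<forall>p\<in>P. (fst p)\<^sup>2 \<noteq> 0" using P_fst_pos by force+
  let ?A = "\<lambda>p. hr p * (px \<psi> p / fst p)" and ?B = "\<lambda>p. hr p * (py \<psi> p / fst p)"
  let ?Ax = "\<lambda>p. hr' p * (2 * dx p) * (px \<psi> p / fst p) + hr p * (px (px \<psi>) p / fst p - px \<psi> p / (fst p)\<^sup>2)"
  let ?By = "\<lambda>p. hr' p * (2 * dy p) * (py \<psi> p / fst p) + hr p * (py (py \<psi>) p / fst p)"
  have cc: "continuous_on P ?A" "continuous_on P ?B" "continuous_on P ?Ax" "continuous_on P ?By"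
    by (intro continuous_intros psi_cont2 hr_cont nz)+
  have eq1: "px \<psi> p * ?A p + py \<psi> p * ?B p = (e1 p + e2 p) * hr p" if "p \<in> P" for p
    using that by (simp add: e1_def e2_def G1_def G2_def power2_eq_square add_divide_distrib algebra_simps)
  \<comment> \<open>Individual second derivatives have no known bound near the free boundary. Only
    their combination in the equation occurs, and it equals the bounded function
    \<open>- x * f(\<psi>)\<close>; this gives the integrability demanded by
    \<open>truncated_divergence\<close>.\<close>
  have eq2: "\<psi> p * (?Ax p + ?By p) = 2 * (mm p * hr' p) - ff p * hr p" if "p \<in> P" for p
  proof -
    have pz: "px (px \<psi>) p / fst p + py (py \<psi>) p / fst p - px \<psi> p / (fst p)\<^sup>2 = - (fst p * f (\<psi> p))"
      using pde_zero[OF that] by (simp add: pde_def add_divide_distrib)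
    have "\<psi> p * (?Ax p + ?By p) = 2 * (hr' p * ((px \<psi> p * dx p + py \<psi> p * dy p) * (\<psi> p / fst p)))
      + \<psi> p * hr p * (px (px \<psi>) p / fst p + py (py \<psi>) p / fst p - px \<psi> p / (fst p)\<^sup>2)"
      by (simp add: algebra_simps add_divide_distrib)
    then show ?thesis unfolding pz using that by (simp add: mm_def ff_def G1_def G2_def Xc_def algebra_simps)
  qed
  have i1: "integrable lborel (\<lambda>p. (e1 p + e2 p) * hr p)" and i2: "integrable lborel (\<lambda>p. 2 * (mm p * hr' p) - ff p * hr p)"
    by (intro Bochner_Integration.integrable_diff integrable_mult_right integrable_times_cont hr_cont mfnj_integrable
        Bochner_Integration.integrable_add e_integrable e12_sum_off_U offU(2) offP(2) off_U(1); assumption)+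
  note g1 = set_P_of_global[OF i1 eq1] and g2 = set_P_of_global[OF i2 eq2]
  have "(LINT p:P|lborel. px \<psi> p * ?A p + py \<psi> p * ?B p) + (LINT p:P|lborel. \<psi> p * (?Ax p + ?By p)) = 0"
  proof (rule truncated_divergence[OF cball_\<rho> _ cc])
    show "?A p = 0 \<and> ?B p = 0 \<and> ?Ax p = 0 \<and> ?By p = 0" if "p \<in> P - cball Xc \<rho>" for p
      using that by (simp add: hr_zero del: mem_cball)
    show "((\<lambda>t. ?A (t, snd p)) has_real_derivative ?Ax p) (at (fst p))" if p: "p \<in> P" for p
    proof -
      have "((\<lambda>t. px \<psi> (t, snd p) / t) has_real_derivative (px (px \<psi>) p / fst p - px \<psi> p / (fst p)\<^sup>2)) (at (fst p))"
        using P_fst_pos[OF p] by (auto intro!: derivative_eq_intros P_deriv(3)[OF p] simp: power2_eq_square diff_divide_distrib)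
      from DERIV_mult[OF hr_deriv(1) this] show ?thesis by (simp add: algebra_simps)
    qed
    show "((\<lambda>t. ?B (fst p, t)) has_real_derivative ?By p) (at (snd p))" if p: "p \<in> P" for p
      using DERIV_mult[OF hr_deriv(2) DERIV_cdivide[OF P_deriv(6)[OF p], of "fst p"]] by (simp add: algebra_simps)
  qed (use g1(1) g2(1) offP in auto)
  then have 0: "(LINT p|lborel. (e1 p + e2 p) * hr p) + (LINT p|lborel. 2 * (mm p * hr' p) - ff p * hr p) = 0"
    using g1(2) g2(2) offP by simp
  have "(LINT p:ball Xc R|lborel. hr p * (e1 p + e2 p - ff p) + 2 * hr' p * mm p) = (LINT p|lborel. hr p * (e1 p + e2 p - ff p) + 2 * hr' p * mm p)"
    by (rule radial_integral_restrict) (use offU in auto)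
  also have "\<dots> = (LINT p|lborel. (e1 p + e2 p) * hr p + (2 * (mm p * hr' p) - ff p * hr p))"
    by (intro Bochner_Integration.integral_cong) (simp_all add: algebra_simps)
  also have "\<dots> = 0" using 0 i1 i2 by simp
  finally show "(LINT p:ball Xc R|lborel. hr p * (e1 p + e2 p - ff p) + 2 * hr' p * mm p) = 0" .
qed

text \<open>The field \<open>h * (p - Xc) * \<psi> / x\<close> is paired with \<open>\<psi>\<close>.
  The divergence of \<open>p - Xc\<close> yields \<open>2 * nn\<close>, the derivative of
  \<open>1/x\<close> yields \<open>- jj\<close>, and the gradient of \<open>\<psi>\<^sup>2\<close>
  yields \<open>2 * mm\<close>. The purpose is to express \<open>N\<close> by a disc
  integral.\<close>

lemma mass_flux: "AE t in lborel. 0 < t \<and> t < R \<longrightarrow> t * disc_int Xc t (\<lambda>p. 2 * mm p + 2 * nn p - jj p) = circ_int Xc t (\<lambda>p. nn p * rsq Xc p)"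
proof (rule radial_flux[OF _ _ R_pos])
  have offU: "2 * mm p + 2 * nn p - jj p = 0" "mm p = 0" "nn p = 0" "jj p = 0" if "p \<notin> U" for p
    using off_U[OF that] by (simp_all add: mm_P)
  show "integrable lborel (\<lambda>p. 2 * mm p + 2 * nn p - jj p)"
    by (intro Bochner_Integration.integrable_add Bochner_Integration.integrable_diff integrable_mult_right mfnj_integrable)
  show ib: "integrable lborel (\<lambda>p. nn p * rsq Xc p)"
    by (intro integrable_times_cont mfnj_integrable rsq_cont offU)
  fix h h' :: "real \<Rightarrow> real" and \<rho> :: real
  assume "\<And>n. Cn n h" "\<And>n. Cn n h'" "\<And>s. (h has_real_derivative h' s) (at s)" "0 < \<rho>" "\<rho> < R" "\<And>s. s \<ge> \<rho>\<^sup>2 \<Longrightarrow> h s = 0"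
  then interpret radial_test \<Omega> f \<psi> g x0 h h' \<rho> by unfold_locales auto
  have nz: "\<forall>p\<in>P. fst p \<noteq> 0" "\<forall>p\<in>P. (fst p)\<^sup>2 \<noteq> 0" using P_fst_pos by force+
  let ?A = "\<lambda>p. hr p * (dx p * (\<psi> p / fst p))" and ?B = "\<lambda>p. hr p * (dy p * (\<psi> p / fst p))"
  let ?Ax = "\<lambda>p. hr' p * (2 * dx p) * (dx p * (\<psi> p / fst p)) + hr p * (\<psi> p / fst p + dx p * (px \<psi> p / fst p - \<psi> p / (fst p)\<^sup>2))"
  let ?By = "\<lambda>p. hr' p * (2 * dy p) * (dy p * (\<psi> p / fst p)) + hr p * (\<psi> p / fst p + dy p * (py \<psi> p / fst p))"
  have cc: "continuous_on P ?A" "continuous_on P ?B" "continuous_on P ?Ax" "continuous_on P ?By"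
    by (intro continuous_intros psi_cont2 hr_cont nz)+
  have eq1: "px \<psi> p * ?A p + py \<psi> p * ?B p = mm p * hr p" if "p \<in> P" for p
    using that by (simp add: mm_def G1_def G2_def Xc_def add_divide_distrib diff_divide_distrib algebra_simps)
  have eq2: "\<psi> p * (?Ax p + ?By p) = 2 * (nn p * rsq Xc p * hr' p) + (2 * nn p + mm p - jj p) * hr p" if "p \<in> P" for p
    using that by (simp add: mm_def G1_def G2_def nn_jj_P rsq_def Xc_def power2_eq_square add_divide_distrib diff_divide_distrib algebra_simps)
  have i1: "integrable lborel (\<lambda>p. mm p * hr p)" and i2: "integrable lborel (\<lambda>p. 2 * (nn p * rsq Xc p * hr' p) + (2 * nn p + mm p - jj p) * hr p)"
  proof -
    have z2: "nn p * rsq Xc p = 0" "2 * nn p + mm p - jj p = 0" if "p \<notin> U" for p using offU[OF that] by simp_all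
    show "integrable lborel (\<lambda>p. mm p * hr p)" by (intro integrable_times_cont hr_cont mfnj_integrable offU)
    have i: "integrable lborel (\<lambda>p. 2 * nn p + mm p - jj p)"
      by (intro Bochner_Integration.integrable_add Bochner_Integration.integrable_diff integrable_mult_right mfnj_integrable)
    show "integrable lborel (\<lambda>p. 2 * (nn p * rsq Xc p * hr' p) + (2 * nn p + mm p - jj p) * hr p)"
      by (intro Bochner_Integration.integrable_add integrable_mult_right integrable_times_cont[OF ib z2(1) hr_cont(2)] integrable_times_cont[OF i z2(2) hr_cont(1)])
  qed
  note g1 = set_P_of_global[OF i1 eq1] and g2 = set_P_of_global[OF i2 eq2]
  have "(LINT p:P|lborel. px \<psi> p * ?A p + py \<psi> p * ?B p) + (LINT p:P|lborel. \<psi> p * (?Ax p + ?By p)) = 0"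
  proof (rule truncated_divergence[OF cball_\<rho> _ cc])
    show "?A p = 0 \<and> ?B p = 0 \<and> ?Ax p = 0 \<and> ?By p = 0" if "p \<in> P - cball Xc \<rho>" for p
      using that by (simp add: hr_zero del: mem_cball)
    show "((\<lambda>t. ?A (t, snd p)) has_real_derivative ?Ax p) (at (fst p))" if p: "p \<in> P" for p
    proof -
      have 1: "((\<lambda>t. \<psi> (t, snd p) / t) has_real_derivative (px \<psi> p / fst p - \<psi> p / (fst p)\<^sup>2)) (at (fst p))"
        using P_fst_pos[OF p] by (auto intro!: derivative_eq_intros P_deriv(1)[OF p] simp: power2_eq_square diff_divide_distrib)
      have 2: "((\<lambda>t. t - fst Xc) has_real_derivative 1) (at (fst p))" by (auto intro!: derivative_eq_intros)
      from DERIV_mult[OF 2 1] have "((\<lambda>t. (t - fst Xc) * (\<psi> (t, snd p) / t)) has_real_derivative (\<psi> p / fst p + dx p * (px \<psi> p / fst p - \<psi> p / (fst p)\<^sup>2))) (at (fst p))"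
        by (simp add: algebra_simps)
      from DERIV_mult[OF hr_deriv(1) this] show ?thesis by (simp add: algebra_simps)
    qed
    show "((\<lambda>t. ?B (fst p, t)) has_real_derivative ?By p) (at (snd p))" if p: "p \<in> P" for p
    proof -
      have "((\<lambda>t. t - snd Xc) has_real_derivative 1) (at (snd p))" by (auto intro!: derivative_eq_intros)
      from DERIV_mult[OF this DERIV_cdivide[OF P_deriv(2)[OF p], of "fst p"]]
      have "((\<lambda>t. (t - snd Xc) * (\<psi> (fst p, t) / fst p)) has_real_derivative (\<psi> p / fst p + dy p * (py \<psi> p / fst p))) (at (snd p))"
        by (simp add: algebra_simps)
      from DERIV_mult[OF hr_deriv(2) this] show ?thesis by (simp add: algebra_simps)
    qed
  qed (use g1(1) g2(1) mm_P in auto)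
  then have 0: "(LINT p|lborel. mm p * hr p) + (LINT p|lborel. 2 * (nn p * rsq Xc p * hr' p) + (2 * nn p + mm p - jj p) * hr p) = 0"
    using g1(2) g2(2) mm_P by simp
  have "(LINT p:ball Xc R|lborel. hr p * (2 * mm p + 2 * nn p - jj p) + 2 * hr' p * (nn p * rsq Xc p)) = (LINT p|lborel. hr p * (2 * mm p + 2 * nn p - jj p) + 2 * hr' p * (nn p * rsq Xc p))"
    by (rule radial_integral_restrict) (use offU in auto)
  also have "\<dots> = (LINT p|lborel. mm p * hr p + (2 * (nn p * rsq Xc p * hr' p) + (2 * nn p + mm p - jj p) * hr p))"
    by (intro Bochner_Integration.integral_cong) (simp_all add: algebra_simps)
  also have "\<dots> = 0" using 0 i1 i2 by (subst Bochner_Integration.integral_add) auto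
  finally show "(LINT p:ball Xc R|lborel. hr p * (2 * mm p + 2 * nn p - jj p) + 2 * hr' p * (nn p * rsq Xc p)) = 0" .
qed

end

section \<open>Nondegeneracy and growth\<close>

context degenerate_point begin

lemma circle_in_U: "0 < t \<Longrightarrow> t < R \<Longrightarrow> polar_map Xc (t, \<theta>) \<in> U"
  using polar_map_in_ball[of t Xc \<theta> R] by (simp add: U_def)

lemma circ_int_cong_U: "0 < t \<Longrightarrow> t < R \<Longrightarrow> (\<And>p. p \<in> U \<Longrightarrow> v p = w p) \<Longrightarrow> circ_int Xc t v = circ_int Xc t w"
  unfolding circ_int_alt by (intro set_lebesgue_integral_cong) (auto simp: circle_in_U)

lemma ball_sub_U: "t \<le> R \<Longrightarrow> ball Xc t \<subseteq> U"
  by (auto simp: U_def)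

lemma disc_int_cong_U: "t \<le> R \<Longrightarrow> (\<And>p. p \<in> U \<Longrightarrow> v p = w p) \<Longrightarrow> disc_int Xc t v = disc_int Xc t w"
  unfolding disc_int_def using ball_sub_U[of t] by (intro set_lebesgue_integral_cong) auto

text \<open>Continuity at every radius is what extends the identity for \<open>N\<close> from almost
  every radius to all of them.\<close>

lemma circ_int_continuous:
  assumes w: "continuous_on (cball Xc R) w"
  shows "continuous_on {0<..<R} (\<lambda>t. circ_int Xc t w)"
proof -
  have cp: "continuous_on S (polar_map Xc)" for S
    unfolding polar_map_def[abs_def] by (intro continuous_intros)
  have sub: "polar_map Xc (t, \<theta>) \<in> cball Xc R" if "t \<in> {0<..<R}" for t \<theta>
    by (rule subsetD[OF U_sub(1) circle_in_U]) (use that in auto)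
  have c2: "continuous_on ({0<..<R} \<times> cbox 0 (2*pi)) (\<lambda>(t, \<theta>). t * w (polar_map Xc (t, \<theta>)))"
    unfolding case_prod_beta
    by (intro continuous_intros continuous_on_compose2[OF w]) (use sub in \<open>auto simp: cp\<close>)
  have "continuous_on {0<..<R} (\<lambda>t. integral (cbox 0 (2*pi)) (\<lambda>\<theta>. t * w (polar_map Xc (t, \<theta>))))"
    by (rule integral_continuous_on_param[OF c2])
  moreover have "circ_int Xc t w = integral (cbox 0 (2*pi)) (\<lambda>\<theta>. t * w (polar_map Xc (t, \<theta>)))" if t: "t \<in> {0<..<R}" for t
  proof -
    have "continuous_on {0..2*pi} (\<lambda>\<theta>. t * w (polar_map Xc (t, \<theta>)))"
      by (intro continuous_intros continuous_on_compose2[OF w] continuous_on_compose2[OF cp[of UNIV]]) (use sub[OF t] in auto)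
    then have "set_integrable lborel {0..2*pi} (\<lambda>\<theta>. t * w (polar_map Xc (t, \<theta>)))"
      unfolding set_integrable_def by (intro borel_integrable_compact) auto
    from interval_integral_eq_integral[OF _ this] show ?thesis
      by (simp add: circ_int_def polar_map_def zero_ereal_def)
  qed
  ultimately show ?thesis by (subst continuous_on_cong[OF refl]) auto
qed

lemma Nfun_eq: "0 < t \<Longrightarrow> t < R \<Longrightarrow> Nfun \<psi> Xc t = circ_int Xc t nn"
  unfolding Nfun_def by (rule circ_int_cong_U) (auto simp: nn_def)

lemma J1_eq: "0 < t \<Longrightarrow> t < R \<Longrightarrow> J1 \<psi> Xc t = circ_int Xc t jj"
  unfolding J1_def by (rule circ_int_cong_U) (auto simp: jj_def Xc_def)

text \<open>Both sides are continuous in \<open>t\<close> and agree almost everywhere. Equality at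
  every radius is essential: the derivative of \<open>N\<close> at \<open>r\<close> involves all
  radii near \<open>r\<close>.\<close>

lemma mass_identity:
  assumes t: "0 < t" "t < R"
  shows "Nfun \<psi> Xc t = disc_int Xc t (\<lambda>p. 2 * mm p + 2 * nn p - jj p) / t"
proof -
  let ?A = "\<lambda>t. disc_int Xc t (\<lambda>p. 2 * mm p + 2 * nn p - jj p)"
  have ia: "integrable lborel (\<lambda>p. 2 * mm p + 2 * nn p - jj p)"
    by (intro Bochner_Integration.integrable_add Bochner_Integration.integrable_diff integrable_mult_right mfnj_integrable)
  have cN: "continuous_on {0<..<R} (\<lambda>t. Nfun \<psi> Xc t - ?A t / t)"
    unfolding Nfun_def by (intro continuous_intros circ_int_continuous nn_cont continuous_on_disc_int[OF ia]) auto
  have ae: "AE t in lborel. t \<in> {0<..<R} \<longrightarrow> Nfun \<psi> Xc t - ?A t / t = 0"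
    using mass_flux
  proof eventually_elim
    case (elim t)
    show ?case
    proof
      assume "t \<in> {0<..<R}"
      then have t: "0 < t" "t < R" by auto
      have "circ_int Xc t (\<lambda>p. nn p * rsq Xc p) = t\<^sup>2 * circ_int Xc t nn"
        unfolding circ_int_alt set_integral_mult_right[symmetric] by (intro set_lebesgue_integral_cong) auto
      with elim t have "t * ?A t = t\<^sup>2 * Nfun \<psi> Xc t" by (simp add: Nfun_eq)
      then show "Nfun \<psi> Xc t - ?A t / t = 0" using t by (simp add: field_simps power2_eq_square)
    qed
  qed
  have "Nfun \<psi> Xc t - ?A t / t = 0"
  proof (rule ccontr)
    assume nz: "Nfun \<psi> Xc t - ?A t / t \<noteq> 0"
    define V where "V = (\<lambda>t. Nfun \<psi> Xc t - ?A t / t) -` (- {0}) \<inter> {0<..<R}"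
    have "open V" unfolding V_def by (rule continuous_on_open_vimage[THEN iffD1, rule_format]) (use cN in auto)
    moreover have "t \<in> V" using nz t by (auto simp: V_def)
    moreover have "V \<in> null_sets lborel"
    proof -
      have "AE t in lborel. t \<notin> V" using ae by eventually_elim (auto simp: V_def)
      then show ?thesis using \<open>open V\<close> by (subst (asm) AE_iff_null_sets[symmetric]) auto
    qed
    then have "negligible V" by (simp add: negligible_iff_null_sets null_sets_completionI)
    ultimately show False using open_not_negligible by blast
  qed
  then show ?thesis by simp
qed

lemma P_meets_ball: "0 < t \<Longrightarrow> P \<inter> ball Xc t \<noteq> {}"
proof -
  assume "0 < t"
  have "Xc \<in> closure (positivity_set \<Omega> \<psi>)" using Xc_frontier by (simp add: frontier_def)
  then obtain p where "p \<in> positivity_set \<Omega> \<psi>" "dist p Xc < min t R"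
    using \<open>0 < t\<close> R_pos unfolding closure_approachable by (metis min_less_iff_conj)
  then have "p \<in> P \<inter> ball Xc t" by (auto simp: P_def U_def positivity_set_def dist_commute)
  then show ?thesis by blast
qed

text \<open>If \<open>\<psi>\<close> vanished on the circle, the flux of the translation invariant variation through it would be
  zero, so the integral of \<open>x\<close> over the part of the disc where \<open>\<psi>\<close> is positive would be zero too.\<close>

lemma Nfun_pos: "AE t in lborel. 0 < t \<and> t < R \<longrightarrow> Nfun \<psi> Xc t > 0"
  using vertical_flux polar_integral(1)[OF mfnj_integrable(3), of Xc]
proof eventually_elim
  case (elim t)
  show ?case
  proof
    assume t: "0 < t \<and> t < R"
    have nn0: "0 \<le> nn p" for p
      using fst_pos[of p] by (cases "p \<in> U") (simp_all add: nn_def)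
    have ge: "0 \<le> Nfun \<psi> Xc t"
      using t nn0 by (simp add: Nfun_eq circ_int_alt set_lebesgue_integral_def integral_nonneg_AE)
    show "0 < Nfun \<psi> Xc t"
    proof (rule ccontr)
      assume "\<not> 0 < Nfun \<psi> Xc t"
      with ge have 0: "Nfun \<psi> Xc t = 0" by simp
      have i: "integrable lborel (\<lambda>\<theta>. indicator {0<..<2*pi} \<theta> *\<^sub>R (t * nn (polar_map Xc (t, \<theta>))))"
        using elim t by (simp add: set_integrable_def)
      have "(\<integral>\<theta>. indicator {0<..<2*pi} \<theta> *\<^sub>R (t * nn (polar_map Xc (t, \<theta>))) \<partial>lborel) = 0"
      proof -
        have "circ_int Xc t nn = 0" using 0 t by (simp add: Nfun_eq)
        then show ?thesis unfolding circ_int_alt set_lebesgue_integral_def .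
      qed
      then have "AE \<theta> in lborel. indicator {0<..<2*pi} \<theta> *\<^sub>R (t * nn (polar_map Xc (t, \<theta>))) = 0"
        using i t nn0 by (subst (asm) integral_nonneg_eq_0_iff_AE) (auto intro!: AE_I2)
      then have ae: "AE \<theta> in lborel. indicator {0<..<2*pi} \<theta> *\<^sub>R (t * b_vertical (polar_map Xc (t, \<theta>))) = 0"
      proof eventually_elim
        case (elim \<theta>)
        let ?p = "polar_map Xc (t, \<theta>)"
        show ?case
        proof (cases "\<theta> \<in> {0<..<2*pi}")
          case True
          then have "nn ?p = 0" using elim t by simp
          moreover have U: "?p \<in> U" using t by (simp add: circle_in_U)
          ultimately have "\<psi> ?p = 0" using fst_pos[OF U] by (simp add: nn_def)
          moreover from this have "?p \<notin> P" by (simp add: P_def)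
          \<comment> \<open>The densities carrying the gradient or the indicator of \<open>P\<close>
            vanish off \<open>P\<close>; the term with \<open>F(\<psi>)\<close> vanishes because
            \<open>Fprim f 0 = 0\<close>.\<close>
          ultimately have "b_vertical ?p = 0" by (simp add: b_vertical_def TF_def e_zero)
          then show ?thesis by simp
        qed simp
      qed
      have "circ_int Xc t b_vertical = 0"
        unfolding circ_int_alt set_lebesgue_integral_def by (rule integral_eq_zero_AE[OF ae])
      with elim t have d0: "disc_int Xc t (\<lambda>p. indicator P p * fst p) = 0" by simp
      have ip: "integrable lborel (\<lambda>p. indicator P p * (fst p :: real))"
        by (intro cball_integrable continuous_on_fst continuous_on_id sets_UP P_sub_cball)
      have "AE p in lborel. indicator (ball Xc t) p *\<^sub>R (indicator P p * fst p) = (0::real)"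
      proof (rule integral_nonneg_eq_0_iff_AE[THEN iffD1])
        show "integrable lborel (\<lambda>p. indicator (ball Xc t) p *\<^sub>R (indicator P p * fst p :: real))"
          using ip by (intro integrable_mult_indicator) auto
        show "AE p in lborel. 0 \<le> indicator (ball Xc t) p *\<^sub>R (indicator P p * fst p :: real)"
          using P_fst_pos by (intro AE_I2) (simp add: indicator_def less_imp_le)
        show "(\<integral>p. indicator (ball Xc t) p *\<^sub>R (indicator P p * fst p) \<partial>lborel) = (0::real)"
          using d0 by (simp add: disc_int_def set_lebesgue_integral_def)
      qed
      \<comment> \<open>The density \<open>x\<close> is positive on \<open>P\<close>, so a zero
        integral makes the open set \<open>P \<inter> ball Xc t\<close> null and hence empty; but
        \<open>Xc\<close> is a limit of points of \<open>P\<close>.\<close>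
      then have "AE p in lborel. p \<notin> P \<inter> ball Xc t"
      proof eventually_elim
        case (elim p)
        show ?case
        proof
          assume "p \<in> P \<inter> ball Xc t"
          then have "p \<in> P" "p \<in> ball Xc t" by auto
          with elim have "fst p = 0" by (simp del: mem_ball)
          with P_fst_pos[OF \<open>p \<in> P\<close>] show False by simp
        qed
      qed
      moreover have o: "open (P \<inter> ball Xc t)" using open_P by auto
      ultimately have "P \<inter> ball Xc t \<in> null_sets lborel"
        by (subst (asm) AE_iff_null_sets[symmetric]) auto
      then have "negligible (P \<inter> ball Xc t)" by (simp add: negligible_iff_null_sets null_sets_completionI)
      then show False using open_not_negligible[OF o] P_meets_ball[of t] t by blast
    qed
  qed
qed

text \<open>The growth assumption is an estimate almost everywhere for \<open>g\<close>. On
  \<open>P\<close> the classical gradient is continuous, so the estimate holds at every point, as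
  required along single segments.\<close>

lemma gradient_growth:
  obtains M r1 where "0 \<le> M" "0 < r1" "r1 \<le> R"
    "\<And>p. p \<in> P \<Longrightarrow> p \<in> ball Xc r1 \<Longrightarrow> (px \<psi> p)\<^sup>2 + (py \<psi> p)\<^sup>2 \<le> M * dist Xc p"
proof -
  obtain C where C: "\<And>X1. X1 \<in> \<Omega> \<inter> frontier (positivity_set \<Omega> \<psi>) \<Longrightarrow> \<exists>r>0.
                   AE X in lborel. X \<in> ball X1 r \<inter> \<Omega> \<longrightarrow>
                     gsq g X / (fst X)\<^sup>2 \<le> C * (\<bar>snd X\<bar> + \<bar>fst X - fst X1\<bar>)"
    using growth by blast
  obtain r where r: "r > 0" "AE X in lborel. X \<in> ball Xc r \<inter> \<Omega> \<longrightarrow>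
                     gsq g X / (fst X)\<^sup>2 \<le> C * (\<bar>snd X\<bar> + \<bar>fst X - fst Xc\<bar>)"
    using C[of Xc] Xc_Omega Xc_frontier by blast
  define r1 where "r1 = min r R"
  \<comment> \<open>The factor 2 bounds the sum of two coordinate differences by the distance, the
    factor \<open>(2 * x0)\<^sup>2\<close> removes the denominator \<open>x\<^sup>2\<close>, and the
    absolute value covers a negative \<open>C\<close>.\<close>
  define M where "M = \<bar>C\<bar> * 2 * (2 * x0)\<^sup>2"
  \<comment> \<open>The positive part of the excess is continuous and vanishes exactly where the
    inequality holds, so \<open>continuous_AE_zero\<close> becomes applicable to an
    inequality.\<close>
  let ?w = "\<lambda>p. max ((px \<psi> p)\<^sup>2 + (py \<psi> p)\<^sup>2 - M * dist Xc p) 0"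
  let ?Q = "P \<inter> ball Xc r1"
  have oQ: "open ?Q" using open_P by auto
  have cQ: "continuous_on ?Q ?w"
    by (intro continuous_intros continuous_on_subset[OF psi_cont2(2)] continuous_on_subset[OF psi_cont2(3)]) auto
  have "AE p in lborel. p \<in> ?Q \<longrightarrow> ?w p = 0"
    using r(2) weak_gradient_on_P
  proof eventually_elim
    case (elim p)
    show ?case
    proof
      assume p: "p \<in> ?Q"
      then have pP: "p \<in> P" "p \<in> U" "dist Xc p < r" using P_sub(1) by (auto simp: r1_def)
      have pO: "p \<in> \<Omega>" using pP(2) U_sub(3) by blast
      have fp: "0 < fst p" "fst p \<le> 2 * x0" using fst_pos[OF pP(2)] fst_upper[OF subsetD[OF U_sub(1) pP(2)]] by auto
      have le1: "((px \<psi> p)\<^sup>2 + (py \<psi> p)\<^sup>2) / (fst p)\<^sup>2 \<le> C * (\<bar>snd p\<bar> + \<bar>fst p - fst Xc\<bar>)"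
        using elim pP pO by (simp add: gsq_def)
      have "\<bar>snd p\<bar> \<le> dist Xc p" "\<bar>fst p - fst Xc\<bar> \<le> dist Xc p"
        using dist_snd_le[of Xc p] dist_fst_le[of Xc p] by (simp_all add: dist_real_def Xc_def abs_minus_commute)
      then have "C * (\<bar>snd p\<bar> + \<bar>fst p - fst Xc\<bar>) \<le> \<bar>C\<bar> * (2 * dist Xc p)"
        by (intro mult_mono) auto
      with le1 have "((px \<psi> p)\<^sup>2 + (py \<psi> p)\<^sup>2) / (fst p)\<^sup>2 \<le> \<bar>C\<bar> * (2 * dist Xc p)" by linarith
      then have "(px \<psi> p)\<^sup>2 + (py \<psi> p)\<^sup>2 \<le> (\<bar>C\<bar> * (2 * dist Xc p)) * (fst p)\<^sup>2"
        using fp by (simp add: pos_divide_le_eq)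
      also have "\<dots> \<le> (\<bar>C\<bar> * (2 * dist Xc p)) * (2 * x0)\<^sup>2"
        using fp by (intro mult_left_mono power_mono) auto
      finally show "?w p = 0" by (simp add: M_def mult_ac)
    qed
  qed
  from continuous_AE_zero[OF oQ cQ this] have "?w p = 0" if "p \<in> ?Q" for p using that .
  then have "(px \<psi> p)\<^sup>2 + (py \<psi> p)\<^sup>2 \<le> M * dist Xc p" if "p \<in> P" "p \<in> ball Xc r1" for p
    using that by (fastforce simp: max_def split: if_splits)
  then show ?thesis using r(1) R_pos by (intro that[of M r1]) (auto simp: M_def r1_def)
qed

text \<open>Follow the vertical segment from \<open>p\<close> down to the first zero met: its length
  is at most the distance \<open>d\<close>, and the slope is at most the square root of
  \<open>M * d\<close>. Hence \<open>\<psi>\<close> grows at most like d^(3/2).\<close>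

lemma psi_growth:
  obtains M r1 where "0 \<le> M" "0 < r1" "r1 \<le> R"
    "\<And>p. p \<in> P \<Longrightarrow> p \<in> ball Xc r1 \<Longrightarrow> (px \<psi> p)\<^sup>2 + (py \<psi> p)\<^sup>2 \<le> M * dist Xc p"
    "\<And>p. p \<in> ball Xc r1 \<Longrightarrow> (\<psi> p)\<^sup>2 \<le> M * dist Xc p ^ 3"
proof -
  obtain M r1 where M: "0 \<le> M" "0 < r1" "r1 \<le> R"
    and g: "\<And>p. p \<in> P \<Longrightarrow> p \<in> ball Xc r1 \<Longrightarrow> (px \<psi> p)\<^sup>2 + (py \<psi> p)\<^sup>2 \<le> M * dist Xc p"
    using gradient_growth by blast
  have "(\<psi> p)\<^sup>2 \<le> M * dist Xc p ^ 3" if p: "p \<in> ball Xc r1" for p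
  proof (cases "p \<in> P")
    case False
    have "p \<in> U" using p M(3) by (auto simp: U_def)
    then show ?thesis using psi_off_P[OF _ False] M by simp
  next
    case True
    obtain x y where xy: "p = (x, y)" by (cases p)
    define d where "d = dist Xc p"
    have d: "d < r1" using p by (simp add: d_def)
    have pU: "p \<in> U" using True P_sub(1) by blast
    have y: "y > 0" using psi_lower[of p] True U_sub(3) pU by (force simp: P_def xy not_less[symmetric])
    \<comment> \<open>Lowering a point towards the line \<open>y = 0\<close> through
      \<open>Xc\<close> does not increase its distance to \<open>Xc\<close>, so the segment stays in
      the ball.\<close>
    have dist_le: "dist Xc (x, s) \<le> d" if "0 \<le> s" "s \<le> y" for s
      using that unfolding d_def xy Xc_def dist_prod_def by (simp add: dist_real_def power_mono)
    have inU: "(x, s) \<in> U" and inb: "(x, s) \<in> ball Xc r1" if "0 \<le> s" "s \<le> y" for s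
      using dist_le[OF that] d M(3) by (auto simp: U_def)
    let ?k = "\<lambda>s. \<psi> (x, s)"
    have ck: "continuous_on {0..y} ?k"
      by (rule continuous_on_compose2[OF psi_cont_U]) (use inU in \<open>auto intro!: continuous_intros\<close>)
    \<comment> \<open>The segment may leave \<open>P\<close>, so the mean value theorem is used only
      above the highest zero \<open>s0\<close>; a zero exists because \<open>\<psi>\<close> vanishes
      at height 0.\<close>
    define S where "S = {s \<in> {0..y}. ?k s = 0}"
    have k0: "?k 0 = 0" using psi_lower[of "(x, 0)"] inU[of 0] y U_sub(3) by auto
    have "closed S" unfolding S_def
      by (rule continuous_closed_preimage_constant[OF ck]) simp
    moreover have "bounded S" unfolding S_def by (rule bounded_subset[of "{0..y}"]) auto
    ultimately have cS: "compact S" by (simp add: compact_eq_bounded_closed)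
    have "0 \<in> S" using k0 y by (simp add: S_def)
    then have "S \<noteq> {}" by blast
    then obtain s0 where s0: "s0 \<in> S" "\<And>s. s \<in> S \<Longrightarrow> s \<le> s0" using compact_attains_sup[OF cS] by auto
    have s0': "0 \<le> s0" "s0 \<le> y" "?k s0 = 0" using s0(1) by (auto simp: S_def)
    have ky: "?k y > 0" using True by (simp add: P_def xy)
    then have s0y: "s0 < y" using s0' by (cases "s0 = y") auto
    have inP: "(x, s) \<in> P" if "s0 < s" "s \<le> y" for s
    proof (rule ccontr)
      assume "(x, s) \<notin> P"
      then have "?k s = 0" using psi_off_P inU[of s] that s0' by auto
      then show False using s0(2)[of s] that s0' by (auto simp: S_def)
    qed
    have "\<exists>l z. s0 < z \<and> z < y \<and> (?k has_real_derivative l) (at z) \<and> ?k y - ?k s0 = (y - s0) * l"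
    proof (rule MVT[OF s0y])
      show "continuous_on {s0..y} ?k" by (rule continuous_on_subset[OF ck]) (use s0' in auto)
      fix z assume "s0 < z" "z < y"
      then show "?k differentiable at z"
        using P_deriv(2)[OF inP[of z]] by (auto simp: real_differentiable_def)
    qed
    then obtain l z where z: "s0 < z" "z < y" "(?k has_real_derivative l) (at z)" "?k y - ?k s0 = (y - s0) * l" by blast
    have l: "l = py \<psi> (x, z)" using P_deriv(2)[OF inP[of z]] z by (auto intro: DERIV_unique)
    have "l\<^sup>2 \<le> M * dist Xc (x, z)" using g[OF inP[of z] inb[of z]] z s0' zero_le_power2[of "px \<psi> (x, z)"] unfolding l by linarith
    also have "\<dots> \<le> M * d" using dist_le[of z] z s0' M by (intro mult_left_mono) auto
    finally have l2: "l\<^sup>2 \<le> M * d" .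
    have yd: "y - s0 \<le> d" "0 \<le> y - s0"
      using s0' s0y dist_snd_le[of Xc p] by (auto simp: d_def xy Xc_def dist_real_def)
    have "(\<psi> p)\<^sup>2 = (y - s0)\<^sup>2 * l\<^sup>2" using z(4) s0' by (simp add: xy power_mult_distrib)
    also have "\<dots> \<le> d\<^sup>2 * (M * d)" using yd l2 by (intro mult_mono power_mono) auto
    finally show ?thesis by (simp add: d_def power2_eq_square power3_eq_cube mult_ac)
  qed
  with M g show ?thesis by (intro that)
qed

end

section \<open>The derivative of the frequency\<close>

text \<open>A prefix \<open>d\<close> marks disc integrals and \<open>c\<close> circle integrals
  (\<open>dE\<close>: energy, \<open>cM\<close>: \<open>mm\<close>, \<open>cW\<close>:
  \<open>ww\<close>); \<open>q1\<close>, \<open>q2\<close>, \<open>q3\<close> are the primitives and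
  \<open>W\<close> is the numerator of \<open>V\<close>. The analysis is contained in
  \<open>flux\<close>, \<open>energy\<close>, \<open>yy\<close> and the formulas for the
  derivatives.\<close>

lemma frequency_derivative_algebra:
  fixes r N :: real
  assumes r: "r > 0" and N: "N > 0"
    and flux: "r * (- 6 * dxF + 2 * x0 * dF + 3 * dP + i2 + i1) = r\<^sup>2 * (cE - 2 * cxF + cP) - 2 * cW"
    and energy: "r * dE = cM"
    and yy: "r * cy = 3 * dy"
    and W: "W = r * (x0 * dy - dP) + r ^ 4 * q1 + r ^ 4 * q2 + 3 / 2 * r ^ 4 * q3"
    and W': "W' = (x0 * dy - dP) + r * (x0 * cy - cP) + 4 * r ^ 3 * q1 + i1 + 4 * r ^ 3 * q2 + i2 + 6 * r ^ 3 * q3 + 3 / 2 * cJ / r"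
    and N': "N' = (2 * cM + N - cJ) / r"
    and D: "D = r * dE / N" and V: "V = W / N" and H: "H = D - V" and Z: "Z = cJ / N"
    and K: "K = r * (2 * cxF - cff) + (2 * x0 * dF - 6 * dxF)"
  shows "((dE + r * (cE - cff) - W') * N - (r * dE - W) * N') / (N * N)
      = 2 / r * ((cW - 2 * D * cM + D\<^sup>2 * N) / N) + 2 / r * V\<^sup>2 + 2 / r * V * (H - 3 / 2) + 1 / r * Z * (H - 3 / 2) + K / N" (is "?L = ?R1")
    and "2 / r * ((cW - 2 * D * cM + D\<^sup>2 * N) / N) + 2 / r * V\<^sup>2 + 2 / r * V * (H - 3 / 2) + 1 / r * Z * (H - 3 / 2) + K / N
      = 2 / r * ((cW - 2 * H * cM + H\<^sup>2 * N) / N) + 2 / r * V * (H - 3 / 2) + 1 / r * Z * (H - 3 / 2) + K / N"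
proof -
  \<comment> \<open>The energy identity enters as \<open>cM = D * N\<close>; it is what collapses
    the mixed term of the squares.\<close>
  have dE: "dE = D * N / r" "cM = D * N" and WV: "W = V * N" and cJ: "cJ = Z * N"
    using D V Z r N energy by (simp_all add: field_simps)
  \<comment> \<open>The primitives are eliminated in favour of \<open>W\<close>, which turns the
    exponent 4 into the term \<open>4 * W / r\<close>.\<close>
  have q: "4 * r ^ 3 * q1 + 4 * r ^ 3 * q2 + 6 * r ^ 3 * q3 = 4 * (W - r * (x0 * dy - dP)) / r"
    using r unfolding W by (simp add: field_simps power4_eq_xxxx power3_eq_cube)
  have cE: "r * cE = (- 6 * dxF + 2 * x0 * dF + 3 * dP + i2 + i1) + 2 * r * cxF - r * cP + 2 * cW / r"
  proof -
    have "r * (r * cE) = r * ((- 6 * dxF + 2 * x0 * dF + 3 * dP + i2 + i1) + 2 * r * cxF - r * cP + 2 * cW / r)"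
      using flux r by (simp add: algebra_simps power2_eq_square)
    then show ?thesis using r by simp
  qed
  \<comment> \<open>By \<open>yy\<close> the terms with \<open>x0 * dy\<close> cancel, 1 + 3 - 4 =
    0; for \<open>dP\<close> the balance -1 + 4 = 3 is the coefficient in the Pohozaev identity, and
    \<open>i1\<close>, \<open>i2\<close> match it as well.\<close>
  have W2: "W' = 3 * dP - r * cP + 4 * W / r + i1 + i2 + 3 / 2 * cJ / r"
  proof -
    have "4 * (W - r * (x0 * dy - dP)) / r = 4 * W / r - 4 * (x0 * dy - dP)"
      using r by (simp add: field_simps)
    with q have A: "4 * r ^ 3 * q1 + 4 * r ^ 3 * q2 + 6 * r ^ 3 * q3 = 4 * W / r - 4 * (x0 * dy - dP)" by (rule trans)
    have "r * (x0 * cy) = 3 * (x0 * dy)" using yy by (metis mult.left_commute)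
    then have B: "r * (x0 * cy - cP) = 3 * (x0 * dy) - r * cP" by (simp add: right_diff_distrib)
    have "W' = (x0 * dy - dP) + (3 * (x0 * dy) - r * cP) + (4 * r ^ 3 * q1 + 4 * r ^ 3 * q2 + 6 * r ^ 3 * q3) + i1 + i2 + 3 / 2 * cJ / r"
      unfolding W' B by simp
    then show ?thesis unfolding A by (simp add: right_diff_distrib)
  qed
  have S: "dE + r * (cE - cff) - W' = D * N / r + 2 * cW / r + K - 4 * V * N / r - 3 / 2 * (Z * N) / r"
  proof -
    have "r * (cE - cff) = r * cE - r * cff" by (simp add: algebra_simps)
    moreover have "K = 2 * (r * cxF) - r * cff + (2 * x0 * dF - 6 * dxF)" using K by (simp add: algebra_simps)
    ultimately show ?thesis unfolding W2 dE(1) cE WV cJ by simp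
  qed
  have N2: "N' = (2 * D * N + N - Z * N) / r" using N' dE cJ by simp
  have diff: "r * dE - W = H * N" unfolding H dE(1) WV using r by (simp add: left_diff_distrib)
  have "?L = ((D * N / r + 2 * cW / r + K - 4 * V * N / r - 3 / 2 * (Z * N) / r) * N - H * N * ((2 * D * N + N - Z * N) / r)) / (N * N)"
    unfolding S diff N2 ..
  also have "\<dots> = ?R1"
    unfolding dE(2) H using r N by (simp add: field_simps power2_eq_square)
  finally show "?L = ?R1" .
  \<comment> \<open>Since \<open>cM = D * N\<close>, the square with coefficient c averages to
    \<open>cW / N - D\<^sup>2\<close> plus the square of D - c. For c = \<open>H\<close> that
    difference is \<open>V\<close>, which accounts for the \<open>V\<^sup>2\<close> term.\<close>
  show "?R1 = 2 / r * ((cW - 2 * H * cM + H\<^sup>2 * N) / N) + 2 / r * V * (H - 3 / 2) + 1 / r * Z * (H - 3 / 2) + K / N"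
    unfolding dE(2) H using r N by (simp add: field_simps power2_eq_square)
qed

section \<open>Linearity and size of disc and circle integrals\<close>

lemma disc_int_linear:
  assumes "integrable lborel u" "integrable lborel v"
  shows "disc_int X t (\<lambda>p. u p + v p) = disc_int X t u + disc_int X t v"
    "disc_int X t (\<lambda>p. u p - v p) = disc_int X t u - disc_int X t v"
  unfolding disc_int_def using assms
  by (intro set_integral_add(2) set_integral_diff(2) set_integrable_of_integrable; simp)+

lemma disc_int_cmult: "disc_int X t (\<lambda>p. c * u p) = c * disc_int X t u"
  unfolding disc_int_def by (rule set_integral_mult_right)

abbreviation circ_integrable :: "point \<Rightarrow> real \<Rightarrow> (point \<Rightarrow> real) \<Rightarrow> bool" where
  "circ_integrable X t u \<equiv> set_integrable lborel {0<..<2*pi} (\<lambda>\<theta>. t * u (polar_map X (t,\<theta>)))"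

lemma circ_int_linear:
  assumes "circ_integrable X t u" "circ_integrable X t v"
  shows "circ_int X t (\<lambda>p. u p + v p) = circ_int X t u + circ_int X t v"
    "circ_int X t (\<lambda>p. u p - v p) = circ_int X t u - circ_int X t v"
  unfolding circ_int_alt distrib_left right_diff_distrib
  by (rule set_integral_add(2)[OF assms], rule set_integral_diff(2)[OF assms])

lemma circ_integrable_linear:
  assumes "circ_integrable X t u" "circ_integrable X t v"
  shows "circ_integrable X t (\<lambda>p. u p + v p)" "circ_integrable X t (\<lambda>p. u p - v p)"
  unfolding distrib_left right_diff_distrib
  by (rule set_integral_add(1)[OF assms], rule set_integral_diff(1)[OF assms])

lemma circ_int_cmult: "circ_int X t (\<lambda>p. c * u p) = c * circ_int X t u"
  unfolding circ_int_alt set_integral_mult_right[symmetric]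
  by (intro set_lebesgue_integral_cong) (auto simp: mult_ac)

lemma circ_integrable_cmult: "circ_integrable X t u \<Longrightarrow> circ_integrable X t (\<lambda>p. c * u p)"
  using set_integrable_mult_right[of c lborel "{0<..<2*pi}" "\<lambda>\<theta>. t * u (polar_map X (t,\<theta>))"]
  by (simp add: mult.left_commute)

lemma disc_int_bound:
  assumes "0 < t" "0 \<le> c" "\<And>p. p \<in> ball X t \<Longrightarrow> \<bar>u p\<bar> \<le> c"
  shows "\<bar>disc_int X t u\<bar> \<le> c * unit_ball_vol 2 * t\<^sup>2"
proof (cases "integrable lborel (\<lambda>p. indicator (ball X t) p *\<^sub>R u p)")
  case True
  have fin: "emeasure lborel (ball X t) < \<infinity>" by (rule emeasure_bounded_finite) simp
  have "norm (\<integral>p. indicator (ball X t) p *\<^sub>R u p \<partial>lborel) \<le> (\<integral>p. c * indicator (ball X t) p \<partial>lborel)"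
  proof (rule Bochner_Integration.integral_norm_bound_integral[OF True])
    show "integrable lborel (\<lambda>p. c * indicator (ball X t) p)" using fin by (intro integrable_mult_right integrable_real_indicator) auto
  qed (use assms in \<open>auto simp: indicator_def\<close>)
  also have "\<dots> = c * unit_ball_vol 2 * t\<^sup>2"
    using content_ball[of t X] assms(1) by (simp add: power2_eq_square)
  finally show ?thesis unfolding disc_int_def set_lebesgue_integral_def real_norm_def .
next
  case False
  \<comment> \<open>The integral of a function that is not integrable is 0 by convention, so the
    bound still holds.\<close>
  then have "disc_int X t u = 0" by (simp add: disc_int_def set_lebesgue_integral_def not_integrable_integral_eq)
  then show ?thesis using assms by (simp add: unit_ball_vol_nonneg)
qed

lemma circ_int_bound:
  assumes "0 < t" "0 \<le> c" "\<And>\<theta>. \<bar>u (polar_map X (t, \<theta>))\<bar> \<le> c"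
  shows "\<bar>circ_int X t u\<bar> \<le> 2 * pi * t * c"
proof (cases "circ_integrable X t u")
  case True
  have "norm (\<integral>\<theta>. indicator {0<..<2*pi} \<theta> *\<^sub>R (t * u (polar_map X (t,\<theta>))) \<partial>lborel) \<le> (\<integral>\<theta>. (t * c) * indicator {0<..<2*pi} \<theta> \<partial>lborel)"
  proof (rule Bochner_Integration.integral_norm_bound_integral[OF True[unfolded set_integrable_def]])
    show "integrable lborel (\<lambda>\<theta>. (t * c) * indicator {0<..<2*pi} \<theta>)" by (intro integrable_mult_right integrable_real_indicator) auto
  qed (use assms in \<open>auto simp: indicator_def abs_mult\<close>)
  also have "\<dots> = 2 * pi * t * c" by simp
  finally show ?thesis unfolding circ_int_alt set_lebesgue_integral_def real_norm_def .
next
  case False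
  then have "circ_int X t u = 0"
    unfolding circ_int_alt set_lebesgue_integral_def set_integrable_def by (rule not_integrable_integral_eq)
  then show ?thesis using assms by simp
qed

text \<open>Near 0 the bound \<open>C * t ^ k\<close> keeps the quotient bounded, away from 0 the
  constant \<open>B\<close> does. The quotient is thus integrable on (0, R), and Lebesgue
  differentiation applies to its primitive.\<close>

lemma weighted_primitive_has_derivative:
  fixes hc hf :: "real \<Rightarrow> real"
  assumes R: "0 < R" and c: "continuous_on {0<..<R} hc" and B: "\<And>t. 0 < t \<Longrightarrow> t < R \<Longrightarrow> \<bar>hc t\<bar> \<le> B"
    and r1: "0 < r1" and C: "\<And>t. 0 < t \<Longrightarrow> t < r1 \<Longrightarrow> t < R \<Longrightarrow> \<bar>hc t\<bar> \<le> C * t ^ k"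
    and eq: "\<And>t. 0 < t \<Longrightarrow> t < R \<Longrightarrow> hf t = hc t"
  shows "AE r in lborel. 0 < r \<and> r < R \<longrightarrow> ((\<lambda>r. LBINT t=0..r. hf t / t ^ k) has_real_derivative hf r / r ^ k) (at r)"
proof -
  define q where "q t = indicator {0<..<R} t *\<^sub>R (hc t / t ^ k)" for t
  have mq: "q \<in> borel_measurable borel"
    unfolding q_def[abs_def] by (intro borel_measurable_continuous_on_indicator continuous_intros c) auto
  define D where "D = max \<bar>C\<bar> (B / r1 ^ k)"
  have qb: "\<bar>q t\<bar> \<le> D * indicator {0<..<R} t" for t
  proof (cases "t \<in> {0<..<R}")
    case True
    then have t: "0 < t" "t < R" by auto
    have "\<bar>hc t\<bar> / t ^ k \<le> D"
    proof (cases "t < r1")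
      case True
      have "\<bar>hc t\<bar> \<le> C * t ^ k" by (rule C[OF t(1) True t(2)])
      also have "\<dots> \<le> \<bar>C\<bar> * t ^ k" using t by (intro mult_right_mono) auto
      finally have "\<bar>hc t\<bar> / t ^ k \<le> \<bar>C\<bar>" using t by (simp add: pos_divide_le_eq)
      then show ?thesis by (simp add: D_def)
    next
      case False
      have "\<bar>hc t\<bar> / t ^ k \<le> B / r1 ^ k" using B[OF t] t r1 False by (intro frac_le power_mono) auto
      then show ?thesis by (simp add: D_def)
    qed
    then show ?thesis using True t by (simp add: q_def abs_divide)
  qed (simp add: q_def)
  have iq: "integrable lborel q"
  proof (rule Bochner_Integration.integrable_bound)
    show "integrable lborel (\<lambda>t. D * indicator {0<..<R} t)" using R by (intro integrable_mult_right integrable_real_indicator) auto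
    show "AE t in lborel. norm (q t) \<le> norm (D * indicator {0<..<R} t)"
    proof (rule AE_I2)
      fix t show "norm (q t) \<le> norm (D * indicator {0<..<R} t)" using qb[of t] by simp
    qed
  qed (use mq in simp)
  have prim: "(LBINT t=0..r. hf t / t ^ k) = (LINT t:{..r}|lborel. q t)" if r: "0 < r" "r < R" for r
  proof -
    have "(LBINT t=0..r. hf t / t ^ k) = (LINT t:{0<..<r}|lborel. hf t / t ^ k)"
      using r by (simp add: interval_lebesgue_integral_def zero_ereal_def)
    also have "\<dots> = (LINT t:{0<..<r}|lborel. q t)"
      using r eq by (intro set_lebesgue_integral_cong) (auto simp: q_def)
    also have "\<dots> = (LINT t:{..r}|lborel. q t)"
      unfolding set_lebesgue_integral_def
    proof (rule integral_cong_AE)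
      have "AE t in lborel. t \<notin> {r}" by (intro AE_not_in finite_imp_null_set_lborel) auto
      then show "AE t in lborel. indicator {0<..<r} t *\<^sub>R q t = indicator {..r} t *\<^sub>R q t"
        by eventually_elim (auto simp: indicator_def q_def)
    qed (use mq in measurable)
    finally show ?thesis .
  qed
  show ?thesis using lebesgue_differentiation[OF iq]
  proof eventually_elim
    case (elim r)
    show ?case
    proof
      assume r: "0 < r \<and> r < R"
      have "q r = hf r / r ^ k" using r eq by (simp add: q_def)
      with elim have "((\<lambda>r. LINT t:{..r}|lborel. q t) has_real_derivative hf r / r ^ k) (at r)" by simp
      then show "((\<lambda>r. LBINT t=0..r. hf t / t ^ k) has_real_derivative hf r / r ^ k) (at r)"
        by (rule has_field_derivative_transform_within_open[where S="{0<..<R}"]) (use r prim in auto)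
    qed
  qed
qed

section \<open>The ingredients of the frequency in terms of integrable densities\<close>

context degenerate_point begin

definition ee :: "point \<Rightarrow> real" where "ee p = e1 p + e2 p"
definition xF :: "point \<Rightarrow> real" where "xF p = indicator U p * (fst p * Fprim f (\<psi> p))"
definition F0 :: "point \<Rightarrow> real" where "F0 p = indicator U p * Fprim f (\<psi> p)"
definition pp :: "point \<Rightarrow> real" where "pp p = indicator P p * (fst p * snd p)"
definition yy :: "point \<Rightarrow> real" where "yy p = indicator U p * max (snd p) 0"
definition i1d :: "point \<Rightarrow> real" where "i1d p = ee p * ((fst p - x0) / fst p)"
definition i2d :: "point \<Rightarrow> real" where "i2d p = indicator P p * ((fst p - x0) * snd p)"
text \<open>The square of \<open>G1 p * (fst p - x0) + G2 p * snd p\<close> divided by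
  \<open>x\<close>, multiplied out; on the circle of radius \<open>r\<close> it is
  \<open>r\<^sup>2\<close> times the weighted squared normal derivative.\<close>

definition ww :: "point \<Rightarrow> real" where
  "ww p = e1 p * (fst p - x0)\<^sup>2 + 2 * (e12 p * ((fst p - x0) * snd p)) + e2 p * (snd p)\<^sup>2"

lemma densities_integrable:
  "integrable lborel ee" "integrable lborel xF" "integrable lborel F0" "integrable lborel pp" "integrable lborel yy"
  "integrable lborel i1d" "integrable lborel i2d" "integrable lborel ww"
proof -
  have c: "continuous_on (cball Xc R) (\<lambda>p. fst p * Fprim f (\<psi> p))" "continuous_on (cball Xc R) (\<lambda>p. (fst p - x0) * snd p)"
    "continuous_on (cball Xc R) (\<lambda>p. fst p * snd p)" "continuous_on (cball Xc R) (\<lambda>p. fst p - x0)"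
    "continuous_on (cball Xc R) (\<lambda>p. (fst p - x0)\<^sup>2)" "continuous_on (cball Xc R) (\<lambda>p. (snd p)\<^sup>2)"
    "continuous_on (cball Xc R) (\<lambda>p. max (snd p) 0)"
    by (intro continuous_intros F_psi_cont)+
  note i = cball_integrable[OF _ sets_UP(1) U_sub(1)] cball_integrable[OF _ sets_UP(2) P_sub_cball]
  show ee: "integrable lborel ee" unfolding ee_def[abs_def] by (intro Bochner_Integration.integrable_add e_integrable)
  show "integrable lborel xF" "integrable lborel F0" "integrable lborel pp" "integrable lborel yy" "integrable lborel i2d"
    unfolding xF_def[abs_def] F0_def[abs_def] pp_def[abs_def] yy_def[abs_def] i2d_def[abs_def]
    by (rule i(1)[OF c(1)], rule i(1)[OF F_psi_cont], rule i(2)[OF c(3)], rule i(1)[OF c(7)], rule i(2)[OF c(2)])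
  have z: "p \<notin> U \<Longrightarrow> ee p = 0" for p by (simp add: ee_def off_U)
  show "integrable lborel i1d" unfolding i1d_def[abs_def]
    by (rule integrable_times_cont[OF ee z cball_cont_over_fst[OF c(4)]])
  show "integrable lborel ww" unfolding ww_def[abs_def]
    by (intro Bochner_Integration.integrable_add integrable_mult_right integrable_times_cont e_integrable c off_U)
qed

text \<open>\<open>E\<close> is an integrand as written with \<open>g\<close>, \<open>M\<close> a
  measurable copy of it on the ball, and \<open>W\<close> the version with \<open>G1\<close> and
  \<open>G2\<close>. Equality almost everywhere is used between the measurable \<open>M\<close> and
  \<open>W\<close>.\<close>

lemma disc_int_g_eq:
  assumes M: "M \<in> borel_measurable borel" and W: "W \<in> borel_measurable borel" and EM: "\<And>p. p \<in> U \<Longrightarrow> E p = M p"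
    and EW: "\<And>p. p \<in> U \<Longrightarrow> g p = (G1 p, G2 p) \<Longrightarrow> E p = W p" and t: "t \<le> R"
  shows "disc_int Xc t E = disc_int Xc t W"
proof -
  have "disc_int Xc t E = disc_int Xc t M" by (rule disc_int_cong_U[OF t EM])
  also have "\<dots> = disc_int Xc t W"
    unfolding disc_int_def set_lebesgue_integral_def
  proof (rule integral_cong_AE)
    show "AE p in lborel. indicator (ball Xc t) p *\<^sub>R M p = indicator (ball Xc t) p *\<^sub>R W p"
      using g_eq_G
    proof eventually_elim
      case (elim p)
      show ?case
      proof (cases "p \<in> ball Xc t")
        case True
        then have "p \<in> U" using ball_sub_U[OF t] by blast
        then show ?thesis using elim EM[of p] EW[of p] by simp
      qed simp
    qed
  qed (unfold measurable_lborel2, (intro borel_measurable_scaleR borel_measurable_indicator borel_open open_ball M W)+)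
  finally show ?thesis .
qed

text \<open>Membership in \<open>U\<close> stays a premise, so the condition is literally what
  \<open>AE_polar\<close> extracts from \<open>g_eq_G\<close>; for \<open>0 < t < R\<close> the
  whole circle lies in the ball.\<close>

definition good_circle :: "real \<Rightarrow> bool" where
  "good_circle t \<longleftrightarrow> (AE \<theta> in lborel. \<theta> \<in> {0<..<2*pi} \<longrightarrow>
     (polar_map Xc (t,\<theta>) \<in> U \<longrightarrow> g (polar_map Xc (t,\<theta>)) = (G1 (polar_map Xc (t,\<theta>)), G2 (polar_map Xc (t,\<theta>)))))"

lemma AE_good_circle: "AE t in lborel. 0 < t \<longrightarrow> good_circle t"
  using AE_polar[OF g_eq_G, of Xc] by (simp add: good_circle_def)

lemma circ_int_g_eq:
  assumes M: "M \<in> borel_measurable borel" and W: "W \<in> borel_measurable borel" and EM: "\<And>p. p \<in> U \<Longrightarrow> E p = M p"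
    and EW: "\<And>p. p \<in> U \<Longrightarrow> g p = (G1 p, G2 p) \<Longrightarrow> E p = W p" and t: "0 < t" "t < R" "good_circle t"
  shows "circ_int Xc t E = circ_int Xc t W"
proof -
  have mp: "(\<lambda>\<theta>. polar_map Xc (t, \<theta>)) \<in> borel \<rightarrow>\<^sub>M borel"
    unfolding polar_map_def by (intro borel_measurable_continuous_onI continuous_intros)
  have "circ_int Xc t E = circ_int Xc t M" by (rule circ_int_cong_U[OF t(1,2) EM])
  also have "\<dots> = circ_int Xc t W"
    unfolding circ_int_alt set_lebesgue_integral_def
  proof (rule integral_cong_AE)
    show "AE \<theta> in lborel. indicator {0<..<2*pi} \<theta> *\<^sub>R (t * M (polar_map Xc (t, \<theta>))) = indicator {0<..<2*pi} \<theta> *\<^sub>R (t * W (polar_map Xc (t, \<theta>)))"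
      using t(3) unfolding good_circle_def
    proof eventually_elim
      case (elim \<theta>)
      show ?case
        using elim circle_in_U[OF t(1,2), of \<theta>] EM[of "polar_map Xc (t, \<theta>)"] EW[of "polar_map Xc (t, \<theta>)"]
        by (cases "\<theta> \<in> {0<..<2*pi}") auto
    qed
  qed (use measurable_compose[OF mp M] measurable_compose[OF mp W] in measurable)
  finally show ?thesis .
qed

text \<open>The positive part of \<open>y\<close> is homogeneous of degree one about
  \<open>Xc\<close>: its circle integrals are a constant times t^2, its disc integrals that constant
  times r^3 / 3.\<close>

lemma yy_scaling:
  assumes r: "0 < r" "r < R"
  shows "r * circ_int Xc r yy = 3 * disc_int Xc r yy"
proof -
  define c where "c = (LINT \<theta>:{0<..<2*pi}|lborel. max (sin \<theta>) 0)"
  have circ: "circ_int Xc t yy = c * t\<^sup>2" if t: "0 < t" "t < R" for t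
  proof -
    have "t * yy (polar_map Xc (t, \<theta>)) = t\<^sup>2 * max (sin \<theta>) 0" for \<theta>
      using circle_in_U[OF t, of \<theta>] t
      by (simp add: yy_def polar_map_def Xc_def max_def power2_eq_square zero_le_mult_iff mult_le_0_iff)
    then show ?thesis unfolding circ_int_alt c_def by (simp add: mult.commute)
  qed
  have "disc_int Xc r yy = (LINT t:{..r}|lborel. indicator {0<..} t * circ_int Xc t yy)"
    by (rule disc_int_polar[OF densities_integrable(5)])
  also have "\<dots> = (\<integral>t. indicator {0..r} t *\<^sub>R (c * t\<^sup>2) \<partial>lborel)"
    unfolding set_lebesgue_integral_def using circ r
    by (intro Bochner_Integration.integral_cong) (auto simp: indicator_def less_le)
  also have "\<dots> = c * r ^ 3 / 3 - c * 0 ^ 3 / 3"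
  proof (rule integral_FTC_Icc)
    fix t show "((\<lambda>t. c * t ^ 3 / 3) has_vector_derivative c * t\<^sup>2) (at t within {0..r})"
      unfolding has_real_derivative_iff_has_vector_derivative[symmetric]
      by (auto intro!: derivative_eq_intros simp: power2_eq_square)
  qed (use r in \<open>auto intro!: continuous_intros\<close>)
  finally have disc: "disc_int Xc r yy = c * r ^ 3 / 3" by simp
  show ?thesis unfolding circ[OF r] disc by (simp add: power2_eq_square power3_eq_cube)
qed

lemma I1_eq: "t \<le> R \<Longrightarrow> I1 g Xc t = - disc_int Xc t i1d"
proof -
  assume t: "t \<le> R"
  note [measurable] = g_meas
  have [measurable]: "(\<lambda>p::point. fst p) \<in> borel_measurable borel" by (intro borel_measurable_continuous_onI continuous_intros)
  have "I1 g Xc t = disc_int Xc t (\<lambda>p. (- 1) * i1d p)"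
    unfolding I1_def
  proof (rule disc_int_g_eq[OF _ _ _ _ t])
    show "(\<lambda>p. - (fst p - fst Xc) / (fst p)\<^sup>2 * ((indicator (cball Xc R) p * fst (g p))\<^sup>2 + (indicator (cball Xc R) p * snd (g p))\<^sup>2)) \<in> borel_measurable borel"
      by measurable
    show "(\<lambda>p. (- 1) * i1d p) \<in> borel_measurable borel" using densities_integrable(6) by simp
    show "- (fst p - fst Xc) / (fst p)\<^sup>2 * gsq g p = - (fst p - fst Xc) / (fst p)\<^sup>2 * ((indicator (cball Xc R) p * fst (g p))\<^sup>2 + (indicator (cball Xc R) p * snd (g p))\<^sup>2)"
      if "p \<in> U" for p using subsetD[OF U_sub(1) that] by (simp add: gsq_def del: mem_cball)
    show "- (fst p - fst Xc) / (fst p)\<^sup>2 * gsq g p = (- 1) * i1d p" if "p \<in> U" "g p = (G1 p, G2 p)" for p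
      using fst_pos[OF that(1)] that(2) by (simp add: gsq_def i1d_def ee_def e1_def e2_def Xc_def field_simps power2_eq_square)
  qed
  then show ?thesis unfolding disc_int_cmult by simp
qed

lemma I2_eq: "t \<le> R \<Longrightarrow> I2 \<psi> Xc t = disc_int Xc t i2d"
  unfolding I2_def by (rule disc_int_cong_U) (auto simp: i2d_def Xc_def chi_eq)

text \<open>The exponents 4 and 5 are exactly the available decay. The densities of
  \<open>I1\<close> and \<open>I2\<close> are of order t^2 on discs of area of order t^2, by the
  gradient growth and by the size of the coordinates respectively; that of \<open>J1\<close> is of
  order t^4, from |x - x0| at most t and \<open>\<psi>\<^sup>2\<close> of order t^3, on circles of
  length of order t.\<close>

lemma I1_primitive: "AE r in lborel. 0 < r \<and> r < R \<longrightarrow> ((\<lambda>r. LBINT t=0..r. I1 g Xc t / t ^ 4) has_real_derivative I1 g Xc r / r ^ 4) (at r)"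
  and I2_primitive: "AE r in lborel. 0 < r \<and> r < R \<longrightarrow> ((\<lambda>r. LBINT t=0..r. I2 \<psi> Xc t / t ^ 4) has_real_derivative I2 \<psi> Xc r / r ^ 4) (at r)"
  and J1_primitive: "AE r in lborel. 0 < r \<and> r < R \<longrightarrow> ((\<lambda>r. LBINT t=0..r. J1 \<psi> Xc t / t ^ 5) has_real_derivative J1 \<psi> Xc r / r ^ 5) (at r)"
proof -
  obtain M r1 where M: "0 \<le> M" "0 < r1" "r1 \<le> R"
    and gG: "\<And>p. p \<in> P \<Longrightarrow> p \<in> ball Xc r1 \<Longrightarrow> (px \<psi> p)\<^sup>2 + (py \<psi> p)\<^sup>2 \<le> M * dist Xc p"
    and gP: "\<And>p. p \<in> ball Xc r1 \<Longrightarrow> (\<psi> p)\<^sup>2 \<le> M * dist Xc p ^ 3"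
    using psi_growth by blast
  have bdd: "\<exists>B. \<forall>t. 0 < t \<and> t < R \<longrightarrow> \<bar>disc_int Xc t w\<bar> \<le> B" if "integrable lborel w" for w
  proof -
    have "compact ((\<lambda>t. disc_int Xc t w) ` {0..R})" by (intro compact_continuous_image continuous_on_disc_int[OF that]) auto
    then obtain B where "\<And>t. t \<in> {0..R} \<Longrightarrow> \<bar>disc_int Xc t w\<bar> \<le> B"
      using compact_imp_bounded[of "(\<lambda>t. disc_int Xc t w) ` {0..R}"] unfolding bounded_real by blast
    then show ?thesis by (intro exI[of _ B]) auto
  qed
  have coord: "\<bar>fst p - x0\<bar> \<le> dist Xc p" "\<bar>snd p\<bar> \<le> dist Xc p" for p
    using dist_snd_le[of Xc p] dist_fst_le[of Xc p] by (simp_all add: dist_real_def Xc_def abs_minus_commute)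
  have inv: "1 / fst p \<le> 2 / x0" "0 < fst p" if "p \<in> U" for p
  proof -
    show "0 < fst p" by (rule fst_pos[OF that])
    then show "1 / fst p \<le> 2 / x0" using fst_lower[OF subsetD[OF U_sub(1) that]] x0_pos by (simp add: field_simps)
  qed
  have i1b: "\<bar>i1d p\<bar> \<le> (M * (2 / x0)\<^sup>2) * t\<^sup>2" if t: "0 < t" "t < r1" and p: "p \<in> ball Xc t" for t p
  proof (cases "p \<in> P")
    case True
    have U: "p \<in> U" using True P_sub(1) by blast
    have d: "dist Xc p \<le> t" using p by simp
    have "p \<in> ball Xc r1" using p t by simp
    from gG[OF True this] have g1: "(px \<psi> p)\<^sup>2 + (py \<psi> p)\<^sup>2 \<le> M * t" using mult_left_mono[OF d M(1)] by linarith
    have "i1d p = ((px \<psi> p)\<^sup>2 + (py \<psi> p)\<^sup>2) * (fst p - x0) * (1 / fst p)\<^sup>2"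
      using True by (simp add: i1d_def ee_def e1_def e2_def G1_def G2_def power2_eq_square add_divide_distrib diff_divide_distrib algebra_simps)
    then have "\<bar>i1d p\<bar> = ((px \<psi> p)\<^sup>2 + (py \<psi> p)\<^sup>2) * \<bar>fst p - x0\<bar> * (1 / fst p)\<^sup>2"
      by (simp add: abs_mult)
    also have "\<dots> \<le> (M * t) * t * (2 / x0)\<^sup>2"
      using g1 coord(1)[of p] d inv[OF U] M(1) t by (intro mult_mono power_mono) auto
    finally show ?thesis by (simp add: power2_eq_square mult_ac)
  qed (use M in \<open>simp add: i1d_def ee_def e_zero\<close>)
  have i2b: "\<bar>i2d p\<bar> \<le> 1 * t\<^sup>2" if p: "p \<in> ball Xc t" for t p
  proof -
    have "\<bar>i2d p\<bar> \<le> \<bar>fst p - x0\<bar> * \<bar>snd p\<bar>" by (simp add: i2d_def indicator_def abs_mult)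
    also have "\<dots> \<le> t * t" using coord[of p] p by (intro mult_mono) auto
    finally show ?thesis by (simp add: power2_eq_square)
  qed
  have jb: "\<bar>jj p\<bar> \<le> (M * (2 / x0)\<^sup>2) * t ^ 4" if t: "0 < t" "t < r1" and p: "p \<in> U" "dist Xc p \<le> t" for t p
  proof -
    have "p \<in> ball Xc r1" using p t by simp
    from gP[OF this] have g1: "(\<psi> p)\<^sup>2 \<le> M * t ^ 3"
      using mult_left_mono[OF power_mono[OF p(2), of 3] M(1)] by simp
    have "\<bar>jj p\<bar> = \<bar>fst p - x0\<bar> * (1 / fst p)\<^sup>2 * (\<psi> p)\<^sup>2"
      using p inv[OF p(1)] by (simp add: jj_def abs_mult power_divide)
    also have "\<dots> \<le> t * (2 / x0)\<^sup>2 * (M * t ^ 3)"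
      using g1 coord(1)[of p] p inv[OF p(1)] x0_pos t by (intro mult_mono power_mono) auto
    finally show ?thesis by (simp add: power4_eq_xxxx power3_eq_cube mult_ac)
  qed
  have jbU: "\<exists>B\<ge>0. \<forall>p\<in>U. \<bar>jj p\<bar> \<le> B"
  proof -
    have "compact ((\<lambda>p. (fst p - x0) / (fst p)\<^sup>2 * (\<psi> p)\<^sup>2) ` cball Xc R)" by (rule compact_continuous_image[OF jj_cont compact_cball])
    then obtain B where B: "\<And>p. p \<in> cball Xc R \<Longrightarrow> \<bar>(fst p - x0) / (fst p)\<^sup>2 * (\<psi> p)\<^sup>2\<bar> \<le> B"
      using compact_imp_bounded[of "(\<lambda>p. (fst p - x0) / (fst p)\<^sup>2 * (\<psi> p)\<^sup>2) ` cball Xc R"] unfolding bounded_real by blast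
    have "\<bar>jj p\<bar> \<le> \<bar>B\<bar>" if "p \<in> U" for p
      using B[OF subsetD[OF U_sub(1) that]] that by (simp add: jj_def)
    then show ?thesis by (intro exI[of _ "\<bar>B\<bar>"]) auto
  qed
  obtain B1 where B1: "\<And>t. 0 < t \<Longrightarrow> t < R \<Longrightarrow> \<bar>disc_int Xc t i1d\<bar> \<le> B1" using bdd[OF densities_integrable(6)] by blast
  obtain B2 where B2: "\<And>t. 0 < t \<Longrightarrow> t < R \<Longrightarrow> \<bar>disc_int Xc t i2d\<bar> \<le> B2" using bdd[OF densities_integrable(7)] by blast
  obtain B3 where B3: "0 \<le> B3" "\<And>p. p \<in> U \<Longrightarrow> \<bar>jj p\<bar> \<le> B3" using jbU by blast
  show "AE r in lborel. 0 < r \<and> r < R \<longrightarrow> ((\<lambda>r. LBINT t=0..r. I1 g Xc t / t ^ 4) has_real_derivative I1 g Xc r / r ^ 4) (at r)"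
  proof (rule weighted_primitive_has_derivative[where hc="\<lambda>t. - disc_int Xc t i1d" and B=B1 and C="(M * (2 / x0)\<^sup>2) * unit_ball_vol 2", OF R_pos _ _ M(2)])
    show "continuous_on {0<..<R} (\<lambda>t. - disc_int Xc t i1d)" by (intro continuous_intros continuous_on_disc_int densities_integrable)
    show "\<bar>- disc_int Xc t i1d\<bar> \<le> (M * (2 / x0)\<^sup>2) * unit_ball_vol 2 * t ^ 4" if "0 < t" "t < r1" for t
      using disc_int_bound[OF that(1) _ i1b[OF that], where X=Xc] M(1) by (simp add: power4_eq_xxxx power2_eq_square mult_ac)
  qed (use B1 I1_eq in auto)
  show "AE r in lborel. 0 < r \<and> r < R \<longrightarrow> ((\<lambda>r. LBINT t=0..r. I2 \<psi> Xc t / t ^ 4) has_real_derivative I2 \<psi> Xc r / r ^ 4) (at r)"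
  proof (rule weighted_primitive_has_derivative[where hc="\<lambda>t. disc_int Xc t i2d" and B=B2 and C="unit_ball_vol 2", OF R_pos _ _ M(2)])
    show "continuous_on {0<..<R} (\<lambda>t. disc_int Xc t i2d)" by (intro continuous_on_disc_int densities_integrable)
    show "\<bar>disc_int Xc t i2d\<bar> \<le> unit_ball_vol 2 * t ^ 4" if "0 < t" for t
      using disc_int_bound[OF that _ i2b[of _ t], where X=Xc] by (simp add: power4_eq_xxxx power2_eq_square mult_ac)
  qed (use B2 I2_eq in auto)
  show "AE r in lborel. 0 < r \<and> r < R \<longrightarrow> ((\<lambda>r. LBINT t=0..r. J1 \<psi> Xc t / t ^ 5) has_real_derivative J1 \<psi> Xc r / r ^ 5) (at r)"
  proof (rule weighted_primitive_has_derivative[where hc="\<lambda>t. J1 \<psi> Xc t" and B="2 * pi * R * B3" and C="2 * pi * (M * (2 / x0)\<^sup>2)", OF R_pos _ _ M(2)])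
    have "fst Xc = x0" by (simp add: Xc_def)
    then show "continuous_on {0<..<R} (\<lambda>t. J1 \<psi> Xc t)" unfolding J1_def by (simp only: circ_int_continuous[OF jj_cont])
    have on: "dist Xc (polar_map Xc (t, \<theta>)) \<le> t" if "0 < t" for t \<theta>
    proof (rule ccontr)
      assume "\<not> dist Xc (polar_map Xc (t, \<theta>)) \<le> t"
      then show False using polar_map_in_ball[OF that, of Xc \<theta> "dist Xc (polar_map Xc (t, \<theta>))"] by simp
    qed
    show "\<bar>J1 \<psi> Xc t\<bar> \<le> 2 * pi * R * B3" if t: "0 < t" "t < R" for t
    proof -
      have "\<bar>circ_int Xc t jj\<bar> \<le> 2 * pi * t * B3"
        using t(1) B3(1) B3(2)[OF circle_in_U[OF t]] by (rule circ_int_bound)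
      also have "\<dots> \<le> 2 * pi * R * B3" using t B3 by (intro mult_right_mono mult_left_mono) auto
      finally show ?thesis by (simp add: J1_eq[OF t])
    qed
    show "\<bar>J1 \<psi> Xc t\<bar> \<le> 2 * pi * (M * (2 / x0)\<^sup>2) * t ^ 5" if t: "0 < t" "t < r1" "t < R" for t
    proof -
      have "\<bar>circ_int Xc t jj\<bar> \<le> 2 * pi * t * ((M * (2 / x0)\<^sup>2) * t ^ 4)"
        using t M(1) by (intro circ_int_bound jb circle_in_U on) auto
      also have "\<dots> = 2 * pi * (M * (2 / x0)\<^sup>2) * t ^ 5" by (simp add: eval_nat_numeral mult_ac)
      finally show ?thesis by (simp add: J1_eq[OF t(1,3)])
    qed
  qed simp
qed

definition Wnum :: "real \<Rightarrow> real" where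
  "Wnum r = r * (x0 * disc_int Xc r yy - disc_int Xc r pp)
     + r ^ 4 * (LBINT t=0..r. I1 g Xc t / t ^ 4) + r ^ 4 * (LBINT t=0..r. I2 \<psi> Xc t / t ^ 4)
     + 3 / 2 * r ^ 4 * (LBINT t=0..r. J1 \<psi> Xc t / t ^ 5)"

definition Efun :: "real \<Rightarrow> real" where "Efun r = disc_int Xc r (\<lambda>p. ee p - ff p)"

lemma ef_integrable: "integrable lborel (\<lambda>p. ee p - ff p)"
  by (intro Bochner_Integration.integrable_diff densities_integrable mfnj_integrable)

lemma Dfun_eq: "r \<le> R \<Longrightarrow> Dfun f \<psi> g Xc r = r * Efun r / Nfun \<psi> Xc r"
proof -
  assume r: "r \<le> R"
  note [measurable] = g_meas
  have [measurable]: "(\<lambda>p::point. fst p) \<in> borel_measurable borel" by (intro borel_measurable_continuous_onI continuous_intros)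
  have mf: "ff \<in> borel_measurable borel" "ee \<in> borel_measurable borel" using mfnj_integrable(2) densities_integrable(1) by auto
  note [measurable] = mf
  have fU: "fst p * \<psi> p * f (\<psi> p) = ff p" if "p \<in> U" for p
    using psi_off_P[OF that] by (cases "p \<in> P") (simp_all add: ff_def)
  have "disc_int Xc r (\<lambda>p. gsq g p / fst p - fst p * \<psi> p * f (\<psi> p)) = disc_int Xc r (\<lambda>p. ee p - ff p)"
  proof (rule disc_int_g_eq[OF _ _ _ _ r])
    show "(\<lambda>p. ((indicator (cball Xc R) p * fst (g p))\<^sup>2 + (indicator (cball Xc R) p * snd (g p))\<^sup>2) / fst p - ff p) \<in> borel_measurable borel"
      by measurable
    show "gsq g p / fst p - fst p * \<psi> p * f (\<psi> p) = ((indicator (cball Xc R) p * fst (g p))\<^sup>2 + (indicator (cball Xc R) p * snd (g p))\<^sup>2) / fst p - ff p"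
      if "p \<in> U" for p using subsetD[OF U_sub(1) that] by (simp add: gsq_def fU[OF that] del: mem_cball)
    show "gsq g p / fst p - fst p * \<psi> p * f (\<psi> p) = ee p - ff p" if "p \<in> U" "g p = (G1 p, G2 p)" for p
      using that(2) by (simp add: gsq_def fU[OF that(1)] ee_def e1_def e2_def add_divide_distrib)
  qed measurable
  then show ?thesis by (simp add: Dfun_def Efun_def)
qed

lemma Vfun_eq: "r \<le> R \<Longrightarrow> Vfun \<psi> g Xc r = Wnum r / Nfun \<psi> Xc r"
proof -
  assume r: "r \<le> R"
  have "disc_int Xc r (\<lambda>p. max (snd p) 0 * (fst Xc - fst p * chi \<psi> p)) = disc_int Xc r (\<lambda>p. x0 * yy p - pp p)"
  proof (rule disc_int_cong_U[OF r])
    fix p assume U: "p \<in> U"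
    \<comment> \<open>\<open>\<psi>\<close> vanishes where \<open>y\<close> is at most 0, so on
      \<open>P\<close> the positive part of \<open>y\<close> is \<open>y\<close> itself.\<close>
    have "snd p \<ge> 0" if "p \<in> P" using psi_lower[of p] that U U_sub(3) by (fastforce simp: P_def not_le[symmetric])
    then show "max (snd p) 0 * (fst Xc - fst p * chi \<psi> p) = x0 * yy p - pp p"
      using U by (cases "p \<in> P") (simp_all add: chi_eq yy_def pp_def Xc_def algebra_simps)
  qed
  also have "\<dots> = x0 * disc_int Xc r yy - disc_int Xc r pp"
    using densities_integrable by (subst disc_int_linear(2)) (auto simp: disc_int_cmult)
  finally show ?thesis by (simp add: Vfun_def Wnum_def)
qed

lemma Kfun_eq:
  assumes r: "0 < r" "r < R" and i: "circ_integrable Xc r xF" "circ_integrable Xc r ff"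
  shows "Kfun f \<psi> Xc r = r * (2 * circ_int Xc r xF - circ_int Xc r ff) + (2 * x0 * disc_int Xc r F0 - 6 * disc_int Xc r xF)"
proof -
  have fU: "fst p * \<psi> p * f (\<psi> p) = ff p" if "p \<in> U" for p
    using psi_off_P[OF that] by (cases "p \<in> P") (simp_all add: ff_def)
  have "circ_int Xc r (\<lambda>p. 2 * fst p * Fprim f (\<psi> p) - fst p * \<psi> p * f (\<psi> p)) = circ_int Xc r (\<lambda>p. 2 * xF p - ff p)"
    by (rule circ_int_cong_U[OF r]) (simp add: fU, simp add: xF_def)
  also have "\<dots> = 2 * circ_int Xc r xF - circ_int Xc r ff"
    by (simp add: circ_int_linear(2)[OF circ_integrable_cmult[OF i(1)] i(2)] circ_int_cmult)
  finally have c: "circ_int Xc r (\<lambda>p. 2 * fst p * Fprim f (\<psi> p) - fst p * \<psi> p * f (\<psi> p)) = 2 * circ_int Xc r xF - circ_int Xc r ff" .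
  have "disc_int Xc r (\<lambda>p. 2 * fst Xc * Fprim f (\<psi> p) - 6 * fst p * Fprim f (\<psi> p)) = disc_int Xc r (\<lambda>p. (2 * x0) * F0 p - 6 * xF p)"
    by (rule disc_int_cong_U) (use r in \<open>simp_all add: F0_def xF_def Xc_def\<close>)
  also have "\<dots> = 2 * x0 * disc_int Xc r F0 - 6 * disc_int Xc r xF"
    using densities_integrable by (subst disc_int_linear(2)) (auto simp: disc_int_cmult)
  finally show ?thesis by (simp add: Kfun_def c)
qed

text \<open>Here \<open>D\<close> is an arbitrary number: the expansion is used with the frequency
  coefficients \<open>D\<close> and \<open>H\<close> alike.\<close>

lemma circ_square:
  assumes r: "0 < r" "r < R" "good_circle r" and N: "N > 0"
    and i: "circ_integrable Xc r ww" "circ_integrable Xc r mm" "circ_integrable Xc r nn"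
  shows "circ_int Xc r (\<lambda>p. 1 / fst p * (r * (g p \<bullet> nu Xc r p) / sqrt N - D * \<psi> p / sqrt N)\<^sup>2)
    = (circ_int Xc r ww - 2 * D * circ_int Xc r mm + D\<^sup>2 * circ_int Xc r nn) / N"
proof -
  note [measurable] = g_meas
  have [measurable]: "(\<lambda>p::point. fst p) \<in> borel_measurable borel" "(\<lambda>p::point. snd p) \<in> borel_measurable borel"
    by (intro borel_measurable_continuous_onI continuous_intros)+
  have mw: "ww \<in> borel_measurable borel" "mm \<in> borel_measurable borel" "nn \<in> borel_measurable borel"
    using mfnj_integrable densities_integrable by auto
  note [measurable] = mw
  have [measurable]: "(\<lambda>p. indicator U p * \<psi> p) \<in> borel_measurable borel"
    using borel_measurable_continuous_on_indicator[OF sets_UP(1) psi_cont_U] by simp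
  have nu: "r * (v \<bullet> nu Xc r p) = fst v * (fst p - x0) + snd v * snd p" for v :: point and p
    using r by (cases v) (simp add: nu_def Xc_def inner_prod_def field_simps)
  let ?M = "\<lambda>p. 1 / fst p * (((indicator (cball Xc R) p * fst (g p)) * (fst p - x0) + (indicator (cball Xc R) p * snd (g p)) * snd p) / sqrt N - D * (indicator U p * \<psi> p) / sqrt N)\<^sup>2"
  have "circ_int Xc r (\<lambda>p. 1 / fst p * (r * (g p \<bullet> nu Xc r p) / sqrt N - D * \<psi> p / sqrt N)\<^sup>2)
    = circ_int Xc r (\<lambda>p. (1 / N) * (ww p - (2 * D) * mm p + D\<^sup>2 * nn p))"
  proof (rule circ_int_g_eq[OF _ _ _ _ r])
    show "?M \<in> borel_measurable borel" by measurable
    show "1 / fst p * (r * (g p \<bullet> nu Xc r p) / sqrt N - D * \<psi> p / sqrt N)\<^sup>2 = ?M p" if "p \<in> U" for p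
      using subsetD[OF U_sub(1) that] that by (simp add: nu del: mem_cball)
    show "1 / fst p * (r * (g p \<bullet> nu Xc r p) / sqrt N - D * \<psi> p / sqrt N)\<^sup>2 = (1 / N) * (ww p - (2 * D) * mm p + D\<^sup>2 * nn p)"
      if "p \<in> U" "g p = (G1 p, G2 p)" for p
    proof -
      let ?A = "G1 p * (fst p - x0) + G2 p * snd p"
      have expand: "1 / x * ((A - D * s)\<^sup>2 / N) = (1 / N) * (A\<^sup>2 / x - (2 * D) * (A * s / x) + D\<^sup>2 * (s\<^sup>2 / x))" for A s x :: real
        unfolding power2_diff power_mult_distrib by (simp add: add_divide_distrib diff_divide_distrib distrib_left right_diff_distrib mult_ac)
      have "(?A / sqrt N - D * \<psi> p / sqrt N)\<^sup>2 = (?A - D * \<psi> p)\<^sup>2 / N"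
        using N by (simp add: diff_divide_distrib[symmetric] power_divide)
      moreover have "ww p = ?A\<^sup>2 / fst p"
        by (simp add: ww_def e1_def e2_def e12_def power2_sum power_mult_distrib add_divide_distrib mult_ac)
      moreover have "mm p = ?A * \<psi> p / fst p" by (simp add: mm_def)
      moreover have "nn p = (\<psi> p)\<^sup>2 / fst p" using that by (simp add: nn_def)
      moreover from expand[of "fst p" ?A "\<psi> p"]
      have "1 / fst p * ((?A - D * \<psi> p)\<^sup>2 / N) = (1 / N) * (?A\<^sup>2 / fst p - (2 * D) * (?A * \<psi> p / fst p) + D\<^sup>2 * ((\<psi> p)\<^sup>2 / fst p))" .
      ultimately show ?thesis unfolding nu that(2) fst_conv snd_conv by simp
    qed
  qed measurable
  also have "\<dots> = (1 / N) * (circ_int Xc r ww - (2 * D) * circ_int Xc r mm + D\<^sup>2 * circ_int Xc r nn)"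
    by (simp only: circ_int_cmult circ_int_linear(1)[OF circ_integrable_linear(2)[OF i(1) circ_integrable_cmult[OF i(2)]] circ_integrable_cmult[OF i(3)]]
        circ_int_linear(2)[OF i(1) circ_integrable_cmult[OF i(2)]])
  finally show ?thesis by simp
qed

lemma pohozaev_on_circle:
  assumes r: "0 < r" "r < R" and flux: "r * disc_int Xc r a_pohozaev = circ_int Xc r b_pohozaev"
    and i: "circ_integrable Xc r ee" "circ_integrable Xc r xF" "circ_integrable Xc r pp" "circ_integrable Xc r ww"
  shows "r * (- 6 * disc_int Xc r xF + 2 * x0 * disc_int Xc r F0 + 3 * disc_int Xc r pp + I2 \<psi> Xc r + I1 g Xc r)
    = r\<^sup>2 * (circ_int Xc r ee - 2 * circ_int Xc r xF + circ_int Xc r pp) - 2 * circ_int Xc r ww"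
proof -
  note d = densities_integrable
  have id: "integrable lborel (\<lambda>p. (- 6) * xF p)" "integrable lborel (\<lambda>p. (2 * x0) * F0 p)" "integrable lborel (\<lambda>p. 3 * pp p)"
    "integrable lborel (\<lambda>p. (- 6) * xF p + (2 * x0) * F0 p)"
    "integrable lborel (\<lambda>p. (- 6) * xF p + (2 * x0) * F0 p + 3 * pp p)"
    "integrable lborel (\<lambda>p. (- 6) * xF p + (2 * x0) * F0 p + 3 * pp p + i2d p)"
    by (intro Bochner_Integration.integrable_add integrable_mult_right d)+
  have "a_pohozaev = (\<lambda>p. (- 6) * xF p + (2 * x0) * F0 p + 3 * pp p + i2d p - i1d p)"
    by (auto simp: fun_eq_iff a_pohozaev_def xF_def F0_def pp_def i2d_def i1d_def ee_def)
  then have "disc_int Xc r a_pohozaev = - 6 * disc_int Xc r xF + 2 * x0 * disc_int Xc r F0 + 3 * disc_int Xc r pp + disc_int Xc r i2d - disc_int Xc r i1d"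
    by (simp only: disc_int_linear(2)[OF id(6) d(6)] disc_int_linear(1)[OF id(5) d(7)] disc_int_linear(1)[OF id(4) id(3)]
        disc_int_linear(1)[OF id(1) id(2)] disc_int_cmult)
  then have a: "disc_int Xc r a_pohozaev = - 6 * disc_int Xc r xF + 2 * x0 * disc_int Xc r F0 + 3 * disc_int Xc r pp + I2 \<psi> Xc r + I1 g Xc r"
    using r by (simp add: I1_eq I2_eq)
  \<comment> \<open>On the circle \<open>rsq\<close> is the constant \<open>r\<^sup>2\<close>, which
    can be taken out of the integral.\<close>
  have "circ_int Xc r b_pohozaev = circ_int Xc r (\<lambda>p. r\<^sup>2 * (ee p - 2 * xF p + pp p) - 2 * ww p)"
    unfolding circ_int_alt
    by (intro set_lebesgue_integral_cong) (auto simp: b_pohozaev_def TF_def ee_def xF_def pp_def ww_def algebra_simps)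
  also have "\<dots> = r\<^sup>2 * (circ_int Xc r ee - 2 * circ_int Xc r xF + circ_int Xc r pp) - 2 * circ_int Xc r ww"
  proof -
    note c1 = circ_integrable_cmult[OF i(2), of 2]
    note c2 = circ_integrable_linear(2)[OF i(1) c1]
    note c3 = circ_integrable_linear(1)[OF c2 i(3)]
    note c4 = circ_integrable_cmult[OF c3, of "r\<^sup>2"]
    show ?thesis
      by (simp only: circ_int_linear(2)[OF c4 circ_integrable_cmult[OF i(4)]] circ_int_cmult circ_int_linear(1)[OF c2 i(3)] circ_int_linear(2)[OF i(1) c1])
  qed
  finally show ?thesis using flux a by simp
qed

text \<open>Finitely many ingredients each exclude a null set of radii. At a remaining radius,
  \<open>H\<close> agrees on a whole neighbourhood with the quotient of
  \<open>t * Efun t - Wnum t\<close> by \<open>?A t / t\<close>, both differentiable there.\<close>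

lemma frequency_derivative:
  "AE r in lborel. 0 < r \<and> r < delta \<Omega> (x0, 0) \<longrightarrow>
    (let X0 = (x0, 0 :: real);
         N = Nfun \<psi> X0 r; D = Dfun f \<psi> g X0 r; V = Vfun \<psi> g X0 r;
         H = Hfun f \<psi> g X0 r; Z = Zfun \<psi> X0 r; K = Kfun f \<psi> X0 r;
         rhs1 = 2 / r * circ_int X0 r (\<lambda>p. 1 / fst p *
                   (r * (g p \<bullet> nu X0 r p) / sqrt N - D * \<psi> p / sqrt N)\<^sup>2)
                + 2 / r * V\<^sup>2 + 2 / r * V * (H - 3 / 2) + 1 / r * Z * (H - 3 / 2) + K / N;
         rhs2 = 2 / r * circ_int X0 r (\<lambda>p. 1 / fst p *
                   (r * (g p \<bullet> nu X0 r p) / sqrt N - H * \<psi> p / sqrt N)\<^sup>2)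
                + 2 / r * V * (H - 3 / 2) + 1 / r * Z * (H - 3 / 2) + K / N
     in (Hfun f \<psi> g X0 has_real_derivative rhs1) (at r) \<and> rhs1 = rhs2)"
proof -
  let ?A = "\<lambda>r. disc_int Xc r (\<lambda>p. 2 * mm p + 2 * nn p - jj p)"
  have iA: "integrable lborel (\<lambda>p. 2 * mm p + 2 * nn p - jj p)"
    by (intro Bochner_Integration.integrable_add Bochner_Integration.integrable_diff integrable_mult_right mfnj_integrable)
  show ?thesis
    unfolding Xc_def[symmetric] R_def[symmetric] Let_def
    using pohozaev_flux energy_flux Nfun_pos AE_good_circle I1_primitive I2_primitive J1_primitive
      disc_int_has_derivative[OF ef_integrable, of Xc] disc_int_has_derivative[OF iA, of Xc]
      disc_int_has_derivative[OF densities_integrable(5), of Xc] disc_int_has_derivative[OF densities_integrable(4), of Xc]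
      polar_integral(1)[OF densities_integrable(1), of Xc] polar_integral(1)[OF densities_integrable(2), of Xc]
      polar_integral(1)[OF densities_integrable(4), of Xc] polar_integral(1)[OF densities_integrable(8), of Xc]
      polar_integral(1)[OF mfnj_integrable(1), of Xc] polar_integral(1)[OF mfnj_integrable(2), of Xc]
      polar_integral(1)[OF mfnj_integrable(3), of Xc] polar_integral(1)[OF mfnj_integrable(4), of Xc]
  proof eventually_elim
    case (elim r)
    show ?case
    proof
      assume r': "0 < r \<and> r < R"
      then have r: "0 < r" "r < R" by auto
      have ci: "circ_integrable Xc r ee" "circ_integrable Xc r xF" "circ_integrable Xc r pp" "circ_integrable Xc r ww"
        "circ_integrable Xc r mm" "circ_integrable Xc r ff" "circ_integrable Xc r nn" "circ_integrable Xc r jj"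
        using elim(12-19) r by blast+
      have pos: "Nfun \<psi> Xc r > 0" and good: "good_circle r" using elim(3,4) r by blast+
      define N where "N = Nfun \<psi> Xc r"
      define D where "D = Dfun f \<psi> g Xc r"
      define V where "V = Vfun \<psi> g Xc r"
      define H where "H = Hfun f \<psi> g Xc r"
      define Z where "Z = Zfun \<psi> Xc r"
      define K where "K = Kfun f \<psi> Xc r"
      define cJ where "cJ = circ_int Xc r jj"
      define cM where "cM = circ_int Xc r mm"
      define cW where "cW = circ_int Xc r ww"
      define dy where "dy = disc_int Xc r yy"
      define dP where "dP = disc_int Xc r pp"
      define cy where "cy = circ_int Xc r yy"
      define cP where "cP = circ_int Xc r pp"
      define q1 where "q1 = (LBINT t=0..r. I1 g Xc t / t ^ 4)"
      define q2 where "q2 = (LBINT t=0..r. I2 \<psi> Xc t / t ^ 4)"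
      define q3 where "q3 = (LBINT t=0..r. J1 \<psi> Xc t / t ^ 5)"
      have N: "N > 0" using pos by (simp add: N_def)
      have Nnn: "circ_int Xc r nn = N" using Nfun_eq[OF r] by (simp add: N_def)
      have J: "J1 \<psi> Xc r = cJ" using J1_eq[OF r] by (simp add: cJ_def)
      define W' where "W' = (x0 * dy - dP) + r * (x0 * cy - cP) + 4 * r ^ 3 * q1 + I1 g Xc r + 4 * r ^ 3 * q2 + I2 \<psi> Xc r + 6 * r ^ 3 * q3 + 3 / 2 * cJ / r"
      define N' where "N' = (2 * cM + N - cJ) / r"
      define E' where "E' = circ_int Xc r ee - circ_int Xc r ff"
      have flux: "r * (- 6 * disc_int Xc r xF + 2 * x0 * disc_int Xc r F0 + 3 * dP + I2 \<psi> Xc r + I1 g Xc r)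
          = r\<^sup>2 * (circ_int Xc r ee - 2 * circ_int Xc r xF + cP) - 2 * cW"
        unfolding dP_def cP_def cW_def by (rule pohozaev_on_circle[OF r _ ci(1-4)]) (use elim(1) r in blast)
      have "(\<lambda>p. e1 p + e2 p - ff p) = (\<lambda>p. ee p - ff p)" by (simp add: ee_def)
      then have energy: "r * Efun r = cM" using elim(2) r by (simp add: Efun_def cM_def)
      have y: "r * cy = 3 * dy" unfolding cy_def dy_def by (rule yy_scaling[OF r])
      have Wn: "Wnum r = r * (x0 * dy - dP) + r ^ 4 * q1 + r ^ 4 * q2 + 3 / 2 * r ^ 4 * q3"
        by (simp add: Wnum_def dy_def dP_def q1_def q2_def q3_def)
      have Deq: "D = r * Efun r / N" and Veq: "V = Wnum r / N"
        using r by (simp_all add: D_def V_def N_def Dfun_eq Vfun_eq)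
      have Heq: "H = D - V" by (simp add: H_def D_def V_def Hfun_def)
      have Zeq: "Z = cJ / N"
        using J by (simp add: Z_def Zfun_def N_def J1_def)
      have Keq: "K = r * (2 * circ_int Xc r xF - circ_int Xc r ff) + (2 * x0 * disc_int Xc r F0 - 6 * disc_int Xc r xF)"
        unfolding K_def by (rule Kfun_eq[OF r ci(2,6)])
      note alg = frequency_derivative_algebra[OF r(1) N flux energy y Wn W'_def N'_def Deq Veq Heq Zeq Keq]
      have sq: "circ_int Xc r (\<lambda>p. 1 / fst p * (r * (g p \<bullet> nu Xc r p) / sqrt N - c * \<psi> p / sqrt N)\<^sup>2)
        = (cW - 2 * c * cM + c\<^sup>2 * N) / N" for c
        unfolding circ_square[OF r good N ci(4,5,7)] cW_def cM_def Nnn ..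
      have dE: "(Efun has_real_derivative E') (at r)"
        using elim(8) r unfolding Efun_def[abs_def] E'_def circ_int_linear(2)[OF ci(1,6), symmetric] by blast
      have dy': "((\<lambda>r. disc_int Xc r yy) has_real_derivative cy) (at r)" "((\<lambda>r. disc_int Xc r pp) has_real_derivative cP) (at r)"
        using elim(10,11) r unfolding cy_def cP_def by blast+
      have dq: "((\<lambda>r. LBINT t=0..r. I1 g Xc t / t ^ 4) has_real_derivative I1 g Xc r / r ^ 4) (at r)"
         "((\<lambda>r. LBINT t=0..r. I2 \<psi> Xc t / t ^ 4) has_real_derivative I2 \<psi> Xc r / r ^ 4) (at r)"
         "((\<lambda>r. LBINT t=0..r. J1 \<psi> Xc t / t ^ 5) has_real_derivative cJ / r ^ 5) (at r)"
        using elim(5,6,7) r unfolding J by blast+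
      have dW: "(Wnum has_real_derivative W') (at r)"
      proof -
        have "(Wnum has_real_derivative
          ((r * (x0 * cy - cP) + 1 * (x0 * dy - dP)) + (r ^ 4 * (I1 g Xc r / r ^ 4) + (4 * r ^ 3) * q1)
            + (r ^ 4 * (I2 \<psi> Xc r / r ^ 4) + (4 * r ^ 3) * q2) + (3 / 2 * r ^ 4 * (cJ / r ^ 5) + (3 / 2 * (4 * r ^ 3)) * q3))) (at r)"
          unfolding Wnum_def[abs_def] dy_def dP_def q1_def q2_def q3_def
          by (intro DERIV_add DERIV_mult' DERIV_diff DERIV_cmult DERIV_ident dy' dq) (auto intro!: derivative_eq_intros)
        moreover have "r ^ 4 * (I1 g Xc r / r ^ 4) = I1 g Xc r" "r ^ 4 * (I2 \<psi> Xc r / r ^ 4) = I2 \<psi> Xc r"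
          "3 / 2 * r ^ 4 * (cJ / r ^ 5) = 3 / 2 * cJ / r"
          using r by (simp_all add: eval_nat_numeral)
        ultimately show ?thesis unfolding W'_def by (simp add: algebra_simps)
      qed
      have dA: "(?A has_real_derivative (2 * cM + 2 * N - cJ)) (at r)"
      proof -
        note c = circ_integrable_cmult[OF ci(5), of 2] circ_integrable_cmult[OF ci(7), of 2]
        have "circ_int Xc r (\<lambda>p. 2 * mm p + 2 * nn p - jj p) = 2 * cM + 2 * N - cJ"
          by (simp only: circ_int_linear(2)[OF circ_integrable_linear(1)[OF c] ci(8)] circ_int_linear(1)[OF c] circ_int_cmult cM_def Nnn cJ_def)
        then show ?thesis using elim(9) r by simp
      qed
      have AN: "?A t = t * Nfun \<psi> Xc t" if "0 < t" "t < R" for t using mass_identity[OF that] that by simp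
      \<comment> \<open>The quotient rule subtracts one \<open>N\<close>, so the coefficient 2 of
        \<open>N\<close> in the derivative of \<open>?A\<close> becomes 1 in
        \<open>N'\<close>.\<close>
      have dN: "((\<lambda>t. ?A t / t) has_real_derivative N') (at r)"
      proof -
        have "((\<lambda>t. ?A t / t) has_real_derivative ((2 * cM + 2 * N - cJ) * r - ?A r * 1) / (r * r)) (at r)"
          by (rule DERIV_divide[OF dA DERIV_ident]) (use r in simp)
        moreover have "((2 * cM + 2 * N - cJ) * r - ?A r * 1) / (r * r) = N'"
          unfolding AN[OF r] N'_def N_def[symmetric] using r by (simp add: field_simps)
        ultimately show ?thesis by simp
      qed
      have Nr: "?A r / r = N" using AN[OF r] r by (simp add: N_def)
      have dH: "((\<lambda>t. (t * Efun t - Wnum t) / (?A t / t)) has_real_derivative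
         ((Efun r + r * E' - W') * N - (r * Efun r - Wnum r) * N') / (N * N)) (at r)"
      proof -
        have "((\<lambda>t. t * Efun t - Wnum t) has_real_derivative (Efun r + r * E' - W')) (at r)"
          using DERIV_diff[OF DERIV_mult'[OF DERIV_ident dE] dW] by (simp add: add.commute)
        from DERIV_divide[OF this dN] N show ?thesis unfolding Nr by simp
      qed
      have "(Hfun f \<psi> g Xc has_real_derivative
         ((Efun r + r * E' - W') * N - (r * Efun r - Wnum r) * N') / (N * N)) (at r)"
      proof (rule has_field_derivative_transform_within_open[OF dH, of "{0<..<R}"])
        fix t assume "t \<in> {0<..<R}"
        then have t: "0 < t" "t < R" by auto
        show "(t * Efun t - Wnum t) / (?A t / t) = Hfun f \<psi> g Xc t"
          using t by (simp add: Hfun_def Dfun_eq Vfun_eq AN[OF t] diff_divide_distrib)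
      qed (use r in auto)
      then have "(Hfun f \<psi> g Xc has_real_derivative
          2 / r * ((cW - 2 * D * cM + D\<^sup>2 * N) / N) + 2 / r * V\<^sup>2 + 2 / r * V * (H - 3 / 2) + 1 / r * Z * (H - 3 / 2) + K / N) (at r)"
        unfolding E'_def alg(1) .
      then show "(Hfun f \<psi> g Xc has_real_derivative
           2 / r * circ_int Xc r (\<lambda>p. 1 / fst p * (r * (g p \<bullet> nu Xc r p) / sqrt (Nfun \<psi> Xc r) - Dfun f \<psi> g Xc r * \<psi> p / sqrt (Nfun \<psi> Xc r))\<^sup>2)
           + 2 / r * (Vfun \<psi> g Xc r)\<^sup>2 + 2 / r * Vfun \<psi> g Xc r * (Hfun f \<psi> g Xc r - 3 / 2)
           + 1 / r * Zfun \<psi> Xc r * (Hfun f \<psi> g Xc r - 3 / 2) + Kfun f \<psi> Xc r / Nfun \<psi> Xc r) (at r) \<and>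
         2 / r * circ_int Xc r (\<lambda>p. 1 / fst p * (r * (g p \<bullet> nu Xc r p) / sqrt (Nfun \<psi> Xc r) - Dfun f \<psi> g Xc r * \<psi> p / sqrt (Nfun \<psi> Xc r))\<^sup>2)
           + 2 / r * (Vfun \<psi> g Xc r)\<^sup>2 + 2 / r * Vfun \<psi> g Xc r * (Hfun f \<psi> g Xc r - 3 / 2)
           + 1 / r * Zfun \<psi> Xc r * (Hfun f \<psi> g Xc r - 3 / 2) + Kfun f \<psi> Xc r / Nfun \<psi> Xc r
         = 2 / r * circ_int Xc r (\<lambda>p. 1 / fst p * (r * (g p \<bullet> nu Xc r p) / sqrt (Nfun \<psi> Xc r) - Hfun f \<psi> g Xc r * \<psi> p / sqrt (Nfun \<psi> Xc r))\<^sup>2)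
           + 2 / r * Vfun \<psi> g Xc r * (Hfun f \<psi> g Xc r - 3 / 2)
           + 1 / r * Zfun \<psi> Xc r * (Hfun f \<psi> g Xc r - 3 / 2) + Kfun f \<psi> Xc r / Nfun \<psi> Xc r"
        unfolding N_def[symmetric] D_def[symmetric] V_def[symmetric] H_def[symmetric] Z_def[symmetric] K_def[symmetric] sq
        using alg(2) by blast
    qed
  qed
qed

end

theorem mainTheorem3:
  fixes \<Omega> :: "(real \<times> real) set" and f :: "real \<Rightarrow> real"
    and \<psi> :: "real \<times> real \<Rightarrow> real" and g :: "real \<times> real \<Rightarrow> real \<times> real"
    and x0 :: real
  assumes \<Omega>_sub: "\<Omega> \<subseteq> halfplane"
    and \<Omega>_open: "openin (top_of_set halfplane) \<Omega>"
    and \<Omega>_conn: "connected \<Omega>"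
    and f_cont: "continuous_on UNIV f"
    and var: "variational_solution \<Omega> f \<psi> g"
    and growth: "\<exists>C. \<forall>X1 \<in> \<Omega> \<inter> frontier (positivity_set \<Omega> \<psi>). \<exists>r>0.
                   AE X in lborel. X \<in> ball X1 r \<inter> \<Omega> \<longrightarrow>
                     gsq g X / (fst X)\<^sup>2 \<le> C * (\<bar>snd X\<bar> + \<bar>fst X - fst X1\<bar>)"
    and X0: "(x0, 0) \<in> S_s \<Omega> \<psi>"
  shows "AE r in lborel. 0 < r \<and> r < delta \<Omega> (x0, 0) \<longrightarrow>
    (let X0 = (x0, 0 :: real);
         N = Nfun \<psi> X0 r; D = Dfun f \<psi> g X0 r; V = Vfun \<psi> g X0 r;
         H = Hfun f \<psi> g X0 r; Z = Zfun \<psi> X0 r; K = Kfun f \<psi> X0 r;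
         rhs1 = 2 / r * circ_int X0 r (\<lambda>p. 1 / fst p *
                   (r * (g p \<bullet> nu X0 r p) / sqrt N - D * \<psi> p / sqrt N)\<^sup>2)
                + 2 / r * V\<^sup>2 + 2 / r * V * (H - 3 / 2) + 1 / r * Z * (H - 3 / 2) + K / N;
         rhs2 = 2 / r * circ_int X0 r (\<lambda>p. 1 / fst p *
                   (r * (g p \<bullet> nu X0 r p) / sqrt N - H * \<psi> p / sqrt N)\<^sup>2)
                + 2 / r * V * (H - 3 / 2) + 1 / r * Z * (H - 3 / 2) + K / N
     in (Hfun f \<psi> g X0 has_real_derivative rhs1) (at r) \<and> rhs1 = rhs2)"
proof -
  interpret degenerate_point \<Omega> f \<psi> g x0
    by unfold_locales fact+
  show ?thesis by (rule frequency_derivative)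
qed

end
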